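(* For every integer $d\ge1$ there is a connected orientable one-vertex ideal triangulation $\mathcal S_d$ with $3d$ tetrahedra, which can be labelled $A_k,B_k,C_k$ ($k\in\mathbb Z/d\mathbb Z$), and with exactly $d+1$ quotient edges $a_0,\ldots,a_{d-1},b$, such that $$v(a_k)=7\quad(k\in\mathbb Z/d\mathbb Z),\qquad v(b)=11d.$$ Its unique vertex link has genus $2d$. For each $k\in\mathbb Z/d\mathbb Z$, each of the tetrahedra $A_k,B_k,C_k$ uses only the quotient-edge classes $a_k$ and $b$, and $\mathcal S_d$ is geometric.
   Context: Face-pairing complexes: let $\widehat{\mathcal T}$ be a finite disjoint union of tetrahedra whose codimension-one faces are paired (each face with exactly one other face) by affine extensions of vertex bijections; the quotient is a closed pseudo 3-manifold $(M,\mathcal T)$. $E$ is the set of quotient edges, $P_E$ the quotient map on local edges, and the valence is $v(e)=\#P_E^{-1}(e)$ (number of local edges in the class $e$). Ideal triangulation: for a compact 3-manifold $N$ with nonempty boundary, $C(N)$ is obtained by collapsing each boundary component to a point; an ideal triangulation of $N$ is a presentation of $C(N)$ as the quotient of a finite disjoint union of tetrahedra by pairing their codimension-one faces (each face with exactly one other face) via affine extensions of vertex bijections, such that the vertex set of the quotient is exactly the set of these points. Thus the link of each vertex is the corresponding boundary component. It is called connected, orientable if $N$ is, and one-vertex if there is a single vertex. Extended angles: order the six edges of a tetrahedron as $(e_1,\dots,e_6)$ so that $(e_1,e_4),(e_2,e_5),(e_3,e_6)$ are opposite pairs and $e_1,e_2,e_3$ share an endpoint. A hyper-ideal tetrahedron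 is a compact convex polyhedron in $\mathbb H^3$ combinatorially equivalent to a truncated tetrahedron, whose four triangular truncation faces meet the adjacent hexagonal faces orthogonally; it has six internal edges (one per edge of the underlying tetrahedron), and is determined up to isometry by their lengths $l_i$. With $x_i=\cosh l_i$, its dihedral angle at $e_1$ is $\arccos\varphi(x_1,\dots,x_6)$, where $$\varphi(x_1,\ldots,x_6)=\frac{x_2x_3+x_5x_6+x_1x_2x_5+x_1x_3x_6-x_1^2x_4+x_4}{\sqrt{2x_1x_2x_6+x_1^2+x_2^2+x_6^2-1}\,\sqrt{2x_1x_3x_5+x_1^2+x_3^2+x_5^2-1}}.$$ Geometric: $(M,\mathcal T)$ is geometric if there is $l\in\mathbb R_{>0}^E$ such that, giving each local edge the length of its quotient edge, every tetrahedron is realized by a (nondegenerate) hyper-ideal tetrahedron with these internal edge lengths, and for each $e\in E$ the dihedral angles at all local edges in the class $e$ sum to $2\pi$. *)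

theory Defs
  imports "HOL-Analysis.Analysis"
begin

section \<open>Face pairings of tetrahedra\<close>

text \<open>
  The vertices of every tetrahedron are the four elements of the numeral type \<open>4\<close>, and the face
  \<open>f\<close> is the one opposite to the vertex \<open>f\<close>. A gluing \<open>g\<close> sends the face \<open>f\<close> of the tetrahedron
  \<open>t\<close> to the tetrahedron \<open>t' = fst (g t f)\<close>; the bijection between the vertices of face \<open>f\<close> of \<open>t\<close>
  and the vertices of the partner face of \<open>t'\<close> is encoded by its unique extension
  \<open>\<sigma> = snd (g t f)\<close> to a permutation of the four labels, so that the partner face is \<open>\<sigma> f\<close>.
\<close>

type_synonym 't gluing = "'t \<Rightarrow> 4 \<Rightarrow> 't \<times> (4 \<Rightarrow> 4)"

definition face_pairing :: "'t set \<Rightarrow> 't gluing \<Rightarrow> bool" where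
  "face_pairing T g \<longleftrightarrow> finite T \<and>
     (\<forall>t\<in>T. \<forall>f. \<forall>t' \<sigma>. g t f = (t', \<sigma>) \<longrightarrow>
        t' \<in> T \<and> bij \<sigma> \<and> (t', \<sigma> f) \<noteq> (t, f) \<and> g t' (\<sigma> f) = (t, inv \<sigma>))"

definition glue_rel :: "'a set \<Rightarrow> ('a \<Rightarrow> 'a \<Rightarrow> bool) \<Rightarrow> ('a \<times> 'a) set" where
  "glue_rel S step = {(x, y). x \<in> S \<and> y \<in> S \<and> equivclp step x y}"

definition local_edges :: "'t set \<Rightarrow> ('t \<times> 4 set) set" where
  "local_edges T = {(t, s). t \<in> T \<and> card s = 2}"

definition edge_step :: "'t set \<Rightarrow> 't gluing \<Rightarrow> 't \<times> 4 set \<Rightarrow> 't \<times> 4 set \<Rightarrow> bool" where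
  "edge_step T g = (\<lambda>(t, s) (t', s'). t \<in> T \<and>
     (\<exists>f. f \<notin> s \<and> t' = fst (g t f) \<and> s' = snd (g t f) ` s))"

definition quot_edges :: "'t set \<Rightarrow> 't gluing \<Rightarrow> ('t \<times> 4 set) set set" where
  "quot_edges T g = local_edges T // glue_rel (local_edges T) (edge_step T g)"

definition edge_class :: "'t set \<Rightarrow> 't gluing \<Rightarrow> 't \<times> 4 set \<Rightarrow> ('t \<times> 4 set) set" where
  "edge_class T g \<epsilon> = glue_rel (local_edges T) (edge_step T g) `` {\<epsilon>}"

definition valence :: "'t set \<Rightarrow> 't gluing \<Rightarrow> ('t \<times> 4 set) set \<Rightarrow> nat" where
  "valence T g e = card {\<epsilon> \<in> local_edges T. edge_class T g \<epsilon> = e}"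

definition vertex_step :: "'t set \<Rightarrow> 't gluing \<Rightarrow> 't \<times> 4 \<Rightarrow> 't \<times> 4 \<Rightarrow> bool" where
  "vertex_step T g = (\<lambda>(t, i) (t', i'). t \<in> T \<and>
     (\<exists>f. f \<noteq> i \<and> t' = fst (g t f) \<and> i' = snd (g t f) i))"

definition quot_vertices :: "'t set \<Rightarrow> 't gluing \<Rightarrow> ('t \<times> 4) set set" where
  "quot_vertices T g = (T \<times> UNIV) // glue_rel (T \<times> UNIV) (vertex_step T g)"


section \<open>Vertex links\<close>

text \<open>
  The link of a quotient vertex \<open>v\<close> is the closed surface glued from the triangles cutting off the
  local vertices \<open>(t, i) \<in> v\<close>. The triangle at \<open>(t, i)\<close> has one corner \<open>(t, i, j)\<close> on each
  edge \<open>{i, j}\<close> of \<open>t\<close> and one side \<open>(t, i, f)\<close> in each face \<open>f \<noteq> i\<close> of \<open>t\<close>. Links are connected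
  by construction, and they are orientable if the triangulated manifold is; the genus is then
  determined by the Euler characteristic \<open>2 - 2 * genus\<close>.
\<close>

definition link_flags :: "('t \<times> 4) set \<Rightarrow> ('t \<times> 4 \<times> 4) set" where
  "link_flags v = {(t, i, j). (t, i) \<in> v \<and> i \<noteq> j}"

definition corner_step :: "'t set \<Rightarrow> 't gluing \<Rightarrow> 't \<times> 4 \<times> 4 \<Rightarrow> 't \<times> 4 \<times> 4 \<Rightarrow> bool" where
  "corner_step T g = (\<lambda>(t, i, j) (t', i', j'). t \<in> T \<and>
     (\<exists>f. f \<noteq> i \<and> f \<noteq> j \<and> t' = fst (g t f) \<and> i' = snd (g t f) i \<and> j' = snd (g t f) j))"

definition side_step :: "'t set \<Rightarrow> 't gluing \<Rightarrow> 't \<times> 4 \<times> 4 \<Rightarrow> 't \<times> 4 \<times> 4 \<Rightarrow> bool" where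
  "side_step T g = (\<lambda>(t, i, f) (t', i', f'). t \<in> T \<and> f \<noteq> i \<and>
     t' = fst (g t f) \<and> i' = snd (g t f) i \<and> f' = snd (g t f) f)"

definition link_euler_char :: "'t set \<Rightarrow> 't gluing \<Rightarrow> ('t \<times> 4) set \<Rightarrow> int" where
  "link_euler_char T g v =
     int (card (link_flags v // glue_rel (link_flags v) (corner_step T g)))
     - int (card (link_flags v // glue_rel (link_flags v) (side_step T g)))
     + int (card v)"

definition link_genus :: "'t set \<Rightarrow> 't gluing \<Rightarrow> ('t \<times> 4) set \<Rightarrow> real" where
  "link_genus T g v = (2 - real_of_int (link_euler_char T g v)) / 2"


section \<open>The quotient space of a face pairing\<close>

definition quot_topology :: "'a topology \<Rightarrow> ('a \<Rightarrow> 'b) \<Rightarrow> 'b topology" where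
  "quot_topology X q =
     topology (\<lambda>U. U \<subseteq> q ` topspace X \<and> openin X {x \<in> topspace X. q x \<in> U})"

lemma openin_quot_topology:
  "openin (quot_topology X q) U \<longleftrightarrow>
     U \<subseteq> q ` topspace X \<and> openin X {x \<in> topspace X. q x \<in> U}"
proof -
  have "istopology (\<lambda>U. U \<subseteq> q ` topspace X \<and> openin X {x \<in> topspace X. q x \<in> U})"
    unfolding istopology_def
  proof (intro conjI allI impI)
    fix S S' assume "S \<subseteq> q ` topspace X \<and> openin X {x \<in> topspace X. q x \<in> S}"
      and "S' \<subseteq> q ` topspace X \<and> openin X {x \<in> topspace X. q x \<in> S'}"
    moreover have "{x \<in> topspace X. q x \<in> S \<inter> S'} =
        {x \<in> topspace X. q x \<in> S} \<inter> {x \<in> topspace X. q x \<in> S'}" by blast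
    ultimately show "S \<inter> S' \<subseteq> q ` topspace X" "openin X {x \<in> topspace X. q x \<in> S \<inter> S'}"
      by (blast, simp only: openin_Int)
  next
    fix K assume K: "\<forall>S\<in>K. S \<subseteq> q ` topspace X \<and> openin X {x \<in> topspace X. q x \<in> S}"
    have "{x \<in> topspace X. q x \<in> \<Union>K} = (\<Union>S\<in>K. {x \<in> topspace X. q x \<in> S})" by blast
    moreover have "openin X (\<Union>S\<in>K. {x \<in> topspace X. q x \<in> S})"
      using K by (intro openin_Union) blast
    ultimately show "openin X {x \<in> topspace X. q x \<in> \<Union>K}" by simp
    show "\<Union>K \<subseteq> q ` topspace X" using K by blast
  qed
  then show ?thesis
    unfolding quot_topology_def by (subst topology_inverse') (assumption, rule refl)
qed

lemma topspace_quot_topology: "topspace (quot_topology X q) = q ` topspace X"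
proof
  show "topspace (quot_topology X q) \<subseteq> q ` topspace X"
    using openin_topspace[of "quot_topology X q"] unfolding openin_quot_topology by (rule conjunct1)
  have "{x \<in> topspace X. q x \<in> q ` topspace X} = topspace X" by auto
  then have "openin (quot_topology X q) (q ` topspace X)"
    unfolding openin_quot_topology by simp
  then show "q ` topspace X \<subseteq> topspace (quot_topology X q)"
    by (rule openin_subset)
qed

lemma quotient_map_quot_topology: "quotient_map X (quot_topology X q) q"
  unfolding quotient_map_def topspace_quot_topology openin_quot_topology
  by (intro conjI refl allI impI iffI) simp_all

text \<open>Points of a tetrahedron are given by their barycentric coordinates.\<close>

definition tetrahedron :: "(real^4) set" where
  "tetrahedron = {x. (\<forall>i. 0 \<le> x $ i) \<and> (\<Sum>i\<in>UNIV. x $ i) = 1}"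

definition point_step :: "'t set \<Rightarrow> 't gluing \<Rightarrow> 't \<times> (real^4) \<Rightarrow> 't \<times> (real^4) \<Rightarrow> bool" where
  "point_step T g = (\<lambda>(t, x) (t', y). t \<in> T \<and>
     (\<exists>f. x $ f = 0 \<and> t' = fst (g t f) \<and> (\<forall>i. y $ (snd (g t f) i) = x $ i)))"

definition point_class :: "'t set \<Rightarrow> 't gluing \<Rightarrow> 't \<times> (real^4) \<Rightarrow> ('t \<times> (real^4)) set" where
  "point_class T g p = glue_rel (T \<times> tetrahedron) (point_step T g) `` {p}"

definition realization :: "'t set \<Rightarrow> 't gluing \<Rightarrow> ('t \<times> (real^4)) set topology" where
  "realization T g =
     quot_topology (prod_topology (discrete_topology T) (top_of_set tetrahedron)) (point_class T g)"

definition vertex_points :: "'t set \<Rightarrow> 't gluing \<Rightarrow> ('t \<times> (real^4)) set set" where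
  "vertex_points T g = {point_class T g (t, axis i 1) | t i. t \<in> T}"


section \<open>Compact 3-manifolds with boundary\<close>

text \<open>
  A chart is a homeomorphism from an open set onto an open subset of \<open>\<real>\<^sup>3\<close>, respectively onto a
  relatively open subset of the closed half space.
\<close>

definition half_space3 :: "(real^3) set" where
  "half_space3 = {x. 0 \<le> x $ 1}"

definition chart3 :: "'a topology \<Rightarrow> 'a set \<Rightarrow> ('a \<Rightarrow> real^3) \<Rightarrow> bool" where
  "chart3 X U \<phi> \<longleftrightarrow> openin X U \<and> open (\<phi> ` U) \<and>
     homeomorphic_map (subtopology X U) (top_of_set (\<phi> ` U)) \<phi>"

definition half_chart3 :: "'a topology \<Rightarrow> 'a set \<Rightarrow> ('a \<Rightarrow> real^3) \<Rightarrow> bool" where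
  "half_chart3 X U \<phi> \<longleftrightarrow> openin X U \<and> openin (top_of_set half_space3) (\<phi> ` U) \<and>
     homeomorphic_map (subtopology X U) (top_of_set (\<phi> ` U)) \<phi>"

definition manifold3 :: "'a topology \<Rightarrow> bool" where
  "manifold3 X \<longleftrightarrow> Hausdorff_space X \<and> second_countable X \<and>
     (\<forall>x \<in> topspace X. \<exists>U \<phi>. x \<in> U \<and> half_chart3 X U \<phi>)"

definition mfd_interior :: "'a topology \<Rightarrow> 'a set" where
  "mfd_interior X = {x \<in> topspace X. \<exists>U \<phi>. x \<in> U \<and> chart3 X U \<phi>}"

definition mfd_boundary :: "'a topology \<Rightarrow> 'a set" where
  "mfd_boundary X = topspace X - mfd_interior X"

text \<open>
  A local homeomorphism \<open>f\<close> of \<open>\<real>\<^sup>3\<close> preserves orientation at \<open>p\<close> iff it has local degree \<open>1\<close>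
  there: the displacement map \<open>y \<mapsto> f (p + y) - f p\<close> on a small sphere around \<open>0\<close> is homotopic,
  in the complement of \<open>0\<close>, to the inclusion. A manifold is orientable if its interior has
  an atlas all of whose transition maps preserve orientation.
\<close>

definition orientation_preserving_at :: "(real^3 \<Rightarrow> real^3) \<Rightarrow> real^3 \<Rightarrow> bool" where
  "orientation_preserving_at f p \<longleftrightarrow>
     (\<forall>\<^sub>F r in at_right 0.
        homotopic_with_canon (\<lambda>_. True) (sphere 0 r) (- {0}) (\<lambda>y. f (p + y) - f p) (\<lambda>y. y))"

definition orientable3 :: "'a topology \<Rightarrow> bool" where
  "orientable3 X \<longleftrightarrow> (\<exists>\<A>.
     (\<forall>(U, \<phi>) \<in> \<A>. chart3 X U \<phi>) \<and>
     (\<Union>(U, \<phi>) \<in> \<A>. U) = mfd_interior X \<and>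
     (\<forall>(U, \<phi>) \<in> \<A>. \<forall>(V, \<psi>) \<in> \<A>. \<forall>x \<in> U \<inter> V.
        orientation_preserving_at (\<psi> \<circ> inv_into U \<phi>) (\<phi> x)))"

text \<open>
  \<open>C(N)\<close> is realized on the set of subsets of \<open>N\<close>: the points are the components of the boundary
  and the singletons of interior points.
\<close>

definition collapse_map :: "'a topology \<Rightarrow> 'a \<Rightarrow> 'a set" where
  "collapse_map N x =
     (if x \<in> mfd_boundary N then connected_component_of_set (subtopology N (mfd_boundary N)) x
      else {x})"

definition collapse :: "'a topology \<Rightarrow> 'a set topology" where
  "collapse N = quot_topology N (collapse_map N)"

definition ideal_triangulation :: "'t set \<Rightarrow> 't gluing \<Rightarrow> 'a topology \<Rightarrow> bool" where
  "ideal_triangulation T g N \<longleftrightarrow>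
     face_pairing T g \<and>
     compact_space N \<and> manifold3 N \<and> mfd_boundary N \<noteq> {} \<and>
     (\<exists>h. homeomorphic_map (collapse N) (realization T g) h \<and>
          h ` (collapse_map N ` mfd_boundary N) = vertex_points T g)"


section \<open>Hyper-ideal tetrahedra\<close>

text \<open>
  Hyperbolic space is the projective (Klein) model, i.e. the open unit ball of \<open>\<real>\<^sup>3\<close>: geodesic
  convexity is Euclidean convexity, so that the compact convex polyhedra of hyperbolic space are
  the polytopes contained in the open unit ball.
\<close>

definition hyp_dist :: "real^3 \<Rightarrow> real^3 \<Rightarrow> real" where
  "hyp_dist p q = arcosh ((1 - p \<bullet> q) / sqrt ((1 - p \<bullet> p) * (1 - q \<bullet> q)))"

text \<open>
  \<open>hyp_dihedral P F G \<theta>\<close>: the interior hyperbolic dihedral angle of the solid polytope \<open>P\<close> between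
  its facets \<open>F\<close> and \<open>G\<close> is \<open>\<theta>\<close>. The half space \<open>n \<bullet> x \<le> c\<close> has the outward Lorentz normal
  \<open>(n, c)\<close>, with respect to the form \<open>(n, c) \<bullet> (m, e) = n \<bullet> m - c * e\<close>; for a facet of a solid
  polytope it is unique up to a positive factor, and hence \<open>\<theta>\<close> is unique.
\<close>

definition hyp_dihedral :: "(real^3) set \<Rightarrow> (real^3) set \<Rightarrow> (real^3) set \<Rightarrow> real \<Rightarrow> bool" where
  "hyp_dihedral P F G \<theta> \<longleftrightarrow> F facet_of P \<and> G facet_of P \<and>
     (\<exists>n c m e.
        P \<subseteq> {x. n \<bullet> x \<le> c} \<and> F = P \<inter> {x. n \<bullet> x = c} \<and>
        P \<subseteq> {x. m \<bullet> x \<le> e} \<and> G = P \<inter> {x. m \<bullet> x = e} \<and>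
        \<theta> = arccos (- (n \<bullet> m - c * e) / (sqrt (n \<bullet> n - c\<^sup>2) * sqrt (m \<bullet> m - e\<^sup>2))))"

text \<open>
  The combinatorial model of a truncated tetrahedron. Any truncation level strictly between
  \<open>1/2\<close> and \<open>1\<close> gives the same face lattice. Its facets are the hexagons \<open>trunc_hex k\<close> in
  the faces opposite to \<open>k\<close> and the triangles \<open>trunc_tri i\<close> cutting off \<open>i\<close>; \<open>trunc_vertex i j\<close>
  is the endpoint near \<open>i\<close> of the internal edge joining \<open>trunc_tri i\<close> and \<open>trunc_tri j\<close>.
\<close>

definition trunc_tet :: "(real^4) set" where
  "trunc_tet = {x \<in> tetrahedron. \<forall>i. x $ i \<le> 2/3}"

definition trunc_hex :: "4 \<Rightarrow> (real^4) set" where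
  "trunc_hex k = {x \<in> trunc_tet. x $ k = 0}"

definition trunc_tri :: "4 \<Rightarrow> (real^4) set" where
  "trunc_tri i = {x \<in> trunc_tet. x $ i = 2/3}"

definition trunc_vertex :: "4 \<Rightarrow> 4 \<Rightarrow> (real^4) set" where
  "trunc_vertex i j = {x \<in> trunc_tri i. \<forall>k. k \<noteq> i \<and> k \<noteq> j \<longrightarrow> x $ k = 0}"

text \<open>
  A hyper-ideal tetrahedron is marked by an isomorphism \<open>\<Phi>\<close> from the face lattice of the
  truncated tetrahedron to its own; \<open>\<Phi>\<close> is what labels its faces and internal edges.
\<close>

definition hyper_ideal_tet :: "(real^3) set \<Rightarrow> ((real^4) set \<Rightarrow> (real^3) set) \<Rightarrow> bool" where
  "hyper_ideal_tet P \<Phi> \<longleftrightarrow>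
     polytope P \<and> interior P \<noteq> {} \<and> P \<subseteq> ball 0 1 \<and>
     bij_betw \<Phi> {F. F face_of trunc_tet} {F. F face_of P} \<and>
     (\<forall>F G. F face_of trunc_tet \<longrightarrow> G face_of trunc_tet \<longrightarrow> (\<Phi> F \<subseteq> \<Phi> G \<longleftrightarrow> F \<subseteq> G)) \<and>
     (\<forall>i k. i \<noteq> k \<longrightarrow> hyp_dihedral P (\<Phi> (trunc_tri i)) (\<Phi> (trunc_hex k)) (pi / 2))"

definition internal_length :: "((real^4) set \<Rightarrow> (real^3) set) \<Rightarrow> 4 \<Rightarrow> 4 \<Rightarrow> real" where
  "internal_length \<Phi> i j =
     hyp_dist (the_elem (\<Phi> (trunc_vertex i j))) (the_elem (\<Phi> (trunc_vertex j i)))"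

definition geometric :: "'t set \<Rightarrow> 't gluing \<Rightarrow> bool" where
  "geometric T g \<longleftrightarrow>
     (\<exists>(l :: ('t \<times> 4 set) set \<Rightarrow> real) P \<Phi> (\<theta> :: 't \<times> 4 set \<Rightarrow> real).
        (\<forall>e \<in> quot_edges T g. 0 < l e) \<and>
        (\<forall>t \<in> T. hyper_ideal_tet (P t) (\<Phi> t) \<and>
           (\<forall>i j. i \<noteq> j \<longrightarrow>
              internal_length (\<Phi> t) i j = l (edge_class T g (t, {i, j}))) \<and>
           (\<forall>k m. k \<noteq> m \<longrightarrow>
              hyp_dihedral (P t) (\<Phi> t (trunc_hex k)) (\<Phi> t (trunc_hex m)) (\<theta> (t, - {k, m})))) \<and>
        (\<forall>e \<in> quot_edges T g. (\<Sum>\<epsilon> | \<epsilon> \<in> local_edges T \<and> edge_class T g \<epsilon> = e. \<theta> \<epsilon>) = 2 * pi))"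

end

theory Submission
  imports Defs
begin

text \<open>
  The triangulation is given by an explicit cyclic gluing table. Vertex links, valences and the genus
  are read off from the cycles of flags \<open>(t, i, j)\<close> around the edges. The manifold is the quotient of
  the truncated tetrahedra; its charts unfold the tetrahedra around an edge into sectors of the plane,
  and the linear parts of these charts are homotopic to each other because all gluings are odd
  permutations of the vertices. Pushing the truncated tetrahedra out to the full ones collapses the
  boundary to the vertex.

  By symmetry the edge lengths are determined by two numbers \<open>x = cosh l\<^sub>a\<close> and \<open>y = cosh l\<^sub>b\<close>, and the
  two angle equations are solved on the rectangle \<open>[1, 3] \<times> [1, 9/4]\<close> by Brouwer's theorem, since
  each angle sum crosses its target value between opposite sides. The hyper-ideal tetrahedra are then
  built in the projective model from vectors with the Gram matrix \<open>- cosh l\<^sub>i\<^sub>j\<close>.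
\<close>


text \<open>All blocks carry the same two edge lengths, so for every \<open>d\<close> only two
  equations remain: angle sum 2 pi at each a_k, and 2 pi / d for the share of one block in b. On the
  sides x = 1 and y = 1 of the rectangle the respective sum degenerates to 0; the constants 3 and
  9/4 are such that it exceeds 2 pi on the opposite side. This serves all targets in (0, 2 pi],
  hence all \<open>d\<close> at once.

  On the topological side the edges are the obstacle. A chart at an edge of valence n needs n
  consecutive convex sectors that close up after one turn. Hence the numbering of the flags around
  each edge, the sign that keeps an edge from being identified with its reverse, and the lower bound
  3 for \<open>len\<close>. These charts are only piecewise affine, while orientation is a matter of
  local degree; a transition map is therefore compared with an affine map at a nearby point inside a
  tetrahedron.

  The link has 2 vertices per edge and 6 sides and 4 triangles per tetrahedron, so its Euler
  characteristic is 2 (d + 1) - 18 d + 12 d = 2 - 4 d, which is genus 2 d.\<close>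

text \<open>
  \<open>(i, j, third i j, third j i)\<close> is an even permutation of the four vertices, which fixes the sense of
  rotation around the directed edge \<open>(i, j)\<close>.
\<close>

definition third :: "4 \<Rightarrow> 4 \<Rightarrow> 4" where
  "third i j =
     (if i = 1 then if j = 2 then 3 else if j = 3 then 4 else 2
      else if i = 2 then if j = 1 then 4 else if j = 3 then 1 else 3
      else if i = 3 then if j = 1 then 2 else if j = 2 then 4 else 1
      else if j = 1 then 3 else if j = 2 then 1 else 2)"

lemma third_neq:
  assumes "i \<noteq> j"
  shows "third i j \<noteq> i" "third i j \<noteq> j" "third i j \<noteq> third j i" "third j i \<noteq> i" "third j i \<noteq> j"
    "i \<noteq> third i j" "j \<noteq> third i j" "third j i \<noteq> third i j" "i \<noteq> third j i" "j \<noteq> third j i"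
  using assms exhaust_4[of i] exhaust_4[of j] by (auto simp: third_def)

lemma third_cases:
  assumes "i \<noteq> j"
  shows "m = i \<or> m = j \<or> m = third i j \<or> m = third j i"
  using assms exhaust_4[of i] exhaust_4[of j] exhaust_4[of m] by (auto simp: third_def)

lemma UNIV_third: "i \<noteq> j \<Longrightarrow> (UNIV :: 4 set) = {i, j, third i j, third j i}"
  using third_cases by blast

lemma third_cycle:
  assumes "i \<noteq> j"
  shows "third i (third i j) = third j i" "third (third i j) i = j"
    "third j (third i j) = i" "third (third i j) j = third j i"
    "third i (third j i) = j" "third (third j i) i = third i j"
  using assms exhaust_4[of i] exhaust_4[of j] by (auto simp: third_def)

lemma all_third: "i \<noteq> j \<Longrightarrow> (\<forall>m. P m) \<longleftrightarrow> P i \<and> P j \<and> P (third i j) \<and> P (third j i)"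
  using third_cases by metis

lemma sum_third:
  fixes f :: "4 \<Rightarrow> 'a::comm_monoid_add"
  assumes "i \<noteq> j"
  shows "sum f UNIV = f i + f j + f (third i j) + f (third j i)"
  unfolding UNIV_third[OF assms] using third_neq[OF assms] assms by (simp add: add.assoc)

section \<open>Equivalence closures of gluing steps\<close>

lemma equiv_glue_rel: "equiv S (glue_rel S step)"
proof (rule equivI)
  show "glue_rel S step \<subseteq> S \<times> S" by (auto simp: glue_rel_def)
  show "refl_on S (glue_rel S step)" by (auto simp: refl_on_def glue_rel_def)
  show "sym (glue_rel S step)" by (auto simp: sym_def glue_rel_def intro: equivclp_sym)
  show "trans (glue_rel S step)" by (auto simp: trans_def glue_rel_def intro: equivclp_trans)
qed

lemma glue_rel_Image: "x \<in> S \<Longrightarrow> glue_rel S step `` {x} = {y \<in> S. equivclp step x y}"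
  by (auto simp: glue_rel_def)

lemma equivclp_invariant:
  assumes "equivclp r x y" "P x"
    and "\<And>a b. P a \<Longrightarrow> r a b \<Longrightarrow> P b" "\<And>a b. P a \<Longrightarrow> r b a \<Longrightarrow> P b"
  shows "P y"
  using assms(1,2) by (induction rule: equivclp_induct) (use assms(3,4) in blast)+

lemma equivclp_map:
  assumes "equivclp r x y" "P x"
    and "\<And>a b. P a \<Longrightarrow> r a b \<Longrightarrow> P b \<and> equivclp s (f a) (f b)"
    and "\<And>a b. P a \<Longrightarrow> r b a \<Longrightarrow> P b \<and> equivclp s (f a) (f b)"
  shows "P y \<and> equivclp s (f x) (f y)"
  using assms(1)
proof (induction rule: equivclp_induct)
  case base
  then show ?case using assms(2) by simp
next
  case (step y z)
  then show ?case using assms(3)[of y z] assms(4)[of y z] by (meson equivclp_trans)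
qed

section \<open>Combinatorics of glued tetrahedra: cycles around edges, valences, the vertex
  link\<close>

locale face_paired =
  fixes T :: "nat set" and g :: "nat gluing"
  assumes face_pairing: "face_pairing T g"
begin

abbreviation nb :: "nat \<Rightarrow> 4 \<Rightarrow> nat" where "nb t f \<equiv> fst (g t f)"
abbreviation gl :: "nat \<Rightarrow> 4 \<Rightarrow> 4 \<Rightarrow> 4" where "gl t f \<equiv> snd (g t f)"

lemma finite_T: "finite T"
  using face_pairing by (simp add: face_pairing_def)

lemma glueD:
  assumes "t \<in> T"
  shows "nb t f \<in> T" "bij (gl t f)" "(nb t f, gl t f f) \<noteq> (t, f)"
    "g (nb t f) (gl t f f) = (t, inv (gl t f))"
  using face_pairing assms unfolding face_pairing_def by (metis prod.collapse)+

lemma gl_eq_iff: "t \<in> T \<Longrightarrow> gl t f i = gl t f j \<longleftrightarrow> i = j"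
  using glueD(2) by (metis bij_pointE)

lemma inv_gl: "t \<in> T \<Longrightarrow> inv (gl t f) (gl t f i) = i"
  using glueD(2) by (simp add: bij_is_inj)

lemma gl_inv: "t \<in> T \<Longrightarrow> gl t f (inv (gl t f) i) = i"
  using glueD(2) by (simp add: bij_is_surj surj_f_inv_f)

end

text \<open>
  A flag \<open>(t, i, j)\<close> is a directed local edge. Its quotient edge is \<open>ecl t i j\<close>, and \<open>esg t i j\<close> tells
  in which direction that edge is traversed; turning once around a quotient edge \<open>c\<close> meets
  \<open>len c\<close> flags of the same direction, numbered by \<open>pos\<close>.
\<close>

locale triangulation = face_paired T g
  for T :: "nat set" and g :: "nat gluing" +
  fixes ecl :: "nat \<Rightarrow> 4 \<Rightarrow> 4 \<Rightarrow> 'c" and esg :: "nat \<Rightarrow> 4 \<Rightarrow> 4 \<Rightarrow> bool"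
    and pos :: "nat \<Rightarrow> 4 \<Rightarrow> 4 \<Rightarrow> nat" and len :: "'c \<Rightarrow> nat"
  assumes T_nonempty: "T \<noteq> {}"
    and odd_gl: "t \<in> T \<Longrightarrow> i \<noteq> j \<Longrightarrow> third (snd (g t f) i) (snd (g t f) j) = snd (g t f) (third j i)"
    and ecl_sym: "t \<in> T \<Longrightarrow> i \<noteq> j \<Longrightarrow> ecl t j i = ecl t i j"
    and esg_anti: "t \<in> T \<Longrightarrow> i \<noteq> j \<Longrightarrow> esg t j i \<longleftrightarrow> \<not> esg t i j"
    and pos_less: "t \<in> T \<Longrightarrow> i \<noteq> j \<Longrightarrow> pos t i j < len (ecl t i j)"
    and len_ge: "t \<in> T \<Longrightarrow> i \<noteq> j \<Longrightarrow> len (ecl t i j) \<ge> 3"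
    and flag_step: "t \<in> T \<Longrightarrow> i \<noteq> j \<Longrightarrow> g t (third i j) = (t', \<sigma>) \<Longrightarrow>
       ecl t' (\<sigma> i) (\<sigma> j) = ecl t i j \<and> esg t' (\<sigma> i) (\<sigma> j) = esg t i j \<and>
       pos t' (\<sigma> i) (\<sigma> j) = Suc (pos t i j) mod len (ecl t i j)"
    and flag_inj: "t \<in> T \<Longrightarrow> i \<noteq> j \<Longrightarrow> t' \<in> T \<Longrightarrow> i' \<noteq> j' \<Longrightarrow> ecl t i j = ecl t' i' j' \<Longrightarrow>
       esg t i j = esg t' i' j' \<Longrightarrow> pos t i j = pos t' i' j' \<Longrightarrow> (t, i, j) = (t', i', j')"
    and vertices_connected: "t \<in> T \<Longrightarrow> t' \<in> T \<Longrightarrow> equivclp (vertex_step T g) (t, i) (t', i')"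
begin

definition flags :: "(nat \<times> 4 \<times> 4) set" where
  "flags = {(t, i, j). t \<in> T \<and> i \<noteq> j}"

definition fcl :: "nat \<times> 4 \<times> 4 \<Rightarrow> 'c \<times> bool" where
  "fcl = (\<lambda>(t, i, j). (ecl t i j, esg t i j))"

definition fpos :: "nat \<times> 4 \<times> 4 \<Rightarrow> nat" where
  "fpos = (\<lambda>(t, i, j). pos t i j)"

definition nx :: "nat \<times> 4 \<times> 4 \<Rightarrow> nat \<times> 4 \<times> 4" where
  "nx = (\<lambda>(t, i, j). (nb t (third i j), gl t (third i j) i, gl t (third i j) j))"

definition pv :: "nat \<times> 4 \<times> 4 \<Rightarrow> nat \<times> 4 \<times> 4" where
  "pv = (\<lambda>(t, i, j). (nb t (third j i), gl t (third j i) i, gl t (third j i) j))"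

lemma nx_flags: "F \<in> flags \<Longrightarrow> nx F \<in> flags"
  by (auto simp: flags_def nx_def glueD gl_eq_iff)

lemma pv_flags: "F \<in> flags \<Longrightarrow> pv F \<in> flags"
  by (auto simp: flags_def pv_def glueD gl_eq_iff)

text \<open>A gluing is odd, hence exchanges the two senses of rotation: behind the face
  \<open>third j i\<close> the partner face is the one that \<open>nx\<close> crosses from the new
  flag, so \<open>nx\<close> leads straight back.\<close>

lemma nx_pv: "F \<in> flags \<Longrightarrow> nx (pv F) = F"
  by (auto simp: flags_def pv_def nx_def odd_gl glueD(4) inv_gl)

lemma fcl_nx: "F \<in> flags \<Longrightarrow> fcl (nx F) = fcl F"
  using flag_step by (auto simp: flags_def nx_def fcl_def)

lemma fpos_nx: "F \<in> flags \<Longrightarrow> fpos (nx F) = Suc (fpos F) mod len (fst (fcl F))"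
  using flag_step by (auto simp: flags_def nx_def fcl_def fpos_def)

lemma fcl_pv: "F \<in> flags \<Longrightarrow> fcl (pv F) = fcl F"
  using fcl_nx[OF pv_flags, of F] by (simp add: nx_pv)

lemma fpos_less: "F \<in> flags \<Longrightarrow> fpos F < len (fst (fcl F))"
  using pos_less by (auto simp: flags_def fcl_def fpos_def)

lemma len_fcl: "F \<in> flags \<Longrightarrow> len (fst (fcl F)) \<ge> 3"
  using len_ge by (auto simp: flags_def fcl_def)

lemma flags_eqI: "F \<in> flags \<Longrightarrow> F' \<in> flags \<Longrightarrow> fcl F = fcl F' \<Longrightarrow> fpos F = fpos F' \<Longrightarrow> F = F'"
  using flag_inj[of "fst F" "fst (snd F)" "snd (snd F)" "fst F'" "fst (snd F')" "snd (snd F')"]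
  by (cases F; cases F') (auto simp: flags_def fcl_def fpos_def)

lemma nx_funpow:
  assumes "F \<in> flags"
  shows "(nx ^^ m) F \<in> flags \<and> fcl ((nx ^^ m) F) = fcl F \<and>
    fpos ((nx ^^ m) F) = (fpos F + m) mod len (fst (fcl F))"
proof (induction m)
  case 0
  then show ?case using assms fpos_less by simp
next
  case (Suc m)
  then show ?case
    by (simp add: nx_flags fcl_nx fpos_nx mod_Suc_eq)
qed

text \<open>\<open>nx\<close> raises the position by one modulo the length, and the position
  determines the flag inside a directed class; so such a class is a single cycle of
  \<open>nx\<close>.\<close>

lemma flags_reach:
  assumes "F \<in> flags" "F' \<in> flags" "fcl F = fcl F'"
  obtains m where "F' = (nx ^^ m) F"
proof -
  define n where "n = len (fst (fcl F))"
  have lt: "fpos F < n" "fpos F' < n"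
    using fpos_less assms unfolding n_def by metis+
  \<comment> \<open>Adding \<open>n\<close> first keeps the subtraction of natural numbers from
    being cut off at 0.\<close>
  define m where "m = fpos F' + n - fpos F"
  have "(fpos F + m) mod n = fpos F'"
    using lt by (simp add: m_def)
  then have "F' = (nx ^^ m) F"
    using nx_funpow[OF assms(1), of m] assms
    by (intro flags_eqI) (auto simp: n_def)
  then show ?thesis using that by blast
qed

text \<open>Only the faces \<open>third i j\<close> and \<open>third j i\<close> contain the edge
  {i, j}; they are the two ways out of a corner.\<close>

lemma corner_step_iff:
  assumes "F \<in> flags"
  shows "corner_step T g F F' \<longleftrightarrow> F' = nx F \<or> F' = pv F"
proof -
  obtain t i j where F: "F = (t, i, j)" by (cases F)
  obtain t' i' j' where F': "F' = (t', i', j')" by (cases F')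
  have ij: "i \<noteq> j" "t \<in> T" using assms by (auto simp: flags_def F)
  show ?thesis
    using ij third_neq[OF ij(1)] third_cases[OF ij(1)]
    unfolding corner_step_def nx_def pv_def F F' by (auto; metis)
qed

lemma corner_step_flags_iff: "corner_step T g F F' \<Longrightarrow> F \<in> flags \<longleftrightarrow> F' \<in> flags"
  by (auto simp: corner_step_def flags_def glueD gl_eq_iff)

lemma corner_equiv_imp:
  assumes "F \<in> flags" "equivclp (corner_step T g) F F'"
  shows "F' \<in> flags \<and> fcl F' = fcl F"
proof (rule equivclp_invariant[OF assms(2)])
  have st: "fcl a = fcl b" if "a \<in> flags" "corner_step T g a b" for a b
    using that corner_step_iff fcl_nx fcl_pv by metis
  show "b \<in> flags \<and> fcl b = fcl F" if "a \<in> flags \<and> fcl a = fcl F" "corner_step T g a b" for a b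
    using that st[OF _ that(2)] corner_step_flags_iff[OF that(2)] by simp
  show "b \<in> flags \<and> fcl b = fcl F" if "a \<in> flags \<and> fcl a = fcl F" "corner_step T g b a" for a b
    using that st[OF _ that(2)] corner_step_flags_iff[OF that(2)] by simp
  show "F \<in> flags \<and> fcl F = fcl F" using assms(1) by simp
qed

lemma corner_equiv_nx: "F \<in> flags \<Longrightarrow> equivclp (corner_step T g) F ((nx ^^ m) F)"
proof (induction m)
  case (Suc m)
  have "corner_step T g ((nx ^^ m) F) ((nx ^^ Suc m) F)"
    using nx_funpow[OF Suc.prems, of m] corner_step_iff by simp
  then show ?case using Suc by (meson equivclp_trans r_into_equivclp)
qed simp

lemma corner_equiv_iff:
  assumes "F \<in> flags" "F' \<in> flags"
  shows "equivclp (corner_step T g) F F' \<longleftrightarrow> fcl F = fcl F'"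
  using assms corner_equiv_imp corner_equiv_nx flags_reach by metis

lemma edge_equiv_of_corner:
  assumes "equivclp (corner_step T g) (t, i, j) (t', i', j')" "i \<noteq> j" "t \<in> T"
  shows "equivclp (edge_step T g) (t, {i, j}) (t', {i', j'})"
proof -
  let ?f = "\<lambda>(t, i, j). (t, {i, j :: 4})"
  have st: "equivclp (edge_step T g) (?f a) (?f b)" if "corner_step T g a b" for a b
    using that by (intro r_into_equivclp) (auto simp: corner_step_def edge_step_def)
  have "True \<and> equivclp (edge_step T g) (?f (t, i, j)) (?f (t', i', j'))"
    using assms(1)
  proof (rule equivclp_map[where P = "\<lambda>_. True" and f = ?f])
    show "True \<and> equivclp (edge_step T g) (?f a) (?f b)" if "corner_step T g a b" for a b
      using st[OF that] by simp
    show "True \<and> equivclp (edge_step T g) (?f a) (?f b)" if "corner_step T g b a" for a b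
      using equivclp_sym[OF st[OF that]] by simp
  qed simp
  then show ?thesis by simp
qed

text \<open>A local edge underlies two opposite flags with the same label. Gluing preserves the
  label, and two local edges with equal labels are joined by a walk of corners once one flag has
  been reversed, if necessary, to make the directions agree.\<close>

lemma edge_equiv_iff:
  assumes "t \<in> T" "i \<noteq> j" "t' \<in> T" "i' \<noteq> j'"
  shows "equivclp (edge_step T g) (t, {i, j}) (t', {i', j'}) \<longleftrightarrow> ecl t i j = ecl t' i' j'"
proof
  \<comment> \<open>Quantifying over both orderings of \<open>s\<close> makes the label a property
    of the undirected edge.\<close>
  define P where "P = (\<lambda>(u, s :: 4 set). u \<in> T \<and> card s = 2 \<and> (\<forall>k l. k \<noteq> l \<longrightarrow> s = {k, l} \<longrightarrow> ecl u k l = ecl t i j))"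
  have st: "P a \<longleftrightarrow> P b" if ab: "edge_step T g a b" for a b
  proof -
    obtain u s u' s' where a: "a = (u, s)" and b: "b = (u', s')" by (metis surj_pair)
    obtain f where f: "u \<in> T" "f \<notin> s" "u' = nb u f" "s' = gl u f ` s"
      using ab by (auto simp: edge_step_def a b)
    have inj: "inj (gl u f)" using f glueD(2) bij_is_inj by blast
    have u': "u' \<in> T" using f glueD by simp
    have card: "card s' = card s" using inj f by (metis card_image inj_on_subset subset_UNIV)
    have ecl: "ecl u' (gl u f k) (gl u f l) = ecl u k l" if "k \<noteq> l" "s = {k, l}" for k l
    proof -
      have kl: "(u, k, l) \<in> flags" using that f by (simp add: flags_def)
      have "(u', gl u f k, gl u f l) \<in> {nx (u, k, l), pv (u, k, l)}"
        using third_cases[OF that(1), of f] f that by (auto simp: nx_def pv_def)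
      then have "fcl (u', gl u f k, gl u f l) = fcl (u, k, l)"
        using fcl_nx[OF kl] fcl_pv[OF kl] by auto
      then show ?thesis by (simp add: fcl_def)
    qed
    show ?thesis
    proof (cases "card s = 2")
      case True
      then obtain k l where kl: "s = {k, l}" "k \<noteq> l" by (meson card_2_iff)
      have s': "s' = {gl u f k, gl u f l}" using f kl by simp
      have ne: "gl u f k \<noteq> gl u f l" using kl f gl_eq_iff by simp
      have "P a \<longleftrightarrow> ecl u k l = ecl t i j"
        using kl f ecl_sym[OF f(1) kl(2)] by (auto simp: P_def a doubleton_eq_iff)
      moreover have "P b \<longleftrightarrow> ecl u' (gl u f k) (gl u f l) = ecl t i j"
        using s' ne u' ecl_sym[OF u' ne] by (auto simp: P_def b doubleton_eq_iff)
      ultimately show ?thesis using ecl kl by simp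
    qed (auto simp: P_def a b card)
  qed
  assume eq: "equivclp (edge_step T g) (t, {i, j}) (t', {i', j'})"
  have "P (t', {i', j'})"
    by (rule equivclp_invariant[OF eq, where P = P]) (use st assms ecl_sym[OF assms(1,2)] in \<open>auto simp: P_def doubleton_eq_iff\<close>)
  then show "ecl t i j = ecl t' i' j'" using assms by (auto simp: P_def)
next
  assume e: "ecl t i j = ecl t' i' j'"
  show "equivclp (edge_step T g) (t, {i, j}) (t', {i', j'})"
  proof (cases "esg t i j = esg t' i' j'")
    case True
    then have "equivclp (corner_step T g) (t, i, j) (t', i', j')"
      using e assms by (subst corner_equiv_iff) (auto simp: flags_def fcl_def)
    then show ?thesis using edge_equiv_of_corner assms by blast
  next
    case False
    then have "equivclp (corner_step T g) (t, i, j) (t', j', i')"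
      using e assms esg_anti[OF assms(3,4)] ecl_sym[OF assms(3,4)]
      by (subst corner_equiv_iff) (auto simp: flags_def fcl_def)
    then show ?thesis using edge_equiv_of_corner[of t i j t' j' i'] assms by (simp add: insert_commute)
  qed
qed

definition labels :: "'c set" where
  "labels = {ecl t i j | t i j. t \<in> T \<and> i \<noteq> j}"

definition eset :: "'c \<Rightarrow> (nat \<times> 4 set) set" where
  "eset c = {(t, {i, j}) | t i j. t \<in> T \<and> i \<noteq> j \<and> ecl t i j = c}"

lemma local_edges_eq: "local_edges T = {(t, {i, j}) | t i j. t \<in> T \<and> i \<noteq> j}"
  by (auto simp: local_edges_def card_2_iff)

lemma edge_class_eq:
  assumes "t \<in> T" "i \<noteq> j"
  shows "edge_class T g (t, {i, j}) = eset (ecl t i j)"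
proof -
  have "(t, {i, j}) \<in> local_edges T" using assms by (auto simp: local_edges_eq)
  then have "edge_class T g (t, {i, j}) = {y \<in> local_edges T. equivclp (edge_step T g) (t, {i, j}) y}"
    unfolding edge_class_def by (rule glue_rel_Image)
  also have "\<dots> = eset (ecl t i j)"
    unfolding local_edges_eq eset_def using edge_equiv_iff[OF assms] by fastforce
  finally show ?thesis .
qed

lemma quot_edges_eq: "quot_edges T g = eset ` labels"
proof -
  have "quot_edges T g = edge_class T g ` local_edges T"
    by (auto simp: quot_edges_def quotient_def edge_class_def)
  also have "\<dots> = eset ` labels"
  proof (intro equalityI subsetI)
    fix e assume "e \<in> edge_class T g ` local_edges T"
    then obtain t i j where "t \<in> T" "i \<noteq> j" "e = edge_class T g (t, {i, j})"
      by (auto simp: local_edges_eq)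
    then have "e = eset (ecl t i j)" "ecl t i j \<in> labels"
      using edge_class_eq by (auto simp: labels_def)
    then show "e \<in> eset ` labels" by blast
  next
    fix e assume "e \<in> eset ` labels"
    then obtain t i j where "t \<in> T" "i \<noteq> j" "e = eset (ecl t i j)" by (auto simp: labels_def)
    then have "e = edge_class T g (t, {i, j})" "(t, {i, j}) \<in> local_edges T"
      using edge_class_eq by (auto simp: local_edges_eq)
    then show "e \<in> edge_class T g ` local_edges T" by blast
  qed
  finally show ?thesis .
qed

lemma eset_mem_iff:
  assumes "t \<in> T" "i \<noteq> j"
  shows "(t, {i, j}) \<in> eset c \<longleftrightarrow> ecl t i j = c"
  using assms ecl_sym[OF assms] by (auto simp: eset_def doubleton_eq_iff)

lemma inj_eset: "inj_on eset labels"
proof (intro inj_onI)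
  fix c c' assume c: "c \<in> labels" and eq: "eset c = eset c'"
  obtain t i j where t: "t \<in> T" "i \<noteq> j" "c = ecl t i j" using c by (auto simp: labels_def)
  show "c = c'" using eset_mem_iff[OF t(1,2), of c] eset_mem_iff[OF t(1,2), of c'] t(3) eq by simp
qed

lemma flags_class_bij:
  assumes "F \<in> flags"
  shows "bij_betw fpos {F' \<in> flags. fcl F' = fcl F} {..<len (fst (fcl F))}"
proof (rule bij_betwI')
  fix x y assume "x \<in> {F' \<in> flags. fcl F' = fcl F}" "y \<in> {F' \<in> flags. fcl F' = fcl F}"
  then show "(fpos x = fpos y) = (x = y)" using flags_eqI[of x y] by auto
next
  fix x assume "x \<in> {F' \<in> flags. fcl F' = fcl F}"
  then show "fpos x \<in> {..<len (fst (fcl F))}" using fpos_less[of x] by auto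
next
  fix m assume m: "m \<in> {..<len (fst (fcl F))}"
  have "fpos ((nx ^^ (m + len (fst (fcl F)) - fpos F)) F) = m"
    using nx_funpow[OF assms, of "m + len (fst (fcl F)) - fpos F"] fpos_less[OF assms] m by simp
  then show "\<exists>x\<in>{F' \<in> flags. fcl F' = fcl F}. m = fpos x"
    using nx_funpow[OF assms, of "m + len (fst (fcl F)) - fpos F"]
    by (intro bexI[of _ "(nx ^^ (m + len (fst (fcl F)) - fpos F)) F"]) simp_all
qed

text \<open>Of the two flags on a local edge exactly one has the sign of the flag chosen for
  \<open>c\<close>. So local edges with label \<open>c\<close> can be counted by flags of one
  directed class, and these fill the positions below \<open>len c\<close>.\<close>

lemma valence_eset:
  assumes "c \<in> labels"
  shows "valence T g (eset c) = len c"
proof -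
  obtain t i j where c: "t \<in> T" "i \<noteq> j" "c = ecl t i j" using assms by (auto simp: labels_def)
  have F: "(t, i, j) \<in> flags" using c by (simp add: flags_def)
  let ?S = "{F' \<in> flags. fcl F' = fcl (t, i, j)}"
  have "{\<epsilon> \<in> local_edges T. edge_class T g \<epsilon> = eset c} = eset c"
  proof -
    have "edge_class T g (u, {k, l}) = eset c \<longleftrightarrow> ecl u k l = c" if "u \<in> T" "k \<noteq> l" for u k l
      using edge_class_eq[OF that] eset_mem_iff[OF that, of "ecl u k l"] eset_mem_iff[OF that, of c] by auto
    then have "edge_class T g p = eset c \<longleftrightarrow> p \<in> eset c" if "p \<in> local_edges T" for p
      using that eset_mem_iff unfolding local_edges_eq by force
    moreover have "eset c \<subseteq> local_edges T" by (auto simp: eset_def local_edges_eq)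
    ultimately show ?thesis by blast
  qed
  moreover have "eset c = (\<lambda>(t, i, j). (t, {i, j})) ` ?S"
  proof -
    have "(u, {k, l}) \<in> (\<lambda>(t, i, j). (t, {i, j})) ` ?S" if "u \<in> T" "k \<noteq> l" "ecl u k l = c" for u k l
    proof (cases "esg u k l = esg t i j")
      case True
      then have "(u, k, l) \<in> ?S" using that c by (simp add: flags_def fcl_def)
      then show ?thesis by force
    next
      case False
      then have "(u, l, k) \<in> ?S"
        using that c ecl_sym[OF that(1,2)] esg_anti[OF that(1,2)] by (auto simp: flags_def fcl_def)
      then show ?thesis by (force simp: insert_commute)
    qed
    then show ?thesis using c by (auto simp: eset_def flags_def fcl_def)
  qed
  moreover have "inj_on (\<lambda>(t, i, j). (t, {i, j})) ?S"
  proof -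
    have "False" if "u \<in> T" "k \<noteq> l" "esg u k l = esg t i j" "esg u l k = esg t i j" for u k l
      using that esg_anti[OF that(1,2)] by simp
    then show ?thesis by (auto simp: inj_on_def flags_def fcl_def doubleton_eq_iff)
  qed
  moreover have "card ?S = len c"
    using bij_betw_same_card[OF flags_class_bij[OF F]] c by (simp add: fcl_def)
  ultimately show ?thesis unfolding valence_def by (simp add: card_image)
qed

lemma quot_vertices_eq: "quot_vertices T g = {T \<times> UNIV}"
proof -
  have "glue_rel (T \<times> UNIV) (vertex_step T g) `` {x} = T \<times> UNIV" if "x \<in> T \<times> UNIV" for x
    unfolding glue_rel_Image[OF that] using that vertices_connected by auto
  then show ?thesis
    unfolding quot_vertices_def quotient_def using T_nonempty by auto
qed

lemma finite_flags: "finite flags"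
  by (rule finite_subset[of _ "T \<times> UNIV \<times> UNIV"]) (auto simp: flags_def finite_T)

lemma card_flags: "card flags = 12 * card T"
proof -
  have "flags = T \<times> {(i, j). i \<noteq> j}" by (auto simp: flags_def)
  moreover have "{(i, j). i \<noteq> (j :: 4)} = UNIV \<times> UNIV - (\<lambda>i. (i, i)) ` UNIV" by auto
  then have "card {(i, j). i \<noteq> (j :: 4)} = 12"
    by (simp add: card_Diff_subset card_cartesian_product card_image inj_on_def)
  ultimately show ?thesis by (simp add: card_cartesian_product)
qed

lemma link_flags_eq: "link_flags (T \<times> UNIV) = flags"
  by (auto simp: link_flags_def flags_def)

text \<open>A quotient edge meets the link in its two ends, and the sign of a flag tells at which of
  them the corner lies.\<close>

lemma card_corner_classes: "card (flags // glue_rel flags (corner_step T g)) = 2 * card labels"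
proof -
  let ?h = "\<lambda>c. {F' \<in> flags. fcl F' = c}"
  have "flags // glue_rel flags (corner_step T g) = (\<lambda>F. {F' \<in> flags. equivclp (corner_step T g) F F'}) ` flags"
    by (auto simp: quotient_def glue_rel_Image)
  also have "\<dots> = (\<lambda>F. ?h (fcl F)) ` flags"
    by (intro image_cong refl) (auto simp: corner_equiv_iff)
  also have "\<dots> = ?h ` (fcl ` flags)" by (simp add: image_image)
  finally have 1: "flags // glue_rel flags (corner_step T g) = ?h ` (fcl ` flags)" .
  have "inj_on ?h (fcl ` flags)" by (auto simp: inj_on_def)
  moreover have "fcl ` flags = labels \<times> UNIV"
  proof -
    have "(ecl t i j, b) \<in> fcl ` flags" if "t \<in> T" "i \<noteq> j" for t i j b
    proof (cases "esg t i j = b")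
      case True
      then have "(ecl t i j, b) = fcl (t, i, j)" "(t, i, j) \<in> flags" using that by (auto simp: fcl_def flags_def)
      then show ?thesis by blast
    next
      case False
      then have "(ecl t i j, b) = fcl (t, j, i)" "(t, j, i) \<in> flags"
        using that esg_anti[OF that] ecl_sym[OF that] by (auto simp: fcl_def flags_def)
      then show ?thesis by blast
    qed
    then show ?thesis unfolding labels_def by (auto simp: fcl_def flags_def)
  qed
  ultimately show ?thesis unfolding 1
    by (simp add: card_image card_cartesian_product)
qed

text \<open>Gluing along sides is an involution without fixed points, because no face is glued to
  itself; hence every class has two elements.\<close>

lemma card_side_classes: "2 * card (flags // glue_rel flags (side_step T g)) = card flags"
proof -
  define s where "s = (\<lambda>(t, i, f). (nb t f, gl t f i, gl t f f))"
  have sF: "s F \<in> flags" "s (s F) = F" "s F \<noteq> F" if "F \<in> flags" for F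
    using that glueD by (auto simp: s_def flags_def gl_eq_iff inv_gl)
  have step: "side_step T g F F' \<longleftrightarrow> F \<in> flags \<and> F' = s F" for F F'
    by (auto simp: side_step_def s_def flags_def)
  have cls: "equivclp (side_step T g) F F' \<longleftrightarrow> F' = F \<or> F' = s F" if "F \<in> flags" for F F'
  proof
    assume e: "equivclp (side_step T g) F F'"
    show "F' = F \<or> F' = s F"
    proof (rule equivclp_invariant[OF e, where P = "\<lambda>x. x = F \<or> x = s F"])
      show "b = F \<or> b = s F" if "a = F \<or> a = s F" "side_step T g a b" for a b
        using that step[of a b] sF[OF \<open>F \<in> flags\<close>] by auto
      show "b = F \<or> b = s F" if "a = F \<or> a = s F" "side_step T g b a" for a b
        using that step[of b a] sF[of b] sF[OF \<open>F \<in> flags\<close>] by metis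
    qed simp
  next
    assume "F' = F \<or> F' = s F"
    then show "equivclp (side_step T g) F F'"
      using step[of F "s F"] that by (auto intro: r_into_equivclp)
  qed
  let ?R = "glue_rel flags (side_step T g)"
  have E: "equiv flags ?R" by (rule equiv_glue_rel)
  have U: "\<Union> (flags // ?R) = flags" using E by (rule Union_quotient)
  have "2 * card (flags // ?R) = card (\<Union> (flags // ?R))"
  proof (rule card_partition)
    show "finite (flags // ?R)"
      using finite_flags by (rule finite_quotient) (auto simp: glue_rel_def)
    show "finite (\<Union> (flags // ?R))" using U finite_flags by simp
    show "c1 \<inter> c2 = {}" if "c1 \<in> flags // ?R" "c2 \<in> flags // ?R" "c1 \<noteq> c2" for c1 c2
      using quotient_disj[OF E that(1,2)] that(3) by blast
    fix c assume "c \<in> flags // ?R"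
    then obtain F where F: "F \<in> flags" "c = ?R `` {F}" by (auto simp: quotient_def)
    then have "c = {F' \<in> flags. F' = F \<or> F' = s F}" using cls[OF F(1)] by (simp add: glue_rel_Image)
    then have "c = {F, s F}" using sF(1)[OF F(1)] F(1) by blast
    then show "card c = 2" using sF(3)[OF F(1)] by auto
  qed
  then show ?thesis using U by simp
qed

text \<open>Per tetrahedron the link has 4 triangles and 6 sides, and per edge 2 vertices, so its
  Euler characteristic is twice \<open>card labels\<close> minus twice
  \<open>card T\<close>.\<close>

lemma link_genus_eq: "link_genus T g (T \<times> UNIV) = 1 + real (card T) - real (card labels)"
proof -
  have "card (flags // glue_rel flags (side_step T g)) = 6 * card T"
    using card_side_classes card_flags by simp
  then have "link_euler_char T g (T \<times> UNIV) = 2 * int (card labels) - 2 * int (card T)"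
    unfolding link_euler_char_def link_flags_eq card_corner_classes
    by (simp add: card_cartesian_product)
  then show ?thesis by (simp add: link_genus_def)
qed

end

section \<open>Sectors of the plane\<close>

lemma cis_two_pi_mult: "cis (2 * pi / real n * real (m mod n)) = cis (2 * pi / real n * real m)" if "n > 0"
proof -
  have "real m = real n * real (m div n) + real (m mod n)"
    by (metis of_nat_add of_nat_mult mult_div_mod_eq)
  then have "2 * pi / real n * real m = 2 * pi * real (m div n) + 2 * pi / real n * real (m mod n)"
    using that by (simp add: field_simps)
  then have "cis (2 * pi / real n * real m) =
      cis (2 * pi * real (m div n)) * cis (2 * pi / real n * real (m mod n))"
    by (simp only: cis_mult)
  moreover have "cis (2 * pi * real (m div n)) = 1"
    by (rule cis_multiple_2pi) simp
  ultimately show ?thesis by simp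
qed

text \<open>At least three sectors make each of them convex: two rays at an angle below pi give
  linear coordinates.\<close>

lemma sector_width:
  assumes "n \<ge> 3" "\<alpha> = 2 * pi / real n"
  shows "0 < \<alpha>" "\<alpha> < pi"
proof -
  have "2 * pi < real n * pi" using assms by simp
  then show "0 < \<alpha>" "\<alpha> < pi" using assms by (simp_all add: divide_less_eq mult.commute)
qed

text \<open>If w had an argument b in [\<alpha>, pi], then |w| sin (b - \<alpha>) would be
  nonnegative, but it equals - s sin \<alpha>.\<close>

lemma sector_angle:
  assumes "0 < \<alpha>" "\<alpha> < pi" "0 < s" "0 \<le> u"
  shows "Arg2pi (complex_of_real s + of_real u * cis \<alpha>) < \<alpha>"
proof (rule ccontr)
  let ?w = "complex_of_real s + of_real u * cis \<alpha>"
  let ?b = "Arg2pi ?w"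
  assume "\<not> ?b < \<alpha>"
  moreover have "0 \<le> sin \<alpha>" using assms by (intro sin_ge_zero) auto
  then have "0 \<le> Im ?w" using assms by simp
  then have "?b \<le> pi" using Arg2pi_le_pi by blast
  ultimately have "0 \<le> sin (?b - \<alpha>)" using assms by (intro sin_ge_zero) auto
  then have "0 \<le> cmod ?w * sin (?b - \<alpha>)" by simp
  also have "\<dots> = Im ?w * cos \<alpha> - Re ?w * sin \<alpha>"
    unfolding sin_diff cos_Arg2pi[of ?w, symmetric] sin_Arg2pi[of ?w, symmetric]
    by (simp add: algebra_simps)
  also have "\<dots> = - (s * sin \<alpha>)" by (simp add: algebra_simps)
  finally have "s * sin \<alpha> \<le> 0" by simp
  moreover have "0 < sin \<alpha>" using assms by (intro sin_gt_zero) auto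
  ultimately show False using assms by (simp add: mult_le_0_iff)
qed

lemma sector_coords_inj:
  assumes "0 < \<alpha>" "\<alpha> < pi"
    and "complex_of_real s + of_real u * cis \<alpha> = complex_of_real s' + of_real u' * cis \<alpha>"
  shows "s = s' \<and> u = u'"
proof -
  have "0 < sin \<alpha>" using assms by (intro sin_gt_zero) auto
  moreover have "Im (complex_of_real s + of_real u * cis \<alpha>) = Im (complex_of_real s' + of_real u' * cis \<alpha>)"
    using assms(3) by simp
  ultimately have "u = u'" by simp
  then show ?thesis using assms(3) by simp
qed

text \<open>For s > 0 the point stays off the closing ray of its sector, so its argument is \<alpha>
  m + b with 0 \<le> b < \<alpha>. These half-open intervals are disjoint and lie within one full
  turn.\<close>

lemma sector_unique_pos:
  assumes n: "n \<ge> 3" "\<alpha> = 2 * pi / real n" and m: "m < n" "m' < n"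
    and "0 < s" "0 \<le> u" "0 < s'" "0 \<le> u'"
    and eq: "cis (\<alpha> * real m) * (complex_of_real s + of_real u * cis \<alpha>) =
             cis (\<alpha> * real m') * (complex_of_real s' + of_real u' * cis \<alpha>)"
  shows "m = m' \<and> s = s' \<and> u = u'"
proof -
  note al = sector_width[OF n]
  have arg: "\<exists>b. 0 \<le> b \<and> b < \<alpha> \<and> Arg2pi (cis (\<alpha> * real k) * (complex_of_real r + of_real q * cis \<alpha>)) = \<alpha> * real k + b"
    if "0 < r" "0 \<le> q" "k < n" for r q k
  proof -
    let ?w = "complex_of_real r + of_real q * cis \<alpha>"
    have b: "0 \<le> Arg2pi ?w" "Arg2pi ?w < \<alpha>" using sector_angle[OF al that(1,2)] Arg2pi_ge_0 by auto
    have "0 < Re ?w \<or> Im ?w \<noteq> 0"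
    proof (cases "q = 0")
      case False
      then show ?thesis using al sin_gt_zero[of \<alpha>] by simp
    qed (use that in simp)
    then have w0: "?w \<noteq> 0" by (metis less_irrefl zero_complex.sel)
    have "\<alpha> * real k + Arg2pi ?w < \<alpha> * real k + \<alpha>" using b by simp
    also have "\<dots> = \<alpha> * real (Suc k)" by (simp add: algebra_simps)
    also have "\<dots> \<le> \<alpha> * real n" using that al by (intro mult_left_mono) auto
    also have "\<dots> = 2 * pi" using n by simp
    finally have lt: "\<alpha> * real k + Arg2pi ?w < 2 * pi" .
    have "Arg2pi (cis (\<alpha> * real k) * ?w) = \<alpha> * real k + Arg2pi ?w"
    proof (rule Arg2pi_unique[of "cmod ?w"])
      have "?w = of_real (cmod ?w) * exp (\<i> * of_real (Arg2pi ?w))" by (rule Arg2pi_eq)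
      then have "cis (\<alpha> * real k) * ?w = cis (\<alpha> * real k) * (of_real (cmod ?w) * exp (\<i> * of_real (Arg2pi ?w)))"
        by (rule arg_cong)
      also have "\<dots> = of_real (cmod ?w) * exp (\<i> * of_real (\<alpha> * real k + Arg2pi ?w))"
        by (simp add: cis_conv_exp distrib_left exp_add mult_ac)
      finally show "of_real (cmod ?w) * exp (\<i> * of_real (\<alpha> * real k + Arg2pi ?w)) = cis (\<alpha> * real k) * ?w"
        by (rule sym)
    qed (use w0 lt b al in auto)
    then show ?thesis using b by blast
  qed
  obtain b where b: "0 \<le> b" "b < \<alpha>" "Arg2pi (cis (\<alpha> * real m) * (complex_of_real s + of_real u * cis \<alpha>)) = \<alpha> * real m + b"
    using arg[of s u m] assms by blast
  obtain b' where b': "0 \<le> b'" "b' < \<alpha>" "Arg2pi (cis (\<alpha> * real m') * (complex_of_real s' + of_real u' * cis \<alpha>)) = \<alpha> * real m' + b'"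
    using arg[of s' u' m'] assms by blast
  have e: "\<alpha> * real m + b = \<alpha> * real m' + b'" using b b' eq by simp
  have "\<not> k < k'" if "\<alpha> * real k + c = \<alpha> * real k' + c'" "0 \<le> c'" "c < \<alpha>" for k k' c c'
  proof
    assume "k < k'"
    then have "\<alpha> * real (Suc k) \<le> \<alpha> * real k'" using al by (intro mult_left_mono) auto
    then show False using that by (simp add: algebra_simps)
  qed
  from this[of m b m' b'] this[of m' b' m b] have mm: "m = m'" using e b b' by linarith
  then have "complex_of_real s + of_real u * cis \<alpha> = complex_of_real s' + of_real u' * cis \<alpha>"
    using eq by simp
  then show ?thesis using mm sector_coords_inj[OF al] by blast
qed

lemma sector_shift:
  assumes "n > 0" "\<alpha> = 2 * pi / real n"
  shows "cis (\<alpha> * real m) * (complex_of_real 0 + of_real u * cis \<alpha>) =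
         cis (\<alpha> * real (Suc m mod n)) * (complex_of_real u + of_real 0 * cis \<alpha>)"
proof -
  have "cis (\<alpha> * real (Suc m mod n)) = cis (\<alpha> * real (Suc m))"
    using cis_two_pi_mult[OF assms(1), of "Suc m"] assms(2) by simp
  also have "\<dots> = cis (\<alpha> * real m) * cis \<alpha>" by (simp add: cis_mult algebra_simps)
  finally show ?thesis by simp
qed

text \<open>The coincidences listed are exactly those that gluing around an edge produces: the
  common apex, and the closing ray of one sector with the opening ray of the next. A point with s =
  0 is moved on to the next sector, where its first coordinate is positive.\<close>

lemma sector_unique:
  assumes n: "n \<ge> 3" "\<alpha> = 2 * pi / real n" and m: "m < n" "m' < n"
    and nonneg: "0 \<le> s" "0 \<le> u" "0 \<le> s'" "0 \<le> u'"
    and eq: "cis (\<alpha> * real m) * (complex_of_real s + of_real u * cis \<alpha>) =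
             cis (\<alpha> * real m') * (complex_of_real s' + of_real u' * cis \<alpha>)"
  shows "(s = 0 \<and> u = 0 \<and> s' = 0 \<and> u' = 0) \<or> (m = m' \<and> s = s' \<and> u = u') \<or>
    (m' = Suc m mod n \<and> s = 0 \<and> u' = 0 \<and> u = s') \<or> (m = Suc m' mod n \<and> s' = 0 \<and> u = 0 \<and> u' = s)"
proof -
  note al = sector_width[OF n]
  have n0: "n > 0" using n by simp
  have zero: "s = 0 \<and> u = 0 \<longleftrightarrow> s' = 0 \<and> u' = 0"
  proof -
    have "cmod (complex_of_real s + of_real u * cis \<alpha>) = cmod (complex_of_real s' + of_real u' * cis \<alpha>)"
      using arg_cong[OF eq, of cmod] by (simp only: norm_mult norm_cis mult_1)
    then have "cmod (complex_of_real s + of_real u * cis \<alpha>) = 0 \<longleftrightarrow> cmod (complex_of_real s' + of_real u' * cis \<alpha>) = 0"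
      by (rule arg_cong)
    then have "complex_of_real s + of_real u * cis \<alpha> = 0 \<longleftrightarrow> complex_of_real s' + of_real u' * cis \<alpha> = 0"
      by (simp only: norm_eq_zero)
    moreover have "complex_of_real s + of_real u * cis \<alpha> = 0 \<longleftrightarrow> s = 0 \<and> u = 0"
      using sector_coords_inj[OF al, of s u 0 0] by auto
    moreover have "complex_of_real s' + of_real u' * cis \<alpha> = 0 \<longleftrightarrow> s' = 0 \<and> u' = 0"
      using sector_coords_inj[OF al, of s' u' 0 0] by auto
    ultimately show ?thesis by blast
  qed
  have lt: "Suc m mod n < n" "Suc m' mod n < n" using n0 by simp_all
  have "s = 0 \<and> u = 0 \<or> 0 < s \<and> 0 < s' \<or> s = 0 \<and> 0 < u \<and> 0 < s' \<or> 0 < s \<and> s' = 0 \<and> 0 < u' \<or>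
      s = 0 \<and> 0 < u \<and> s' = 0 \<and> 0 < u'"
    using nonneg zero by (cases "s = 0"; cases "s' = 0"; cases "u = 0"; cases "u' = 0") auto
  then consider "s = 0 \<and> u = 0" | "0 < s" "0 < s'" | "s = 0" "0 < u" "0 < s'" | "0 < s" "s' = 0" "0 < u'"
    | "s = 0" "0 < u" "s' = 0" "0 < u'"
    by blast
  then show ?thesis
  proof cases
    case 1
    then show ?thesis using zero by simp
  next
    case 2
    then show ?thesis using sector_unique_pos[OF n m _ nonneg(2) _ nonneg(4) eq] by blast
  next
    case 3
    then have "cis (\<alpha> * real (Suc m mod n)) * (complex_of_real u + of_real 0 * cis \<alpha>) =
             cis (\<alpha> * real m') * (complex_of_real s' + of_real u' * cis \<alpha>)"
      using eq sector_shift[OF n0 n(2), of m u] by simp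
    from sector_unique_pos[OF n lt(1) m(2) _ _ _ nonneg(4) this] 3 show ?thesis by simp
  next
    case 4
    then have "cis (\<alpha> * real m) * (complex_of_real s + of_real u * cis \<alpha>) =
        cis (\<alpha> * real (Suc m' mod n)) * (complex_of_real u' + of_real 0 * cis \<alpha>)"
      using eq sector_shift[OF n0 n(2), of m' u'] by simp
    from sector_unique_pos[OF n m(1) lt(2) _ nonneg(2) _ _ this] 4 show ?thesis by simp
  next
    case 5
    then have "cis (\<alpha> * real (Suc m mod n)) * (complex_of_real u + of_real 0 * cis \<alpha>) =
        cis (\<alpha> * real (Suc m' mod n)) * (complex_of_real u' + of_real 0 * cis \<alpha>)"
      unfolding sector_shift[OF n0 n(2), symmetric] using eq 5 by simp
    from sector_unique_pos[OF n lt _ _ _ _ this] 5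
    have e: "Suc m mod n = Suc m' mod n" "u = u'" by simp_all
    have "m = m'"
    proof (cases "Suc m = n \<or> Suc m' = n")
      case True
      then show ?thesis using e m by (auto simp: mod_Suc split: if_splits)
    next
      case False
      then show ?thesis using e m by (auto simp: mod_Suc split: if_splits)
    qed
    then show ?thesis using e 5 by simp
  qed
qed

text \<open>The sector is found by dividing the argument of z by \<alpha> with remainder b.\<close>

lemma sector_exists:
  assumes n: "n \<ge> 3" "\<alpha> = 2 * pi / real n"
  obtains m s u where "m < n" "0 \<le> s" "0 \<le> u"
    "z = cis (\<alpha> * real m) * (complex_of_real s + of_real u * cis \<alpha>)"
proof -
  note al = sector_width[OF n]
  have sa: "0 < sin \<alpha>" using al by (intro sin_gt_zero) auto
  define a where "a = Arg2pi z"
  define m where "m = nat \<lfloor>a / \<alpha>\<rfloor>"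
  define b where "b = a - \<alpha> * real m"
  have a: "0 \<le> a" "a < 2 * pi" using Arg2pi unfolding a_def by auto
  have rm: "real m = of_int \<lfloor>a / \<alpha>\<rfloor>" using a al by (simp add: m_def)
  have "real m \<le> a / \<alpha>" "a / \<alpha> < real m + 1" unfolding rm by linarith+
  then have b: "0 \<le> b" "b < \<alpha>" unfolding b_def using al by (auto simp: field_simps)
  have "real m < real n"
  proof -
    have "real m \<le> a / \<alpha>" by fact
    also have "\<dots> < 2 * pi / \<alpha>" using a al by (simp add: divide_strict_right_mono)
    also have "\<dots> = real n" using n by simp
    finally show ?thesis .
  qed
  then have mn: "m < n" by simp
  define r where "r = cmod z"
  \<comment> \<open>Law of sines: the components, along the two bounding rays, of the vector of
    length r at angle b.\<close>
  define s where "s = r * sin (\<alpha> - b) / sin \<alpha>"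
  define u where "u = r * sin b / sin \<alpha>"
  have s: "0 \<le> s" unfolding s_def r_def using sa b al by (intro divide_nonneg_pos mult_nonneg_nonneg sin_ge_zero) auto
  have u: "0 \<le> u" unfolding u_def r_def using sa b al by (intro divide_nonneg_pos mult_nonneg_nonneg sin_ge_zero) auto
  have "s + u * cos \<alpha> = r * cos b"
    unfolding s_def u_def sin_diff using sa by (simp add: field_simps)
  then have w: "complex_of_real s + of_real u * cis \<alpha> = of_real r * cis b"
    using sa by (simp add: complex_eq_iff u_def)
  have "cis (\<alpha> * real m) * (of_real r * cis b) = of_real r * cis a"
    by (simp add: b_def cis_mult mult.left_commute)
  also have "\<dots> = z" using Arg2pi_eq[of z] by (simp add: r_def a_def cis_conv_exp)
  finally show ?thesis using that[OF mn s u] w by simp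
qed

section \<open>Charts of a quotient space\<close>

lemma continuous_on_local:
  fixes f :: "'a::t2_space \<Rightarrow> 'b::topological_space"
  assumes "\<And>x. x \<in> S \<Longrightarrow> \<exists>W. open W \<and> x \<in> W \<and> continuous_on (S \<inter> W) f"
  shows "continuous_on S f"
proof (subst continuous_on_eq_continuous_within, rule ballI)
  fix x assume x: "x \<in> S"
  then obtain W where W: "open W" "x \<in> W" "continuous_on (S \<inter> W) f" using assms by blast
  then have "continuous (at x within S \<inter> W) f" using x by (simp add: continuous_on_eq_continuous_within)
  moreover have "at x within S \<inter> W = at x within S"
    by (rule at_within_nhd[of x W]) (use W in auto)
  ultimately show "continuous (at x within S) f" by simp
qed

definition saturated :: "'a set \<Rightarrow> ('a \<Rightarrow> 'b) \<Rightarrow> 'a set \<Rightarrow> bool" where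
  "saturated X q D \<longleftrightarrow> (\<forall>p\<in>D. \<forall>p'\<in>X. q p' = q p \<longrightarrow> p' \<in> D)"

text \<open>
  The compact set \<open>K\<close> serves to make the chart on \<open>q ` D\<close> a homeomorphism, and the larger open
  set \<open>U\<close> to separate points.
\<close>

definition chart_datum :: "'a::topological_space set \<Rightarrow> ('a \<Rightarrow> 'b) \<Rightarrow> 'a set \<Rightarrow> 'a set \<Rightarrow> 'a set \<Rightarrow> ('a \<Rightarrow> real^3) \<Rightarrow> bool" where
  "chart_datum X q D K U F \<longleftrightarrow> compact X \<and> D \<subseteq> K \<and> K \<subseteq> U \<and> U \<subseteq> X \<and>
     openin (top_of_set X) D \<and> closedin (top_of_set X) K \<and> openin (top_of_set X) U \<and>
     saturated X q D \<and> saturated X q K \<and> saturated X q U \<and> continuous_on U F \<and>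
     (\<forall>p\<in>U. \<forall>p'\<in>U. F p = F p' \<longleftrightarrow> q p = q p')"

definition chart_map :: "('a \<Rightarrow> 'b) \<Rightarrow> 'a set \<Rightarrow> ('a \<Rightarrow> real^3) \<Rightarrow> 'b \<Rightarrow> real^3" where
  "chart_map q U F n = F (inv_into U q n)"

lemma saturated_vimage: "saturated X q D \<Longrightarrow> D \<subseteq> X \<Longrightarrow> {p \<in> X. q p \<in> q ` D} = D"
  unfolding saturated_def by auto

lemma saturated_diff: "saturated X q D \<Longrightarrow> D \<subseteq> X \<Longrightarrow> saturated X q (X - D)"
  unfolding saturated_def by (metis Diff_iff)

lemma openin_quot_image:
  assumes "saturated X q D" "openin (top_of_set X) D"
  shows "openin (quot_topology (top_of_set X) q) (q ` D)"
proof -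
  have "D \<subseteq> X" using assms(2) openin_imp_subset by blast
  then show ?thesis
    unfolding openin_quot_topology using saturated_vimage[OF assms(1)] assms(2) by auto
qed

lemma closedin_quot_image:
  assumes "saturated X q D" "closedin (top_of_set X) D"
  shows "closedin (quot_topology (top_of_set X) q) (q ` D)"
proof -
  have D: "D \<subseteq> X" using assms(2) closedin_imp_subset by blast
  have "q ` X - q ` D = q ` (X - D)"
  proof -
    have "q x \<noteq> q z" if "x \<in> X" "x \<notin> D" "z \<in> D" for x z
      using assms(1) that unfolding saturated_def by metis
    then show ?thesis by auto
  qed
  moreover have "openin (quot_topology (top_of_set X) q) (q ` (X - D))"
    using openin_quot_image[OF saturated_diff[OF assms(1) D]] assms(2) by (simp add: closedin_def)
  ultimately show ?thesis
    unfolding closedin_def topspace_quot_topology using D by auto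
qed

lemma chart_map_eq:
  assumes "chart_datum X q D K U F" "p \<in> U"
  shows "chart_map q U F (q p) = F p"
proof -
  have "inv_into U q (q p) \<in> U" "q (inv_into U q (q p)) = q p"
    using assms(2) by (simp_all add: inv_into_into f_inv_into_f)
  then show ?thesis using assms unfolding chart_map_def chart_datum_def by blast
qed

lemma chart_map_image:
  assumes "chart_datum X q D K U F" "E \<subseteq> U"
  shows "chart_map q U F ` q ` E = F ` E"
  using chart_map_eq[OF assms(1)] assms(2) by (force simp: image_image)

text \<open>A continuous bijection from a compact space to a Hausdorff space is a homeomorphism. The
  domain \<open>D\<close> is open and in general not compact, so the argument is run on the closed
  saturated set \<open>K\<close>, to which the quotient map restricts; the result is then restricted
  to \<open>D\<close>.\<close>

lemma chart_homeomorphic: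
  assumes cd: "chart_datum X q D K U F"
  shows "homeomorphic_map (subtopology (quot_topology (top_of_set X) q) (q ` D))
           (top_of_set (F ` D)) (chart_map q U F)"
proof -
  let ?N = "quot_topology (top_of_set X) q"
  have sub: "D \<subseteq> K" "K \<subseteq> U" "U \<subseteq> X" "D \<subseteq> U" "K \<subseteq> X" using cd unfolding chart_datum_def by auto
  have cl: "closedin ?N (q ` K)"
    using cd unfolding chart_datum_def by (intro closedin_quot_image) auto
  have "{p \<in> topspace (top_of_set X). q p \<in> q ` K} = K"
    using saturated_vimage[of X q K] cd sub unfolding chart_datum_def by simp
  then have "quotient_map (subtopology (top_of_set X) K) (subtopology ?N (q ` K)) q"
    using quotient_map_quot_topology cl by (intro quotient_map_restriction) auto
  then have qm: "quotient_map (top_of_set K) (subtopology ?N (q ` K)) q"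
    using sub by (simp add: subtopology_subtopology Int_absorb1)
  have "continuous_on K F"
    using cd sub unfolding chart_datum_def by (meson continuous_on_subset)
  then have "continuous_on K (chart_map q U F \<circ> q)"
    by (rule continuous_on_eq) (use chart_map_eq[OF cd] sub in auto)
  then have "continuous_map (top_of_set K) (top_of_set (F ` K)) (chart_map q U F \<circ> q)"
    using chart_map_image[OF cd sub(2)] by (auto simp: image_image)
  then have cont: "continuous_map (subtopology ?N (q ` K)) (top_of_set (F ` K)) (chart_map q U F)"
    by (rule continuous_compose_quotient_map[OF qm])
  have top: "topspace (subtopology ?N (q ` K)) = q ` K"
    using sub by (auto simp: topspace_quot_topology)
  have "compact K"
    using cd unfolding chart_datum_def by (meson closedin_compact)
  then have "compactin (subtopology ?N (q ` K)) (q ` K)"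
    using quotient_imp_continuous_map[OF qm] by (intro image_compactin[of "top_of_set K"]) auto
  then have cpt: "compact_space (subtopology ?N (q ` K))"
    using top by (simp add: compact_space_def)
  have inj: "inj_on (chart_map q U F) (q ` K)"
  proof (rule inj_onI)
    fix a b assume "a \<in> q ` K" "b \<in> q ` K" and e: "chart_map q U F a = chart_map q U F b"
    then obtain p p' where p: "p \<in> K" "p' \<in> K" "a = q p" "b = q p'" by blast
    then have "p \<in> U" "p' \<in> U" using sub by auto
    then have "F p = F p'" using e p chart_map_eq[OF cd] by metis
    then show "a = b" using p sub cd unfolding chart_datum_def by blast
  qed
  have "homeomorphic_map (subtopology ?N (q ` K)) (top_of_set (F ` K)) (chart_map q U F)"
  proof (rule continuous_imp_homeomorphic_map[OF cont cpt])
    show "Hausdorff_space (top_of_set (F ` K))" by (intro Hausdorff_space_subtopology) simp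
    show "chart_map q U F ` topspace (subtopology ?N (q ` K)) = topspace (top_of_set (F ` K))"
      unfolding top using chart_map_image[OF cd sub(2)] by simp
    show "inj_on (chart_map q U F) (topspace (subtopology ?N (q ` K)))" unfolding top by (rule inj)
  qed
  then have "homeomorphic_map (subtopology (subtopology ?N (q ` K)) (q ` D))
      (subtopology (top_of_set (F ` K)) (F ` D)) (chart_map q U F)"
  proof (rule homeomorphic_map_subtopologies)
    have "topspace (subtopology ?N (q ` K)) \<inter> q ` D = q ` D" using sub unfolding top by auto
    moreover have "topspace (top_of_set (F ` K)) \<inter> F ` D = F ` D" using sub by auto
    ultimately show "chart_map q U F ` (topspace (subtopology ?N (q ` K)) \<inter> q ` D) =
        topspace (top_of_set (F ` K)) \<inter> F ` D"
      using chart_map_image[OF cd sub(4)] by simp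
  qed
  moreover have "q ` K \<inter> q ` D = q ` D" "F ` K \<inter> F ` D = F ` D" using sub by auto
  ultimately show ?thesis by (simp add: subtopology_subtopology)
qed

text \<open>Two points of \<open>U\<close> are separated by their values under \<open>F\<close>; a
  point outside \<open>U\<close> is separated from one in \<open>D\<close> by the complement of
  \<open>K\<close>.\<close>

lemma Hausdorff_quot:
  assumes ch: "\<And>p. p \<in> X \<Longrightarrow> \<exists>D K U F. chart_datum X q D K U F \<and> p \<in> D"
  shows "Hausdorff_space (quot_topology (top_of_set X) q)"
  unfolding Hausdorff_space_def
proof (intro allI impI)
  let ?N = "quot_topology (top_of_set X) q"
  fix a b assume "a \<in> topspace ?N \<and> b \<in> topspace ?N \<and> a \<noteq> b"
  then obtain p p' where p: "p \<in> X" "p' \<in> X" "a = q p" "b = q p'" "q p \<noteq> q p'"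
    by (auto simp: topspace_quot_topology)
  obtain D K U F where cd: "chart_datum X q D K U F" "p \<in> D" using ch p by blast
  note cdd = cd(1)[unfolded chart_datum_def]
  have sub: "D \<subseteq> K" "K \<subseteq> U" "U \<subseteq> X" using cdd by auto
  show "\<exists>V W. openin ?N V \<and> openin ?N W \<and> a \<in> V \<and> b \<in> W \<and> disjnt V W"
  proof (cases "p' \<in> U")
    case True
    have pU: "p \<in> U" using cd sub by auto
    then have "F p \<noteq> F p'" using cdd True p by blast
    then obtain A B where AB: "open A" "open B" "F p \<in> A" "F p' \<in> B" "A \<inter> B = {}"
      using hausdorff by metis
    have op: "openin ?N (q ` {y \<in> U. F y \<in> C})" if "open C" for C
    proof (rule openin_quot_image)
      show "saturated X q {y \<in> U. F y \<in> C}"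
        using cdd unfolding saturated_def by (metis (no_types, lifting) mem_Collect_eq)
      have "openin (top_of_set U) {y \<in> U. F y \<in> C}"
        using continuous_openin_preimage_gen[of U F C] cdd that by (simp add: vimage_def Int_def)
      then show "openin (top_of_set X) {y \<in> U. F y \<in> C}" using cdd openin_trans by blast
    qed
    have "disjnt (q ` {y \<in> U. F y \<in> A}) (q ` {y \<in> U. F y \<in> B})"
    proof -
      have "q y \<noteq> q z" if "y \<in> U" "F y \<in> A" "z \<in> U" "F z \<in> B" for y z
      proof
        assume "q y = q z"
        then have "F y = F z" using cdd that by blast
        then show False using that AB by auto
      qed
      then show ?thesis by (auto simp: disjnt_def)
    qed
    moreover have "a \<in> q ` {y \<in> U. F y \<in> A}" "b \<in> q ` {y \<in> U. F y \<in> B}"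
      using p pU True AB by auto
    ultimately show ?thesis using op AB(1,2) by blast
  next
    case False
    then have pK: "p' \<notin> K" using sub by blast
    have sK: "saturated X q K" "K \<subseteq> X" using cdd by auto
    have "openin ?N (q ` D)" using cdd by (intro openin_quot_image) auto
    moreover have "openin ?N (q ` (X - K))"
      using saturated_diff[OF sK] cdd by (intro openin_quot_image) (auto simp: closedin_def)
    moreover have "disjnt (q ` D) (q ` (X - K))"
    proof -
      have "q y \<noteq> q z" if "y \<in> D" "z \<in> X" "z \<notin> K" for y z
        using sK(1) sub(1) that unfolding saturated_def by (metis subsetD)
      then show ?thesis by (auto simp: disjnt_def)
    qed
    ultimately show ?thesis using p cd pK by blast
  qed
qed

lemma second_countable_finite_open_cover:
  assumes "finite \<C>" "\<And>C. C \<in> \<C> \<Longrightarrow> openin X C \<and> second_countable (subtopology X C)"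
    and "topspace X = \<Union>\<C>"
  shows "second_countable X"
proof -
  have "\<exists>\<B>. countable \<B> \<and> (\<forall>V \<in> \<B>. openin (subtopology X C) V) \<and>
      (\<forall>U x. openin (subtopology X C) U \<and> x \<in> U \<longrightarrow> (\<exists>V \<in> \<B>. x \<in> V \<and> V \<subseteq> U))" if "C \<in> \<C>" for C
    using assms(2)[OF that] unfolding second_countable_def by blast
  then have "\<forall>C\<in>\<C>. \<exists>\<B>. countable \<B> \<and> (\<forall>V \<in> \<B>. openin (subtopology X C) V) \<and>
      (\<forall>U x. openin (subtopology X C) U \<and> x \<in> U \<longrightarrow> (\<exists>V \<in> \<B>. x \<in> V \<and> V \<subseteq> U))" by (rule ballI)
  then obtain \<B> where B0: "\<forall>C\<in>\<C>. countable (\<B> C) \<and> (\<forall>V \<in> \<B> C. openin (subtopology X C) V) \<and>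
      (\<forall>U x. openin (subtopology X C) U \<and> x \<in> U \<longrightarrow> (\<exists>V \<in> \<B> C. x \<in> V \<and> V \<subseteq> U))"
    by (rule bchoice[THEN exE])
  have B: "\<And>C. C \<in> \<C> \<Longrightarrow> countable (\<B> C)" "\<And>C V. C \<in> \<C> \<Longrightarrow> V \<in> \<B> C \<Longrightarrow> openin (subtopology X C) V"
    "\<And>C U x. C \<in> \<C> \<Longrightarrow> openin (subtopology X C) U \<Longrightarrow> x \<in> U \<Longrightarrow> \<exists>V\<in>\<B> C. x \<in> V \<and> V \<subseteq> U"
    using B0 by simp_all
  have cnt: "countable (\<Union>C\<in>\<C>. \<B> C)" using B(1) assms(1) by (simp add: countable_finite)
  have opn: "openin X V" if V: "V \<in> (\<Union>C\<in>\<C>. \<B> C)" for V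
  proof -
    obtain C where C: "C \<in> \<C>" "V \<in> \<B> C" using V by (rule UN_E)
    then show ?thesis using B(2)[OF C] assms(2)[OF C(1)] openin_open_subtopology[of X C V] by simp
  qed
  have bas: "\<exists>V\<in>(\<Union>C\<in>\<C>. \<B> C). x \<in> V \<and> V \<subseteq> U" if xU: "openin X U" "x \<in> U" for U x
  proof -
    have "x \<in> topspace X" using xU openin_subset by blast
    then obtain C where C: "C \<in> \<C>" "x \<in> C" using assms(3) by blast
    have "openin (subtopology X C) (C \<inter> U)" using xU by (simp add: openin_subtopology_Int2)
    from B(3)[OF C(1) this, of x] obtain V where "V \<in> \<B> C" "x \<in> V" "V \<subseteq> C \<inter> U" using C(2) xU by auto
    moreover have "V \<in> (\<Union>C\<in>\<C>. \<B> C)" using C(1) \<open>V \<in> \<B> C\<close> by (rule UN_I)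
    ultimately show ?thesis by (intro bexI[of _ V]) auto
  qed
  show ?thesis unfolding second_countable_def
  proof (intro exI[of _ "\<Union>C\<in>\<C>. \<B> C"] conjI ballI allI impI)
    show "\<exists>V\<in>\<Union>C\<in>\<C>. \<B> C. x \<in> V \<and> V \<subseteq> U" if "openin X U \<and> x \<in> U" for U x
      using that bas by simp
  qed (fact cnt, fact opn)
qed

lemma quot_compact: "compact X \<Longrightarrow> compact_space (quot_topology (top_of_set X) q)"
proof -
  assume "compact X"
  then have "compactin (quot_topology (top_of_set X) q) (q ` X)"
    using quotient_imp_continuous_map[OF quotient_map_quot_topology]
    by (intro image_compactin[of "top_of_set X"]) auto
  then show ?thesis by (simp add: compact_space_def topspace_quot_topology)
qed

text \<open>By compactness finitely many chart domains cover the quotient, and each is homeomorphic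
  to a subspace of euclidean space.\<close>

lemma second_countable_quot:
  assumes ch: "\<And>p. p \<in> X \<Longrightarrow> \<exists>D K U F. chart_datum X q D K U F \<and> p \<in> D" and X: "compact X"
  shows "second_countable (quot_topology (top_of_set X) q)"
proof -
  let ?N = "quot_topology (top_of_set X) q"
  define \<A> where "\<A> = {q ` D | D. \<exists>K U F. chart_datum X q D K U F}"
  have A: "openin ?N C \<and> second_countable (subtopology ?N C)" if "C \<in> \<A>" for C
  proof -
    obtain D K U F where C: "C = q ` D" and cd: "chart_datum X q D K U F"
      using \<open>C \<in> \<A>\<close> unfolding \<A>_def by blast
    have "openin ?N C" unfolding C using cd unfolding chart_datum_def by (intro openin_quot_image) auto
    moreover have "subtopology ?N C homeomorphic_space top_of_set (F ` D)"
      unfolding C using chart_homeomorphic[OF cd] homeomorphic_map_imp_homeomorphic_space by blast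
    moreover have "second_countable (top_of_set (F ` D))"
    proof (rule second_countable_subtopology)
      obtain B :: "(real^3) set set" where "countable B" "\<And>C. C \<in> B \<Longrightarrow> open C" "\<And>S. open S \<Longrightarrow> \<exists>U. U \<subseteq> B \<and> S = \<Union>U"
        using univ_second_countable by metis
      then show "second_countable (euclidean :: (real^3) topology)"
        unfolding second_countable_def
      proof (intro exI[of _ B] conjI ballI allI impI)
        fix V assume "V \<in> B"
        then show "openin euclidean V" using \<open>\<And>C. C \<in> B \<Longrightarrow> open C\<close> by simp
      next
        fix V :: "(real^3) set" and x assume V: "openin euclidean V \<and> x \<in> V"
        then obtain S where "S \<subseteq> B" "V = \<Union>S" using \<open>\<And>S. open S \<Longrightarrow> \<exists>U. U \<subseteq> B \<and> S = \<Union>U\<close>[of V] by auto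
        then show "\<exists>W\<in>B. x \<in> W \<and> W \<subseteq> V" using V by blast
      qed
    qed
    ultimately show ?thesis using homeomorphic_space_second_countability by blast
  qed
  have cov: "topspace ?N \<subseteq> \<Union>\<A>"
  proof
    fix n assume "n \<in> topspace ?N"
    then obtain p where p: "p \<in> X" "n = q p" by (auto simp: topspace_quot_topology)
    obtain D K U F where "chart_datum X q D K U F" "p \<in> D" using ch[OF p(1)] by auto
    then have "q ` D \<in> \<A>" "n \<in> q ` D" using p unfolding \<A>_def by auto
    then show "n \<in> \<Union>\<A>" by (rule UnionI)
  qed
  have "compact_space ?N" using X by (rule quot_compact)
  then obtain \<F> where F: "finite \<F>" "\<F> \<subseteq> \<A>" "topspace ?N \<subseteq> \<Union>\<F>"
    using A cov unfolding compact_space_alt by (metis (no_types, lifting))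
  have "topspace ?N = \<Union>\<F>"
    using F A openin_subset by (intro equalityI Union_least) blast+
  then show ?thesis using F A by (intro second_countable_finite_open_cover[of \<F>]) blast+
qed

lemma open_in_half_space_first_pos:
  assumes "open S" "S \<subseteq> half_space3" "x \<in> S"
  shows "0 < x $ 1"
proof (rule ccontr)
  assume n: "\<not> 0 < x $ 1"
  obtain e where e: "e > 0" "ball x e \<subseteq> S" using assms openE by blast
  have "x - (e/2) *\<^sub>R axis 1 1 \<in> ball x e" using e by (simp add: dist_norm norm_axis_1)
  then have "x - (e/2) *\<^sub>R axis 1 1 \<in> half_space3" using e assms by blast
  then have "e / 2 \<le> x $ 1" by (simp add: half_space3_def axis_def)
  then show False using n e by simp
qed

text \<open>
  A chart of the quotient that meets the boundary of the half space would, by invariance of domain,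
  have an open image in space.
\<close>

lemma boundary_not_interior:
  assumes cd: "chart_datum X q D K U F" and half: "F ` D \<subseteq> half_space3"
    and p: "p \<in> D" "F p $ 1 = 0"
  shows "q p \<notin> mfd_interior (quot_topology (top_of_set X) q)"
proof
  let ?N = "quot_topology (top_of_set X) q"
  assume "q p \<in> mfd_interior ?N"
  then obtain V \<psi> where V: "q p \<in> V" "chart3 ?N V \<psi>" unfolding mfd_interior_def by blast
  have VN: "openin ?N V" "open (\<psi> ` V)" and hpsi: "homeomorphic_map (subtopology ?N V) (top_of_set (\<psi> ` V)) \<psi>"
    using V unfolding chart3_def by auto
  let ?\<phi> = "chart_map q U F"
  have hphi: "homeomorphic_map (subtopology ?N (q ` D)) (top_of_set (F ` D)) ?\<phi>"
    by (rule chart_homeomorphic[OF cd])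
  have DN: "openin ?N (q ` D)" using cd unfolding chart_datum_def by (intro openin_quot_image) auto
  have DU: "D \<subseteq> U" using cd unfolding chart_datum_def by blast
  define W where "W = V \<inter> q ` D"
  have WN: "openin ?N W" "W \<subseteq> V" "W \<subseteq> q ` D" unfolding W_def using VN DN by auto
  have topV: "topspace (subtopology ?N V) = V" using openin_subset[OF VN(1)] by auto
  have topD: "topspace (subtopology ?N (q ` D)) = q ` D" using openin_subset[OF DN] by auto
  have opW: "open (\<psi> ` W)"
  proof -
    have "openin (subtopology ?N V) W" using WN VN openin_open_subtopology by blast
    then have "openin (top_of_set (\<psi> ` V)) (\<psi> ` W)"
      using hpsi homeomorphic_map_openness_eq WN topV by blast
    then show ?thesis using VN openin_open_trans by blast
  qed
  obtain \<psi>' where ps: "homeomorphic_maps (subtopology ?N V) (top_of_set (\<psi> ` V)) \<psi> \<psi>'"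
    using hpsi homeomorphic_map_maps by blast
  have inv: "\<psi>' (\<psi> y) = y" if "y \<in> V" for y
    using ps that topV unfolding homeomorphic_maps_def by blast
  have c1: "continuous_map (top_of_set (\<psi> ` W)) (subtopology ?N W) \<psi>'"
  proof -
    have "continuous_map (top_of_set (\<psi> ` V)) (subtopology ?N V) \<psi>'"
      using ps unfolding homeomorphic_maps_def by blast
    then have "continuous_map (top_of_set (\<psi> ` V)) ?N \<psi>'" using continuous_map_in_subtopology by blast
    then have "continuous_map (subtopology (top_of_set (\<psi> ` V)) (\<psi> ` W)) ?N \<psi>'"
      by (rule continuous_map_from_subtopology)
    moreover have "subtopology (top_of_set (\<psi> ` V)) (\<psi> ` W) = top_of_set (\<psi> ` W)"
      using WN by (auto simp: subtopology_subtopology intro!: arg_cong[where f = top_of_set])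
    moreover have "\<psi>' ` (\<psi> ` W) \<subseteq> W" using inv WN by auto
    ultimately show ?thesis unfolding continuous_map_in_subtopology by auto
  qed
  have c2: "continuous_map (subtopology ?N W) euclidean ?\<phi>"
  proof -
    have "continuous_map (subtopology ?N (q ` D)) euclidean ?\<phi>"
      using hphi homeomorphic_imp_continuous_map continuous_map_in_subtopology by blast
    then have "continuous_map (subtopology (subtopology ?N (q ` D)) W) euclidean ?\<phi>"
      by (rule continuous_map_from_subtopology)
    then show ?thesis using WN by (simp add: subtopology_subtopology Int_absorb1)
  qed
  have "continuous_map (top_of_set (\<psi> ` W)) euclidean (?\<phi> \<circ> \<psi>')"
    using c1 c2 continuous_map_compose by blast
  then have cont: "continuous_on (\<psi> ` W) (?\<phi> \<circ> \<psi>')" by simp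
  have "inj_on ?\<phi> (q ` D)"
    using hphi topD unfolding homeomorphic_eq_everything_map by simp
  then have inj: "inj_on (?\<phi> \<circ> \<psi>') (\<psi> ` W)"
  proof (intro inj_onI)
    fix a b assume ab: "a \<in> \<psi> ` W" "b \<in> \<psi> ` W" "(?\<phi> \<circ> \<psi>') a = (?\<phi> \<circ> \<psi>') b"
    then obtain y z where yz: "y \<in> W" "z \<in> W" "a = \<psi> y" "b = \<psi> z" by auto
    then have "y \<in> V" "z \<in> V" "y \<in> q ` D" "z \<in> q ` D" using WN(2,3) by auto
    then have "?\<phi> y = ?\<phi> z" using ab(3) yz inv by simp
    then have "y = z" using \<open>inj_on ?\<phi> (q ` D)\<close> \<open>y \<in> q ` D\<close> \<open>z \<in> q ` D\<close> by (metis inj_onD)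
    then show "a = b" using yz by simp
  qed
  have im: "(?\<phi> \<circ> \<psi>') ` \<psi> ` W = ?\<phi> ` W"
  proof -
    have "\<psi>' (\<psi> y) = y" if "y \<in> W" for y using inv WN(2) that by auto
    then show ?thesis by (simp add: image_comp cong: image_cong)
  qed
  have "open (?\<phi> ` W)" using invariance_of_domain[OF cont opW inj] im by simp
  moreover have "?\<phi> ` W \<subseteq> half_space3"
    using image_mono[OF WN(3), of ?\<phi>] chart_map_image[OF cd DU] half by simp
  moreover have "?\<phi> (q p) = F p" using chart_map_eq[OF cd] p DU by blast
  moreover have "q p \<in> W" using V p by (simp add: W_def)
  ultimately have "0 < F p $ 1" using open_in_half_space_first_pos by (metis imageI)
  then show False using p by simp
qed

text \<open>Only the domain shrinks, while \<open>K\<close> and \<open>U\<close> are kept; the same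
  map becomes a chart whose image is open in space and not only in the half space.\<close>

lemma chart_datum_positive:
  assumes cd: "chart_datum X q D K U F"
    and half: "openin (top_of_set half_space3) (F ` D)"
  defines "D0 \<equiv> {y \<in> D. 0 < F y $ 1}"
  shows "chart_datum X q D0 K U F" "open (F ` D0)"
proof -
  note cdd = cd[unfolded chart_datum_def]
  have sub: "D \<subseteq> U" using cdd by blast
  have op: "open {v :: real^3. 0 < v $ 1}" by (intro open_Collect_less continuous_intros)
  have "openin (top_of_set D) {y \<in> D. F y \<in> {v. 0 < v $ 1}}"
    using continuous_openin_preimage_gen[OF continuous_on_subset[of U F D] op] cdd sub
    by (simp add: vimage_def Int_def)
  then have "openin (top_of_set X) D0" using cdd openin_trans unfolding D0_def by auto
  moreover have "saturated X q D0"
    unfolding saturated_def D0_def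
  proof (intro ballI impI)
    fix a b assume a: "a \<in> {y \<in> D. 0 < F y $ 1}" and b: "b \<in> X" "q b = q a"
    have "b \<in> D" using a b cdd unfolding saturated_def by blast
    moreover have "F b = F a" using \<open>b \<in> D\<close> a b sub cdd by blast
    ultimately show "b \<in> {y \<in> D. 0 < F y $ 1}" using a by simp
  qed
  moreover have "D0 \<subseteq> K" using cdd unfolding D0_def by blast
  ultimately show "chart_datum X q D0 K U F" using cdd unfolding chart_datum_def by blast
  obtain S where S: "open S" "F ` D = half_space3 \<inter> S" using half openin_open by blast
  have "F ` D0 = S \<inter> {v. 0 < v $ 1}"
  proof
    show "F ` D0 \<subseteq> S \<inter> {v. 0 < v $ 1}" using S unfolding D0_def by auto
    show "S \<inter> {v. 0 < v $ 1} \<subseteq> F ` D0"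
    proof
      fix v assume v: "v \<in> S \<inter> {v. 0 < v $ 1}"
      then have "v \<in> F ` D" using S by (auto simp: half_space3_def)
      then show "v \<in> F ` D0" using v unfolding D0_def by blast
    qed
  qed
  then show "open (F ` D0)" using S op by auto
qed

section \<open>Face lattices of simple cuts\<close>

text \<open>Tight constraints do not move, and the finitely many others leave room.\<close>

lemma small_perturbation:
  fixes f h :: "'i \<Rightarrow> real"
  assumes "finite I" "\<And>m. m \<in> I \<Longrightarrow> f m \<le> 0" "\<And>m. m \<in> I \<Longrightarrow> f m = 0 \<Longrightarrow> h m = 0"
  shows "\<exists>e>0. \<forall>m\<in>I. f m + e * \<bar>h m\<bar> \<le> 0"
  using assms
proof (induction I)
  case empty
  then show ?case by (intro exI[of _ 1]) simp
next
  case (insert a I)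
  then obtain e where e: "e > 0" "\<forall>m\<in>I. f m + e * \<bar>h m\<bar> \<le> 0" by auto
  define e' where "e' = (if h a = 0 then e else min e (- f a / \<bar>h a\<bar>))"
  have "f a < 0" if "h a \<noteq> 0" using that insert.prems(1)[of a] insert.prems(2)[of a] by fastforce
  then have e': "e' > 0" using e by (auto simp: e'_def divide_neg_pos)
  have "f m + e' * \<bar>h m\<bar> \<le> 0" if "m \<in> I" for m
  proof -
    have "e' * \<bar>h m\<bar> \<le> e * \<bar>h m\<bar>" by (intro mult_right_mono) (auto simp: e'_def)
    then show ?thesis using e that by force
  qed
  moreover have "f a + e' * \<bar>h a\<bar> \<le> 0"
  proof (cases "h a = 0")
    case False
    have "e' * \<bar>h a\<bar> \<le> (- f a / \<bar>h a\<bar>) * \<bar>h a\<bar>" using False by (intro mult_right_mono) (auto simp: e'_def)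
    then show ?thesis using False by simp
  qed (use insert.prems in simp)
  ultimately show ?case using e' by blast
qed

text \<open>A polytope known by its vertices and by its inequalities at the same time. The
  assumption \<open>ext\<close> makes every face a cell: x can be pushed away, inside
  \<open>P\<close>, from any y that satisfies all equations valid at x. By \<open>no_full\<close>
  the empty face, too, is cut out by equations. \<open>I\<close>, \<open>V\<close> and
  \<open>inc\<close> contain no geometry, so two polytopes with the same incidences can share
  them.\<close>

locale cut_polytope =
  fixes P :: "'a::euclidean_space set" and I :: "'i set" and a :: "'i \<Rightarrow> 'a" and b :: "'i \<Rightarrow> real"
    and V :: "'v set" and v :: "'v \<Rightarrow> 'a" and inc :: "'v \<Rightarrow> 'i set"
  assumes finI: "finite I" and finV: "finite V"
    and hull: "P = convex hull (v ` V)"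
    and le: "x \<in> P \<Longrightarrow> m \<in> I \<Longrightarrow> a m \<bullet> x \<le> b m"
    and inc: "k \<in> V \<Longrightarrow> m \<in> I \<Longrightarrow> a m \<bullet> v k = b m \<longleftrightarrow> m \<in> inc k"
    and ext: "x \<in> P \<Longrightarrow> y \<in> P \<Longrightarrow> (\<forall>m\<in>I. a m \<bullet> x = b m \<longrightarrow> a m \<bullet> y = b m) \<Longrightarrow>
      \<exists>e>0. x + e *\<^sub>R (x - y) \<in> P"
    and no_full: "k \<in> V \<Longrightarrow> \<not> I \<subseteq> inc k"
begin

definition cell :: "'i set \<Rightarrow> 'a set" where
  "cell J = P \<inter> {x. \<forall>m\<in>J. a m \<bullet> x = b m}"

lemma convex_P: "convex P" unfolding hull by (rule convex_convex_hull)

lemma cell_face: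
  assumes "J \<subseteq> I"
  shows "cell J face_of P"
proof -
  have "finite J" using assms finI finite_subset by blast
  then show ?thesis using assms
  proof (induction J)
    case empty
    then show ?case by (simp add: cell_def face_of_refl convex_P)
  next
    case (insert m J)
    have "cell (insert m J) = cell J \<inter> (P \<inter> {x. a m \<bullet> x = b m})" by (auto simp: cell_def)
    moreover have "(P \<inter> {x. a m \<bullet> x = b m}) face_of P"
      using insert.prems le by (intro face_of_Int_supporting_hyperplane_le convex_P) auto
    ultimately show ?case using insert by (simp add: face_of_Int)
  qed
qed

lemma vertex_in_P: "k \<in> V \<Longrightarrow> v k \<in> P"
  unfolding hull by (simp add: hull_inc)

lemma vertex_in_cell: "k \<in> V \<Longrightarrow> J \<subseteq> I \<Longrightarrow> v k \<in> cell J \<longleftrightarrow> J \<subseteq> inc k"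
  using vertex_in_P[of k] inc[of k] unfolding cell_def by blast

lemma cell_hull:
  assumes "J \<subseteq> I"
  shows "cell J = convex hull (v ` {k \<in> V. J \<subseteq> inc k})"
proof
  have "cell J face_of convex hull (v ` V)" using cell_face[OF assms] hull by simp
  then obtain S where S: "S \<subseteq> v ` V" "cell J = convex hull S"
    using face_of_convex_hull_subset[of "v ` V" "cell J"] finV by (auto simp: finite_imp_compact)
  have "S \<subseteq> cell J" using S by (simp add: hull_subset)
  then have "S \<subseteq> v ` {k \<in> V. J \<subseteq> inc k}" using S(1) vertex_in_cell[OF _ assms] by blast
  then show "cell J \<subseteq> convex hull (v ` {k \<in> V. J \<subseteq> inc k})" using S by (simp add: hull_mono)
  show "convex hull (v ` {k \<in> V. J \<subseteq> inc k}) \<subseteq> cell J"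
    using vertex_in_cell[OF _ assms] face_of_imp_convex[OF cell_face[OF assms]]
    by (intro hull_minimal) auto
qed

lemma cell_I: "cell I = {}"
  using cell_hull[of I] no_full by auto

text \<open>Let x be a relative interior point of the face and \<open>J\<close> the set of equations
  valid at x. Each of these holds on the whole face, because its cell is a face that meets the
  relative interior. Conversely, for y in the cell of \<open>J\<close>, pushing x away from y puts x
  inside a segment of \<open>P\<close> starting at y, and a face containing x contains that
  endpoint.\<close>

lemma face_is_cell:
  assumes F: "F face_of P"
  obtains J where "J \<subseteq> I" "F = cell J"
proof (cases "F = {}")
  case True
  then show ?thesis using that[of I] cell_I by simp
next
  case False
  have "convex F" using F face_of_imp_convex by blast
  then obtain x where x: "x \<in> rel_interior F" using False rel_interior_eq_empty by blast
  have xF: "x \<in> F" using x rel_interior_subset by blast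
  have FP: "F \<subseteq> P" using F face_of_imp_subset by blast
  define J where "J = {m \<in> I. a m \<bullet> x = b m}"
  have JI: "J \<subseteq> I" by (auto simp: J_def)
  have "F \<subseteq> cell {m}" if "m \<in> J" for m
  proof (rule subset_of_face_of)
    show "cell {m} face_of P" using that by (intro cell_face) (auto simp: J_def)
    have "x \<in> cell {m}" using that xF FP by (auto simp: J_def cell_def)
    then show "cell {m} \<inter> rel_interior F \<noteq> {}" using x by blast
  qed (rule FP)
  then have "F \<subseteq> cell J" using FP unfolding cell_def by blast
  moreover have "cell J \<subseteq> F"
  proof
    fix y assume y: "y \<in> cell J"
    then have "\<exists>e>0. x + e *\<^sub>R (x - y) \<in> P"
      using xF FP by (intro ext) (auto simp: cell_def J_def)
    then obtain e where e: "e > 0" "x + e *\<^sub>R (x - y) \<in> P" by blast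
    show "y \<in> F"
    proof (cases "x = y")
      case False
      let ?z = "x + e *\<^sub>R (x - y)"
      have "x = (1 - 1 / (1 + e)) *\<^sub>R y + (1 / (1 + e)) *\<^sub>R ?z"
      proof -
        have "(1 + e) *\<^sub>R x = e *\<^sub>R y + ?z" by (simp add: algebra_simps)
        then have "(1 / (1 + e)) *\<^sub>R ((1 + e) *\<^sub>R x) = (1 / (1 + e)) *\<^sub>R (e *\<^sub>R y + ?z)" by simp
        then have "x = (e / (1 + e)) *\<^sub>R y + (1 / (1 + e)) *\<^sub>R ?z"
          using e by (simp add: scaleR_add_right)
        moreover have "e / (1 + e) = 1 - 1 / (1 + e)" using e by (simp add: field_simps)
        ultimately show ?thesis by simp
      qed
      moreover have "y \<noteq> ?z"
      proof
        assume "y = ?z"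
        then have "(1 + e) *\<^sub>R (x - y) = 0" by (simp add: algebra_simps)
        then show False using False e by simp
      qed
      moreover have "0 < 1 / (1 + e)" "1 / (1 + e) < 1" using e by auto
      ultimately have "x \<in> open_segment y ?z" unfolding in_segment by blast
      then show ?thesis using F xF y e face_ofD[of F P x y ?z] by (auto simp: cell_def)
    qed (use xF in simp)
  qed
  ultimately show ?thesis using that JI by blast
qed

lemma faces_eq: "{F. F face_of P} = cell ` Pow I"
proof (intro equalityI subsetI)
  fix F assume "F \<in> {F. F face_of P}"
  then obtain J where "J \<subseteq> I" "F = cell J" using face_is_cell by blast
  then show "F \<in> cell ` Pow I" by blast
qed (use cell_face in auto)

text \<open>The order of the cells depends on the incidences alone; this is the source of the
  lattice isomorphism.\<close>

lemma cell_subset_iff: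
  assumes "J \<subseteq> I" "K \<subseteq> I"
  shows "cell J \<subseteq> cell K \<longleftrightarrow> (\<forall>k\<in>V. J \<subseteq> inc k \<longrightarrow> K \<subseteq> inc k)"
proof
  assume "cell J \<subseteq> cell K"
  then show "\<forall>k\<in>V. J \<subseteq> inc k \<longrightarrow> K \<subseteq> inc k"
    using vertex_in_cell assms by blast
next
  assume "\<forall>k\<in>V. J \<subseteq> inc k \<longrightarrow> K \<subseteq> inc k"
  then have "v ` {k \<in> V. J \<subseteq> inc k} \<subseteq> v ` {k \<in> V. K \<subseteq> inc k}" by blast
  then show "cell J \<subseteq> cell K" unfolding cell_hull[OF assms(1)] cell_hull[OF assms(2)] by (rule hull_mono)
qed

end

text \<open>Faces correspond if they are spanned by vertices with the same names. The last two
  conclusions trace facets and vertices through the isomorphism, which is how hexagons, triangles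
  and ends of internal edges get their labels.\<close>

lemma face_lattice_iso:
  fixes P :: "'a::euclidean_space set" and P' :: "'b::euclidean_space set"
  assumes "cut_polytope P I a b V v inc" "cut_polytope P' I a' b' V v' inc"
  obtains \<Phi> where "bij_betw \<Phi> {F. F face_of P} {F. F face_of P'}"
    "\<And>F G. F face_of P \<Longrightarrow> G face_of P \<Longrightarrow> \<Phi> F \<subseteq> \<Phi> G \<longleftrightarrow> F \<subseteq> G"
    "\<And>J. J \<subseteq> I \<Longrightarrow> \<Phi> (P \<inter> {x. \<forall>m\<in>J. a m \<bullet> x = b m}) = P' \<inter> {x. \<forall>m\<in>J. a' m \<bullet> x = b' m}"
    "\<And>k. k \<in> V \<Longrightarrow> {m \<in> V. inc k \<inter> I \<subseteq> inc m} = {k} \<Longrightarrow> \<Phi> {v k} = {v' k}"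
proof -
  interpret p: cut_polytope P I a b V v inc by fact
  interpret q: cut_polytope P' I a' b' V v' inc by fact
  define \<Phi> where "\<Phi> F = convex hull (v' ` {k \<in> V. v k \<in> F})" for F
  have \<Phi>: "\<Phi> (p.cell J) = q.cell J" if "J \<subseteq> I" for J
  proof -
    have "{k \<in> V. v k \<in> p.cell J} = {k \<in> V. J \<subseteq> inc k}" using p.vertex_in_cell[OF _ that] by blast
    then show ?thesis unfolding \<Phi>_def q.cell_hull[OF that] by simp
  qed
  have ord: "\<Phi> F \<subseteq> \<Phi> G \<longleftrightarrow> F \<subseteq> G" if FG: "F face_of P" "G face_of P" for F G
  proof -
    obtain J where J: "J \<subseteq> I" "F = p.cell J" by (rule p.face_is_cell[OF FG(1)])
    obtain K where K: "K \<subseteq> I" "G = p.cell K" by (rule p.face_is_cell[OF FG(2)])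
    note J K
    then show ?thesis by (simp add: \<Phi> p.cell_subset_iff q.cell_subset_iff)
  qed
  have "inj_on \<Phi> {F. F face_of P}" 
  proof (rule inj_onI)
    fix F G assume "F \<in> {F. F face_of P}" "G \<in> {F. F face_of P}" "\<Phi> F = \<Phi> G"
    then show "F = G" using ord[of F G] ord[of G F] by simp
  qed
  moreover have "\<Phi> ` {F. F face_of P} = {F. F face_of P'}"
    unfolding p.faces_eq q.faces_eq image_image using \<Phi> by (intro image_cong) auto
  ultimately have bij: "bij_betw \<Phi> {F. F face_of P} {F. F face_of P'}" by (simp add: bij_betw_def)
  have vert: "\<Phi> {v k} = {v' k}" if k: "k \<in> V" "{m \<in> V. inc k \<inter> I \<subseteq> inc m} = {k}" for k
  proof -
    have "p.cell (inc k \<inter> I) = {v k}" "q.cell (inc k \<inter> I) = {v' k}"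
      using p.cell_hull[of "inc k \<inter> I"] q.cell_hull[of "inc k \<inter> I"] k(2) by simp_all
    then show ?thesis using \<Phi>[of "inc k \<inter> I"] by simp
  qed
  show ?thesis
  proof (rule that[of \<Phi>, OF bij ord _ vert])
    show "\<Phi> (P \<inter> {x. \<forall>m\<in>J. a m \<bullet> x = b m}) = P' \<inter> {x. \<forall>m\<in>J. a' m \<bullet> x = b' m}" if "J \<subseteq> I" for J
      using \<Phi>[OF that] by (simp only: p.cell_def q.cell_def)
  qed
qed

section \<open>Truncated simplices\<close>

text \<open>\<open>Inl k\<close> is the inequality x_k \<ge> 0 of the face opposite
  \<open>k\<close>; \<open>Inr i\<close> cuts off the vertex \<open>i\<close> by bounding x_i by a
  weighted sum of the other coordinates. The weights vary with \<open>j\<close> because the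
  truncation planes of a hyper-ideal tetrahedron are in general not parallel to the opposite
  faces.\<close>

definition cut_fun :: "(4 \<Rightarrow> 4 \<Rightarrow> real) \<Rightarrow> 4 + 4 \<Rightarrow> real^4" where
  "cut_fun w m = (case m of Inl k \<Rightarrow> \<chi> j. if j = k then - 1 else 0
     | Inr i \<Rightarrow> \<chi> j. if j = i then 1 else - w i j)"

definition cut_simplex :: "(4 \<Rightarrow> 4 \<Rightarrow> real) \<Rightarrow> (real^4) set" where
  "cut_simplex w = {x. (\<Sum>i\<in>UNIV. x $ i) = 1 \<and> (\<forall>m. cut_fun w m \<bullet> x \<le> 0)}"

definition cut_vertex :: "(4 \<Rightarrow> 4 \<Rightarrow> real) \<Rightarrow> 4 \<times> 4 \<Rightarrow> real^4" where
  "cut_vertex w = (\<lambda>(i, j). \<chi> k. if k = i then w i j / (1 + w i j) else if k = j then 1 / (1 + w i j) else 0)"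

text \<open>The polytope is simple: two hexagons and one triangle meet at the vertex near
  \<open>i\<close> on the edge {i, j}.\<close>

definition cut_inc :: "4 \<times> 4 \<Rightarrow> (4 + 4) set" where
  "cut_inc = (\<lambda>(i, j). {Inl (third i j), Inl (third j i), Inr i})"

definition ordered_pairs :: "(4 \<times> 4) set" where
  "ordered_pairs = {(i, j). i \<noteq> j}"

lemma cut_fun_Inl: "cut_fun w (Inl k) \<bullet> x = - x $ k"
  by (simp add: cut_fun_def inner_vec_def if_distrib[of "\<lambda>c. c * _"] sum.delta cong: if_cong)

lemma cut_fun_Inr:
  assumes "i \<noteq> j"
  shows "cut_fun w (Inr i) \<bullet> x = x $ i - w i j * x $ j - w i (third i j) * x $ third i j
     - w i (third j i) * x $ third j i"
  using third_neq[OF assms] assms by (simp add: cut_fun_def inner_vec_def sum_third[OF assms])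

text \<open>That \<open>w i j * w j i\<close> exceeds 1 means that the two cut points on the edge
  {i, j} come in the right order, so that the cuts at \<open>i\<close> and \<open>j\<close> stay
  apart.\<close>

locale cut_weights =
  fixes w :: "4 \<Rightarrow> 4 \<Rightarrow> real"
  assumes w_pos: "i \<noteq> j \<Longrightarrow> 0 < w i j" and w_gt: "i \<noteq> j \<Longrightarrow> 1 < w i j * w j i"
begin

lemma cut_simplex_nonneg: "x \<in> cut_simplex w \<Longrightarrow> 0 \<le> x $ k"
  using cut_fun_Inl[of w k x] by (auto simp: cut_simplex_def) (metis neg_le_0_iff_le)

text \<open>Inserting one truncation equation into the other gives w_ij w_ji x_i \<le> x_i, hence
  x_i = 0. Then every term of the first equation vanishes, against the coordinate sum 1.\<close>

lemma cut_simplex_two_tight: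
  assumes x: "x \<in> cut_simplex w" and ij: "i \<noteq> j"
    and t: "cut_fun w (Inr i) \<bullet> x = 0" "cut_fun w (Inr j) \<bullet> x = 0"
  shows False
proof -
  let ?k = "third i j" and ?l = "third j i"
  note n = cut_simplex_nonneg[OF x]
  note nn = third_neq[OF ij]
  have 1: "x $ i = w i j * x $ j + (w i ?k * x $ ?k + w i ?l * x $ ?l)"
    using t(1) cut_fun_Inr[OF ij, of w x] by simp
  have 2: "x $ j = w j i * x $ i + (w j ?k * x $ ?k + w j ?l * x $ ?l)"
    using t(2) cut_fun_Inr[OF ij[symmetric], of w x] by simp
  have p: "0 \<le> w i ?k * x $ ?k" "0 \<le> w i ?l * x $ ?l" "0 \<le> w j ?k * x $ ?k" "0 \<le> w j ?l * x $ ?l"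
    using n nn w_pos by (simp_all add: less_imp_le)
  have "w i j * (w j i * x $ i) \<le> w i j * x $ j"
    using 2 p w_pos[OF ij] by (intro mult_left_mono) auto
  then have "(w i j * w j i) * x $ i \<le> x $ i" using 1 p by simp
  then have xi: "x $ i = 0" using w_gt[OF ij] n[of i] mult_strict_right_mono[of 1 "w i j * w j i" "x $ i"] by fastforce
  have "w i j * x $ j = 0" "w i ?k * x $ ?k = 0" "w i ?l * x $ ?l = 0"
    using 1 p xi n[of j] w_pos[OF ij] mult_nonneg_nonneg[of "w i j" "x $ j"] by linarith+
  then have "x $ j = 0" "x $ ?k = 0" "x $ ?l = 0"
    using w_pos[OF ij] w_pos[OF nn(6)] w_pos[OF nn(9)] by simp_all
  then show False using x xi by (simp add: cut_simplex_def sum_third[OF ij])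
qed

lemma cut_perturb:
  assumes x: "x \<in> cut_simplex w" and d: "(\<Sum>i\<in>UNIV. d $ i) = 0"
    and t: "\<And>m. cut_fun w m \<bullet> x = 0 \<Longrightarrow> cut_fun w m \<bullet> d = 0"
  shows "\<exists>e>0. x + e *\<^sub>R d \<in> cut_simplex w \<and> x - e *\<^sub>R d \<in> cut_simplex w"
proof -
  obtain e where e: "e > 0" "\<And>m. cut_fun w m \<bullet> x + e * \<bar>cut_fun w m \<bullet> d\<bar> \<le> 0"
    using small_perturbation[of "UNIV :: (4 + 4) set" "\<lambda>m. cut_fun w m \<bullet> x" "\<lambda>m. cut_fun w m \<bullet> d"] x t
    by (auto simp: cut_simplex_def)
  have "cut_fun w m \<bullet> x + e * (cut_fun w m \<bullet> d) \<le> 0 \<and> cut_fun w m \<bullet> x - e * (cut_fun w m \<bullet> d) \<le> 0" for m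
  proof -
    have "e * (cut_fun w m \<bullet> d) \<le> e * \<bar>cut_fun w m \<bullet> d\<bar>" "e * - (cut_fun w m \<bullet> d) \<le> e * \<bar>cut_fun w m \<bullet> d\<bar>"
      using e(1) by (intro mult_left_mono; simp)+
    then show ?thesis using e(2)[of m] by simp
  qed
  then have "x + e *\<^sub>R d \<in> cut_simplex w \<and> x - e *\<^sub>R d \<in> cut_simplex w"
    using x d
    by (simp add: cut_simplex_def inner_add_right inner_diff_right sum.distrib sum_subtractf flip: sum_distrib_left)
  then show ?thesis using e by blast
qed

lemma extreme_no_perturb:
  assumes "x extreme_point_of cut_simplex w" and d: "(\<Sum>i\<in>UNIV. d $ i) = 0"
    and t: "\<And>m. cut_fun w m \<bullet> x = 0 \<Longrightarrow> cut_fun w m \<bullet> d = 0"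
  shows "d = 0"
proof (rule ccontr)
  assume d0: "d \<noteq> 0"
  have x: "x \<in> cut_simplex w" using assms(1) by (simp add: extreme_point_of_def)
  obtain e where e: "e > 0" "x + e *\<^sub>R d \<in> cut_simplex w" "x - e *\<^sub>R d \<in> cut_simplex w"
    using cut_perturb[OF x d t] by blast
  have "x \<in> open_segment (x - e *\<^sub>R d) (x + e *\<^sub>R d)"
    unfolding in_segment
  proof (intro conjI exI[of _ "1/2"])
    show "x - e *\<^sub>R d \<noteq> x + e *\<^sub>R d"
    proof
      assume "x - e *\<^sub>R d = x + e *\<^sub>R d"
      then have "(2 * e) *\<^sub>R d = 0" by (simp add: algebra_simps flip: scaleR_2)
      then show False using d0 e by simp
    qed
    show "x = (1 - 1 / 2) *\<^sub>R (x - e *\<^sub>R d) + (1 / 2) *\<^sub>R (x + e *\<^sub>R d)"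
      by (simp add: algebra_simps flip: scaleR_add_left)
  qed auto
  then show False using assms(1) e by (simp add: extreme_point_of_def)
qed

text \<open>At a point with three positive coordinates at most one truncation is tight and only the
  fourth coordinate can vanish. Together with the coordinate sum these conditions leave a free
  direction.\<close>

lemma extreme_support:
  assumes ext: "x extreme_point_of cut_simplex w" and ij: "i \<noteq> j"
    and pos: "0 < x $ i" "0 < x $ j" "0 < x $ third i j"
  shows False
proof -
  let ?k = "third i j" and ?l = "third j i"
  note nn = third_neq[OF ij]
  have x: "x \<in> cut_simplex w" using ext by (simp add: extreme_point_of_def)
  \<comment> \<open>The normal of the only truncation that can be tight, or 0 if there is
    none.\<close>
  define c where "c = (if \<exists>m. cut_fun w (Inr m) \<bullet> x = 0 then cut_fun w (Inr (SOME m. cut_fun w (Inr m) \<bullet> x = 0)) else 0)"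
  have c: "cut_fun w (Inr m) = c" if "cut_fun w (Inr m) \<bullet> x = 0" for m
  proof -
    have "cut_fun w (Inr (SOME m. cut_fun w (Inr m) \<bullet> x = 0)) \<bullet> x = 0" using that by (rule someI)
    then have "(SOME m. cut_fun w (Inr m) \<bullet> x = 0) = m" using cut_simplex_two_tight[OF x] that by blast
    then show ?thesis using that by (auto simp: c_def)
  qed
  \<comment> \<open>The cross product of \<open>c\<close> with (1, 1, 1) in the coordinates
    \<open>i\<close>, \<open>j\<close>, \<open>?k\<close>. If it vanishes, \<open>c\<close> is
    constant there and is orthogonal to e_i - e_j.\<close>
  define d0 :: "real^4" where "d0 = (\<chi> a. if a = i then c $ j - c $ ?k else if a = j then c $ ?k - c $ i
     else if a = ?k then c $ i - c $ j else 0)"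
  define d :: "real^4" where "d = (if d0 = 0 then (\<chi> a. if a = i then 1 else if a = j then - 1 else 0) else d0)"
  have d0: "d0 $ i = c $ j - c $ ?k" "d0 $ j = c $ ?k - c $ i" "d0 $ ?k = c $ i - c $ j" "d0 $ ?l = 0"
    using nn ij by (simp_all add: d0_def)
  have inn: "c \<bullet> y = c $ i * y $ i + c $ j * y $ j + c $ ?k * y $ ?k + c $ ?l * y $ ?l" for y
    by (simp add: inner_vec_def sum_third[OF ij])
  have "c \<bullet> d = 0"
  proof (cases "d0 = 0")
    case True
    then have "c $ ?k = c $ i" "c $ i = c $ j" using d0 by (metis eq_iff_diff_eq_0 zero_index)+
    then show ?thesis using True nn ij by (simp add: d_def inn)
  next
    case False
    then show ?thesis by (simp add: d_def inn d0 algebra_simps)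
  qed
  moreover have dl: "d $ ?l = 0" "d \<noteq> 0"
  proof -
    show "d $ ?l = 0" using nn by (auto simp: d_def d0)
    show "d \<noteq> 0"
    proof (cases "d0 = 0")
      case True
      then have "d $ i = 1" by (simp add: d_def)
      then show ?thesis by auto
    qed (simp add: d_def)
  qed
  moreover have sd: "(\<Sum>a\<in>UNIV. d $ a) = 0"
    using nn ij d0 by (auto simp: d_def sum_third[OF ij])
  moreover have "cut_fun w m \<bullet> d = 0" if "cut_fun w m \<bullet> x = 0" for m
  proof (cases m)
    case (Inl a)
    then have "x $ a = 0" using that cut_fun_Inl by (metis neg_equal_0_iff_equal)
    then have "a = ?l" using pos third_cases[OF ij, of a] by auto
    then show ?thesis using Inl cut_fun_Inl dl by simp
  next
    case (Inr a)
    then show ?thesis using c that \<open>c \<bullet> d = 0\<close> by simp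
  qed
  ultimately show False using extreme_no_perturb[OF ext sd] by blast
qed

text \<open>An extreme point has exactly two positive coordinates, so it lies on an edge. If neither
  truncation at the ends of the edge were tight, it could slide along the edge, because the
  truncations at the other two vertices are strict there.\<close>

lemma extreme_is_vertex:
  assumes ext: "x extreme_point_of cut_simplex w"
  shows "x \<in> cut_vertex w ` ordered_pairs"
proof -
  have x: "x \<in> cut_simplex w" using ext by (simp add: extreme_point_of_def)
  note n = cut_simplex_nonneg[OF x]
  have s1: "(\<Sum>a\<in>UNIV. x $ a) = 1" using x by (simp add: cut_simplex_def)
  then obtain i where i: "0 < x $ i"
    using n by (metis (no_types, lifting) UNIV_I less_eq_real_def sum.neutral zero_neq_one)
  have "\<exists>j. j \<noteq> i \<and> 0 < x $ j"
  proof (rule ccontr)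
    assume "\<not> ?thesis"
    then have z: "x $ j = 0" if "j \<noteq> i" for j using that n[of j] by force
    obtain j where ij: "i \<noteq> j" using exhaust_4[of i] by (metis (full_types) one_neq_zero third_neq(1))
    have "cut_fun w (Inr i) \<bullet> x = x $ i" using cut_fun_Inr[OF ij] z third_neq[OF ij] ij by simp
    then show False using x i by (auto simp: cut_simplex_def) (metis not_le)
  qed
  then obtain j where j: "i \<noteq> j" "0 < x $ j" by metis
  let ?k = "third i j" and ?l = "third j i"
  note nn = third_neq[OF j(1)]
  have "x $ ?k = 0" using extreme_support[OF ext j(1) i j(2)] n[of ?k] by force
  moreover have "x $ ?l = 0" using extreme_support[OF ext j(1)[symmetric] j(2) i] n[of ?l] by force
  ultimately have kl: "x $ ?k = 0" "x $ ?l = 0" by auto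
  have s: "x $ i + x $ j = 1" using s1 kl by (simp add: sum_third[OF j(1)])
  have vert: "x = cut_vertex w (p, r)" if pr: "p \<noteq> r" "{p, r} = {i, j}" and t: "cut_fun w (Inr p) \<bullet> x = 0" for p r
  proof -
    have z: "x $ third p r = 0" "x $ third r p = 0"
      using pr kl j by (auto simp: doubleton_eq_iff)
    have e: "x $ p = w p r * x $ r" using t cut_fun_Inr[OF pr(1), of w x] z by simp
    have "x $ p + x $ r = 1" using pr s by (auto simp: doubleton_eq_iff)
    then have "(1 + w p r) * x $ r = 1" using e by (simp add: algebra_simps)
    then have r: "x $ r = 1 / (1 + w p r)" using w_pos[OF pr(1)] by (simp add: field_simps)
    then have "x $ p = w p r / (1 + w p r)" using e by simp
    then show ?thesis
      using r z third_neq[OF pr(1)] pr(1) by (simp add: vec_eq_iff cut_vertex_def all_third[OF pr(1)])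
  qed
  have "cut_fun w (Inr i) \<bullet> x = 0 \<or> cut_fun w (Inr j) \<bullet> x = 0"
  proof (rule ccontr)
    assume no: "\<not> ?thesis"
    define d :: "real^4" where "d = (\<chi> a. if a = i then 1 else if a = j then - 1 else 0)"
    have dc: "d $ i = 1" "d $ j = -1" "d $ ?k = 0" "d $ ?l = 0" using nn j by (simp_all add: d_def)
    have "d = 0"
    proof (rule extreme_no_perturb[OF ext])
      show "(\<Sum>a\<in>UNIV. d $ a) = 0" by (simp add: sum_third[OF j(1)] dc)
      fix m assume m: "cut_fun w m \<bullet> x = 0"
      show "cut_fun w m \<bullet> d = 0"
      proof (cases m)
        case (Inl a)
        then have "x $ a = 0" using m cut_fun_Inl by (metis neg_equal_0_iff_equal)
        then have "a = ?k \<or> a = ?l" using i j third_cases[OF j(1), of a] by auto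
        then show ?thesis using Inl cut_fun_Inl dc by auto
      next
        case (Inr a)
        then have "a \<noteq> i" "a \<noteq> j" using no m by auto
        then have a: "a = ?k \<or> a = ?l" using third_cases[OF j(1), of a] by auto
        then have ai: "a \<noteq> i" using nn by auto
        have "{third a i, third i a} = {j, (if a = ?k then ?l else ?k)}"
          using a third_cycle[OF j(1)] nn by auto
        then have "(third a i = j \<and> x $ third i a = 0) \<or> (third i a = j \<and> x $ third a i = 0)"
          using kl by (auto simp: doubleton_eq_iff split: if_splits)
        moreover have "x $ a = 0" using a kl by auto
        moreover have "w a i * x $ i > 0" "w a j * x $ j > 0"
          using w_pos[OF ai] w_pos[of a j] \<open>a \<noteq> j\<close> i j by simp_all
        ultimately have "cut_fun w (Inr a) \<bullet> x < 0"
          unfolding cut_fun_Inr[OF ai] by auto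
        then show ?thesis using m Inr by simp
      qed
    qed
    then show False using dc(1) by simp
  qed
  then show ?thesis
    using vert[of i j] vert[of j i] j(1) by (auto simp: ordered_pairs_def)
qed

lemma cut_vertex_vals:
  assumes "i \<noteq> j"
  shows "cut_vertex w (i, j) $ i = w i j / (1 + w i j)" "cut_vertex w (i, j) $ j = 1 / (1 + w i j)"
    "cut_vertex w (i, j) $ third i j = 0" "cut_vertex w (i, j) $ third j i = 0"
  using assms third_neq[OF assms] by (simp_all add: cut_vertex_def)

lemma cut_vertex_inc:
  assumes "i \<noteq> j"
  shows "cut_fun w m \<bullet> cut_vertex w (i, j) \<le> 0"
    "cut_fun w m \<bullet> cut_vertex w (i, j) = 0 \<longleftrightarrow> m \<in> cut_inc (i, j)"
proof -
  let ?k = "third i j" and ?l = "third j i"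
  note nn = third_neq[OF assms] note cy = third_cycle[OF assms] note v = cut_vertex_vals[OF assms]
  have wp: "0 < w i j" "0 < w j i" "1 < w i j * w j i" using assms w_pos w_gt by auto
  have "cut_fun w m \<bullet> cut_vertex w (i, j) \<le> 0 \<and>
    (cut_fun w m \<bullet> cut_vertex w (i, j) = 0 \<longleftrightarrow> m \<in> cut_inc (i, j))"
  proof (cases m)
    case (Inl a)
    then show ?thesis
      using third_cases[OF assms, of a] v wp nn assms by (auto simp: cut_fun_Inl cut_inc_def)
  next
    case (Inr a)
    consider "a = i" | "a = j" | "a = ?k" | "a = ?l" using third_cases[OF assms, of a] by blast
    then show ?thesis
    proof cases
      case 1
      then show ?thesis using Inr v by (simp add: cut_fun_Inr[OF assms] cut_inc_def)
    next
      case 2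
      have "cut_fun w (Inr j) \<bullet> cut_vertex w (i, j) = (1 - w i j * w j i) / (1 + w i j)"
        using v wp by (simp add: cut_fun_Inr[OF assms[symmetric]] field_simps)
      also have "\<dots> < 0" using wp by (simp add: divide_neg_pos)
      finally show ?thesis using Inr 2 assms by (auto simp: cut_inc_def)
    next
      case 3
      have "cut_fun w (Inr ?k) \<bullet> cut_vertex w (i, j) = - w ?k i * (w i j / (1 + w i j)) - w ?k j / (1 + w i j)"
        using v cy cut_fun_Inr[OF nn(1)] by simp
      also have "\<dots> < 0 - 0" using wp w_pos[OF nn(1)] w_pos[OF nn(2)] by (intro diff_strict_mono) (simp_all add: divide_pos_pos add_pos_pos mult_pos_pos)
      finally show ?thesis using Inr 3 nn by (auto simp: cut_inc_def)
    next
      case 4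
      have "cut_fun w (Inr ?l) \<bullet> cut_vertex w (i, j) = - w ?l i * (w i j / (1 + w i j)) - w ?l j / (1 + w i j)"
        using v cy cut_fun_Inr[OF nn(4)] third_cycle[OF assms[symmetric]] by simp
      also have "\<dots> < 0 - 0" using wp w_pos[OF nn(4)] w_pos[OF nn(5)] by (intro diff_strict_mono) (simp_all add: divide_pos_pos add_pos_pos mult_pos_pos)
      finally show ?thesis using Inr 4 nn by (auto simp: cut_inc_def)
    qed
  qed
  then show "cut_fun w m \<bullet> cut_vertex w (i, j) \<le> 0"
    "cut_fun w m \<bullet> cut_vertex w (i, j) = 0 \<longleftrightarrow> m \<in> cut_inc (i, j)" by auto
qed

lemma cut_vertex_in: "p \<in> ordered_pairs \<Longrightarrow> cut_vertex w p \<in> cut_simplex w"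
proof -
  assume "p \<in> ordered_pairs"
  then obtain i j where p: "p = (i, j)" "i \<noteq> j" by (auto simp: ordered_pairs_def)
  have "0 < 1 + w i j" using w_pos[OF p(2)] by simp
  then have "(\<Sum>a\<in>UNIV. cut_vertex w (i, j) $ a) = 1"
    by (simp add: sum_third[OF p(2)] cut_vertex_vals[OF p(2)] flip: add_divide_distrib)
  then show ?thesis using cut_vertex_inc(1)[OF p(2)] by (simp add: cut_simplex_def p)
qed

lemma cut_simplex_convex: "convex (cut_simplex w)"
proof -
  have e: "cut_simplex w = (\<Inter>m. {x. cut_fun w m \<bullet> x \<le> 0}) \<inter> {x. (\<chi> i. 1) \<bullet> x = 1}"
    by (auto simp: cut_simplex_def inner_vec_def)
  show ?thesis unfolding e
    by (intro convex_Int convex_INT convex_halfspace_le convex_hyperplane)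
qed

lemma cut_simplex_compact: "compact (cut_simplex w)"
proof -
  have e: "cut_simplex w = (\<Inter>m. {x. cut_fun w m \<bullet> x \<le> 0}) \<inter> {x. (\<chi> i. 1) \<bullet> x = 1}"
    by (auto simp: cut_simplex_def inner_vec_def)
  have "closed (cut_simplex w)" unfolding e
    by (intro closed_Int closed_INT ballI closed_halfspace_le closed_hyperplane)
  moreover have "bounded (cut_simplex w)"
  proof (rule bounded_subset[of "cbox 0 (\<chi> i. 1)"])
    show "cut_simplex w \<subseteq> cbox 0 (\<chi> i. 1)"
    proof
      fix x assume x: "x \<in> cut_simplex w"
      note n = cut_simplex_nonneg[OF x]
      have "x $ k \<le> (\<Sum>i\<in>UNIV. x $ i)" for k using n by (intro member_le_sum) auto
      then show "x \<in> cbox 0 (\<chi> i. 1)" using n x by (simp add: mem_box_cart cut_simplex_def)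
    qed
  qed simp
  ultimately show ?thesis by (simp add: compact_eq_bounded_closed)
qed

lemma cut_simplex_hull: "cut_simplex w = convex hull (cut_vertex w ` ordered_pairs)"
proof
  have "cut_simplex w = convex hull {x. x extreme_point_of cut_simplex w}"
    by (rule Krein_Milman_Minkowski[OF cut_simplex_compact cut_simplex_convex])
  also have "\<dots> \<subseteq> convex hull (cut_vertex w ` ordered_pairs)"
    using extreme_is_vertex by (intro hull_mono) blast
  finally show "cut_simplex w \<subseteq> convex hull (cut_vertex w ` ordered_pairs)" .
  show "convex hull (cut_vertex w ` ordered_pairs) \<subseteq> cut_simplex w"
    using cut_vertex_in cut_simplex_convex by (intro hull_minimal) auto
qed

text \<open>
  A polytope that is a projective image \<open>L\<close> of the cut simplex, each of whose defining
  inequalities is a positive multiple of the corresponding one in the simplex.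
\<close>

lemma image_cut_polytope:
  fixes L :: "real^4 \<Rightarrow> 'a::euclidean_space"
  assumes L: "linear L"
    and a: "\<And>m x. (\<Sum>i\<in>UNIV. x $ i) = 1 \<Longrightarrow> a m \<bullet> L x - b m = c m * (cut_fun w m \<bullet> x)"
    and c: "\<And>m. 0 < c m"
  shows "cut_polytope (L ` cut_simplex w) UNIV a b ordered_pairs (\<lambda>p. L (cut_vertex w p)) cut_inc"
proof
  show "L ` cut_simplex w = convex hull ((\<lambda>p. L (cut_vertex w p)) ` ordered_pairs)"
    unfolding cut_simplex_hull using convex_hull_linear_image[OF L] by (simp add: image_image)
  have val: "a m \<bullet> L x \<le> b m \<longleftrightarrow> cut_fun w m \<bullet> x \<le> 0" "a m \<bullet> L x = b m \<longleftrightarrow> cut_fun w m \<bullet> x = 0"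
    if "(\<Sum>i\<in>UNIV. x $ i) = 1" for m x
    using a[OF that, of m] c[of m] by (smt (verit) mult_pos_pos mult_nonneg_nonpos mult_eq_0_iff mult_pos_neg)+
  show "a m \<bullet> x \<le> b m" if "x \<in> L ` cut_simplex w" for x m
    using that val(1) by (auto simp: cut_simplex_def)
  show "a m \<bullet> L (cut_vertex w k) = b m \<longleftrightarrow> m \<in> cut_inc k" if "k \<in> ordered_pairs" for k m
  proof -
    obtain i j where k: "k = (i, j)" "i \<noteq> j" using \<open>k \<in> ordered_pairs\<close> by (auto simp: ordered_pairs_def)
    show ?thesis
      using val(2)[of "cut_vertex w k" m] cut_vertex_in[OF that] cut_vertex_inc(2)[OF k(2), of m] k
      by (simp add: cut_simplex_def)
  qed
  show "\<exists>e>0. x + e *\<^sub>R (x - y) \<in> L ` cut_simplex w"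
    if xy: "x \<in> L ` cut_simplex w" "y \<in> L ` cut_simplex w"
      and t: "\<forall>m\<in>UNIV. a m \<bullet> x = b m \<longrightarrow> a m \<bullet> y = b m" for x y
  proof -
    obtain x' y' where x': "x' \<in> cut_simplex w" "x = L x'" and y': "y' \<in> cut_simplex w" "y = L y'"
      using xy by blast
    have s: "(\<Sum>i\<in>UNIV. x' $ i) = 1" "(\<Sum>i\<in>UNIV. y' $ i) = 1"
      using x' y' by (simp_all add: cut_simplex_def)
    have "\<exists>e>0. x' + e *\<^sub>R (x' - y') \<in> cut_simplex w \<and> x' - e *\<^sub>R (x' - y') \<in> cut_simplex w"
      using x'(1)
    proof (rule cut_perturb)
      show "(\<Sum>i\<in>UNIV. (x' - y') $ i) = 0" using s by (simp add: sum_subtractf)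
      show "cut_fun w m \<bullet> (x' - y') = 0" if "cut_fun w m \<bullet> x' = 0" for m
        using that t val(2)[OF s(1)] val(2)[OF s(2)] x' y' by (simp add: inner_diff_right)
    qed
    then obtain e where "e > 0" "x' + e *\<^sub>R (x' - y') \<in> cut_simplex w" by blast
    moreover have "L (x' + e *\<^sub>R (x' - y')) = x + e *\<^sub>R (x - y)"
      using L by (simp add: linear_add linear_diff linear_scale x' y')
    ultimately show ?thesis by (metis imageI)
  qed
  show "\<not> UNIV \<subseteq> cut_inc k" if "k \<in> ordered_pairs" for k
  proof
    obtain i j where k: "k = (i, j)" "i \<noteq> j" using \<open>k \<in> ordered_pairs\<close> by (auto simp: ordered_pairs_def)
    assume "UNIV \<subseteq> cut_inc k"
    then have "Inr j \<in> cut_inc k" by blast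
    then show False using k by (auto simp: cut_inc_def)
  qed
qed auto

end

lemma cut_inc_unique: "k \<in> ordered_pairs \<Longrightarrow> {m \<in> ordered_pairs. cut_inc k \<inter> UNIV \<subseteq> cut_inc m} = {k}"
proof -
  have "m = k" if k: "k \<in> ordered_pairs" and m: "m \<in> ordered_pairs" and s: "cut_inc k \<subseteq> cut_inc m" for m k
  proof -
    obtain i j i' j' where e: "k = (i, j)" "i \<noteq> j" "m = (i', j')" "i' \<noteq> j'"
      using k m by (auto simp: ordered_pairs_def)
    have ii: "i = i'" using s e by (auto simp: cut_inc_def)
    have "j' \<noteq> third i j \<and> j' \<noteq> third j i"
      using s e third_neq[OF e(4)] by (auto simp: cut_inc_def)
    then have "j' = j" using third_cases[OF e(2), of j'] e ii by auto
    then show ?thesis using ii e by simp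
  qed
  then show "k \<in> ordered_pairs \<Longrightarrow> ?thesis" by blast
qed

text \<open>As the coordinates sum to 1, bounding x_i by 2/3 is the same as bounding it by twice the
  sum of the others.\<close>

lemma trunc_tet_eq: "trunc_tet = cut_simplex (\<lambda>i j. 2)"
proof -
  have tr: "cut_fun (\<lambda>i j. 2) (Inr i) \<bullet> x = 3 * x $ i - 2 * (\<Sum>k\<in>UNIV. x $ k)" for i and x :: "real^4"
  proof -
    obtain j where ij: "i \<noteq> j" using exhaust_4[of i] by (metis (full_types) one_neq_zero third_neq(1))
    show ?thesis by (simp add: cut_fun_Inr[OF ij] sum_third[OF ij])
  qed
  show ?thesis
    unfolding trunc_tet_def tetrahedron_def cut_simplex_def
    by (auto simp: split_sum_all cut_fun_Inl tr mult.commute)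
qed

lemma cut_weights_two: "cut_weights (\<lambda>i j. 2)"
  by unfold_locales auto

section \<open>The angle equations\<close>

text \<open>
  In terms of \<open>x = cosh l\<^sub>a\<close> and \<open>y = cosh l\<^sub>b\<close>, the cosines of the dihedral angles are: for the
  tetrahedron with a single \<open>a\<close>-edge, \<open>cosA\<close> at that edge, \<open>cosB\<close> at the opposite edge and \<open>cosC\<close>
  at the four others; for the tetrahedron whose \<open>a\<close>-edges form a path, \<open>cosM\<close> at the middle of the
  path, \<open>cosE\<close> at its two ends, and by the symmetry between \<open>a\<close> and \<open>b\<close> the same functions with
  exchanged arguments at the \<open>b\<close>-edges.
\<close>

definition cosA :: "real \<Rightarrow> real \<Rightarrow> real" where
  "cosA x y = (2 * y\<^sup>2 + y * (1 - x)) / (2 * y\<^sup>2 + x - 1)"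

definition cosB :: "real \<Rightarrow> real \<Rightarrow> real" where
  "cosB x y = (2 * y\<^sup>2 + x * (1 - y)) / ((y + 1) * (2 * y - 1))"

definition cosC :: "real \<Rightarrow> real \<Rightarrow> real" where
  "cosC x y = y * sqrt (1 + x) / sqrt ((2 * y\<^sup>2 + x - 1) * (2 * y - 1))"

definition cosM :: "real \<Rightarrow> real \<Rightarrow> real" where
  "cosM x y = (x ^ 3 + x * y\<^sup>2 + 2 * x * y + y - x\<^sup>2 * y) / ((y + 1) * (2 * x\<^sup>2 + y - 1))"

definition cosE :: "real \<Rightarrow> real \<Rightarrow> real" where
  "cosE x y = (y\<^sup>2 + x * y + x - x\<^sup>2) * sqrt (1 + x) /
     sqrt ((2 * y\<^sup>2 + x - 1) * (y + 1) * (2 * x\<^sup>2 + y - 1))"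

definition clamp_to :: "real \<Rightarrow> real \<Rightarrow> real \<Rightarrow> real" where
  "clamp_to a b c = max a (min b c)"

text \<open>Clamping gives a continuous function on the whole rectangle without control of the
  cosines there. At the solution it is the true angle, by the bound proved for realized
  tetrahedra.\<close>

definition angle_of :: "real \<Rightarrow> real" where
  "angle_of c = arccos (clamp_to (-1) 1 c)"

definition sumA :: "real \<Rightarrow> real \<Rightarrow> real" where
  "sumA x y = angle_of (cosA x y) + 2 * angle_of (cosM x y) + 4 * angle_of (cosE x y)"

definition sumB :: "real \<Rightarrow> real \<Rightarrow> real" where
  "sumB x y = angle_of (cosB x y) + 4 * angle_of (cosC x y) + 2 * angle_of (cosM y x) + 4 * angle_of (cosE y x)"

lemma arccos_half: "arccos (1 / 2) = pi / 3"
  using arccos_cos[of "pi / 3"] by (simp add: cos_60)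

lemma arccos_sqrt2: "arccos (sqrt 2 / 2) = pi / 4"
  using arccos_cos[of "pi / 4"] by (simp add: cos_45)

lemma arccos_sqrt3: "arccos (sqrt 3 / 2) = pi / 6"
  using arccos_cos[of "pi / 6"] by (simp add: cos_30)

lemma angle_of_eq: "-1 \<le> c \<Longrightarrow> c \<le> 1 \<Longrightarrow> angle_of c = arccos c"
  by (simp add: angle_of_def clamp_to_def)

lemma angle_of_ge: "c \<le> c0 \<Longrightarrow> -1 \<le> c0 \<Longrightarrow> c0 \<le> 1 \<Longrightarrow> arccos c0 \<le> angle_of c"
  unfolding angle_of_def clamp_to_def by (intro arccos_le_arccos) auto

lemma angle_of_gt: "c < c0 \<Longrightarrow> -1 \<le> c0 \<Longrightarrow> c0 \<le> 1 \<Longrightarrow> -1 < c0 \<Longrightarrow> arccos c0 < angle_of c"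
  unfolding angle_of_def clamp_to_def by (intro arccos_less_arccos) auto

lemma angle_of_1: "angle_of 1 = 0"
  by (simp add: angle_of_def clamp_to_def)

lemma continuous_on_angle_of: "continuous_on S f \<Longrightarrow> continuous_on S (\<lambda>x. angle_of (f x))"
  unfolding angle_of_def clamp_to_def
  by (intro continuous_intros) auto

lemma sqrt2_bound: "7 / 10 \<le> sqrt 2 / 2"
  by (rule power2_le_imp_le) (auto simp: power_divide)

lemma sqrt3_bound: "4 / 5 < sqrt 3 / 2"
  by (rule power2_less_imp_less) (auto simp: power_divide)

lemma poly_pos:
  fixes x y :: real
  assumes "1 \<le> x" "1 \<le> y"
  shows "0 < 2 * y\<^sup>2 + x - 1" "0 < 2 * y - 1" "0 < y + 1"
proof -
  have "1 \<le> y\<^sup>2" using assms by simp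
  then show "0 < 2 * y\<^sup>2 + x - 1" "0 < 2 * y - 1" "0 < y + 1" using assms by linarith+
qed

text \<open>Here the edges of the class have length 0, and all cosines in its sum degenerate to
  1.\<close>

lemma sum_at_one:
  assumes "1 \<le> x"
  shows "sumA 1 x = 0" "sumB x 1 = 0"
proof -
  have p: "0 < x" "0 < 1 + x" using assms by auto
  have A: "cosA 1 x = 1" "cosB x 1 = 1" "cosC x 1 = 1" using p by (auto simp: cosA_def cosB_def cosC_def)
  have M: "cosM 1 x = 1"
  proof -
    have "1 ^ 3 + 1 * x\<^sup>2 + 2 * 1 * x + x - 1\<^sup>2 * x = (x + 1) * (2 * 1\<^sup>2 + x - 1)"
      by (simp add: power2_eq_square algebra_simps)
    then show ?thesis unfolding cosM_def using p by simp
  qed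
  have E: "cosE 1 x = 1"
  proof -
    have "(2 * x\<^sup>2 + 1 - 1) * (x + 1) * (2 * 1\<^sup>2 + x - 1) = 2 * (x * (x + 1))\<^sup>2"
      by (simp add: power2_eq_square algebra_simps)
    then have "sqrt ((2 * x\<^sup>2 + 1 - 1) * (x + 1) * (2 * 1\<^sup>2 + x - 1)) = sqrt 2 * \<bar>x * (x + 1)\<bar>"
      by (simp only: real_sqrt_mult real_sqrt_abs)
    moreover have "\<bar>x * (x + 1)\<bar> = x * (x + 1)" using p by simp
    moreover have "x\<^sup>2 + 1 * x + 1 - 1\<^sup>2 = x * (x + 1)" by (simp add: power2_eq_square algebra_simps)
    ultimately show ?thesis unfolding cosE_def using p by simp
  qed
  show "sumA 1 x = 0" "sumB x 1 = 0" by (simp_all add: sumA_def sumB_def A M E angle_of_1)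
qed

lemma mult_sqrt_le:
  fixes u a b c :: real
  assumes "0 \<le> a" "0 < b" "0 \<le> c" "u\<^sup>2 * a \<le> c\<^sup>2 * b"
  shows "u * sqrt a / sqrt b \<le> c"
proof -
  have "(u * sqrt a)\<^sup>2 \<le> (c * sqrt b)\<^sup>2" using assms by (simp add: power_mult_distrib)
  then have "u * sqrt a \<le> c * sqrt b" by (rule power2_le_imp_le) (use assms in simp)
  then show ?thesis using assms by (simp add: divide_le_eq)
qed

text \<open>The bounds pi/3 for one angle, pi/6 for two and pi/3 for four add up to exactly 2 pi;
  strictness comes from the middle one.\<close>

lemma sumA_at_three:
  assumes y: "1 \<le> y" "y \<le> 9 / 4"
  shows "2 * pi < sumA 3 y"
proof -
  \<comment> \<open>For t in [0, 5/4] the higher powers of t are bounded by multiples of t, which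
    makes the polynomial inequalities linear.\<close>
  define t where "t = y - 1"
  have t: "0 \<le> t" "t \<le> 5 / 4" "y = 1 + t" using y by (auto simp: t_def)
  have tt: "t\<^sup>2 \<le> 5 / 4 * t" unfolding power2_eq_square using t by (intro mult_right_mono) auto
  have y2: "y\<^sup>2 = 1 + 2 * t + t\<^sup>2" by (simp add: t power2_eq_square algebra_simps)
  have "cosA 3 y \<le> 1 / 2"
  proof -
    have "2 * (2 * y\<^sup>2 + y * (1 - 3)) \<le> 2 * y\<^sup>2 + 3 - 1" unfolding y2 using t tt by (simp add: algebra_simps)
    then show ?thesis using poly_pos(1)[of 3 y] y by (simp add: cosA_def divide_le_eq)
  qed
  then have A: "pi / 3 \<le> angle_of (cosA 3 y)" using angle_of_ge[of "cosA 3 y" "1/2"] by (simp add: arccos_half)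
  have "cosM 3 y < sqrt 3 / 2"
  proof -
    have "5 * (3 ^ 3 + 3 * y\<^sup>2 + 2 * 3 * y + y - 3\<^sup>2 * y) \<le> 4 * ((y + 1) * (2 * 3\<^sup>2 + y - 1))"
    proof -
      have "4 * ((y + 1) * (2 * 3\<^sup>2 + y - 1)) - 5 * (3 ^ 3 + 3 * y\<^sup>2 + 2 * 3 * y + y - 3\<^sup>2 * y) = 4 + 60 * t - 11 * t\<^sup>2"
        unfolding y2 using t by (simp add: power2_eq_square algebra_simps)
      then show ?thesis using t tt by linarith
    qed
    moreover have "0 < (y + 1) * (2 * 3\<^sup>2 + y - 1)" using y by (intro mult_pos_pos) auto
    ultimately have "cosM 3 y \<le> 4 / 5" by (simp add: cosM_def divide_le_eq)
    then show ?thesis using sqrt3_bound by linarith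
  qed
  then have M: "pi / 6 < angle_of (cosM 3 y)"
    using angle_of_gt[of "cosM 3 y" "sqrt 3 / 2"] by (simp add: arccos_sqrt3) (smt (verit) real_sqrt_ge_zero real_sqrt_le_iff sqrt3_bound real_sqrt_four)
  have "cosE 3 y \<le> 1 / 2"
    unfolding cosE_def
  proof (rule mult_sqrt_le)
    show "0 < (2 * y\<^sup>2 + 3 - 1) * (y + 1) * (2 * 3\<^sup>2 + y - 1)"
      using poly_pos[of 3 y] y by (intro mult_pos_pos) auto
    have t3: "t ^ 3 \<le> 25 / 16 * t"
    proof -
      have "t ^ 3 = t * t\<^sup>2" by (simp add: power2_eq_square power3_eq_cube)
      also have "\<dots> \<le> t * (25 / 16)" using tt t by (intro mult_left_mono) auto
      finally show ?thesis by simp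
    qed
    have t4: "t ^ 4 \<le> 125 / 64 * t"
    proof -
      have "t ^ 4 = t * t ^ 3" by (simp add: power4_eq_xxxx power3_eq_cube)
      also have "\<dots> \<le> t * (125 / 64)" using t3 t by (intro mult_left_mono) auto
      finally show ?thesis by simp
    qed
    have "(2 * y\<^sup>2 + 3 - 1) * (y + 1) * (2 * 3\<^sup>2 + y - 1) - 16 * (y\<^sup>2 + 3 * y + 3 - 3\<^sup>2)\<^sup>2 =
       80 + 544 * t - 180 * t\<^sup>2 - 116 * t ^ 3 - 14 * t ^ 4"
      by (simp add: t power2_eq_square power3_eq_cube power4_eq_xxxx algebra_simps)
    then show "(y\<^sup>2 + 3 * y + 3 - 3\<^sup>2)\<^sup>2 * (1 + 3) \<le> (1 / 2)\<^sup>2 * ((2 * y\<^sup>2 + 3 - 1) * (y + 1) * (2 * 3\<^sup>2 + y - 1))"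
      using tt t3 t4 t by (simp add: power_divide)
  qed auto
  then have E: "pi / 3 \<le> angle_of (cosE 3 y)" using angle_of_ge[of "cosE 3 y" "1/2"] by (simp add: arccos_half)
  show ?thesis unfolding sumA_def using A M E by linarith
qed

text \<open>The bounds pi/6, 4 pi/4, 2 pi/4 and 4 pi/6 add up to 7 pi / 3.\<close>

lemma sumB_at_end:
  assumes x: "1 \<le> x" "x \<le> 3"
  shows "2 * pi < sumB x (9 / 4)"
proof -
  define t where "t = x - 1"
  have t: "0 \<le> t" "t \<le> 2" "x = 1 + t" using x by (auto simp: t_def)
  have tt: "t\<^sup>2 \<le> 2 * t" unfolding power2_eq_square using t by (intro mult_right_mono) auto
  have x2: "x\<^sup>2 = 1 + 2 * t + t\<^sup>2" by (simp add: t power2_eq_square algebra_simps)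
  have s3: "sqrt 3 / 2 \<le> 1" using real_sqrt_le_iff[of 3 4] by simp
  have s2: "sqrt 2 / 2 \<le> 1" using real_sqrt_le_iff[of 2 4] by simp
  have "cosB x (9 / 4) \<le> sqrt 3 / 2"
  proof -
    have "cosB x (9 / 4) \<le> 4 / 5" using x by (simp add: cosB_def divide_le_eq power2_eq_square)
    then show ?thesis using sqrt3_bound by linarith
  qed
  then have B: "pi / 6 \<le> angle_of (cosB x (9 / 4))"
    using angle_of_ge[of "cosB x (9 / 4)" "sqrt 3 / 2"] s3 by (simp add: arccos_sqrt3) (smt (verit) real_sqrt_ge_zero)
  have "cosC x (9 / 4) \<le> sqrt 2 / 2"
    unfolding cosC_def
  proof (rule mult_sqrt_le)
    show "0 < (2 * (9 / 4)\<^sup>2 + x - 1) * (2 * (9 / 4) - 1)" using x by (simp add: power2_eq_square)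
    show "(9 / 4)\<^sup>2 * (1 + x) \<le> (sqrt 2 / 2)\<^sup>2 * ((2 * (9 / 4)\<^sup>2 + x - 1) * (2 * (9 / 4) - 1))"
      using x by (simp add: power_divide power2_eq_square)
  qed (use x in auto)
  then have C: "pi / 4 \<le> angle_of (cosC x (9 / 4))"
    using angle_of_ge[of "cosC x (9 / 4)" "sqrt 2 / 2"] s2 by (simp add: arccos_sqrt2) (smt (verit) real_sqrt_ge_zero)
  have "cosM (9 / 4) x \<le> 7 / 10"
  proof -
    have "7 / 10 * ((x + 1) * (2 * (9 / 4)\<^sup>2 + x - 1)) - ((9 / 4) ^ 3 + 9 / 4 * x\<^sup>2 + 2 * (9 / 4) * x + x - (9 / 4)\<^sup>2 * x)
      = 31 / 320 + 71 / 20 * t - 31 / 20 * t\<^sup>2"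
      by (simp add: t power2_eq_square power3_eq_cube field_simps)
    moreover have "31 / 20 * t\<^sup>2 \<le> 71 / 20 * t" using tt t by linarith
    ultimately have "(9 / 4) ^ 3 + 9 / 4 * x\<^sup>2 + 2 * (9 / 4) * x + x - (9 / 4)\<^sup>2 * x \<le> 7 / 10 * ((x + 1) * (2 * (9 / 4)\<^sup>2 + x - 1))"
      by linarith
    moreover have "0 < (x + 1) * (2 * (9 / 4)\<^sup>2 + x - 1)" using x by (intro mult_pos_pos) (auto simp: power2_eq_square)
    ultimately show ?thesis unfolding cosM_def by (simp only: pos_divide_le_eq)
  qed
  then have M: "pi / 4 \<le> angle_of (cosM (9 / 4) x)"
    using angle_of_ge[of "cosM (9 / 4) x" "sqrt 2 / 2"] s2 sqrt2_bound by (simp add: arccos_sqrt2)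
  have "cosE (9 / 4) x \<le> sqrt 3 / 2"
    unfolding cosE_def
  proof (rule mult_sqrt_le)
    show "0 < (2 * x\<^sup>2 + 9 / 4 - 1) * (x + 1) * (2 * (9 / 4)\<^sup>2 + x - 1)"
      using x by (intro mult_pos_pos add_pos_pos) (auto simp: power2_eq_square intro: add_pos_pos)
    \<comment> \<open>With denominators cleared the claim reads 13 u^2 \<le> 3 D for the radicand D.
      Bounding u by a linear function of t lowers the degree, and the quadratic factor left over is
      nonnegative by completing the square.\<close>
    let ?u = "x\<^sup>2 + 9 / 4 * x + 9 / 4 - (9 / 4)\<^sup>2"
    have u: "0 \<le> ?u" "?u \<le> 7 / 16 + 25 / 4 * t"
    proof -
      have "?u = 7 / 16 + 17 / 4 * t + t\<^sup>2" by (simp add: t power2_eq_square field_simps)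
      then show "0 \<le> ?u" "?u \<le> 7 / 16 + 25 / 4 * t" using tt t zero_le_power2[of t] by linarith+
    qed
    have "?u\<^sup>2 \<le> (7 / 16 + 25 / 4 * t)\<^sup>2" using u by (intro power_mono) auto
    moreover have "3 * ((2 * x\<^sup>2 + 9 / 4 - 1) * (x + 1) * (2 * (9 / 4)\<^sup>2 + x - 1)) - 13 * (7 / 16 + 25 / 4 * t)\<^sup>2
        = 49907 / 256 + t * (2321 / 8 - 3697 / 16 * t + 339 / 4 * t\<^sup>2) + 6 * t ^ 4"
      by (simp add: t power2_eq_square power3_eq_cube power4_eq_xxxx field_simps)
    moreover have "0 \<le> 2321 / 8 - 3697 / 16 * t + 339 / 4 * t\<^sup>2"
    proof -
      have "2321 / 8 - 3697 / 16 * t + 339 / 4 * t\<^sup>2 = 339 / 4 * (t - 3697 / 2712)\<^sup>2 + (2321 / 8 - 339 / 4 * (3697 / 2712)\<^sup>2)"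
        by (simp add: power2_eq_square field_simps)
      moreover have "0 \<le> 339 / 4 * (t - 3697 / 2712)\<^sup>2" by simp
      moreover have "0 \<le> 2321 / 8 - 339 / 4 * (3697 / 2712 :: real)\<^sup>2" by (simp add: power2_eq_square)
      ultimately show ?thesis by linarith
    qed
    then have "0 \<le> t * (2321 / 8 - 3697 / 16 * t + 339 / 4 * t\<^sup>2)" using t by (intro mult_nonneg_nonneg) auto
    moreover have "0 \<le> 6 * t ^ 4" by simp
    ultimately have "13 * ?u\<^sup>2 \<le> 3 * ((2 * x\<^sup>2 + 9 / 4 - 1) * (x + 1) * (2 * (9 / 4)\<^sup>2 + x - 1))" by linarith
    then show "?u\<^sup>2 * (1 + 9 / 4) \<le> (sqrt 3 / 2)\<^sup>2 * ((2 * x\<^sup>2 + 9 / 4 - 1) * (x + 1) * (2 * (9 / 4)\<^sup>2 + x - 1))"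
      by (simp add: power_divide)
  qed auto
  then have E: "pi / 6 \<le> angle_of (cosE (9 / 4) x)"
    using angle_of_ge[of "cosE (9 / 4) x" "sqrt 3 / 2"] s3 by (simp add: arccos_sqrt3) (smt (verit) real_sqrt_ge_zero)
  have "0 < pi" by simp
  then show ?thesis unfolding sumB_def using B C M E by linarith
qed

text \<open>The sign conditions say that at both ends the displacement points inwards. So a fixed
  point cannot sit at an end, where clamping could hide a nonzero displacement.\<close>

lemma clamp_fixed:
  assumes "clamp_to a b (x + c) = x" "a < b" "x = a \<Longrightarrow> 0 < c" "x = b \<Longrightarrow> c < 0"
  shows "c = 0 \<and> a < x \<and> x < b"
proof -
  have "x \<noteq> a"
  proof
    assume "x = a"
    then have "a < clamp_to a b (x + c)" using assms(2,3) by (simp add: clamp_to_def)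
    then show False using assms(1) \<open>x = a\<close> by simp
  qed
  moreover have "x \<noteq> b"
  proof
    assume "x = b"
    then have "clamp_to a b (x + c) < b" using assms(2,4) by (simp add: clamp_to_def)
    then show False using assms(1) \<open>x = b\<close> by simp
  qed
  ultimately show ?thesis using assms(1) unfolding clamp_to_def by linarith
qed

lemma clamp_range: "a \<le> b \<Longrightarrow> a \<le> clamp_to a b c \<and> clamp_to a b c \<le> b"
  by (simp add: clamp_to_def)

lemma angle_equations:
  assumes c: "0 < c" "c \<le> 2 * pi"
  obtains x y where "1 < x" "x < 3" "1 < y" "y < 9 / 4" "sumA x y = 2 * pi" "sumB x y = c"
proof -
  define S :: "(real \<times> real) set" where "S = {1..3} \<times> {1..9/4}"
  \<comment> \<open>Each coordinate moves by the defect of its own equation. The sums are 0 on the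
    lower sides and above 2 pi on the upper ones, so the motion points inwards all along the
    boundary, as in the Poincare-Miranda theorem.\<close>
  define h where "h = (\<lambda>(x, y). (clamp_to 1 3 (x + (2 * pi - sumA x y)), clamp_to 1 (9/4) (y + (c - sumB x y))))"
  have S: "compact S" "convex S" "S \<noteq> {}"
    unfolding S_def by (auto intro: compact_Times convex_Times)
  have pos: "0 < 2 * (snd p)\<^sup>2 + fst p - 1" "0 < 2 * snd p - 1" "0 < snd p + 1"
    "0 < 2 * (fst p)\<^sup>2 + snd p - 1" "0 < fst p + 1" if "p \<in> S" for p
    using that poly_pos[of "fst p" "snd p"] poly_pos[of "snd p" "fst p"] unfolding S_def by auto
  have nz: "2 * (snd p)\<^sup>2 + fst p - 1 \<noteq> 0" "2 * snd p - 1 \<noteq> 0" "snd p + 1 \<noteq> 0"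
    "2 * (fst p)\<^sup>2 + snd p - 1 \<noteq> 0" "fst p + 1 \<noteq> 0" if "p \<in> S" for p
    using pos[OF that] by auto
  have cont: "continuous_on S h"
  proof -
    have A: "continuous_on S (\<lambda>p. cosA (fst p) (snd p))"
      unfolding cosA_def using nz by (intro continuous_intros) auto
    have B: "continuous_on S (\<lambda>p. cosB (fst p) (snd p))"
      unfolding cosB_def using nz by (intro continuous_intros) auto
    have C: "continuous_on S (\<lambda>p. cosC (fst p) (snd p))"
      unfolding cosC_def using nz by (intro continuous_intros) auto
    have M: "continuous_on S (\<lambda>p. cosM (fst p) (snd p))" "continuous_on S (\<lambda>p. cosM (snd p) (fst p))"
      unfolding cosM_def using nz by (intro continuous_intros; auto)+
    have E: "continuous_on S (\<lambda>p. cosE (fst p) (snd p))" "continuous_on S (\<lambda>p. cosE (snd p) (fst p))"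
      unfolding cosE_def using nz by (intro continuous_intros; auto)+
    show ?thesis
      unfolding h_def split_beta sumA_def sumB_def clamp_to_def
      by (intro continuous_intros continuous_on_angle_of A B C M E)
  qed
  have im: "h ` S \<subseteq> S"
    using clamp_range[of 1 3] clamp_range[of 1 "9 / 4"] unfolding h_def S_def by auto
  obtain p where p: "p \<in> S" "h p = p"
    using brouwer[OF S(1,2,3) cont] im by blast
  obtain x y where xy: "p = (x, y)" by (cases p)
  have r: "1 \<le> x" "x \<le> 3" "1 \<le> y" "y \<le> 9/4" using p xy by (auto simp: S_def)
  have X: "clamp_to 1 3 (x + (2 * pi - sumA x y)) = x" and Y: "clamp_to 1 (9/4) (y + (c - sumB x y)) = y"
    using p xy by (auto simp: h_def)
  have "2 * pi - sumA x y = 0 \<and> 1 < x \<and> x < 3"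
    by (rule clamp_fixed[OF X]) (use sum_at_one(1)[OF r(3)] sumA_at_three[OF r(3,4)] in auto)
  moreover have "c - sumB x y = 0 \<and> 1 < y \<and> y < 9/4"
  proof (rule clamp_fixed[OF Y])
    show "y = 9/4 \<Longrightarrow> c - sumB x y < 0" using sumB_at_end[OF r(1,2)] c(2) by (simp only:)
  qed (use sum_at_one(2)[OF r(1)] c in auto)
  ultimately show ?thesis using that by auto
qed

section \<open>The truncated complex\<close>

definition cyl :: "real \<Rightarrow> complex \<Rightarrow> real^3" where
  "cyl h z = (\<chi> a. if a = 1 then h else if a = 2 then Re z else Im z)"

lemma cyl_nth: "cyl h z $ 1 = h" "cyl h z $ 2 = Re z" "cyl h z $ 3 = Im z"
  by (simp_all add: cyl_def)

lemma cyl_eq_iff: "cyl h z = cyl h' z' \<longleftrightarrow> h = h' \<and> z = z'"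
  by (auto simp: vec_eq_iff forall_3 cyl_nth complex_eq_iff)

lemma cyl_nths: "v = cyl (v $ 1) (Complex (v $ 2) (v $ 3))"
  by (simp add: vec_eq_iff forall_3 cyl_nth)

lemma continuous_on_cyl:
  assumes "continuous_on S h" "continuous_on S z"
  shows "continuous_on S (\<lambda>x. cyl (h x) (z x))"
  unfolding cyl_def
proof (rule continuous_on_vec_lambda)
  fix a :: 3
  consider "a = 1" | "a = 2" | "a = 3" using exhaust_3 by blast
  then show "continuous_on S (\<lambda>x. if a = 1 then h x else if a = 2 then Re (z x) else Im (z x))"
    by cases (auto intro!: continuous_intros assms)
qed

text \<open>Coordinates adapted to the edge {i, j}: \<open>s\<close> and \<open>u\<close> vanish on
  the edge and become the sector coordinates around it, while \<xi> gives the position along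
  it.\<close>

definition bary :: "4 \<Rightarrow> 4 \<Rightarrow> real \<Rightarrow> real \<Rightarrow> real \<Rightarrow> real^4" where
  "bary i j \<xi> s u = (\<chi> a. if a = i then \<xi> else if a = j then 1 - \<xi> - s - u else if a = third i j then s else u)"

lemma bary_nth:
  assumes "i \<noteq> j"
  shows "bary i j \<xi> s u $ i = \<xi>" "bary i j \<xi> s u $ j = 1 - \<xi> - s - u"
    "bary i j \<xi> s u $ third i j = s" "bary i j \<xi> s u $ third j i = u"
  using assms third_neq[OF assms] by (simp_all add: bary_def)

lemma trunc_tet_iff:
  "x \<in> trunc_tet \<longleftrightarrow> (\<forall>a. 0 \<le> x $ a \<and> x $ a \<le> 2 / 3) \<and> (\<Sum>a\<in>UNIV. x $ a) = 1"
  by (auto simp: trunc_tet_def tetrahedron_def)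

lemma bary_trunc:
  assumes "i \<noteq> j"
  shows "bary i j \<xi> s u \<in> trunc_tet \<longleftrightarrow>
    (\<forall>r\<in>{\<xi>, 1 - \<xi> - s - u, s, u}. 0 \<le> r \<and> r \<le> 2 / 3)"
  by (simp add: trunc_tet_iff all_third[OF assms] sum_third[OF assms] bary_nth[OF assms])

lemma eq_bary:
  assumes "i \<noteq> j" "(\<Sum>a\<in>UNIV. x $ a) = 1"
  shows "x = bary i j (x $ i) (x $ third i j) (x $ third j i)"
  using assms(2) by (simp add: vec_eq_iff all_third[OF assms(1)] bary_nth[OF assms(1)] sum_third[OF assms(1)])

lemma bary_eqI:
  assumes "i \<noteq> j" "x \<in> tetrahedron" "y \<in> tetrahedron" "x $ i = y $ i" "x $ third i j = y $ third i j"
    "x $ third j i = y $ third j i"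
  shows "x = y"
  using eq_bary[OF assms(1), of x] eq_bary[OF assms(1), of y] assms(2-) by (simp add: tetrahedron_def)

lemma trunc_subset: "trunc_tet \<subseteq> tetrahedron"
  by (auto simp: trunc_tet_def)

lemma trunc_nonneg: "x \<in> trunc_tet \<Longrightarrow> 0 \<le> x $ a" "x \<in> trunc_tet \<Longrightarrow> x $ a \<le> 2 / 3"
  by (auto simp: trunc_tet_iff)

lemma tetrahedron_compact: "compact tetrahedron"
proof -
  have e: "tetrahedron = (\<Inter>i. {x :: real^4. 0 \<le> x $ i}) \<inter> {x. (\<chi> i. 1) \<bullet> x = 1}"
    by (auto simp: tetrahedron_def inner_vec_def)
  have "closed tetrahedron"
    unfolding e by (intro closed_Int closed_INT ballI closed_hyperplane closed_Collect_le continuous_intros)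
  moreover have "bounded tetrahedron"
  proof (rule bounded_subset[of "cbox 0 (\<chi> i. 1)"])
    show "tetrahedron \<subseteq> cbox 0 (\<chi> i. 1)"
    proof
      fix x :: "real^4" assume x: "x \<in> tetrahedron"
      then have "x $ k \<le> (\<Sum>i\<in>UNIV. x $ i)" for k by (intro member_le_sum) (auto simp: tetrahedron_def)
      then show "x \<in> cbox 0 (\<chi> i. 1)" using x by (simp add: mem_box_cart tetrahedron_def)
    qed
  qed simp
  ultimately show ?thesis by (simp add: compact_eq_bounded_closed)
qed

lemma trunc_compact: "compact trunc_tet"
proof -
  have e: "trunc_tet = tetrahedron \<inter> (\<Inter>i. {x. x $ i \<le> 2 / 3})" by (auto simp: trunc_tet_def)
  show ?thesis
    unfolding e by (intro compact_Int_closed tetrahedron_compact closed_INT ballI closed_Collect_le continuous_intros)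
qed

lemma perm_all: "bij \<sigma> \<Longrightarrow> (\<And>i. y $ \<sigma> i = x $ i) \<Longrightarrow> (\<forall>a. P (y $ a)) \<longleftrightarrow> (\<forall>a. P (x $ a))"
  by (metis bij_pointE)

lemma perm_sum:
  fixes x y :: "real^4"
  assumes "bij \<sigma>" "\<And>i. y $ \<sigma> i = x $ i"
  shows "(\<Sum>a\<in>UNIV. y $ a) = (\<Sum>a\<in>UNIV. x $ a)"
  using sum.reindex_bij_betw[OF assms(1), of "\<lambda>a. y $ a"] assms(2) by simp

lemma perm_trunc:
  assumes "bij \<sigma>" "\<And>i. y $ \<sigma> i = x $ i"
  shows "y \<in> trunc_tet \<longleftrightarrow> x \<in> trunc_tet"
  using perm_all[OF assms, of "\<lambda>r. 0 \<le> r \<and> r \<le> 2/3"] perm_sum[OF assms] by (simp add: trunc_tet_iff)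

section \<open>Classes of glued points\<close>

context face_paired
begin

lemma point_stepD:
  assumes "point_step T g (t, x) (t', y)"
  obtains f where "t \<in> T" "x $ f = 0" "t' = nb t f" "t' \<in> T" "bij (gl t f)" "\<forall>a. y $ gl t f a = x $ a"
  using assms glueD(1,2) by (auto simp: point_step_def)

lemma point_step_sym:
  assumes "point_step T g p p'"
  shows "point_step T g p' p"
proof -
  obtain t x t' y where p: "p = (t, x)" "p' = (t', y)" by (cases p; cases p')
  obtain f where f: "t \<in> T" "x $ f = 0" "t' = nb t f" "t' \<in> T" "bij (gl t f)" "\<forall>a. y $ gl t f a = x $ a"
    using assms unfolding p by (rule point_stepD)
  have g: "g t' (gl t f f) = (t, inv (gl t f))" using glueD(4)[OF f(1)] f(3) by simp
  have "x $ inv (gl t f) i = y $ i" for i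
    using f(6)[rule_format, of "inv (gl t f) i"] gl_inv[OF f(1)] by simp
  then show ?thesis unfolding p point_step_def using f g by (auto intro!: exI[of _ "gl t f f"])
qed

lemma point_class_eq_iff:
  assumes "p \<in> T \<times> tetrahedron" "p' \<in> T \<times> tetrahedron"
  shows "point_class T g p = point_class T g p' \<longleftrightarrow> equivclp (point_step T g) p p'"
  unfolding point_class_def using eq_equiv_class_iff[OF equiv_glue_rel assms] assms
  by (simp add: glue_rel_def)

lemma saturatedI:
  assumes "X \<subseteq> T \<times> tetrahedron" "D \<subseteq> X"
    and "\<And>p p'. p \<in> D \<Longrightarrow> point_step T g p p' \<Longrightarrow> p' \<in> D"
  shows "saturated X (point_class T g) D"
  unfolding saturated_def
proof (intro ballI impI)
  fix p p' assume p: "p \<in> D" "p' \<in> X" "point_class T g p' = point_class T g p"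
  have "p' \<in> T \<times> tetrahedron" "p \<in> T \<times> tetrahedron" using p assms(1,2) by auto
  then have e: "equivclp (point_step T g) p p'"
    using p(3) point_class_eq_iff[of p p'] by simp
  show "p' \<in> D"
    by (rule equivclp_invariant[OF e, where P = "\<lambda>x. x \<in> D"]) (use p assms(3) point_step_sym in blast)+
qed

lemma class_invariant:
  assumes "X \<subseteq> T \<times> tetrahedron" "D \<subseteq> X"
    and st: "\<And>p p'. p \<in> D \<Longrightarrow> point_step T g p p' \<Longrightarrow> p' \<in> D \<and> F p' = F p"
    and p: "p \<in> D" "p' \<in> D" "point_class T g p = point_class T g p'"
  shows "F p = F p'"
proof -
  have "p' \<in> T \<times> tetrahedron" "p \<in> T \<times> tetrahedron" using p assms(1,2) by auto
  then have e: "equivclp (point_step T g) p p'"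
    using p(3) point_class_eq_iff[of p p'] by simp
  have "p' \<in> D \<and> F p' = F p"
  proof (rule equivclp_invariant[OF e, where P = "\<lambda>x. x \<in> D \<and> F x = F p"])
    show "b \<in> D \<and> F b = F p" if "a \<in> D \<and> F a = F p" "point_step T g a b" for a b
      using that st[of a b] by simp
    show "b \<in> D \<and> F b = F p" if "a \<in> D \<and> F a = F p" "point_step T g b a" for a b
      using that st[of a b] point_step_sym[of b a] by simp
  qed (use p in simp)
  then show ?thesis by simp
qed

end

section \<open>Fan charts\<close>

context triangulation
begin

abbreviation XS :: "(nat \<times> (real^4)) set" where "XS \<equiv> T \<times> trunc_tet"
abbreviation pc :: "nat \<times> (real^4) \<Rightarrow> (nat \<times> (real^4)) set" where "pc \<equiv> point_class T g"
abbreviation fz :: "real \<Rightarrow> nat \<times> 4 \<times> 4 \<Rightarrow> real^4 \<Rightarrow> complex" where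
  "fz \<alpha> F x \<equiv> complex_of_real (x $ third (fst (snd F)) (snd (snd F))) +
     complex_of_real (x $ third (snd (snd F)) (fst (snd F))) * cis \<alpha>"

lemma XS_compact: "compact XS"
  using finite_T trunc_compact by (simp add: compact_Times finite_imp_compact)

lemma XS_sub: "XS \<subseteq> T \<times> tetrahedron"
  using trunc_subset by auto

definition dom :: "(nat \<times> 4 \<times> 4) set \<Rightarrow> (nat \<times> 4 \<times> 4 \<Rightarrow> real^4 \<Rightarrow> bool) \<Rightarrow> (nat \<times> (real^4)) set" where
  "dom Fl P = {p \<in> XS. \<exists>F\<in>Fl. fst p = fst F \<and> P F (snd p)}"

text \<open>
  A fan chart unfolds the tetrahedra of the flags in \<open>Fl\<close>, which are consecutive around an edge,
  into sectors of angle \<open>\<alpha>\<close> starting at the angles \<open>\<theta>\<close>. The predicates \<open>P 0\<close>, \<open>P 1\<close>, \<open>P 2\<close>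
  cut out the sets \<open>D\<close>, \<open>K\<close>, \<open>U\<close> of a chart datum.
\<close>

definition fan :: "(nat \<times> 4 \<times> 4) set \<Rightarrow> (nat \<times> 4 \<times> 4 \<Rightarrow> real) \<Rightarrow> real \<Rightarrow>
    (nat \<Rightarrow> nat \<times> 4 \<times> 4 \<Rightarrow> real^4 \<Rightarrow> bool) \<Rightarrow> bool" where
  "fan Fl \<theta> \<alpha> P \<longleftrightarrow> Fl \<subseteq> flags \<and> 0 < \<alpha> \<and> \<alpha> < pi \<and>
     (\<forall>F\<in>Fl. \<forall>x\<in>trunc_tet. (P 0 F x \<longrightarrow> P 1 F x) \<and> (P 1 F x \<longrightarrow> P 2 F x)) \<and>
     (\<forall>F\<in>Fl. open {x. P 0 F x} \<and> closed {x. P 1 F x} \<and> open {x. P 2 F x}) \<and>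
     (\<forall>F\<in>Fl. \<forall>F'\<in>Fl. \<forall>x\<in>trunc_tet. fst F = fst F' \<longrightarrow> P 2 F x \<longrightarrow> P 2 F' x \<longrightarrow> F = F') \<and>
     (\<forall>l\<in>{0, 1, 2}. \<forall>t i j. (t, i, j) \<in> Fl \<longrightarrow> (\<forall>x\<in>trunc_tet. \<forall>y\<in>trunc_tet. \<forall>m.
        P l (t, i, j) x \<longrightarrow> x $ m = 0 \<longrightarrow> (\<forall>a. y $ gl t m a = x $ a) \<longrightarrow>
        (m = third i j \<and> nx (t, i, j) \<in> Fl \<and> P l (nx (t, i, j)) y \<and>
           cis (\<theta> (nx (t, i, j))) = cis (\<theta> (t, i, j)) * cis \<alpha>) \<or>
        (m = third j i \<and> pv (t, i, j) \<in> Fl \<and> P l (pv (t, i, j)) y \<and>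
           cis (\<theta> (t, i, j)) = cis (\<theta> (pv (t, i, j))) * cis \<alpha>))) \<and>
     (\<forall>F\<in>Fl. \<forall>F'\<in>Fl. \<forall>x\<in>trunc_tet. \<forall>x'\<in>trunc_tet. P 2 F x \<longrightarrow> P 2 F' x' \<longrightarrow>
        x $ fst (snd F) = x' $ fst (snd F') \<longrightarrow> cis (\<theta> F) * fz \<alpha> F x = cis (\<theta> F') * fz \<alpha> F' x' \<longrightarrow>
        equivclp (point_step T g) (fst F, x) (fst F', x'))"

text \<open>The choice is harmless: a point satisfies \<open>P 2\<close> for at most one flag of
  \<open>Fl\<close> in its tetrahedron.\<close>

definition fan_map :: "(nat \<times> 4 \<times> 4) set \<Rightarrow> (nat \<times> 4 \<times> 4 \<Rightarrow> real) \<Rightarrow> real \<Rightarrow>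
    (nat \<Rightarrow> nat \<times> 4 \<times> 4 \<Rightarrow> real^4 \<Rightarrow> bool) \<Rightarrow> nat \<times> (real^4) \<Rightarrow> real^3" where
  "fan_map Fl \<theta> \<alpha> P = (\<lambda>(t, x). let F = (SOME F. F \<in> Fl \<and> fst F = t \<and> P 2 F x) in
     cyl (2 / 3 - x $ fst (snd F)) (cis (\<theta> F) * fz \<alpha> F x))"

lemma fan_map_eq:
  assumes fan: "fan Fl \<theta> \<alpha> P" and F: "F \<in> Fl" "x \<in> trunc_tet" "P 2 F x"
  shows "fan_map Fl \<theta> \<alpha> P (fst F, x) = cyl (2 / 3 - x $ fst (snd F)) (cis (\<theta> F) * fz \<alpha> F x)"
proof -
  have u: "\<forall>F\<in>Fl. \<forall>F'\<in>Fl. \<forall>x\<in>trunc_tet. fst F = fst F' \<longrightarrow> P 2 F x \<longrightarrow> P 2 F' x \<longrightarrow> F = F'"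
    using fan unfolding fan_def by (elim conjE)
  have "(SOME F'. F' \<in> Fl \<and> fst F' = fst F \<and> P 2 F' x) = F"
  proof (rule some_equality)
    show "F \<in> Fl \<and> fst F = fst F \<and> P 2 F x" using F by simp
    fix F' assume F': "F' \<in> Fl \<and> fst F' = fst F \<and> P 2 F' x"
    from u[rule_format, of F' F x] show "F' = F" using F F' by simp
  qed
  then show ?thesis unfolding fan_map_def prod.case Let_def by simp
qed

lemma fan_imp:
  assumes "fan Fl \<theta> \<alpha> P" "F \<in> Fl" "x \<in> trunc_tet"
  shows "P 0 F x \<Longrightarrow> P 1 F x" "P 1 F x \<Longrightarrow> P 2 F x"
  using assms unfolding fan_def by blast+

text \<open>Crossing to the next flag turns the sector by \<alpha>, and the coordinate along the
  closing ray becomes the one along the opening ray; the oddness of the gluing is what matches these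
  coordinates. Hence the chart agrees on glued points.\<close>

lemma fan_step:
  assumes fan: "fan Fl \<theta> \<alpha> P" and l: "l \<in> {0, 1, 2}" and p: "p \<in> dom Fl (P l)"
    and st: "point_step T g p p'"
  shows "p' \<in> dom Fl (P l) \<and> fan_map Fl \<theta> \<alpha> P p' = fan_map Fl \<theta> \<alpha> P p"
proof -
  obtain t x where px: "p = (t, x)" by (cases p)
  obtain t' y where py: "p' = (t', y)" by (cases p')
  obtain i j where F: "(t, i, j) \<in> Fl" "P l (t, i, j) x" and x: "x \<in> trunc_tet" "t \<in> T"
    using p unfolding dom_def px by auto
  have ij: "i \<noteq> j" using F fan by (auto simp: fan_def flags_def)
  obtain m where tT: "t \<in> T" and m: "x $ m = 0" "t' = nb t m" "t' \<in> T" "bij (gl t m)" "\<forall>a. y $ gl t m a = x $ a"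
    using st unfolding px py by (rule point_stepD)
  have y: "y \<in> trunc_tet" using perm_trunc[OF m(4) m(5)[rule_format]] x by simp
  have P2: "P 2 F z" if "F \<in> Fl" "z \<in> trunc_tet" "P l F z" for F z
    using that fan_imp[OF fan that(1,2)] l by auto
  have x2: "fan_map Fl \<theta> \<alpha> P p = cyl (2 / 3 - x $ i) (cis (\<theta> (t, i, j)) * fz \<alpha> (t, i, j) x)"
    using fan_map_eq[OF fan F(1) x(1) P2[OF F(1) x(1) F(2)]] by (simp add: px)
  have steps: "\<forall>l\<in>{0, 1, 2}. \<forall>t i j. (t, i, j) \<in> Fl \<longrightarrow> (\<forall>x\<in>trunc_tet. \<forall>y\<in>trunc_tet. \<forall>m.
        P l (t, i, j) x \<longrightarrow> x $ m = 0 \<longrightarrow> (\<forall>a. y $ gl t m a = x $ a) \<longrightarrow>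
        (m = third i j \<and> nx (t, i, j) \<in> Fl \<and> P l (nx (t, i, j)) y \<and>
           cis (\<theta> (nx (t, i, j))) = cis (\<theta> (t, i, j)) * cis \<alpha>) \<or>
        (m = third j i \<and> pv (t, i, j) \<in> Fl \<and> P l (pv (t, i, j)) y \<and>
           cis (\<theta> (t, i, j)) = cis (\<theta> (pv (t, i, j))) * cis \<alpha>))"
    using fan unfolding fan_def by (elim conjE)
  have "(m = third i j \<and> nx (t, i, j) \<in> Fl \<and> P l (nx (t, i, j)) y \<and>
           cis (\<theta> (nx (t, i, j))) = cis (\<theta> (t, i, j)) * cis \<alpha>) \<or>
        (m = third j i \<and> pv (t, i, j) \<in> Fl \<and> P l (pv (t, i, j)) y \<and>
           cis (\<theta> (t, i, j)) = cis (\<theta> (pv (t, i, j))) * cis \<alpha>)"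
    using steps[rule_format, OF l F(1) x(1) y F(2) m(1) m(5)[rule_format]] .
  then show ?thesis
  proof
    assume c: "m = third i j \<and> nx (t, i, j) \<in> Fl \<and> P l (nx (t, i, j)) y \<and>
           cis (\<theta> (nx (t, i, j))) = cis (\<theta> (t, i, j)) * cis \<alpha>"
    then have N: "nx (t, i, j) = (t', gl t m i, gl t m j)" using m(2) by (simp add: nx_def)
    have "p' \<in> dom Fl (P l)"
      unfolding dom_def py using c N y m(3) by (auto intro!: bexI[of _ "nx (t, i, j)"])
    moreover have "fan_map Fl \<theta> \<alpha> P p' = cyl (2 / 3 - y $ gl t m i) (cis (\<theta> (nx (t, i, j))) * fz \<alpha> (nx (t, i, j)) y)"
      using fan_map_eq[OF fan _ y P2[OF _ y]] c N py by (metis fst_conv snd_conv)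
    moreover have "fz \<alpha> (nx (t, i, j)) y = complex_of_real (x $ third j i)"
      unfolding N using odd_gl[OF x(2) ij, of m] odd_gl[OF x(2) ij[symmetric], of m] m(1,5) c by simp
    moreover have "fz \<alpha> (t, i, j) x = complex_of_real (x $ third j i) * cis \<alpha>" using m(1) c by simp
    ultimately show ?thesis using x2 c m(5) by (simp add: mult_ac)
  next
    assume c: "m = third j i \<and> pv (t, i, j) \<in> Fl \<and> P l (pv (t, i, j)) y \<and>
           cis (\<theta> (t, i, j)) = cis (\<theta> (pv (t, i, j))) * cis \<alpha>"
    then have N: "pv (t, i, j) = (t', gl t m i, gl t m j)" using m(2) by (simp add: pv_def)
    have "p' \<in> dom Fl (P l)"
      unfolding dom_def py using c N y m(3) by (auto intro!: bexI[of _ "pv (t, i, j)"])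
    moreover have "fan_map Fl \<theta> \<alpha> P p' = cyl (2 / 3 - y $ gl t m i) (cis (\<theta> (pv (t, i, j))) * fz \<alpha> (pv (t, i, j)) y)"
      using fan_map_eq[OF fan _ y P2[OF _ y]] c N py by (metis fst_conv snd_conv)
    moreover have "fz \<alpha> (pv (t, i, j)) y = complex_of_real (x $ third i j) * cis \<alpha>"
      unfolding N using odd_gl[OF x(2) ij, of m] odd_gl[OF x(2) ij[symmetric], of m] m(1,5) c by simp
    moreover have "fz \<alpha> (t, i, j) x = complex_of_real (x $ third i j)" using m(1) c by simp
    ultimately show ?thesis using x2 c m(5) by (simp add: mult_ac)
  qed
qed

lemma openin_dom:
  assumes "finite Fl" "\<And>F. F \<in> Fl \<Longrightarrow> open {x. P F x}"
  shows "openin (top_of_set XS) (dom Fl P)"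
proof -
  have "dom Fl P = XS \<inter> (\<Union>F\<in>Fl. {fst F} \<times> {x. P F x})" by (intro set_eqI) (simp add: dom_def mem_Times_iff)
  moreover have "open (\<Union>F\<in>Fl. {fst F} \<times> {x. P F x})"
    using assms by (intro open_UN ballI open_Times open_discrete) auto
  ultimately show ?thesis by (simp add: openin_open_Int)
qed

lemma closedin_dom:
  assumes "finite Fl" "\<And>F. F \<in> Fl \<Longrightarrow> closed {x. P F x}"
  shows "closedin (top_of_set XS) (dom Fl P)"
proof -
  have "dom Fl P = XS \<inter> (\<Union>F\<in>Fl. {fst F} \<times> {x. P F x})" by (intro set_eqI) (simp add: dom_def mem_Times_iff)
  moreover have "closed (\<Union>F\<in>Fl. {fst F} \<times> {x. P F x})"
    using assms by (intro closed_UN ballI closed_Times) auto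
  ultimately show ?thesis by (simp add: closedin_closed_Int)
qed

lemma dom_mono:
  assumes "\<And>F x. F \<in> Fl \<Longrightarrow> x \<in> trunc_tet \<Longrightarrow> P F x \<Longrightarrow> Q F x"
  shows "dom Fl P \<subseteq> dom Fl Q"
  using assms unfolding dom_def by fastforce

lemma fan_local:
  assumes fan: "fan Fl \<theta> \<alpha> P" and p: "(t, x) \<in> dom Fl (P 2)"
  obtains F where "F \<in> Fl" "fst F = t" "open {y. P 2 F y}" "P 2 F x"
    "\<And>y. y \<in> trunc_tet \<Longrightarrow> P 2 F y \<Longrightarrow> (t, y) \<in> dom Fl (P 2) \<and>
      fan_map Fl \<theta> \<alpha> P (t, y) = cyl (2 / 3 - y $ fst (snd F)) (cis (\<theta> F) * fz \<alpha> F y)"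
proof -
  obtain F where F: "F \<in> Fl" "fst F = t" "P 2 F x" "x \<in> trunc_tet" "t \<in> T" using p by (auto simp: dom_def)
  have "open {y. P 2 F y}" using fan F(1) unfolding fan_def by blast
  moreover have "(t, y) \<in> dom Fl (P 2) \<and>
      fan_map Fl \<theta> \<alpha> P (t, y) = cyl (2 / 3 - y $ fst (snd F)) (cis (\<theta> F) * fz \<alpha> F y)"
    if y: "y \<in> trunc_tet" "P 2 F y" for y
    using fan_map_eq[OF fan F(1) y] y F by (auto simp: dom_def)
  ultimately show ?thesis using that F by blast
qed

text \<open>Invariance under single gluing steps gives saturation and one half of the fibre
  condition; the last clause of \<open>fan\<close> gives the other half. Continuity is local, since
  near each point a single flag describes the map by an affine formula.\<close>

lemma fan_chart:
  assumes fan: "fan Fl \<theta> \<alpha> P"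
  shows "chart_datum XS pc (dom Fl (P 0)) (dom Fl (P 1)) (dom Fl (P 2)) (fan_map Fl \<theta> \<alpha> P)"
proof -
  have fin: "finite Fl" using fan finite_flags unfolding fan_def by (meson finite_subset)
  have oc: "\<And>F. F \<in> Fl \<Longrightarrow> open {x. P 0 F x}" "\<And>F. F \<in> Fl \<Longrightarrow> closed {x. P 1 F x}"
    "\<And>F. F \<in> Fl \<Longrightarrow> open {x. P 2 F x}" using fan unfolding fan_def by blast+
  have sub: "dom Fl Q \<subseteq> XS" for Q by (auto simp: dom_def)
  have sat: "saturated XS pc (dom Fl (P l))" if "l \<in> {0, 1, 2}" for l
    using XS_sub sub fan_step[OF fan that] by (intro saturatedI) auto
  have cont: "continuous_on (dom Fl (P 2)) (fan_map Fl \<theta> \<alpha> P)"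
  proof (rule continuous_on_local)
    fix p assume p: "p \<in> dom Fl (P 2)"
    obtain t x where tx: "p = (t, x)" by (cases p)
    obtain F where F: "F \<in> Fl" "fst F = t" "open {y. P 2 F y}" "P 2 F x"
      "\<And>y. y \<in> trunc_tet \<Longrightarrow> P 2 F y \<Longrightarrow> (t, y) \<in> dom Fl (P 2) \<and>
        fan_map Fl \<theta> \<alpha> P (t, y) = cyl (2 / 3 - y $ fst (snd F)) (cis (\<theta> F) * fz \<alpha> F y)"
      using fan_local[OF fan p[unfolded tx]] by blast
    let ?W = "{t} \<times> {y. P 2 F y}"
    have "continuous_on (dom Fl (P 2) \<inter> ?W) (\<lambda>p. cyl (2 / 3 - snd p $ fst (snd F)) (cis (\<theta> F) * fz \<alpha> F (snd p)))"
      by (intro continuous_on_cyl continuous_intros)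
    then have "continuous_on (dom Fl (P 2) \<inter> ?W) (fan_map Fl \<theta> \<alpha> P)"
    proof (rule continuous_on_eq)
      fix r assume r: "r \<in> dom Fl (P 2) \<inter> ?W"
      then obtain y where "r = (t, y)" "P 2 F y" "y \<in> trunc_tet" by (auto simp: dom_def)
      then show "cyl (2 / 3 - snd r $ fst (snd F)) (cis (\<theta> F) * fz \<alpha> F (snd r)) = fan_map Fl \<theta> \<alpha> P r"
        using F(5)[of y] by simp
    qed
    moreover have "open ?W" using F(3) by (intro open_Times open_discrete)
    ultimately show "\<exists>W. open W \<and> p \<in> W \<and> continuous_on (dom Fl (P 2) \<inter> W) (fan_map Fl \<theta> \<alpha> P)"
      using F(4) tx by (intro exI[of _ ?W]) auto
  qed
  have iff: "fan_map Fl \<theta> \<alpha> P p = fan_map Fl \<theta> \<alpha> P p' \<longleftrightarrow> pc p = pc p'"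
    if p: "p \<in> dom Fl (P 2)" "p' \<in> dom Fl (P 2)" for p p'
  proof
    assume "pc p = pc p'"
    then show "fan_map Fl \<theta> \<alpha> P p = fan_map Fl \<theta> \<alpha> P p'"
    proof (rule class_invariant[OF XS_sub sub _ p, rotated])
      show "b \<in> dom Fl (P 2) \<and> fan_map Fl \<theta> \<alpha> P b = fan_map Fl \<theta> \<alpha> P a"
        if "a \<in> dom Fl (P 2)" "point_step T g a b" for a b
        using fan_step[OF fan _ that(1,2)] by simp
    qed
  next
    assume e: "fan_map Fl \<theta> \<alpha> P p = fan_map Fl \<theta> \<alpha> P p'"
    obtain t x t' x' where tx: "p = (t, x)" "p' = (t', x')" by (cases p; cases p')
    obtain F where F: "F \<in> Fl" "fst F = t" "P 2 F x" "x \<in> trunc_tet" "t \<in> T" using p by (auto simp: dom_def tx)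
    obtain F' where F': "F' \<in> Fl" "fst F' = t'" "P 2 F' x'" "x' \<in> trunc_tet" "t' \<in> T" using p by (auto simp: dom_def tx)
    have "x $ fst (snd F) = x' $ fst (snd F')" "cis (\<theta> F) * fz \<alpha> F x = cis (\<theta> F') * fz \<alpha> F' x'"
      using e fan_map_eq[OF fan F(1,4,3)] fan_map_eq[OF fan F'(1,4,3)] by (simp_all add: cyl_eq_iff tx F(2) F'(2))
    then have "equivclp (point_step T g) (fst F, x) (fst F', x')"
      using fan F F' unfolding fan_def by blast
    then show "pc p = pc p'"
      using F F' XS_sub by (subst point_class_eq_iff) (auto simp: tx)
  qed
  have "dom Fl (P 0) \<subseteq> dom Fl (P 1)" "dom Fl (P 1) \<subseteq> dom Fl (P 2)"
    using fan_imp[OF fan] by (auto intro!: dom_mono)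
  then show ?thesis
    unfolding chart_datum_def
    using XS_compact sub openin_dom[OF fin oc(1)] closedin_dom[OF fin oc(2)] openin_dom[OF fin oc(3)]
      sat[of 0] sat[of 1] sat[of 2] cont iff by auto
qed

text \<open>Three coordinates are matched by hypothesis; the one at \<open>j'\<close> is forced by
  the sum 1.\<close>

lemma step_nxI:
  assumes F: "(t, i, j) \<in> flags" and x: "x \<in> tetrahedron" "x $ third i j = 0"
    and N: "nx (t, i, j) = (t', i', j')" and y: "y \<in> tetrahedron"
    and e: "y $ i' = x $ i" "y $ third i' j' = x $ third j i" "y $ third j' i' = 0"
  shows "point_step T g (t, x) (t', y)"
proof -
  have ij: "i \<noteq> j" "t \<in> T" using F by (auto simp: flags_def)
  let ?m = "third i j"
  have n: "t' = nb t ?m" "i' = gl t ?m i" "j' = gl t ?m j" using N by (auto simp: nx_def)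
  have ij': "i' \<noteq> j'" using ij n gl_eq_iff by auto
  have th: "third i' j' = gl t ?m (third j i)" "third j' i' = gl t ?m (third i j)"
    using odd_gl[OF ij(2,1)] odd_gl[OF ij(2) ij(1)[symmetric]] n by auto
  have "y $ j' = x $ j"
    using x y e sum_third[OF ij(1), of "\<lambda>a. x $ a"] sum_third[OF ij', of "\<lambda>a. y $ a"]
    by (simp add: tetrahedron_def)
  then have "\<forall>a. y $ gl t ?m a = x $ a"
    unfolding all_third[OF ij(1)] using e x th n by simp
  then show ?thesis using n ij x unfolding point_step_def by auto
qed

end

section \<open>Hyper-ideal tetrahedra with given edge lengths\<close>

definition lor :: "(real^3) \<times> real \<Rightarrow> (real^3) \<times> real \<Rightarrow> real" where
  "lor p q = fst p \<bullet> fst q - snd p * snd q"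

lemma lor_bilinear:
  "lor (p + p') q = lor p q + lor p' q" "lor q (p + p') = lor q p + lor q p'"
  "lor (c *\<^sub>R p) q = c * lor p q" "lor q (c *\<^sub>R p) = c * lor q p" "lor q (p - p') = lor q p - lor q p'"
  by (simp_all add: lor_def inner_add_left inner_add_right inner_diff_right algebra_simps)

lemma lor_sym: "lor p q = lor q p"
  by (simp add: lor_def inner_commute mult.commute)

lemma lor_sum_right: "finite A \<Longrightarrow> lor q (\<Sum>i\<in>A. c i *\<^sub>R f i) = (\<Sum>i\<in>A. c i * lor q (f i))"
proof (induction A rule: finite_induct)
  case empty
  then show ?case by (simp add: lor_def)
qed (simp add: lor_bilinear)

definition lvec :: "real \<Rightarrow> real \<Rightarrow> real \<Rightarrow> real \<Rightarrow> (real^3) \<times> real" where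
  "lvec a b c d = (vector [a, b, c], d)"

lemma lor_lvec: "lor (lvec a b c d) (lvec a' b' c' d') = a * a' + b * b' + c * c' - d * d'"
  by (simp add: lor_def lvec_def inner_vec_def sum_3)

lemma lvec_cases: "X = lvec (fst X $ 1) (fst X $ 2) (fst X $ 3) (snd X)"
  by (simp add: lvec_def prod_eq_iff vec_eq_iff forall_3)

lemma lvec_comb: "a *\<^sub>R lvec p q r s + b *\<^sub>R lvec p' q' r' s' = lvec (a * p + b * p') (a * q + b * q') (a * r + b * r') (a * s + b * s')"
  by (simp add: lvec_def vec_eq_iff forall_3)

lemma lvec_add: "lvec p q r s + lvec p' q' r' s' = lvec (p + p') (q + q') (r + r') (s + s')"
  by (simp add: lvec_def vec_eq_iff forall_3)

text \<open>
  The first two vectors span the hyperbolic line of the first edge; the two others are found by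
  splitting them into their parts along this line and orthogonal to it. The hypothesis says that
  the angle between the orthogonal parts exists.
\<close>

lemma gram_realization:
  fixes p q r s t u :: real
  assumes gt: "1 < p" "1 < q" "1 < r" "1 < s" "1 < t" "1 < u"
    and angle: "(q * r + s * t + p * (q * t + r * s) + u * (1 - p\<^sup>2))\<^sup>2 <
      (2 * p * q * s + p\<^sup>2 + q\<^sup>2 + s\<^sup>2 - 1) * (2 * p * r * t + p\<^sup>2 + r\<^sup>2 + t\<^sup>2 - 1)"
  obtains V1 V2 V3 V4 where
    "lor V1 V1 = 1" "lor V2 V2 = 1" "lor V3 V3 = 1" "lor V4 V4 = 1"
    "lor V1 V2 = - p" "lor V1 V3 = - q" "lor V1 V4 = - r" "lor V2 V3 = - s" "lor V2 V4 = - t" "lor V3 V4 = - u"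
    "0 < snd V1" "0 < snd V2" "0 < snd V3" "0 < snd V4"
    "\<And>X. \<exists>a b c d. X = a *\<^sub>R V1 + b *\<^sub>R V2 + c *\<^sub>R V3 + d *\<^sub>R V4"
proof -
  define N where "N = q * r + s * t + p * (q * t + r * s) + u * (1 - p\<^sup>2)"
  define D where "D = 2 * p * q * s + p\<^sup>2 + q\<^sup>2 + s\<^sup>2 - 1"
  define D' where "D' = 2 * p * r * t + p\<^sup>2 + r\<^sup>2 + t\<^sup>2 - 1"
  define m where "m = p\<^sup>2 - 1"
  have m: "0 < m" using gt by (simp add: m_def)
  have Dp: "0 < D" "0 < D'"
    using gt by (auto simp: D_def D'_def intro!: add_pos_pos) (smt (verit) mult_pos_pos one_less_power pos2 zero_less_power)+
  have ND: "N\<^sup>2 < D * D'" using angle by (simp add: N_def D_def D'_def)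
  \<comment> \<open>C and S are cosh and sinh of half the length of the first edge, whose two
    vertices become the vectors (0, 0, C, S) and (0, 0, -C, S).\<close>
  define C where "C = sqrt ((p + 1) / 2)"
  define S where "S = sqrt ((p - 1) / 2)"
  have CS: "C\<^sup>2 = (p + 1) / 2" "S\<^sup>2 = (p - 1) / 2" "0 < C" "0 < S" using gt by (auto simp: C_def S_def)
  have cs4: "4 * C\<^sup>2 * S\<^sup>2 = m" unfolding CS m_def by (simp add: power2_eq_square field_simps)
  define tk where "tk = (q + s) / (2 * S)"
  define zk where "zk = (s - q) / (2 * C)"
  define tl where "tl = (r + t) / (2 * S)"
  define zl where "zl = (t - r) / (2 * C)"
  have tS: "tk * S = (q + s) / 2" "tl * S = (r + t) / 2" "zk * C = (s - q) / 2" "zl * C = (t - r) / 2"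
    using CS by (simp_all add: tk_def tl_def zk_def zl_def)
  \<comment> \<open>Multiplied by m = 4 C^2 S^2, the products of the coordinates along the line
    reduce to the known products with S and C, free of square roots.\<close>
  have prod: "(a * b - c * d) * m = 4 * ((a * S) * (b * S) * C\<^sup>2 - (c * C) * (d * C) * S\<^sup>2)" for a b c d
    unfolding cs4[symmetric] by (simp add: power2_eq_square algebra_simps)
  have e1: "(tk * tk - zk * zk) * m = q\<^sup>2 + s\<^sup>2 + 2 * p * q * s"
    unfolding prod tS CS by (simp add: power2_eq_square field_simps)
  have e2: "(tl * tl - zl * zl) * m = r\<^sup>2 + t\<^sup>2 + 2 * p * r * t"
    unfolding prod tS CS by (simp add: power2_eq_square field_simps)
  have e3: "(tk * tl - zk * zl) * m = q * r + s * t + p * (q * t + r * s)"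
    unfolding prod tS CS by (simp add: power2_eq_square field_simps)
  define rk where "rk = sqrt (D / m)"
  have rk: "rk\<^sup>2 = D / m" "0 < rk" using Dp m by (auto simp: rk_def)
  have rk2: "rk\<^sup>2 = 1 - zk * zk + tk * tk"
  proof -
    have "D = (1 - zk * zk + tk * tk) * m" using e1 by (simp add: D_def m_def algebra_simps)
    then have "D / m = 1 - zk * zk + tk * tk" using m by simp
    then show ?thesis using rk(1) by simp
  qed
  \<comment> \<open>The orthogonal parts of the last two vectors are (rk, 0) and (a, b). Their
    product fixes a, and the norm leaves b^2 = D'/m - a^2, which is positive by the hypothesis on
    the angle.\<close>
  define a where "a = N / m / rk"
  have a2: "a\<^sup>2 = N\<^sup>2 / (m * D)"
  proof -
    have "a\<^sup>2 = N\<^sup>2 / m\<^sup>2 / rk\<^sup>2" by (simp add: a_def power_divide power_mult_distrib)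
    then show ?thesis unfolding rk(1) using m Dp by (simp add: power2_eq_square)
  qed
  have "a\<^sup>2 < D' / m"
    unfolding a2 using ND m Dp by (simp add: divide_less_eq) (simp add: field_simps)
  define b where "b = sqrt (D' / m - a\<^sup>2)"
  have b: "b\<^sup>2 = D' / m - a\<^sup>2" "0 < b" using \<open>a\<^sup>2 < D' / m\<close> by (auto simp: b_def)
  have ab: "a\<^sup>2 + b\<^sup>2 = 1 - zl * zl + tl * tl"
  proof -
    have "D' = (1 - zl * zl + tl * tl) * m" using e2 by (simp add: D'_def m_def algebra_simps)
    then have "D' / m = 1 - zl * zl + tl * tl" using m by simp
    then show ?thesis using b(1) by simp
  qed
  have ra: "rk * a = - u - zk * zl + tk * tl"
  proof -
    have "N = (- u - zk * zl + tk * tl) * m" using e3 by (simp add: N_def m_def algebra_simps)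
    then show ?thesis using rk m by (simp add: a_def)
  qed
  let ?V1 = "lvec 0 0 C S" and ?V2 = "lvec 0 0 (- C) S" and ?V3 = "lvec rk 0 zk tk" and ?V4 = "lvec a b zl tl"
  show ?thesis
  proof (rule that[of ?V1 ?V2 ?V3 ?V4])
    show "lor ?V1 ?V1 = 1" "lor ?V2 ?V2 = 1" "lor ?V1 ?V2 = - p"
      using CS by (simp_all add: lor_lvec power2_eq_square[symmetric] field_simps)
    show "lor ?V3 ?V3 = 1" using rk2 by (simp add: lor_lvec power2_eq_square)
    show "lor ?V4 ?V4 = 1" using ab by (simp add: lor_lvec power2_eq_square)
    show "lor ?V3 ?V4 = - u" using ra by (simp add: lor_lvec)
    show "lor ?V1 ?V3 = - q" "lor ?V2 ?V3 = - s" "lor ?V1 ?V4 = - r" "lor ?V2 ?V4 = - t"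
    proof -
      have c: "C * zk = (s - q) / 2" "C * zl = (t - r) / 2" "S * tk = (q + s) / 2" "S * tl = (r + t) / 2"
        using tS by (simp_all only: mult.commute)
      show "lor ?V1 ?V3 = - q" "lor ?V2 ?V3 = - s" "lor ?V1 ?V4 = - r" "lor ?V2 ?V4 = - t"
        unfolding lor_lvec minus_mult_left[symmetric] c by (simp_all add: field_simps)
    qed
    show "0 < snd ?V1" "0 < snd ?V2" "0 < snd ?V3" "0 < snd ?V4"
      using CS gt by (simp_all add: lvec_def tk_def tl_def)
    fix X :: "(real^3) \<times> real"
    define d where "d = fst X $ 2 / b"
    define c where "c = (fst X $ 1 - d * a) / rk"
    define Z where "Z = (fst X $ 3 - c * zk - d * zl) / C"
    define T where "T = (snd X - c * tk - d * tl) / S"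
    have "X = ((T + Z) / 2) *\<^sub>R ?V1 + ((T - Z) / 2) *\<^sub>R ?V2 + (c *\<^sub>R ?V3 + d *\<^sub>R ?V4)"
    proof -
      have Z: "Z * C = fst X $ 3 - c * zk - d * zl" and T: "T * S = snd X - c * tk - d * tl"
        using CS by (simp_all add: Z_def T_def)
      have "d * b = fst X $ 2" "c * rk + d * a = fst X $ 1" using b rk by (simp_all add: d_def c_def)
      moreover have "(T + Z) / 2 * C + (T - Z) / 2 * - C = Z * C" by (simp add: field_simps)
      moreover have "(T + Z) / 2 * S + (T - Z) / 2 * S = T * S" by (simp add: field_simps)
      ultimately show ?thesis
        unfolding lvec_comb lvec_add using Z T by (subst (1) lvec_cases) simp
    qed
    then show "\<exists>a b c d. X = a *\<^sub>R ?V1 + b *\<^sub>R ?V2 + c *\<^sub>R ?V3 + d *\<^sub>R ?V4"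
      by (metis add.assoc)
  qed
qed

section \<open>Gram determinants and cofactors\<close>

definition num4 :: "(4 \<Rightarrow> 4 \<Rightarrow> real) \<Rightarrow> 4 \<Rightarrow> 4 \<Rightarrow> 4 \<Rightarrow> 4 \<Rightarrow> real" where
  "num4 x i j k l = x i k * x i l + x j k * x j l + x i j * (x i k * x j l + x i l * x j k) + x k l * (1 - (x i j)\<^sup>2)"

text \<open>For the Gram matrix with diagonal 1 and entries - x_ij, \<open>tri3\<close> is minus a
  principal 3 by 3 minor and \<open>num4 x i j k l\<close> is the cofactor at (k, l).\<close>

definition tri3 :: "(4 \<Rightarrow> 4 \<Rightarrow> real) \<Rightarrow> 4 \<Rightarrow> 4 \<Rightarrow> 4 \<Rightarrow> real" where
  "tri3 x i j k = 2 * x i j * x i k * x j k + (x i j)\<^sup>2 + (x i k)\<^sup>2 + (x j k)\<^sup>2 - 1"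

text \<open>This is the function phi for e_1 = {i, j}, with e_2 and e_3 the other edges at
  \<open>i\<close> and e_4 the opposite edge.\<close>

definition edge_cos :: "(4 \<Rightarrow> 4 \<Rightarrow> real) \<Rightarrow> 4 \<Rightarrow> 4 \<Rightarrow> real" where
  "edge_cos x i j = num4 x i j (third i j) (third j i) /
     (sqrt (tri3 x i j (third i j)) * sqrt (tri3 x i j (third j i)))"

definition gram_det :: "real \<Rightarrow> real \<Rightarrow> real \<Rightarrow> real \<Rightarrow> real \<Rightarrow> real \<Rightarrow> real" where
  "gram_det p q r s t u = 1 - (p\<^sup>2 + q\<^sup>2 + r\<^sup>2 + s\<^sup>2 + t\<^sup>2 + u\<^sup>2) - 2 * (p * q * s + p * r * t + q * r * u + s * t * u)
     + (p * u)\<^sup>2 + (q * t)\<^sup>2 + (r * s)\<^sup>2 - 2 * (p * u * q * t + p * u * r * s + q * t * r * s)"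

text \<open>Jacobi's identity: a 2 by 2 minor of the adjugate is the determinant times the
  complementary minor, here 1 - p^2. It ties the existence of the angle at one edge to the sign of
  the determinant.\<close>

lemma gram_det_jacobi:
  "(2 * p * q * s + p\<^sup>2 + q\<^sup>2 + s\<^sup>2 - 1) * (2 * p * r * t + p\<^sup>2 + r\<^sup>2 + t\<^sup>2 - 1) -
   (q * r + s * t + p * (q * t + r * s) + u * (1 - p\<^sup>2))\<^sup>2 = gram_det p q r s t u * (1 - p\<^sup>2)"
proof -
  let ?n = "q * r + s * t + p * (q * t + r * s)"
  let ?A = "1 - (p\<^sup>2 + q\<^sup>2 + r\<^sup>2 + s\<^sup>2 + t\<^sup>2) - 2 * (p * q * s + p * r * t) + (q * t - r * s)\<^sup>2"
  let ?a = "q\<^sup>2 + s\<^sup>2 + 2 * p * q * s" and ?b = "r\<^sup>2 + t\<^sup>2 + 2 * p * r * t" and ?c = "1 - p\<^sup>2"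
  have "?a * ?b - ?n\<^sup>2 = ?c * (q * t - r * s)\<^sup>2"
    by (simp add: power2_eq_square algebra_simps)
  then have "(?a - ?c) * (?b - ?c) - ?n\<^sup>2 = ?c * ((q * t - r * s)\<^sup>2 - ?a - ?b + ?c)"
    by (simp add: algebra_simps)
  moreover have "(q * t - r * s)\<^sup>2 - ?a - ?b + ?c = ?A" by simp
  moreover have "gram_det p q r s t u = ?A - 2 * ?n * u - ?c * u\<^sup>2"
    unfolding gram_det_def by (simp add: power2_eq_square algebra_simps)
  moreover have "(2 * p * q * s + p\<^sup>2 + q\<^sup>2 + s\<^sup>2 - 1) = ?a - ?c" "(2 * p * r * t + p\<^sup>2 + r\<^sup>2 + t\<^sup>2 - 1) = ?b - ?c"
    by simp_all
  moreover have "(?n + u * ?c)\<^sup>2 = ?n\<^sup>2 + 2 * ?n * u * ?c + ?c * ?c * u\<^sup>2" by (simp add: power2_eq_square algebra_simps)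
  ultimately show ?thesis by (simp only:) (simp only: algebra_simps)
qed

text \<open>The faces opposite \<open>k\<close> and \<open>m\<close> meet in the edge joining
  \<open>third k m\<close> and \<open>third m k\<close>; this converts between labels of pairs of
  faces and labels of edges.\<close>

lemma third_opposite:
  assumes "k \<noteq> m"
  shows "third (third k m) (third m k) = k"
  using assms exhaust_4[of k] exhaust_4[of m] by (elim disjE; simp add: third_def)

lemma third_thirds:
  assumes "k \<noteq> m"
  shows "third (third k m) (third m k) = k" "third (third m k) (third k m) = m"
    "third (third m k) m = k" "third m (third m k) = third k m" "third m (third k m) = k" "third (third k m) m = third m k"
    "third k (third k m) = third m k" "third (third k m) k = m" "third k (third m k) = m" "third (third m k) k = third k m"
  using third_opposite[OF assms] third_opposite[OF assms[symmetric]] third_cycle[OF assms] third_cycle[OF assms[symmetric]]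
  by simp_all

text \<open>The \<open>v i\<close> are space-like unit vectors, the poles of the truncation planes.
  A negative determinant reflects the Lorentzian signature of the Gram matrix, and positive time
  components put the vertices beyond infinity into the affine chart of the projective model.\<close>

locale hyper_gram =
  fixes x :: "4 \<Rightarrow> 4 \<Rightarrow> real" and v :: "4 \<Rightarrow> (real^3) \<times> real"
  assumes x_sym: "x i j = x j i" and x_gt: "i \<noteq> j \<Longrightarrow> 1 < x i j"
    and lor_eq: "i \<noteq> j \<Longrightarrow> lor (v i) (v j) = - x i j" and lor_self: "lor (v i) (v i) = 1"
    and time: "0 < snd (v i)"
    and span: "\<exists>\<mu>. X = (\<Sum>i\<in>UNIV. \<mu> i *\<^sub>R v i)"
    and det_neg: "gram_det (x 1 2) (x 1 3) (x 1 4) (x 2 3) (x 2 4) (x 3 4) < 0"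
begin

definition dt :: real where "dt = gram_det (x 1 2) (x 1 3) (x 1 4) (x 2 3) (x 2 4) (x 3 4)"

lemma dt_neg: "dt < 0" using det_neg by (simp add: dt_def)

lemma dt_flag:
  assumes "k \<noteq> m"
  shows "dt = gram_det (x k m) (x k (third k m)) (x k (third m k)) (x m (third k m)) (x m (third m k)) (x (third k m) (third m k))"
proof -
  have s: "x 2 1 = x 1 2" "x 3 1 = x 1 3" "x 4 1 = x 1 4" "x 3 2 = x 2 3" "x 4 2 = x 2 4" "x 4 3 = x 3 4"
    by (rule x_sym)+
  show ?thesis
    using assms exhaust_4[of k] exhaust_4[of m]
    by (elim disjE; simp add: third_def s dt_def gram_det_def; simp add: algebra_simps)
qed

definition opp :: "4 \<Rightarrow> real" where
  "opp k = (if k = 1 then tri3 x 2 3 4 else if k = 2 then tri3 x 1 3 4 else if k = 3 then tri3 x 1 2 4 else tri3 x 1 2 3)"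

lemma tri3_perm: "tri3 x i j k = tri3 x j i k" "tri3 x i j k = tri3 x i k j" "tri3 x i j k = tri3 x j k i"
  unfolding tri3_def using x_sym[of i j] x_sym[of i k] x_sym[of j k] by (simp_all add: algebra_simps)

lemma opp_eq:
  assumes "k \<noteq> m"
  shows "opp k = tri3 x m (third k m) (third m k)"
proof -
  have s: "x 2 1 = x 1 2" "x 3 1 = x 1 3" "x 4 1 = x 1 4" "x 3 2 = x 2 3" "x 4 2 = x 2 4" "x 4 3 = x 3 4"
    by (rule x_sym)+
  show ?thesis
    using assms exhaust_4[of k] exhaust_4[of m]
    by (elim disjE; simp add: third_def s opp_def tri3_def; simp add: algebra_simps)
qed

definition cof :: "4 \<Rightarrow> 4 \<Rightarrow> real" where
  "cof k m = (if m = k then - opp k else num4 x (third k m) (third m k) k m)"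

text \<open>Up to the factor \<open>dt\<close> this is the dual basis of \<open>v\<close>, hence
  normal to the faces; as \<open>dt\<close> is negative, the normals point outwards.\<close>

definition nrm :: "4 \<Rightarrow> (real^3) \<times> real" where
  "nrm k = (\<Sum>m\<in>UNIV. cof k m *\<^sub>R v m)"

lemma nrm_flag:
  assumes "k \<noteq> m"
  defines "a \<equiv> third k m" and "b \<equiv> third m k"
  shows "lor q (nrm k) = - tri3 x m a b * lor q (v k) + num4 x a b k m * lor q (v m)
     + num4 x b m k a * lor q (v a) + num4 x m a k b * lor q (v b)"
  unfolding nrm_def lor_sum_right[OF finite_class.finite_UNIV] sum_third[OF assms(1)] a_def b_def
  using third_neq[OF assms(1)] assms(1)
  by (simp add: cof_def opp_eq[OF assms(1)] third_thirds[OF assms(1)] lor_bilinear)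

text \<open>With cofactors as coefficients this is the expansion of a determinant with a repeated
  row.\<close>

lemma lor_nrm_other:
  assumes "k \<noteq> m"
  shows "lor (v m) (nrm k) = 0"
proof -
  let ?a = "third k m" and ?b = "third m k"
  note n = third_neq[OF assms]
  have e: "lor (v m) (v k) = - x k m" "lor (v m) (v ?a) = - x m ?a" "lor (v m) (v ?b) = - x m ?b"
    using lor_eq n assms x_sym by metis+
  have s: "x ?a k = x k ?a" "x ?b k = x k ?b" "x ?a m = x m ?a" "x ?b m = x m ?b" "x ?b ?a = x ?a ?b" "x m k = x k m"
    by (rule x_sym)+
  show ?thesis
    unfolding nrm_flag[OF assms] e lor_self num4_def tri3_def s
    by algebra
qed

lemma lor_nrm_self: "lor (v k) (nrm k) = dt"
proof -
  obtain m where km: "k \<noteq> m" using exhaust_4[of k] by (metis (full_types) one_neq_zero third_neq(1))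
  let ?a = "third k m" and ?b = "third m k"
  note n = third_neq[OF km]
  have e: "lor (v k) (v m) = - x k m" "lor (v k) (v ?a) = - x k ?a" "lor (v k) (v ?b) = - x k ?b"
    using lor_eq n km by metis+
  have s: "x ?a k = x k ?a" "x ?b k = x k ?b" "x ?a m = x m ?a" "x ?b m = x m ?b" "x ?b ?a = x ?a ?b" "x m k = x k m"
    by (rule x_sym)+
  show ?thesis
    unfolding nrm_flag[OF km] e lor_self num4_def tri3_def s dt_flag[OF km] gram_det_def
    by algebra
qed

lemma lor_nrm_nrm: "lor (nrm k) (nrm m) = cof m k * dt"
proof -
  have "lor (nrm k) (nrm m) = (\<Sum>j\<in>UNIV. cof m j * lor (v j) (nrm k))"
    unfolding nrm_def[of m] lor_sum_right[OF finite_class.finite_UNIV] by (simp add: lor_sym)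
  also have "\<dots> = (\<Sum>j\<in>UNIV. if j = k then cof m k * dt else 0)"
    by (intro sum.cong) (auto simp: lor_nrm_self lor_nrm_other)
  finally show ?thesis by simp
qed

text \<open>The time factors turn the Lorentz products into weights for the barycentric coordinates
  of \<open>klein\<close>, whose base points are the \<open>v i\<close> scaled to time 1.\<close>

definition wt :: "4 \<Rightarrow> 4 \<Rightarrow> real" where "wt i j = x i j * snd (v i) / snd (v j)"

text \<open>The time factors cancel in w_ij w_ji = x_ij^2, so positive edge lengths are what keeps
  the truncations apart.\<close>

sublocale cut_weights wt
proof
  fix i j :: 4 assume ij: "i \<noteq> j"
  show "0 < wt i j" using x_gt[OF ij] time by (simp add: wt_def)
  have "wt i j * wt j i = x i j * x i j" using time[of i] time[of j] x_sym[of j i] by (simp add: wt_def)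
  also have "\<dots> > 1" using x_gt[OF ij] by (simp add: less_1_mult)
  finally show "1 < wt i j * wt j i" .
qed

definition klein :: "real^4 \<Rightarrow> real^3" where
  "klein \<mu> = (\<Sum>i\<in>UNIV. (\<mu> $ i / snd (v i)) *\<^sub>R fst (v i))"

definition con :: "4 + 4 \<Rightarrow> (real^3) \<times> real" where
  "con m = (case m of Inl k \<Rightarrow> nrm k | Inr i \<Rightarrow> v i)"

definition sc :: "4 + 4 \<Rightarrow> real" where
  "sc m = (case m of Inl k \<Rightarrow> - dt / snd (v k) | Inr i \<Rightarrow> 1 / snd (v i))"

abbreviation P :: "(real^3) set" where "P \<equiv> klein ` cut_simplex wt"

lemma linear_klein: "linear klein"
proof (rule linearI)
  show "klein (a + b) = klein a + klein b" for a b
    by (simp add: klein_def add_divide_distrib scaleR_add_left sum.distrib)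
  show "klein (c *\<^sub>R a) = c *\<^sub>R klein a" for c a
    by (simp add: klein_def scaleR_sum_right)
qed

lemma lift_klein:
  assumes "(\<Sum>i\<in>UNIV. \<mu> $ i) = 1"
  shows "(klein \<mu>, 1) = (\<Sum>i\<in>UNIV. (\<mu> $ i / snd (v i)) *\<^sub>R v i)"
proof -
  have "(\<Sum>i\<in>UNIV. \<mu> $ i / snd (v i) * snd (v i)) = 1"
    using assms time by (simp add: less_imp_neq[symmetric])
  then show ?thesis by (simp add: prod_eq_iff klein_def fst_sum snd_sum)
qed

lemma con_klein:
  assumes "(\<Sum>i\<in>UNIV. \<mu> $ i) = 1"
  shows "fst (con m) \<bullet> klein \<mu> - snd (con m) = sc m * (cut_fun wt m \<bullet> \<mu>)"
proof -
  have "fst (con m) \<bullet> klein \<mu> - snd (con m) = lor (con m) (klein \<mu>, 1)" by (simp add: lor_def)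
  also have "\<dots> = (\<Sum>i\<in>UNIV. \<mu> $ i / snd (v i) * lor (con m) (v i))"
    unfolding lift_klein[OF assms] by (rule lor_sum_right) simp
  also have "\<dots> = sc m * (cut_fun wt m \<bullet> \<mu>)"
  proof (cases m)
    case (Inl k)
    have "(\<Sum>i\<in>UNIV. \<mu> $ i / snd (v i) * lor (con m) (v i)) = (\<Sum>i\<in>UNIV. if i = k then \<mu> $ k / snd (v k) * dt else 0)"
      using Inl by (intro sum.cong) (auto simp: con_def lor_sym[of "nrm _"] lor_nrm_self lor_nrm_other)
    then show ?thesis using Inl by (simp add: sc_def cut_fun_Inl)
  next
    case (Inr i)
    obtain j where ij: "i \<noteq> j" using exhaust_4[of i] by (metis (full_types) one_neq_zero third_neq(1))
    note n = third_neq[OF ij]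
    have e: "lor (v i) (v j) = - x i j" "lor (v i) (v (third i j)) = - x i (third i j)" "lor (v i) (v (third j i)) = - x i (third j i)"
      using lor_eq n ij by metis+
    have nz: "snd (v a) \<noteq> 0" for a using time[of a] by simp
    show ?thesis
      unfolding Inr sum_third[OF ij] cut_fun_Inr[OF ij]
      using nz[of i] nz[of j] nz[of "third i j"] nz[of "third j i"]
      by (simp add: con_def sc_def e lor_self wt_def field_simps)
  qed
  finally show ?thesis .
qed

lemma sc_pos: "0 < sc m"
  using dt_neg time by (auto simp: sc_def divide_neg_pos split: sum.split)

lemma P_polytope: "cut_polytope P UNIV (\<lambda>m. fst (con m)) (\<lambda>m. snd (con m)) ordered_pairs (\<lambda>p. klein (cut_vertex wt p)) cut_inc"
  by (rule image_cut_polytope[OF linear_klein con_klein sc_pos])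

sublocale pp: cut_polytope P UNIV "\<lambda>m. fst (con m)" "\<lambda>m. snd (con m)" ordered_pairs "\<lambda>p. klein (cut_vertex wt p)" cut_inc
  by (rule P_polytope)

lemma P_le: "y \<in> P \<Longrightarrow> fst (con m) \<bullet> y \<le> snd (con m)"
  by (rule pp.le) auto

text \<open>As the \<open>v i\<close> span space-time, every point of the chart has barycentric
  coordinates; the strict constraints then place these in the cut simplex.\<close>

lemma strict_in_P:
  assumes "\<And>m. fst (con m) \<bullet> y < snd (con m)"
  shows "y \<in> P"
proof -
  obtain c where l: "(y, 1) = (\<Sum>i\<in>UNIV. c i *\<^sub>R v i)" using span by blast
  define \<mu> :: "real^4" where "\<mu> = (\<chi> i. c i * snd (v i))"
  have nz: "snd (v a) \<noteq> 0" for a using time[of a] by simp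
  have "snd (y, 1 :: real) = (\<Sum>i\<in>UNIV. c i * snd (v i))" unfolding l by (simp add: snd_sum)
  then have s: "(\<Sum>i\<in>UNIV. \<mu> $ i) = 1" by (simp add: \<mu>_def)
  have "y = fst (\<Sum>i\<in>UNIV. c i *\<^sub>R v i)" using l by (metis fst_conv)
  then have y: "y = klein \<mu>" using nz by (simp add: \<mu>_def klein_def fst_sum)
  have "cut_fun wt m \<bullet> \<mu> \<le> 0" for m
  proof -
    have "sc m * (cut_fun wt m \<bullet> \<mu>) < 0" using assms[of m] con_klein[OF s, of m] y by simp
    then show ?thesis using sc_pos[of m] by (simp add: mult_less_0_iff)
  qed
  then show ?thesis using s y by (auto simp: cut_simplex_def)
qed

text \<open>The centroid of the vertices satisfies every constraint strictly, since each constraint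
  is strict at some vertex.\<close>

lemma P_interior: "interior P \<noteq> {}"
proof -
  let ?U = "{y. \<forall>m. fst (con m) \<bullet> y < snd (con m)}"
  have "?U = (\<Inter>m. {y. fst (con m) \<bullet> y < snd (con m)})" by auto
  then have "open ?U" by (simp only:) (intro open_INT finite_class.finite_UNIV ballI open_halfspace_lt)
  moreover have "?U \<subseteq> P" using strict_in_P by auto
  ultimately have "?U \<subseteq> interior P" by (rule interior_maximal[rotated])
  moreover have "\<exists>y. y \<in> ?U"
  proof -
    define \<mu> where "\<mu> = (1 / real (card ordered_pairs)) *\<^sub>R (\<Sum>p\<in>ordered_pairs. cut_vertex wt p)"
    have fin: "finite ordered_pairs" by simp
    have "(1, 2) \<in> ordered_pairs" by (simp add: ordered_pairs_def)
    then have ne: "ordered_pairs \<noteq> {}" by blast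
    then have cp: "0 < real (card ordered_pairs)" using fin card_gt_0_iff[of ordered_pairs] by auto
    have s1: "(\<Sum>i\<in>UNIV. cut_vertex wt p $ i) = 1" if "p \<in> ordered_pairs" for p
      using cut_vertex_in[OF that] by (simp add: cut_simplex_def)
    have "(\<Sum>i\<in>UNIV. \<mu> $ i) = 1 / real (card ordered_pairs) * (\<Sum>p\<in>ordered_pairs. \<Sum>i\<in>UNIV. cut_vertex wt p $ i)"
      by (simp add: \<mu>_def sum_distrib_left) (rule sum.swap)
    then have s: "(\<Sum>i\<in>UNIV. \<mu> $ i) = 1" using s1 cp ne by simp
    have "cut_fun wt m \<bullet> \<mu> < 0" for m
    proof -
      have "\<exists>p\<in>ordered_pairs. m \<notin> cut_inc p"
      proof (cases m)
        case (Inl k)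
        obtain j where "k \<noteq> j" using exhaust_4[of k] by (metis (full_types) one_neq_zero third_neq(1))
        then have "(k, j) \<in> ordered_pairs" "m \<notin> cut_inc (k, j)"
          using third_neq[of k j] Inl by (auto simp: ordered_pairs_def cut_inc_def)
        then show ?thesis by blast
      next
        case (Inr i)
        obtain j where "i \<noteq> j" using exhaust_4[of i] by (metis (full_types) one_neq_zero third_neq(1))
        then have "(j, i) \<in> ordered_pairs" "m \<notin> cut_inc (j, i)"
          using Inr by (auto simp: ordered_pairs_def cut_inc_def)
        then show ?thesis by blast
      qed
      then obtain p where p: "p \<in> ordered_pairs" "m \<notin> cut_inc p" by blast
      have le: "cut_fun wt m \<bullet> cut_vertex wt r \<le> 0" "cut_fun wt m \<bullet> cut_vertex wt r = 0 \<longleftrightarrow> m \<in> cut_inc r"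
        if "r \<in> ordered_pairs" for r
        using that cut_vertex_inc[of "fst r" "snd r" m] by (auto simp: ordered_pairs_def)
      have "(\<Sum>r\<in>ordered_pairs. cut_fun wt m \<bullet> cut_vertex wt r) < (\<Sum>r\<in>ordered_pairs. 0)"
      proof (rule sum_strict_mono_ex1[OF fin])
        show "\<forall>r\<in>ordered_pairs. cut_fun wt m \<bullet> cut_vertex wt r \<le> 0" using le by blast
        show "\<exists>r\<in>ordered_pairs. cut_fun wt m \<bullet> cut_vertex wt r < 0"
          using le[OF p(1)] p by (intro bexI[OF _ p(1)]) auto
      qed
      then show ?thesis using cp by (simp add: \<mu>_def inner_sum_right mult_pos_neg divide_neg_pos)
    qed
    then have "fst (con m) \<bullet> klein \<mu> < snd (con m)" for m
      using con_klein[OF s, of m] sc_pos[of m] by (smt (verit) mult_pos_neg)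
    then show ?thesis by blast
  qed
  ultimately show ?thesis by blast
qed

text \<open>Expanding one factor in the Lorentz norm of (y, 1) gives nonpositive terms, \<mu>_i
  times the value of the truncation at \<open>i\<close>. If all of them vanished, a single \<mu>_i
  would be nonzero, because two truncations are never tight together; but then the truncation at
  \<open>i\<close> is not tight either.\<close>

lemma P_ball: "P \<subseteq> ball 0 1"
proof
  fix y assume "y \<in> P"
  then obtain \<mu> where m: "\<mu> \<in> cut_simplex wt" "y = klein \<mu>" by blast
  have s: "(\<Sum>i\<in>UNIV. \<mu> $ i) = 1" and le: "cut_fun wt m \<bullet> \<mu> \<le> 0" for m
    using m by (auto simp: cut_simplex_def)
  let ?c = "\<lambda>i. \<mu> $ i / snd (v i) * (sc (Inr i) * (cut_fun wt (Inr i) \<bullet> \<mu>))"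
  have "lor (y, 1) (y, 1) = (\<Sum>i\<in>UNIV. \<mu> $ i / snd (v i) * lor (y, 1) (v i))"
    unfolding m(2) by (subst (2) lift_klein[OF s]) (rule lor_sum_right, simp)
  also have "\<dots> = (\<Sum>i\<in>UNIV. ?c i)"
  proof (intro sum.cong refl)
    fix i
    have "lor (y, 1) (v i) = fst (con (Inr i)) \<bullet> klein \<mu> - snd (con (Inr i))"
      by (simp add: lor_def m con_def inner_commute)
    then show "\<mu> $ i / snd (v i) * lor (y, 1) (v i) = ?c i" using con_klein[OF s, of "Inr i"] by simp
  qed
  finally have l: "lor (y, 1) (y, 1) = (\<Sum>i\<in>UNIV. ?c i)" .
  have nonneg: "0 \<le> \<mu> $ i" for i using cut_simplex_nonneg[OF m(1)] .
  have cle: "?c i \<le> 0" for i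
    using nonneg[of i] time[of i] sc_pos[of "Inr i"] le[of "Inr i"]
    by (intro mult_nonneg_nonpos divide_nonneg_pos mult_nonneg_nonpos) auto
  have "\<exists>i. ?c i < 0"
  proof (rule ccontr)
    assume no: "\<not> ?thesis"
    have z: "\<mu> $ i = 0 \<or> cut_fun wt (Inr i) \<bullet> \<mu> = 0" for i
      using no cle[of i] time[of i] sc_pos[of "Inr i"] by (metis divide_eq_0_iff less_eq_real_def mult_eq_0_iff less_irrefl)
    obtain i where i: "\<mu> $ i \<noteq> 0" using s by (metis sum.neutral zero_neq_one)
    have "\<mu> $ j = 0" if "j \<noteq> i" for j
      using cut_simplex_two_tight[OF m(1) that] z[of i] z[of j] i by blast
    then have "cut_fun wt (Inr i) \<bullet> \<mu> = \<mu> $ i"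
    proof -
      assume o: "\<And>j. j \<noteq> i \<Longrightarrow> \<mu> $ j = 0"
      obtain j where ij: "i \<noteq> j" using exhaust_4[of i] by (metis (full_types) one_neq_zero third_neq(1))
      show ?thesis using o third_neq[OF ij] ij by (simp add: cut_fun_Inr[OF ij])
    qed
    then show False using z[of i] i by simp
  qed
  then have "(\<Sum>i\<in>UNIV. ?c i) < (\<Sum>i\<in>(UNIV :: 4 set). 0)"
    using cle by (intro sum_strict_mono_ex1) auto
  then have "y \<bullet> y < 1" using l by (simp add: lor_def)
  then have "norm y < 1" by (simp add: norm_eq_sqrt_inner)
  then show "y \<in> ball 0 1" by simp
qed

lemma aff_dim_P: "aff_dim P = 3"
  using aff_dim_nonempty_interior[OF P_interior] by simp

text \<open>Dimension drops strictly along a chain of polytope, facet, edge and vertex. Going from 3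
  to at least 0 in three drops, it is 2 at the facet. The first three pairs witness strictness, the
  last one that the chain ends in a nonempty face.\<close>

lemma facet_chain:
  assumes "k1 \<in> ordered_pairs" "k2 \<in> ordered_pairs" "k3 \<in> ordered_pairs" "k4 \<in> ordered_pairs"
    and "m1 \<notin> cut_inc k1" "m1 \<in> cut_inc k2" "m2 \<notin> cut_inc k2" "{m1, m2} \<subseteq> cut_inc k3" "m3 \<notin> cut_inc k3"
    and "{m1, m2, m3} \<subseteq> cut_inc k4"
  shows "pp.cell {m1} facet_of P"
proof -
  have lt: "aff_dim (pp.cell K) < aff_dim (pp.cell J)"
    if "J \<subseteq> K" "k \<in> ordered_pairs" "J \<subseteq> cut_inc k" "\<not> K \<subseteq> cut_inc k" for J K k
  proof -
    have f: "pp.cell J face_of P" "pp.cell K face_of P" by (rule pp.cell_face, simp)+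
    have sub: "pp.cell K \<subseteq> pp.cell J" using that(1) by (auto simp: pp.cell_def)
    have "pp.cell K face_of pp.cell J"
      using f sub by (meson face_of_imp_subset face_of_subset)
    moreover have "pp.cell K \<noteq> pp.cell J"
      using pp.vertex_in_cell[OF that(2), of K] pp.vertex_in_cell[OF that(2), of J] that by auto
    ultimately show ?thesis using face_of_aff_dim_lt face_of_imp_convex[OF f(1)] by blast
  qed
  have e: "pp.cell {} = P" by (simp add: pp.cell_def)
  have 1: "aff_dim (pp.cell {m1}) < aff_dim P" using lt[of "{}" "{m1}" k1] assms e by simp
  have 2: "aff_dim (pp.cell {m1, m2}) < aff_dim (pp.cell {m1})" using lt[of "{m1}" "{m1, m2}" k2] assms by simp
  have 3: "aff_dim (pp.cell {m1, m2, m3}) < aff_dim (pp.cell {m1, m2})" using lt[of "{m1, m2}" "{m1, m2, m3}" k3] assms by simp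
  have ne: "pp.cell {m1, m2, m3} \<noteq> {}" using pp.vertex_in_cell[OF assms(4), of "{m1, m2, m3}"] assms by auto
  then have "0 \<le> aff_dim (pp.cell {m1, m2, m3})"
    using aff_dim_negative_iff[of "pp.cell {m1, m2, m3}"] by linarith
  then have "aff_dim (pp.cell {m1}) = aff_dim P - 1" using 1 2 3 aff_dim_P by linarith
  moreover have "pp.cell {m1} \<noteq> {}" using ne by (auto simp: pp.cell_def)
  ultimately show ?thesis unfolding facet_of_def using pp.cell_face[of "{m1}"] by simp
qed

lemma cell_facet: "pp.cell {m} facet_of P"
proof (cases m)
  case (Inl k)
  obtain a where ka: "k \<noteq> a" using exhaust_4[of k] by (metis (full_types) one_neq_zero third_neq(1))
  define i where "i = a"
  define j where "j = third k a"
  have ij: "i \<noteq> j" "third i j = k" "third j i = third a k"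
    using third_neq[OF ka] third_thirds[OF ka] by (auto simp: i_def j_def)
  define l where "l = third j i"
  note n = third_neq[OF ij(1), folded l_def, unfolded ij(2)]
  have t: "third i l = j" "third l i = k" using third_cycle[OF ij(1)] ij by (auto simp: l_def)
  show ?thesis unfolding Inl
    by (rule facet_chain[of "(k, i)" "(i, l)" "(j, i)" "(i, j)" _ "Inl l" "Inr i"])
      (use ij n t third_neq[of k i] in \<open>auto simp: ordered_pairs_def cut_inc_def l_def\<close>)
next
  case (Inr i)
  obtain j where ij: "i \<noteq> j" using exhaust_4[of i] by (metis (full_types) one_neq_zero third_neq(1))
  define k where "k = third i j"
  define l where "l = third j i"
  note n = third_neq[OF ij, folded k_def l_def]
  have t: "third i k = l" "third k i = j" "third i l = j" "third l i = k"
    using third_cycle[OF ij] by (auto simp: l_def k_def)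
  show ?thesis unfolding Inr
    by (rule facet_chain[of "(j, i)" "(i, k)" "(i, l)" "(i, j)" _ "Inl k" "Inl l"])
      (use ij n t in \<open>auto simp: ordered_pairs_def cut_inc_def k_def[symmetric] l_def[symmetric]\<close>)
qed

lemma cell_dihedral:
  "hyp_dihedral P (pp.cell {m}) (pp.cell {m'})
     (arccos (- lor (con m) (con m') / (sqrt (lor (con m) (con m)) * sqrt (lor (con m') (con m')))))"
  unfolding hyp_dihedral_def
proof (intro conjI cell_facet exI)
  show "P \<subseteq> {y. fst (con m) \<bullet> y \<le> snd (con m)}" "P \<subseteq> {y. fst (con m') \<bullet> y \<le> snd (con m')}"
    using P_le by auto
  show "pp.cell {m} = P \<inter> {y. fst (con m) \<bullet> y = snd (con m)}" "pp.cell {m'} = P \<inter> {y. fst (con m') \<bullet> y = snd (con m')}"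
    by (simp_all add: pp.cell_def)
qed (simp add: lor_def power2_eq_square)

lemma right_angle: "i \<noteq> k \<Longrightarrow> hyp_dihedral P (pp.cell {Inr i}) (pp.cell {Inl k}) (pi / 2)"
  using cell_dihedral[of "Inr i" "Inl k"] by (simp add: con_def lor_nrm_other)

text \<open>The Gram matrix of the normals is \<open>dt\<close> times the matrix of cofactors, and
  \<open>dt\<close> cancels from the cosine.\<close>

lemma hex_angle:
  assumes "k \<noteq> m"
  shows "hyp_dihedral P (pp.cell {Inl k}) (pp.cell {Inl m}) (arccos (edge_cos x (third k m) (third m k)))"
proof -
  let ?a = "third k m" and ?b = "third m k"
  have o: "opp k = tri3 x ?a ?b m" "opp m = tri3 x ?a ?b k"
    using opp_eq[OF assms] opp_eq[OF assms[symmetric]] tri3_perm by metis+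
  have c: "cof m k = num4 x ?a ?b k m"
  proof -
    have "cof m k = num4 x ?b ?a m k" using assms by (simp add: cof_def)
    also have "\<dots> = num4 x ?a ?b k m"
      unfolding num4_def using x_sym[of ?a ?b] x_sym[of k m] by (simp add: algebra_simps)
    finally show ?thesis .
  qed
  have self: "lor (nrm a) (nrm a) = opp a * - dt" for a by (simp add: lor_nrm_nrm cof_def)
  have "sqrt (lor (nrm k) (nrm k)) * sqrt (lor (nrm m) (nrm m)) = (sqrt (opp k) * sqrt (opp m)) * (sqrt (- dt) * sqrt (- dt))"
    unfolding self real_sqrt_mult by simp
  also have "sqrt (- dt) * sqrt (- dt) = - dt" using dt_neg by simp
  finally have q: "sqrt (lor (nrm k) (nrm k)) * sqrt (lor (nrm m) (nrm m)) = (sqrt (opp k) * sqrt (opp m)) * - dt" .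
  have "- lor (nrm k) (nrm m) / (sqrt (lor (nrm k) (nrm k)) * sqrt (lor (nrm m) (nrm m))) = cof m k / (sqrt (opp k) * sqrt (opp m))"
    unfolding q unfolding lor_nrm_nrm using dt_neg by simp
  also have "\<dots> = edge_cos x ?a ?b"
    unfolding edge_cos_def third_thirds[OF assms] c o by (simp add: mult.commute)
  finally show ?thesis using cell_dihedral[of "Inl k" "Inl m"] by (simp add: con_def)
qed

text \<open>The combination is orthogonal to \<open>v i\<close>: it is the point where the line
  through \<open>v i\<close> and \<open>v j\<close> meets the polar plane of
  \<open>v i\<close>.\<close>

lemma klein_vertex:
  assumes "i \<noteq> j"
  obtains \<kappa> where "0 < \<kappa>" "(klein (cut_vertex wt (i, j)), 1) = \<kappa> *\<^sub>R (x i j *\<^sub>R v i + v j)"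
proof -
  let ?k = "1 / ((1 + wt i j) * snd (v j))"
  have w: "0 < wt i j" using w_pos[OF assms] .
  have s: "(\<Sum>a\<in>UNIV. cut_vertex wt (i, j) $ a) = 1"
    using cut_vertex_in[of "(i, j)"] assms by (simp add: ordered_pairs_def cut_simplex_def)
  have "wt i j / (1 + wt i j) / snd (v i) = ?k * x i j"
    using time[of i] time[of j] w by (simp add: wt_def)
  then have "(klein (cut_vertex wt (i, j)), 1) = ?k *\<^sub>R (x i j *\<^sub>R v i + v j)"
    unfolding lift_klein[OF s] sum_third[OF assms] by (simp add: cut_vertex_vals[OF assms] scaleR_add_right)
  moreover have "0 < ?k" using w time[of j] by simp
  ultimately show ?thesis using that by blast
qed

lemma vertex_dist:
  assumes "i \<noteq> j"
  shows "hyp_dist (klein (cut_vertex wt (i, j))) (klein (cut_vertex wt (j, i))) = arcosh (x i j)"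
proof -
  let ?p = "klein (cut_vertex wt (i, j))" and ?q = "klein (cut_vertex wt (j, i))"
  obtain c where c: "0 < c" "(?p, 1) = c *\<^sub>R (x i j *\<^sub>R v i + v j)" using klein_vertex[OF assms] by blast
  obtain d where d: "0 < d" "(?q, 1) = d *\<^sub>R (x i j *\<^sub>R v j + v i)"
    using klein_vertex[OF assms[symmetric]] x_sym by metis
  have e: "lor (v i) (v j) = - x i j" "lor (v j) (v i) = - x i j" using lor_eq assms x_sym by metis+
  let ?y = "(x i j)\<^sup>2 - 1"
  have y: "0 < ?y" using x_gt[OF assms] by simp
  have pp: "lor (?p, 1) (?p, 1) = - (c\<^sup>2 * ?y)" unfolding c lor_bilinear lor_self e by (simp add: power2_eq_square algebra_simps)
  have qq: "lor (?q, 1) (?q, 1) = - (d\<^sup>2 * ?y)" unfolding d lor_bilinear lor_self e by (simp add: power2_eq_square algebra_simps)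
  have pq: "lor (?p, 1) (?q, 1) = - (c * d * x i j * ?y)" unfolding c d lor_bilinear lor_self e by (simp add: power2_eq_square algebra_simps)
  have 1: "1 - ?p \<bullet> ?q = c * d * x i j * ?y" "1 - ?p \<bullet> ?p = c\<^sup>2 * ?y" "1 - ?q \<bullet> ?q = d\<^sup>2 * ?y"
    using pp qq pq by (simp_all add: lor_def)
  have "sqrt ((c\<^sup>2 * ?y) * (d\<^sup>2 * ?y)) = c * d * ?y"
  proof (rule real_sqrt_unique)
    show "(c * d * ?y)\<^sup>2 = (c\<^sup>2 * ?y) * (d\<^sup>2 * ?y)" by (simp add: power2_eq_square)
  qed (use c d y in simp)
  then show ?thesis unfolding hyp_dist_def 1 using c(1) d(1) y by simp
qed

lemma trunc_polytope: "cut_polytope trunc_tet UNIV (cut_fun (\<lambda>i j. 2)) (\<lambda>m. 0) ordered_pairs (cut_vertex (\<lambda>i j. 2)) cut_inc"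
proof -
  have "linear (id :: real^4 \<Rightarrow> real^4)" by (simp add: linear_iff)
  from cut_weights.image_cut_polytope[OF cut_weights_two this, of "cut_fun (\<lambda>i j. 2)" "\<lambda>m. 0" "\<lambda>m. 1"]
  show ?thesis by (simp add: trunc_tet_eq)
qed

text \<open>Jacobi's identity at this edge, where both the determinant and 1 - x_ij^2 are
  negative.\<close>

lemma edge_cos_bound:
  assumes "i \<noteq> j"
  shows "\<bar>edge_cos x i j\<bar> \<le> 1"
proof -
  let ?a = "third i j" and ?b = "third j i"
  have "tri3 x i j ?a * tri3 x i j ?b - (num4 x i j ?a ?b)\<^sup>2 = dt * (1 - (x i j)\<^sup>2)"
    unfolding dt_flag[OF assms] num4_def tri3_def
    using gram_det_jacobi[of "x i j" "x i ?a" "x j ?a" "x i ?b" "x j ?b" "x ?a ?b"] by simp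
  moreover have "0 < dt * (1 - (x i j)\<^sup>2)"
    using dt_neg x_gt[OF assms] by (intro mult_neg_neg) auto
  ultimately have "(num4 x i j ?a ?b)\<^sup>2 \<le> tri3 x i j ?a * tri3 x i j ?b" by linarith
  then have "\<bar>num4 x i j ?a ?b\<bar> \<le> sqrt (tri3 x i j ?a) * sqrt (tri3 x i j ?b)"
    unfolding real_sqrt_mult[symmetric] by (intro real_le_rsqrt) simp
  then have "\<bar>num4 x i j ?a ?b\<bar> \<le> \<bar>sqrt (tri3 x i j ?a) * sqrt (tri3 x i j ?b)\<bar>" by linarith
  moreover have "p / q \<le> 1" if "p \<le> q" "0 \<le> q" for p q :: real using that by (auto simp: divide_le_eq_1 less_le)
  ultimately show ?thesis unfolding edge_cos_def abs_divide by simp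
qed

theorem realized:
  "\<exists>P \<Phi>. hyper_ideal_tet P \<Phi> \<and> (\<forall>i j. i \<noteq> j \<longrightarrow> internal_length \<Phi> i j = arcosh (x i j)) \<and>
     (\<forall>k m. k \<noteq> m \<longrightarrow> hyp_dihedral P (\<Phi> (trunc_hex k)) (\<Phi> (trunc_hex m)) (arccos (edge_cos x (third k m) (third m k))))"
proof -
  let ?w2 = "(\<lambda>i j. 2) :: 4 \<Rightarrow> 4 \<Rightarrow> real"
  interpret two: cut_weights ?w2 by (rule cut_weights_two)
  obtain \<Phi> where F: "bij_betw \<Phi> {F. F face_of trunc_tet} {F. F face_of P}"
    "\<And>F G. F face_of trunc_tet \<Longrightarrow> G face_of trunc_tet \<Longrightarrow> \<Phi> F \<subseteq> \<Phi> G \<longleftrightarrow> F \<subseteq> G"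
    "\<And>J. J \<subseteq> UNIV \<Longrightarrow> \<Phi> (trunc_tet \<inter> {y. \<forall>m\<in>J. cut_fun ?w2 m \<bullet> y = 0}) = P \<inter> {y. \<forall>m\<in>J. fst (con m) \<bullet> y = snd (con m)}"
    "\<And>k. k \<in> ordered_pairs \<Longrightarrow> {m \<in> ordered_pairs. cut_inc k \<inter> UNIV \<subseteq> cut_inc m} = {k} \<Longrightarrow>
       \<Phi> {cut_vertex ?w2 k} = {klein (cut_vertex wt k)}"
    using face_lattice_iso[OF trunc_polytope P_polytope] by blast
  have cell: "\<Phi> (trunc_tet \<inter> {y. cut_fun ?w2 m \<bullet> y = 0}) = pp.cell {m}" for m
    using F(3)[of "{m}"] by (simp add: pp.cell_def)
  have hex: "\<Phi> (trunc_hex k) = pp.cell {Inl k}" for k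
  proof -
    have "trunc_hex k = trunc_tet \<inter> {y. cut_fun ?w2 (Inl k) \<bullet> y = 0}"
      by (auto simp: trunc_hex_def cut_fun_Inl)
    then show ?thesis using cell by simp
  qed
  have tri_eq: "trunc_tri i = trunc_tet \<inter> {y. cut_fun ?w2 (Inr i) \<bullet> y = 0}" for i
  proof -
    obtain j where ij: "i \<noteq> j" using exhaust_4[of i] by (metis (full_types) one_neq_zero third_neq(1))
    have "cut_fun ?w2 (Inr i) \<bullet> y = 3 * y $ i - 2" if "y \<in> trunc_tet" for y
      using that unfolding cut_fun_Inr[OF ij] by (simp add: trunc_tet_def tetrahedron_def sum_third[OF ij])
    then show ?thesis by (auto simp: trunc_tri_def)
  qed
  have tri: "\<Phi> (trunc_tri i) = pp.cell {Inr i}" for i using cell tri_eq by simp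
  have vert: "\<Phi> (trunc_vertex i j) = {klein (cut_vertex wt (i, j))}" if ij: "i \<noteq> j" for i j
  proof -
    have p: "(i, j) \<in> ordered_pairs" using ij by (simp add: ordered_pairs_def)
    have cv: "cut_vertex ?w2 (i, j) \<in> trunc_tet" using two.cut_vertex_in[OF p] trunc_tet_eq by simp
    note vals = two.cut_vertex_vals[OF ij]
    have "trunc_vertex i j = {cut_vertex ?w2 (i, j)}"
    proof (intro equalityI subsetI)
      fix y assume "y \<in> trunc_vertex i j"
      then have y: "y \<in> trunc_tet" "y $ i = 2 / 3" "y $ third i j = 0" "y $ third j i = 0"
        using third_neq[OF ij] by (auto simp: trunc_vertex_def trunc_tri_def)
      then have "y $ j = 1 / 3" by (simp add: trunc_tet_def tetrahedron_def sum_third[OF ij])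
      then show "y \<in> {cut_vertex ?w2 (i, j)}" using y vals by (simp add: vec_eq_iff all_third[OF ij])
    next
      fix y assume "y \<in> {cut_vertex ?w2 (i, j)}"
      then show "y \<in> trunc_vertex i j"
        using cv vals ij by (simp add: trunc_vertex_def trunc_tri_def all_third[OF ij])
    qed
    then show ?thesis using F(4)[OF p cut_inc_unique[OF p]] by simp
  qed
  have "polytope P" unfolding pp.hull polytope_def by (intro exI[of _ "_ ` ordered_pairs"]) simp
  then have "hyper_ideal_tet P \<Phi>"
    unfolding hyper_ideal_tet_def hex tri using P_interior P_ball F(1,2) right_angle by blast
  moreover have "internal_length \<Phi> i j = arcosh (x i j)" if "i \<noteq> j" for i j
    unfolding internal_length_def vert[OF that] vert[OF that[symmetric]] by (simp add: vertex_dist[OF that])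
  moreover have "hyp_dihedral P (\<Phi> (trunc_hex k)) (\<Phi> (trunc_hex m)) (arccos (edge_cos x (third k m) (third m k)))"
    if "k \<noteq> m" for k m unfolding hex by (rule hex_angle[OF that])
  ultimately show ?thesis by blast
qed

end

text \<open>The angle is assumed to exist at a single edge. This yields the vectors and, through
  Jacobi's identity, the sign of the determinant, which in turn bounds the cosines at all
  edges.\<close>

theorem hyper_ideal_tet_exists:
  fixes x :: "4 \<Rightarrow> 4 \<Rightarrow> real"
  assumes sym: "\<And>i j. x i j = x j i" and gt: "\<And>i j. i \<noteq> j \<Longrightarrow> 1 < x i j"
    and ang: "(num4 x 1 2 3 4)\<^sup>2 < tri3 x 1 2 3 * tri3 x 1 2 4"
  shows "(\<exists>P \<Phi>. hyper_ideal_tet P \<Phi> \<and> (\<forall>i j. i \<noteq> j \<longrightarrow> internal_length \<Phi> i j = arcosh (x i j)) \<and>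
     (\<forall>k m. k \<noteq> m \<longrightarrow> hyp_dihedral P (\<Phi> (trunc_hex k)) (\<Phi> (trunc_hex m)) (arccos (edge_cos x (third k m) (third m k))))) \<and>
     (\<forall>i j. i \<noteq> j \<longrightarrow> \<bar>edge_cos x i j\<bar> \<le> 1)"
proof -
  have g: "1 < x 1 2" "1 < x 1 3" "1 < x 1 4" "1 < x 2 3" "1 < x 2 4" "1 < x 3 4" using gt by simp_all
  have a: "(x 1 3 * x 1 4 + x 2 3 * x 2 4 + x 1 2 * (x 1 3 * x 2 4 + x 1 4 * x 2 3) + x 3 4 * (1 - (x 1 2)\<^sup>2))\<^sup>2 <
      (2 * x 1 2 * x 1 3 * x 2 3 + (x 1 2)\<^sup>2 + (x 1 3)\<^sup>2 + (x 2 3)\<^sup>2 - 1) * (2 * x 1 2 * x 1 4 * x 2 4 + (x 1 2)\<^sup>2 + (x 1 4)\<^sup>2 + (x 2 4)\<^sup>2 - 1)"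
    using ang by (simp add: num4_def tri3_def)
  obtain V1 V2 V3 V4 where V: "lor V1 V1 = 1" "lor V2 V2 = 1" "lor V3 V3 = 1" "lor V4 V4 = 1"
    "lor V1 V2 = - x 1 2" "lor V1 V3 = - x 1 3" "lor V1 V4 = - x 1 4" "lor V2 V3 = - x 2 3" "lor V2 V4 = - x 2 4" "lor V3 V4 = - x 3 4"
    "0 < snd V1" "0 < snd V2" "0 < snd V3" "0 < snd V4"
    and sp: "\<And>X. \<exists>a b c d. X = a *\<^sub>R V1 + b *\<^sub>R V2 + c *\<^sub>R V3 + d *\<^sub>R V4"
    using gram_realization[OF g a] by blast
  define v :: "4 \<Rightarrow> (real^3) \<times> real" where "v i = (if i = 1 then V1 else if i = 2 then V2 else if i = 3 then V3 else V4)" for i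
  have s: "x 2 1 = x 1 2" "x 3 1 = x 1 3" "x 4 1 = x 1 4" "x 3 2 = x 2 3" "x 4 2 = x 2 4" "x 4 3 = x 3 4"
    by (rule sym)+
  interpret hyper_gram x v
  proof
    show "x i j = x j i" for i j by (rule sym)
    show "1 < x i j" if "i \<noteq> j" for i j by (rule gt[OF that])
    show "lor (v i) (v j) = - x i j" if "i \<noteq> j" for i j
      using that exhaust_4[of i] exhaust_4[of j] V(5-10) V(5-10)[unfolded lor_sym[of _ V4]] lor_sym[of V2 V1] lor_sym[of V3 V1]
        lor_sym[of V4 V1] lor_sym[of V3 V2] lor_sym[of V4 V2] lor_sym[of V4 V3]
      by (elim disjE; simp add: v_def s)
    show "lor (v i) (v i) = 1" for i using exhaust_4[of i] V(1-4) by (auto simp: v_def)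
    show "0 < snd (v i)" for i using exhaust_4[of i] V(11-14) by (auto simp: v_def)
    show "\<exists>\<mu>. X = (\<Sum>i\<in>UNIV. \<mu> i *\<^sub>R v i)" for X
    proof -
      obtain a b c d where X: "X = a *\<^sub>R V1 + b *\<^sub>R V2 + c *\<^sub>R V3 + d *\<^sub>R V4" using sp by blast
      show ?thesis
        by (rule exI[of _ "\<lambda>i. if i = 1 then a else if i = 2 then b else if i = 3 then c else d"]) (simp add: X v_def sum_4)
    qed
    show "gram_det (x 1 2) (x 1 3) (x 1 4) (x 2 3) (x 2 4) (x 3 4) < 0"
    proof -
      have "0 < gram_det (x 1 2) (x 1 3) (x 1 4) (x 2 3) (x 2 4) (x 3 4) * (1 - (x 1 2)\<^sup>2)"
        using a gram_det_jacobi[of "x 1 2" "x 1 3" "x 2 3" "x 1 4" "x 2 4" "x 3 4"] by linarith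
      moreover have "1 - (x 1 2)\<^sup>2 < 0" using g(1) by simp
      ultimately show ?thesis by (simp add: zero_less_mult_iff)
    qed
  qed
  show ?thesis
  proof (intro conjI allI impI)
    show "\<bar>edge_cos x i j\<bar> \<le> 1" if "i \<noteq> j" for i j using that by (rule edge_cos_bound)
  qed (rule realized)
qed

section \<open>Charts of the truncated complex\<close>

lemma open_all4: "(\<And>a :: 4. open {x. Q a x}) \<Longrightarrow> open {x. \<forall>a. Q a x}"
  unfolding Collect_all_eq by (intro open_INT) auto

lemma open_imp4: "open {x. Q x} \<Longrightarrow> open {x. c \<longrightarrow> Q x}"
  by (cases c) auto

lemma closed_imp4: "closed {x. Q x} \<Longrightarrow> closed {x. c \<longrightarrow> Q x}"
  by (cases c) auto

text \<open>The imaginary part of the point bounds u; after rotation by - \<alpha> it bounds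
  s.\<close>

lemma sector_bound:
  assumes "0 \<le> s" "0 \<le> u" "0 \<le> sin \<alpha>"
  shows "u * sin \<alpha> \<le> cmod (complex_of_real s + complex_of_real u * cis \<alpha>)"
    "s * sin \<alpha> \<le> cmod (complex_of_real s + complex_of_real u * cis \<alpha>)"
proof -
  let ?z = "complex_of_real s + complex_of_real u * cis \<alpha>"
  show "u * sin \<alpha> \<le> cmod ?z" using abs_Im_le_cmod[of ?z] assms by simp
  have "cmod (?z * cis (- \<alpha>)) = cmod ?z" by (simp add: norm_mult)
  moreover have "?z * cis (- \<alpha>) = complex_of_real s * cis (- \<alpha>) + complex_of_real u"
    by (simp add: distrib_right mult.assoc cis_mult)
  ultimately show "s * sin \<alpha> \<le> cmod ?z"
    using abs_Im_le_cmod[of "?z * cis (- \<alpha>)"] assms by simp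
qed

context triangulation
begin

text \<open>The last clause keeps away all truncation triangles but the one at the first vertex of
  the flag, so that the height of a point in the chart vanishes exactly on the boundary.\<close>

definition good_fan :: "(nat \<times> 4 \<times> 4) set \<Rightarrow> (nat \<times> 4 \<times> 4 \<Rightarrow> real) \<Rightarrow> real \<Rightarrow>
    (nat \<Rightarrow> nat \<times> 4 \<times> 4 \<Rightarrow> real^4 \<Rightarrow> bool) \<Rightarrow> bool" where
  "good_fan Fl \<theta> \<alpha> P \<longleftrightarrow> fan Fl \<theta> \<alpha> P \<and>
     openin (top_of_set half_space3) (fan_map Fl \<theta> \<alpha> P ` dom Fl (P 0)) \<and>
     (\<forall>F\<in>Fl. \<forall>x\<in>trunc_tet. P 0 F x \<longrightarrow> (\<forall>a. a \<noteq> fst (snd F) \<longrightarrow> x $ a < 2 / 3))"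

lemma fan_image:
  assumes fan: "fan Fl \<theta> \<alpha> P"
  shows "fan_map Fl \<theta> \<alpha> P ` dom Fl (P 0) =
    {cyl (2 / 3 - x $ fst (snd F)) (cis (\<theta> F) * fz \<alpha> F x) | F x. F \<in> Fl \<and> x \<in> trunc_tet \<and> P 0 F x}"
proof -
  have e: "fan_map Fl \<theta> \<alpha> P (fst F, x) = cyl (2 / 3 - x $ fst (snd F)) (cis (\<theta> F) * fz \<alpha> F x)"
    if "F \<in> Fl" "x \<in> trunc_tet" "P 0 F x" for F x
    using fan_map_eq[OF fan that(1,2)] fan_imp[OF fan that(1,2)] that(3) by blast
  show ?thesis
  proof (intro equalityI subsetI)
    fix y assume "y \<in> fan_map Fl \<theta> \<alpha> P ` dom Fl (P 0)"
    then obtain p where p: "p \<in> dom Fl (P 0)" "y = fan_map Fl \<theta> \<alpha> P p" by blast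
    then obtain F where F: "F \<in> Fl" "fst p = fst F" "P 0 F (snd p)" "snd p \<in> trunc_tet"
      by (auto simp: dom_def)
    then have "p = (fst F, snd p)" by (simp add: prod_eq_iff)
    then have "y = cyl (2 / 3 - snd p $ fst (snd F)) (cis (\<theta> F) * fz \<alpha> F (snd p))"
      using e[OF F(1,4,3)] p(2) by simp
    then show "y \<in> {cyl (2 / 3 - x $ fst (snd F)) (cis (\<theta> F) * fz \<alpha> F x) | F x. F \<in> Fl \<and> x \<in> trunc_tet \<and> P 0 F x}"
      using F by blast
  next
    fix y assume "y \<in> {cyl (2 / 3 - x $ fst (snd F)) (cis (\<theta> F) * fz \<alpha> F x) | F x. F \<in> Fl \<and> x \<in> trunc_tet \<and> P 0 F x}"
    then obtain F x where F: "F \<in> Fl" "x \<in> trunc_tet" "P 0 F x" "y = cyl (2 / 3 - x $ fst (snd F)) (cis (\<theta> F) * fz \<alpha> F x)"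
      by blast
    have "Fl \<subseteq> flags" using fan by (simp add: fan_def)
    then have "F \<in> flags" using F(1) by blast
    then have "fst F \<in> T" by (auto simp: flags_def)
    then have "(fst F, x) \<in> dom Fl (P 0)" unfolding dom_def using F by (auto intro!: bexI[OF _ F(1)])
    then show "y \<in> fan_map Fl \<theta> \<alpha> P ` dom Fl (P 0)"
      unfolding F(4) e[OF F(1-3), symmetric] by (rule imageI)
  qed
qed

lemma good_fanI:
  assumes fan: "fan Fl \<theta> \<alpha> P" and W: "open {v :: real^3. W (v $ 1) (Complex (v $ 2) (v $ 3))}"
    and im: "\<And>h z. 0 \<le> h \<Longrightarrow> W h z \<Longrightarrow> \<exists>F\<in>Fl. \<exists>x\<in>trunc_tet. P 0 F x \<and> h = 2 / 3 - x $ fst (snd F) \<and> z = cis (\<theta> F) * fz \<alpha> F x"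
    and mi: "\<And>F x. F \<in> Fl \<Longrightarrow> x \<in> trunc_tet \<Longrightarrow> P 0 F x \<Longrightarrow> W (2 / 3 - x $ fst (snd F)) (cis (\<theta> F) * fz \<alpha> F x)"
    and bd: "\<And>F x a. F \<in> Fl \<Longrightarrow> x \<in> trunc_tet \<Longrightarrow> P 0 F x \<Longrightarrow> a \<noteq> fst (snd F) \<Longrightarrow> x $ a < 2 / 3"
  shows "good_fan Fl \<theta> \<alpha> P"
proof -
  have "fan_map Fl \<theta> \<alpha> P ` dom Fl (P 0) = half_space3 \<inter> {v. W (v $ 1) (Complex (v $ 2) (v $ 3))}"
    unfolding fan_image[OF fan]
  proof (intro equalityI subsetI)
    fix v assume "v \<in> {cyl (2 / 3 - x $ fst (snd F)) (cis (\<theta> F) * fz \<alpha> F x) | F x. F \<in> Fl \<and> x \<in> trunc_tet \<and> P 0 F x}"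
    then obtain F x where F: "F \<in> Fl" "x \<in> trunc_tet" "P 0 F x" "v = cyl (2 / 3 - x $ fst (snd F)) (cis (\<theta> F) * fz \<alpha> F x)"
      by blast
    have v: "v $ 1 = 2 / 3 - x $ fst (snd F)" "Complex (v $ 2) (v $ 3) = cis (\<theta> F) * fz \<alpha> F x"
      unfolding F(4) cyl_nth by (simp_all only: complex_surj)
    show "v \<in> half_space3 \<inter> {v. W (v $ 1) (Complex (v $ 2) (v $ 3))}"
    proof (intro IntI CollectI)
      show "v \<in> half_space3"
        unfolding half_space3_def mem_Collect_eq v(1) using trunc_nonneg(2)[OF F(2), of "fst (snd F)"] by simp
      show "W (v $ 1) (Complex (v $ 2) (v $ 3))" unfolding v by (rule mi[OF F(1-3)])
    qed
  next
    fix v assume "v \<in> half_space3 \<inter> {v. W (v $ 1) (Complex (v $ 2) (v $ 3))}"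
    then have "0 \<le> v $ 1" "W (v $ 1) (Complex (v $ 2) (v $ 3))" by (auto simp: half_space3_def)
    from im[OF this] obtain F x where F: "F \<in> Fl" "x \<in> trunc_tet" "P 0 F x" "v $ 1 = 2 / 3 - x $ fst (snd F)"
      "Complex (v $ 2) (v $ 3) = cis (\<theta> F) * fz \<alpha> F x" by blast
    have "v = cyl (v $ 1) (Complex (v $ 2) (v $ 3))" by (rule cyl_nths)
    also have "\<dots> = cyl (2 / 3 - x $ fst (snd F)) (cis (\<theta> F) * fz \<alpha> F x)" by (simp only: F(4,5))
    finally have "v = cyl (2 / 3 - x $ fst (snd F)) (cis (\<theta> F) * fz \<alpha> F x)" .
    then show "v \<in> {cyl (2 / 3 - x $ fst (snd F)) (cis (\<theta> F) * fz \<alpha> F x) | F x. F \<in> Fl \<and> x \<in> trunc_tet \<and> P 0 F x}"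
      using F(1-3) by blast
  qed
  then have "openin (top_of_set half_space3) (fan_map Fl \<theta> \<alpha> P ` dom Fl (P 0))"
    using W by (simp add: openin_open_Int)
  then show ?thesis unfolding good_fan_def using fan bd by blast
qed

lemma fanI:
  assumes "Fl \<subseteq> flags" "0 < \<alpha>" "\<alpha> < pi"
    and "\<And>F x. F \<in> Fl \<Longrightarrow> x \<in> trunc_tet \<Longrightarrow> P 0 F x \<Longrightarrow> P 1 F x"
    and "\<And>F x. F \<in> Fl \<Longrightarrow> x \<in> trunc_tet \<Longrightarrow> P 1 F x \<Longrightarrow> P 2 F x"
    and "\<And>F. F \<in> Fl \<Longrightarrow> open {x. P 0 F x}" "\<And>F. F \<in> Fl \<Longrightarrow> closed {x. P 1 F x}" "\<And>F. F \<in> Fl \<Longrightarrow> open {x. P 2 F x}"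
    and "\<And>F F' x. F \<in> Fl \<Longrightarrow> F' \<in> Fl \<Longrightarrow> x \<in> trunc_tet \<Longrightarrow> fst F = fst F' \<Longrightarrow> P 2 F x \<Longrightarrow> P 2 F' x \<Longrightarrow> F = F'"
    and "\<And>l t i j x y m. l \<in> {0, 1, 2} \<Longrightarrow> (t, i, j) \<in> Fl \<Longrightarrow> x \<in> trunc_tet \<Longrightarrow> y \<in> trunc_tet \<Longrightarrow>
        P l (t, i, j) x \<Longrightarrow> x $ m = 0 \<Longrightarrow> (\<forall>a. y $ gl t m a = x $ a) \<Longrightarrow>
        (m = third i j \<and> nx (t, i, j) \<in> Fl \<and> P l (nx (t, i, j)) y \<and>
           cis (\<theta> (nx (t, i, j))) = cis (\<theta> (t, i, j)) * cis \<alpha>) \<or>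
        (m = third j i \<and> pv (t, i, j) \<in> Fl \<and> P l (pv (t, i, j)) y \<and>
           cis (\<theta> (t, i, j)) = cis (\<theta> (pv (t, i, j))) * cis \<alpha>)"
    and "\<And>F F' x x'. F \<in> Fl \<Longrightarrow> F' \<in> Fl \<Longrightarrow> x \<in> trunc_tet \<Longrightarrow> x' \<in> trunc_tet \<Longrightarrow> P 2 F x \<Longrightarrow> P 2 F' x' \<Longrightarrow>
        x $ fst (snd F) = x' $ fst (snd F') \<Longrightarrow> cis (\<theta> F) * fz \<alpha> F x = cis (\<theta> F') * fz \<alpha> F' x' \<Longrightarrow>
        equivclp (point_step T g) (fst F, x) (fst F', x')"
  shows "fan Fl \<theta> \<alpha> P"
  unfolding fan_def
proof (intro conjI ballI allI impI)
  show "Fl \<subseteq> flags" by (rule assms(1))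
  show "0 < \<alpha>" by (rule assms(2))
  show "\<alpha> < pi" by (rule assms(3))
qed (rule assms(4-); assumption)+

lemma fz_tet: "fz (pi / 2) F x = Complex (x $ third (fst (snd F)) (snd (snd F))) (x $ third (snd (snd F)) (fst (snd F)))"
  by (simp add: complex_eq_iff)

text \<open>The margin \<delta> makes room for a closed set between the two open ones.\<close>

definition tet_pred :: "real \<Rightarrow> nat \<Rightarrow> nat \<times> 4 \<times> 4 \<Rightarrow> real^4 \<Rightarrow> bool" where
  "tet_pred \<delta> l F x = (if l = 0 then (\<forall>a. \<delta> < x $ a) \<and> (\<forall>a. a \<noteq> fst (snd F) \<longrightarrow> x $ a < 2 / 3)
     else if l = 1 then (\<forall>a. \<delta> \<le> x $ a) else (\<forall>a. 0 < x $ a))"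

text \<open>All coordinates are positive, so no gluing step starts here and the condition on steps
  holds vacuously. The right angle makes the sector coordinates cartesian.\<close>

lemma tet_fan:
  assumes F: "(t, i, j) \<in> flags" and d: "0 < \<delta>"
  shows "good_fan {(t, i, j)} (\<lambda>_. 0) (pi / 2) (tet_pred \<delta>)"
proof -
  have ij: "i \<noteq> j" "t \<in> T" using F by (auto simp: flags_def)
  have pos: "0 < x $ a" if "tet_pred \<delta> l F x" for l F x a
    using that d unfolding tet_pred_def by (metis less_le_trans order_less_trans)
  have fan: "fan {(t, i, j)} (\<lambda>_. 0) (pi / 2) (tet_pred \<delta>)"
  proof (rule fanI)
    show "{(t, i, j)} \<subseteq> flags" using F by simp
    show "tet_pred \<delta> 1 F x" if "tet_pred \<delta> 0 F x" for F x using that by (auto simp: tet_pred_def less_imp_le)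
    show "tet_pred \<delta> 2 F x" if "tet_pred \<delta> 1 F x" for F x using pos[OF that] by (simp add: tet_pred_def)
    show "open {x. tet_pred \<delta> 0 F x}" for F
      unfolding tet_pred_def by (simp, intro open_Collect_conj open_all4 open_imp4 open_Collect_less continuous_intros)
    show "closed {x. tet_pred \<delta> 1 F x}" for F
      unfolding tet_pred_def by (simp, intro closed_Collect_all closed_Collect_le continuous_intros)
    show "open {x. tet_pred \<delta> 2 F x}" for F
      unfolding tet_pred_def by (simp, intro open_all4 open_Collect_less continuous_intros)
    show "F = F'" if "F \<in> {(t, i, j)}" "F' \<in> {(t, i, j)}" for F F' using that by simp
  next
    fix l t' i' j' x y m assume "tet_pred \<delta> l (t', i', j') x" "x $ m = 0"
    then show "(m = third i' j' \<and> nx (t', i', j') \<in> {(t, i, j)} \<and> tet_pred \<delta> l (nx (t', i', j')) y \<and>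
           cis 0 = cis 0 * cis (pi / 2)) \<or>
        (m = third j' i' \<and> pv (t', i', j') \<in> {(t, i, j)} \<and> tet_pred \<delta> l (pv (t', i', j')) y \<and>
           cis 0 = cis 0 * cis (pi / 2))" using pos by (metis less_irrefl)
  next
    fix F F' x x' assume FF: "F \<in> {(t, i, j)}" "F' \<in> {(t, i, j)}" and x: "x \<in> trunc_tet" "x' \<in> trunc_tet"
      and e: "x $ fst (snd F) = x' $ fst (snd F')" "cis 0 * fz (pi / 2) F x = cis 0 * fz (pi / 2) F' x'"
    have "x = x'"
      using e FF x trunc_subset unfolding fz_tet by (intro bary_eqI[OF ij(1)]) auto
    then show "equivclp (point_step T g) (fst F, x) (fst F', x')" using FF by simp
  qed auto
  \<comment> \<open>With x_i = 2/3 - h the remaining coordinate x_j is 1/3 + h - Re z - Im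
    z.\<close>
  define W where "W h z \<longleftrightarrow> (\<forall>r\<in>{2 / 3 - h, 1 / 3 + h - Re z - Im z, Re z, Im z}. \<delta> < r) \<and>
     (\<forall>r\<in>{1 / 3 + h - Re z - Im z, Re z, Im z}. r < 2 / 3)" for h :: real and z :: complex
  show ?thesis
  proof (rule good_fanI[OF fan, where W = W])
    show "open {v :: real^3. W (v $ 1) (Complex (v $ 2) (v $ 3))}"
      unfolding W_def by (simp, intro open_Collect_conj open_Collect_less continuous_intros)
    fix h z assume h: "0 \<le> h" "W h z"
    have "bary i j (2 / 3 - h) (Re z) (Im z) \<in> trunc_tet" "tet_pred \<delta> 0 (t, i, j) (bary i j (2 / 3 - h) (Re z) (Im z))"
      using h d unfolding bary_trunc[OF ij(1)] tet_pred_def W_def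
      by (auto simp: all_third[OF ij(1)] bary_nth[OF ij(1)])
    moreover have "z = cis 0 * fz (pi / 2) (t, i, j) (bary i j (2 / 3 - h) (Re z) (Im z))"
      unfolding fz_tet by (simp add: bary_nth[OF ij(1)])
    ultimately show "\<exists>F\<in>{(t, i, j)}. \<exists>x\<in>trunc_tet. tet_pred \<delta> 0 F x \<and> h = 2 / 3 - x $ fst (snd F) \<and> z = cis 0 * fz (pi / 2) F x"
      by (intro bexI[of _ "(t, i, j)"] bexI[of _ "bary i j (2 / 3 - h) (Re z) (Im z)"]) (simp_all add: bary_nth[OF ij(1)])
  next
    fix F x assume "F \<in> {(t, i, j)}" and x: "x \<in> trunc_tet" "tet_pred \<delta> 0 F x"
    then have F: "F = (t, i, j)" by simp
    have "1 / 3 + (2 / 3 - x $ i) - x $ third i j - x $ third j i = x $ j"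
      using x by (simp add: trunc_tet_iff sum_third[OF ij(1)])
    then show "W (2 / 3 - x $ fst (snd F)) (cis 0 * fz (pi / 2) F x)"
      unfolding W_def fz_tet using x third_neq[OF ij(1)] ij(1) by (simp add: F tet_pred_def)
  next
    show "x $ a < 2 / 3" if "tet_pred \<delta> 0 F x" "a \<noteq> fst (snd F)" for F x a
      using that by (simp add: tet_pred_def)
  qed
qed

text \<open>Near the face \<open>f\<close> its coordinate is the strict minimum, hence the only one
  that can vanish.\<close>

definition face_pred :: "real \<Rightarrow> nat \<Rightarrow> 4 \<Rightarrow> 4 \<Rightarrow> real^4 \<Rightarrow> bool" where
  "face_pred \<delta> l f i x = (if l = 0 then (\<forall>a. a \<noteq> f \<longrightarrow> x $ f + \<delta> < x $ a) \<and> (\<forall>a. a \<noteq> f \<and> a \<noteq> i \<longrightarrow> x $ a < 2 / 3)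
     else if l = 1 then (\<forall>a. a \<noteq> f \<longrightarrow> x $ f + \<delta> \<le> x $ a) else (\<forall>a. a \<noteq> f \<longrightarrow> x $ f < x $ a))"

lemma face_pred_perm:
  assumes "bij \<sigma>" "\<forall>a. y $ \<sigma> a = x $ a"
  shows "face_pred \<delta> l (\<sigma> f) (\<sigma> i) y \<longleftrightarrow> face_pred \<delta> l f i x"
proof -
  have 1: "(\<forall>a. a \<noteq> \<sigma> f \<longrightarrow> Q (y $ a)) \<longleftrightarrow> (\<forall>a. a \<noteq> f \<longrightarrow> Q (x $ a))" for Q
    using assms by (metis bij_pointE)
  have 2: "(\<forall>a. a \<noteq> \<sigma> f \<and> a \<noteq> \<sigma> i \<longrightarrow> Q (y $ a)) \<longleftrightarrow> (\<forall>a. a \<noteq> f \<and> a \<noteq> i \<longrightarrow> Q (x $ a))" for Q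
    using assms by (metis bij_pointE)
  show ?thesis
    unfolding face_pred_def assms(2)[rule_format] 1[of "\<lambda>r. x $ f + \<delta> < r"] 1[of "\<lambda>r. x $ f + \<delta> \<le> r"]
      1[of "\<lambda>r. x $ f < r"] 2[of "\<lambda>r. r < 2 / 3"] by (rule refl)
qed

lemma face_pred_min: "face_pred \<delta> l f i x \<Longrightarrow> 0 < \<delta> \<Longrightarrow> a \<noteq> f \<Longrightarrow> x $ f < x $ a"
  unfolding face_pred_def by (smt (verit))

lemma pv_neq: "F \<in> flags \<Longrightarrow> pv F \<noteq> F"
proof
  assume F: "F \<in> flags" "pv F = F"
  then have "nx F = F" using nx_pv by metis
  then have "fpos F = Suc (fpos F) mod len (fst (fcl F))" using fpos_nx[OF F(1)] by simp
  moreover have "3 \<le> len (fst (fcl F))" "fpos F < len (fst (fcl F))" using len_fcl fpos_less F(1) by auto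
  ultimately show False by (auto simp: mod_Suc split: if_splits)
qed

text \<open>The tetrahedra on the two sides of a face unfold into the quadrants above and below the
  positive real axis; \<open>zf\<close> is the face as seen from either side.\<close>

lemma face_fan:
  assumes F: "(t, i, j) \<in> flags" and d: "0 < \<delta>"
  defines "F0 \<equiv> (t, i, j)" and "F1 \<equiv> pv (t, i, j)"
  defines "zf \<equiv> (\<lambda>F. if F = F0 then third j i else third (fst (snd F1)) (snd (snd F1)))"
  shows "good_fan {F0, F1} (\<lambda>F. if F = F0 then 0 else - (pi / 2)) (pi / 2)
     (\<lambda>l F. face_pred \<delta> l (zf F) (fst (snd F)))"
proof -
  have ij: "i \<noteq> j" "t \<in> T" using F by (auto simp: flags_def)
  let ?f = "third j i"
  define t1 where "t1 = fst F1"
  define i1 where "i1 = fst (snd F1)"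
  define j1 where "j1 = snd (snd F1)"
  note t1_i1_j1_def = t1_def i1_def j1_def
  have F1: "F1 = (t1, i1, j1)" by (simp add: t1_i1_j1_def)
  have F1e: "t1 = nb t ?f" "i1 = gl t ?f i" "j1 = gl t ?f j" using F1 by (simp_all add: F1_def pv_def)
  have F1f: "F1 \<in> flags" unfolding F1_def by (rule pv_flags[OF F])
  then have ij1: "i1 \<noteq> j1" "t1 \<in> T" by (auto simp: flags_def F1)
  have ne: "F1 \<noteq> F0" unfolding F1_def F0_def by (rule pv_neq[OF F])
  have nx1: "nx (t1, i1, j1) = (t, i, j)" using nx_pv[OF F] F1 by (simp add: F1_def)
  have th1: "third i1 j1 = gl t ?f ?f" "third j1 i1 = gl t ?f (third i j)"
    using odd_gl[OF ij(2,1), of ?f] odd_gl[OF ij(2) ij(1)[symmetric], of ?f] F1e by auto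
  have pvF0: "pv F0 = F1" by (simp add: F0_def F1_def)
  have zf: "zf F0 = ?f" "zf F1 = third i1 j1" using ne by (simp_all add: zf_def t1_i1_j1_def)
  have g1: "gl t1 (third i1 j1) = inv (gl t ?f)" using glueD(4)[OF ij(2)] F1e th1 by simp
  have bk: "gl t1 (third i1 j1) i1 = i" "gl t1 (third i1 j1) (third i1 j1) = ?f"
    unfolding g1 using inv_gl[OF ij(2)] F1e th1 by simp_all
  let ?\<theta> = "\<lambda>F. if F = F0 then 0 else - (pi / 2)"
  let ?P = "\<lambda>l F. face_pred \<delta> l (zf F) (fst (snd F))"
  have cs: "cis (?\<theta> F0) = cis (?\<theta> F1) * cis (pi / 2)" using ne by (simp add: cis_mult)
  have zero: "m = zf F" if "?P l F x" "x \<in> trunc_tet" "x $ m = 0" for l F x m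
    using face_pred_min[OF that(1) d, of m] trunc_nonneg(1)[OF that(2), of "zf F"] that(3) by force
  have fan: "fan {F0, F1} ?\<theta> (pi / 2) ?P"
  proof (rule fanI)
    show "{F0, F1} \<subseteq> flags" using F F1f by (simp add: F0_def)
    show "?P 1 F x" if "?P 0 F x" for F x using that by (auto simp: face_pred_def less_imp_le)
    show "?P 2 F x" if "?P 1 F x" for F x using face_pred_min[OF that d] by (simp add: face_pred_def)
    show "open {x. ?P 0 F x}" for F
      unfolding face_pred_def by (simp, intro open_Collect_conj open_all4 open_imp4 open_Collect_less continuous_intros)
    show "closed {x. ?P 1 F x}" for F
      unfolding face_pred_def by (simp, intro closed_Collect_all closed_imp4 closed_Collect_le continuous_intros)
    show "open {x. ?P 2 F x}" for F
      unfolding face_pred_def by (simp, intro open_all4 open_imp4 open_Collect_less continuous_intros)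
  next
    fix F F' x assume FF: "F \<in> {F0, F1}" "F' \<in> {F0, F1}" and tt: "fst F = fst F'"
      and x: "?P 2 F x" "?P 2 F' x"
    show "F = F'"
    proof (rule ccontr)
      assume "F \<noteq> F'"
      then have "{F, F'} = {F0, F1}" using FF by auto
      then have t: "t = t1" and P: "?P 2 F0 x" "?P 2 F1 x" using tt x by (auto simp: doubleton_eq_iff F0_def F1)
      \<comment> \<open>The tetrahedron is glued to itself here. Its two faces are then different,
        and a point cannot have the coordinates of both as strict minimum.\<close>
      have "nb t ?f = t" using t F1e(1) by simp
      then have "gl t ?f ?f \<noteq> ?f" using glueD(3)[OF ij(2), of ?f] by simp
      then have "third i1 j1 \<noteq> ?f" unfolding th1(1) .
      then show False using face_pred_min[OF P(1) d, of "third i1 j1"] face_pred_min[OF P(2) d, of ?f] zf by auto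
    qed
  next
    fix l :: nat and t' i' j' x y m
    assume FF: "(t', i', j') \<in> {F0, F1}" and x: "x \<in> trunc_tet" "?P l (t', i', j') x" "x $ m = 0"
      and y: "\<forall>a. y $ gl t' m a = x $ a"
    have m: "m = zf (t', i', j')" using zero[OF x(2,1,3)] .
    show "(m = third i' j' \<and> nx (t', i', j') \<in> {F0, F1} \<and> ?P l (nx (t', i', j')) y \<and>
           cis (?\<theta> (nx (t', i', j'))) = cis (?\<theta> (t', i', j')) * cis (pi / 2)) \<or>
        (m = third j' i' \<and> pv (t', i', j') \<in> {F0, F1} \<and> ?P l (pv (t', i', j')) y \<and>
           cis (?\<theta> (t', i', j')) = cis (?\<theta> (pv (t', i', j'))) * cis (pi / 2))"
    proof (cases "(t', i', j') = F0")
      case True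
      then have e: "t' = t" "i' = i" "j' = j" by (auto simp: F0_def)
      have mf: "m = ?f" using m True zf by simp
      have "?P l F1 y"
        using face_pred_perm[OF glueD(2)[OF ij(2)] y[unfolded e mf], of \<delta> l ?f i] x(2) True zf th1 F1e
        by (simp add: F1 F0_def)
      then show ?thesis using e mf cs ne pvF0 unfolding e mf F0_def[symmetric] pvF0 by simp
    next
      case False
      then have "(t', i', j') = F1" using FF by simp
      then have e: "t' = t1" "i' = i1" "j' = j1" by (auto simp: F1)
      have mf: "m = third i1 j1" using m zf e F1 by simp
      have "?P l F0 y"
        using face_pred_perm[OF glueD(2)[OF ij1(2)] y[unfolded e mf], of \<delta> l "third i1 j1" i1] x(2) zf bk e
        by (simp add: F0_def F1[symmetric]) (simp add: F1)
      then show ?thesis using e mf cs nx1 by (simp add: F0_def[symmetric] F1[symmetric])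
    qed
  next
    fix F F' x x' assume FF: "F \<in> {F0, F1}" "F' \<in> {F0, F1}" and x: "x \<in> trunc_tet" "x' \<in> trunc_tet"
      and e: "x $ fst (snd F) = x' $ fst (snd F')" "cis (?\<theta> F) * fz (pi / 2) F x = cis (?\<theta> F') * fz (pi / 2) F' x'"
    have tx: "x \<in> tetrahedron" "x' \<in> tetrahedron" using x trunc_subset by auto
    have cross: "equivclp (point_step T g) (t1, y') (t, y)"
      if "y \<in> trunc_tet" "y' \<in> trunc_tet" "y $ i = y' $ i1" "cis 0 * fz (pi / 2) F0 y = cis (- (pi / 2)) * fz (pi / 2) F1 y'" for y y'
    proof -
      have "y $ third i j = y' $ third j1 i1 \<and> y $ third j i = - y' $ third i1 j1"
        using that(4) unfolding fz_tet by (simp add: complex_eq_iff F0_def F1)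
      moreover have "0 \<le> y $ third j i" "0 \<le> y' $ third i1 j1" using that trunc_nonneg by auto
      ultimately have "point_step T g (t1, y') (t, y)"
        using that trunc_subset F1f F1 by (intro step_nxI[OF _ _ _ nx1]) auto
      then show ?thesis by (rule r_into_equivclp)
    qed
    consider "F = F'" | "F = F0" "F' = F1" | "F = F1" "F' = F0" using FF by auto
    then show "equivclp (point_step T g) (fst F, x) (fst F', x')"
    proof cases
      case 1
      have "fst (snd F) \<noteq> snd (snd F)" using FF(1) ij(1) ij1(1) by (auto simp: F0_def F1)
      moreover have "fz (pi / 2) F x = fz (pi / 2) F x'" using e(2) 1 by simp
      ultimately have "x = x'" using e(1) 1 tx unfolding fz_tet by (intro bary_eqI) auto
      then show ?thesis using 1 by simp
    next
      case 2
      then show ?thesis using cross[OF x] e ne equivclp_sym by (auto simp: F0_def F1)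
    next
      case 3
      then show ?thesis using cross[OF x(2,1)] e ne by (auto simp: F0_def F1)
    qed
  qed auto
  \<comment> \<open>On either side |Im z| is the coordinate that belongs to the face and must be the
    smallest.\<close>
  define W where "W h z \<longleftrightarrow> (\<forall>r\<in>{2 / 3 - h, 1 / 3 + h - Re z - \<bar>Im z\<bar>, Re z}. \<bar>Im z\<bar> + \<delta> < r) \<and>
     (\<forall>r\<in>{1 / 3 + h - Re z - \<bar>Im z\<bar>, Re z}. r < 2 / 3)" for h :: real and z :: complex
  have z1: "cis (- (pi / 2)) * fz (pi / 2) F1 x = Complex (x $ third j1 i1) (- (x $ third i1 j1))" for x
    unfolding fz_tet by (simp add: complex_eq_iff F1)
  have z0: "cis 0 * fz (pi / 2) F0 x = Complex (x $ third i j) (x $ third j i)" for x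
    unfolding fz_tet by (simp add: F0_def)
  show ?thesis
  proof (rule good_fanI[OF fan, where W = W])
    show "open {v :: real^3. W (v $ 1) (Complex (v $ 2) (v $ 3))}"
      unfolding W_def by (simp, intro open_Collect_conj open_Collect_less continuous_intros)
    fix h z assume h: "0 \<le> h" "W h z"
    show "\<exists>F\<in>{F0, F1}. \<exists>x\<in>trunc_tet. ?P 0 F x \<and> h = 2 / 3 - x $ fst (snd F) \<and> z = cis (?\<theta> F) * fz (pi / 2) F x"
    proof (cases "0 \<le> Im z")
      case True
      let ?x = "bary i j (2 / 3 - h) (Re z) (Im z)"
      note b = bary_nth[OF ij(1), of "2 / 3 - h" "Re z" "Im z"]
      have "?x \<in> trunc_tet" using h d True unfolding bary_trunc[OF ij(1)] W_def by auto
      moreover have "face_pred \<delta> 0 ?f i ?x"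
        using h d True third_neq[OF ij(1)] ij(1) unfolding face_pred_def W_def by (auto simp: all_third[OF ij(1)] b)
      moreover have "z = cis 0 * fz (pi / 2) F0 ?x" unfolding z0 b by simp
      ultimately show ?thesis
        using zf(1) b(1) by (intro bexI[of _ F0] bexI[of _ ?x]) (simp_all add: F0_def)
    next
      case False
      let ?x = "bary i1 j1 (2 / 3 - h) (- Im z) (Re z)"
      note b = bary_nth[OF ij1(1), of "2 / 3 - h" "- Im z" "Re z"]
      have "?x \<in> trunc_tet" using h d False unfolding bary_trunc[OF ij1(1)] W_def by auto
      moreover have "face_pred \<delta> 0 (third i1 j1) i1 ?x"
        using h d False third_neq[OF ij1(1)] ij1(1) unfolding face_pred_def W_def by (auto simp: all_third[OF ij1(1)] b)
      moreover have "z = cis (- (pi / 2)) * fz (pi / 2) F1 ?x" unfolding z1 b by simp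
      ultimately show ?thesis
        using zf(2) b(1) ne by (intro bexI[of _ F1] bexI[of _ ?x]) (simp_all add: F1)
    qed
  next
    fix F x assume FF: "F \<in> {F0, F1}" and x: "x \<in> trunc_tet" "?P 0 F x"
    show "W (2 / 3 - x $ fst (snd F)) (cis (?\<theta> F) * fz (pi / 2) F x)"
    proof (cases "F = F0")
      case True
      have "1 / 3 + (2 / 3 - x $ i) - x $ third i j - x $ third j i = x $ j"
        using x by (simp add: trunc_tet_iff sum_third[OF ij(1)])
      moreover have "0 \<le> x $ third j i" using trunc_nonneg[OF x(1)] by simp
      moreover have "x $ third j i + \<delta> < x $ i" "x $ third j i + \<delta> < x $ j" "x $ third j i + \<delta> < x $ third i j"
        "x $ j < 2 / 3" "x $ third i j < 2 / 3"
        using x(2) third_neq[OF ij(1)] ij(1) True zf(1) by (auto simp: face_pred_def F0_def)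
      ultimately have "W (2 / 3 - x $ i) (Complex (x $ third i j) (x $ third j i))"
        unfolding W_def by auto
      moreover have "fst (snd F) = i" using True by (simp add: F0_def)
      ultimately show ?thesis using z0[of x] True by (simp only: if_True simp_thms)
    next
      case False
      then have F: "F = F1" using FF by simp
      have "1 / 3 + (2 / 3 - x $ i1) - x $ third j1 i1 - x $ third i1 j1 = x $ j1"
        using x by (simp add: trunc_tet_iff sum_third[OF ij1(1)])
      moreover have "0 \<le> x $ third i1 j1" using trunc_nonneg[OF x(1)] by simp
      moreover have "x $ third i1 j1 + \<delta> < x $ i1" "x $ third i1 j1 + \<delta> < x $ j1" "x $ third i1 j1 + \<delta> < x $ third j1 i1"
        "x $ j1 < 2 / 3" "x $ third j1 i1 < 2 / 3"
        using x(2) third_neq[OF ij1(1)] ij1(1) F zf(2) by (auto simp: face_pred_def F1)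
      ultimately have "W (2 / 3 - x $ i1) (Complex (x $ third j1 i1) (- (x $ third i1 j1)))"
        unfolding W_def by auto
      moreover have "fst (snd F) = i1" using F F1 by simp
      ultimately show ?thesis using z1[of x] False F by (simp only: if_False simp_thms)
    qed
  next
    fix F x a assume FF: "F \<in> {F0, F1}" and x: "x \<in> trunc_tet" "?P 0 F x" and a: "a \<noteq> fst (snd F)"
    show "x $ a < 2 / 3"
    proof (cases "a = zf F")
      case True
      have "fst (snd F) \<noteq> zf F" using a True by simp
      then show ?thesis
        using face_pred_min[OF x(2) d, of "fst (snd F)"] trunc_nonneg(2)[OF x(1), of "fst (snd F)"] True by simp
    qed (use x a in \<open>simp add: face_pred_def\<close>)
  qed
qed

text \<open>A point of an edge has a coordinate of at least 1/2 at one end, so 5/12 is low enough to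
  cover the edges by charts from both ends, and 3/8 leaves room around the closed set. Divided by
  sin \<alpha>, the radii bound the two transversal coordinates by 1/24; then x_j > 1 - 2/3 - 1/12 =
  1/4, so that the two ends of the edge stand out from the other vertices.\<close>

definition edge_pred :: "real \<Rightarrow> nat \<Rightarrow> nat \<times> 4 \<times> 4 \<Rightarrow> real^4 \<Rightarrow> bool" where
  "edge_pred \<alpha> l F x = (if l = 0 then 5 / 12 < x $ fst (snd F) \<and> cmod (fz \<alpha> F x) < sin \<alpha> / 48
     else if l = 1 then 5 / 12 \<le> x $ fst (snd F) \<and> cmod (fz \<alpha> F x) \<le> sin \<alpha> / 48
     else 3 / 8 < x $ fst (snd F) \<and> cmod (fz \<alpha> F x) < sin \<alpha> / 24)"

lemma edge_pred_cong:
  assumes "edge_pred \<alpha> l F x" "cmod (fz \<alpha> F' y) = cmod (fz \<alpha> F x)" "y $ fst (snd F') = x $ fst (snd F)"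
  shows "edge_pred \<alpha> l F' y"
  using assms(1) unfolding edge_pred_def assms(2,3) .

lemma edge_pred_bounds:
  assumes e: "edge_pred \<alpha> l (t, i, j) x" and x: "x \<in> trunc_tet" and s: "0 < sin \<alpha>" and ij: "i \<noteq> j"
  shows "3 / 8 < x $ i" "x $ third i j < 1 / 24" "x $ third j i < 1 / 24" "1 / 4 < x $ j"
proof -
  have "cmod (fz \<alpha> (t, i, j) x) < sin \<alpha> / 24" "3 / 8 < x $ i"
    using e s unfolding edge_pred_def by (auto split: if_splits)
  moreover have "x $ third i j * sin \<alpha> \<le> cmod (fz \<alpha> (t, i, j) x)" "x $ third j i * sin \<alpha> \<le> cmod (fz \<alpha> (t, i, j) x)"
    using sector_bound[of "x $ third i j" "x $ third j i" \<alpha>] trunc_nonneg[OF x] s by simp_all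
  ultimately have "x $ third i j * sin \<alpha> < 1 / 24 * sin \<alpha>" "x $ third j i * sin \<alpha> < 1 / 24 * sin \<alpha>"
    by linarith+
  then show kl: "x $ third i j < 1 / 24" "x $ third j i < 1 / 24" using s by (simp_all only: mult_less_cancel_right_pos)
  show "3 / 8 < x $ i" by fact
  have "x $ i + x $ j + x $ third i j + x $ third j i = 1" using x by (simp add: trunc_tet_iff sum_third[OF ij])
  then show "1 / 4 < x $ j" using kl trunc_nonneg(2)[OF x, of i] by linarith
qed

text \<open>Points of the edge itself are passed on through all tetrahedra around it; this is the
  case of the common apex of the sectors.\<close>

lemma edge_chain:
  assumes F: "F \<in> flags" and \<xi>: "1 / 3 \<le> \<xi>" "\<xi> \<le> 2 / 3"
  shows "equivclp (point_step T g) (fst F, bary (fst (snd F)) (snd (snd F)) \<xi> 0 0)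
    (fst ((nx ^^ m) F), bary (fst (snd ((nx ^^ m) F))) (snd (snd ((nx ^^ m) F))) \<xi> 0 0)"
proof (induction m)
  case 0
  then show ?case by simp
next
  case (Suc m)
  obtain t i j where G: "(nx ^^ m) F = (t, i, j)" by (cases "(nx ^^ m) F")
  obtain t' i' j' where G': "nx (t, i, j) = (t', i', j')" by (cases "nx (t, i, j)")
  have fl: "(t, i, j) \<in> flags" using nx_funpow[OF F, of m] G by simp
  then have "(t', i', j') \<in> flags" using nx_flags[OF fl] G' by simp
  then have ij: "i \<noteq> j" "i' \<noteq> j'" using fl by (auto simp: flags_def)
  have tr: "bary a b \<xi> 0 0 \<in> tetrahedron" if "a \<noteq> b" for a b
    using bary_trunc[OF that, of \<xi> 0 0] \<xi> trunc_subset by auto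
  have "point_step T g (t, bary i j \<xi> 0 0) (t', bary i' j' \<xi> 0 0)"
    by (rule step_nxI[OF fl tr[OF ij(1)] _ G' tr[OF ij(2)]]) (simp_all add: bary_nth ij)
  then show ?case using Suc G G' by (simp) (meson equivclp_trans r_into_equivclp)
qed

text \<open>A directed class has one flag at each position 0, ..., n - 1, and the flag at position m
  fills the m-th sector. By \<open>sector_exists\<close> the sectors cover the plane, and by
  \<open>sector_unique\<close> they overlap only where points are glued.\<close>

lemma edge_fan:
  assumes G: "G \<in> flags"
  defines "n \<equiv> len (fst (fcl G))"
  defines "\<alpha> \<equiv> 2 * pi / real n"
  shows "good_fan {F \<in> flags. fcl F = fcl G} (\<lambda>F. \<alpha> * real (fpos F)) \<alpha> (edge_pred \<alpha>)"
proof -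
  let ?Fl = "{F \<in> flags. fcl F = fcl G}"
  let ?\<theta> = "\<lambda>F. \<alpha> * real (fpos F)"
  have n: "n \<ge> 3" using len_fcl[OF G] by (simp add: n_def)
  have ad: "\<alpha> = 2 * pi / real n" by (simp add: \<alpha>_def)
  have al: "0 < \<alpha>" "\<alpha> < pi" using sector_width[OF n] by (auto simp: \<alpha>_def)
  have sa: "0 < sin \<alpha>" using al by (intro sin_gt_zero) auto
  have nF: "len (fst (fcl F)) = n" if "F \<in> ?Fl" for F using that by (simp add: n_def)
  have cnx: "cis (?\<theta> (nx F)) = cis (?\<theta> F) * cis \<alpha>" if "F \<in> ?Fl" for F
  proof -
    have "fpos (nx F) = Suc (fpos F) mod n" using fpos_nx[of F] nF[OF that] that by simp
    then have "cis (?\<theta> (nx F)) = cis (\<alpha> * real (Suc (fpos F)))"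
      using cis_two_pi_mult[of n "Suc (fpos F)"] n by (simp add: \<alpha>_def)
    then show ?thesis by (simp add: cis_mult algebra_simps)
  qed
  have cfz: "continuous_on UNIV (\<lambda>x. fz \<alpha> F x)" for F by (intro continuous_intros)
  have fan: "fan ?Fl ?\<theta> \<alpha> (edge_pred \<alpha>)"
  proof (rule fanI)
    show "?Fl \<subseteq> flags" by auto
    show "0 < \<alpha>" "\<alpha> < pi" by fact+
    show "edge_pred \<alpha> 1 F x" if "edge_pred \<alpha> 0 F x" for F x using that by (simp add: edge_pred_def)
    show "edge_pred \<alpha> 2 F x" if "edge_pred \<alpha> 1 F x" for F x using that sa by (simp add: edge_pred_def)
    show "open {x. edge_pred \<alpha> 0 F x}" for F
      unfolding edge_pred_def by (simp, intro open_Collect_conj open_Collect_less continuous_intros)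
    show "closed {x. edge_pred \<alpha> 1 F x}" for F
      unfolding edge_pred_def by (simp, intro closed_Collect_conj closed_Collect_le continuous_intros)
    show "open {x. edge_pred \<alpha> 2 F x}" for F
      unfolding edge_pred_def by (simp, intro open_Collect_conj open_Collect_less continuous_intros)
  next
    fix F F' x assume FF: "F \<in> ?Fl" "F' \<in> ?Fl" and x: "x \<in> trunc_tet" and tt: "fst F = fst F'"
      and P: "edge_pred \<alpha> 2 F x" "edge_pred \<alpha> 2 F' x"
    obtain t i j where F: "F = (t, i, j)" by (cases F)
    obtain i' j' where F': "F' = (t, i', j')" using tt F by (cases F') auto
    have ij: "i \<noteq> j" "i' \<noteq> j'" "t \<in> T" using FF F F' by (auto simp: flags_def)
    note b = edge_pred_bounds[OF P(1)[unfolded F] x sa ij(1)]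
    note b' = edge_pred_bounds[OF P(2)[unfolded F'] x sa ij(2)]
    have "i' = i \<or> i' = j" "j' = i \<or> j' = j" using third_cases[OF ij(1), of i'] third_cases[OF ij(1), of j'] b b' by auto
    moreover have False if "i' = j" "j' = i"
    proof -
      have "fcl F = fcl F'" using FF by simp
      then show False using F F' that esg_anti[OF ij(3,1)] by (simp add: fcl_def)
    qed
    ultimately show "F = F'" using ij F F' by auto
  next
    fix l :: nat and t i j x y m
    assume FF: "(t, i, j) \<in> ?Fl" and x: "x \<in> trunc_tet" "edge_pred \<alpha> l (t, i, j) x" "x $ m = 0"
      and y: "\<forall>a. y $ gl t m a = x $ a"
    have ij: "i \<noteq> j" "t \<in> T" and fl: "(t, i, j) \<in> flags" using FF by (auto simp: flags_def)
    have th: "third (gl t m i) (gl t m j) = gl t m (third j i)" "third (gl t m j) (gl t m i) = gl t m (third i j)"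
      using odd_gl[OF ij(2,1)] odd_gl[OF ij(2) ij(1)[symmetric]] by auto
    have "m = third i j \<or> m = third j i"
      using third_cases[OF ij(1), of m] edge_pred_bounds[OF x(2,1) sa ij(1)] x(3) by auto
    then show "(m = third i j \<and> nx (t, i, j) \<in> ?Fl \<and> edge_pred \<alpha> l (nx (t, i, j)) y \<and>
           cis (?\<theta> (nx (t, i, j))) = cis (?\<theta> (t, i, j)) * cis \<alpha>) \<or>
        (m = third j i \<and> pv (t, i, j) \<in> ?Fl \<and> edge_pred \<alpha> l (pv (t, i, j)) y \<and>
           cis (?\<theta> (t, i, j)) = cis (?\<theta> (pv (t, i, j))) * cis \<alpha>)"
    proof
      assume m: "m = third i j"
      have N: "nx (t, i, j) = (nb t m, gl t m i, gl t m j)" by (simp add: nx_def m)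
      have "cmod (fz \<alpha> (nx (t, i, j)) y) = cmod (fz \<alpha> (t, i, j) x)"
        unfolding N using th y x(3) m by (simp add: norm_mult)
      then have "edge_pred \<alpha> l (nx (t, i, j)) y"
        using x(2) y by (intro edge_pred_cong[OF x(2)]) (simp_all add: N)
      then show ?thesis using m cnx[OF FF] nx_flags[OF fl] fcl_nx[OF fl] FF by simp
    next
      assume m: "m = third j i"
      have N: "pv (t, i, j) = (nb t m, gl t m i, gl t m j)" by (simp add: pv_def m)
      have "cmod (fz \<alpha> (pv (t, i, j)) y) = cmod (fz \<alpha> (t, i, j) x)"
        unfolding N using th y x(3) m by (simp add: norm_mult)
      then have "edge_pred \<alpha> l (pv (t, i, j)) y"
        using x(2) y by (intro edge_pred_cong[OF x(2)]) (simp_all add: N)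
      moreover have "pv (t, i, j) \<in> ?Fl" using pv_flags[OF fl] fcl_pv[OF fl] FF by simp
      ultimately show ?thesis using m cnx[of "pv (t, i, j)"] nx_pv[OF fl] by simp
    qed
  next
    fix F F' x x' assume FF: "F \<in> ?Fl" "F' \<in> ?Fl" and x: "x \<in> trunc_tet" "x' \<in> trunc_tet"
      and e: "x $ fst (snd F) = x' $ fst (snd F')" "cis (?\<theta> F) * fz \<alpha> F x = cis (?\<theta> F') * fz \<alpha> F' x'"
    obtain t i j where F: "F = (t, i, j)" by (cases F)
    obtain t' i' j' where F': "F' = (t', i', j')" by (cases F')
    have ij: "i \<noteq> j" "i' \<noteq> j'" and fl: "(t, i, j) \<in> flags" "(t', i', j') \<in> flags" using FF F F' by (auto simp: flags_def)
    have tx: "x \<in> tetrahedron" "x' \<in> tetrahedron" using x trunc_subset by auto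
    let ?s = "x $ third i j" and ?u = "x $ third j i" and ?s' = "x' $ third i' j'" and ?u' = "x' $ third j' i'"
    have lt: "fpos F < n" "fpos F' < n" using fpos_less[of F] fpos_less[of F'] nF FF by auto
    have eqf: "F1 = F2" if "F1 \<in> ?Fl" "F2 \<in> ?Fl" "fpos F1 = fpos F2" for F1 F2
      using that by (intro flags_eqI) auto
    have nxF: "nx H \<in> ?Fl \<and> fpos (nx H) = Suc (fpos H) mod n" if "H \<in> ?Fl" for H
      using that nx_flags fcl_nx fpos_nx nF[OF that] by simp
    have cases: "(?s = 0 \<and> ?u = 0 \<and> ?s' = 0 \<and> ?u' = 0) \<or> (fpos F = fpos F' \<and> ?s = ?s' \<and> ?u = ?u') \<or>
      (fpos F' = Suc (fpos F) mod n \<and> ?s = 0 \<and> ?u' = 0 \<and> ?u = ?s') \<or>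
      (fpos F = Suc (fpos F') mod n \<and> ?s' = 0 \<and> ?u = 0 \<and> ?u' = ?s)"
      using sector_unique[OF n ad lt] trunc_nonneg[OF x(1)] trunc_nonneg[OF x(2)] e(2)
      by (simp add: F F')
    then consider (zero) "?s = 0" "?u = 0" "?s' = 0" "?u' = 0" | (same) "fpos F = fpos F'" "?s = ?s'" "?u = ?u'"
      | (nxt) "fpos F' = Suc (fpos F) mod n" "?s = 0" "?u' = 0" "?u = ?s'"
      | (prv) "fpos F = Suc (fpos F') mod n" "?s' = 0" "?u = 0" "?u' = ?s" by blast
    then show "equivclp (point_step T g) (fst F, x) (fst F', x')"
    proof cases
      case zero
      obtain m where m: "F' = (nx ^^ m) F" using flags_reach[of F F'] FF by auto
      have b: "x = bary i j (x $ i) 0 0" "x' = bary i' j' (x' $ i') 0 0"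
        using eq_bary[OF ij(1), of x] eq_bary[OF ij(2), of x'] zero tx by (simp_all add: tetrahedron_def)
      have "x $ i + x $ j = 1" using tx zero by (simp add: tetrahedron_def sum_third[OF ij(1)])
      then have "1 / 3 \<le> x $ i" "x $ i \<le> 2 / 3"
        using trunc_nonneg(2)[OF x(1), of i] trunc_nonneg(2)[OF x(1), of j] by auto
      from edge_chain[OF fl(1) this, of m]
      have E: "equivclp (point_step T g) (t, bary i j (x $ i) 0 0) (t', bary i' j' (x $ i) 0 0)"
        unfolding m[symmetric, unfolded F F'] by simp
      have xi: "x $ i = x' $ i'" using e(1) F F' by simp
      show ?thesis
        unfolding F F' fst_conv using E unfolding b(1)[symmetric] unfolding xi b(2)[symmetric] .
    next
      case same
      then have "F = F'" using eqf FF by blast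
      then have "x = x'" using same e(1) F F' tx by (intro bary_eqI[OF ij(1)]) auto
      then show ?thesis using \<open>F = F'\<close> by simp
    next
      case nxt
      then have "nx F = F'" using eqf[of "nx F" F'] nxF[OF FF(1)] FF by simp
      then have "point_step T g (t, x) (t', x')"
        using nxt e(1) F F' tx by (intro step_nxI[OF fl(1)]) auto
      then show ?thesis using F F' by (simp add: r_into_equivclp)
    next
      case prv
      then have "nx F' = F" using eqf[of "nx F'" F] nxF[OF FF(2)] FF by simp
      then have "point_step T g (t', x') (t, x)"
        using prv e(1) F F' tx by (intro step_nxI[OF fl(2)]) auto
      then have "equivclp (point_step T g) (t', x') (t, x)" by (rule r_into_equivclp)
      from equivclp_sym[OF this] show ?thesis using F F' by simp
    qed
  qed
  define W where "W h z \<longleftrightarrow> h < 1 / 4 \<and> cmod z < sin \<alpha> / 48" for h :: real and z :: complex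
  show ?thesis
  proof (rule good_fanI[OF fan, where W = W])
    have "continuous_on UNIV (\<lambda>v :: real^3. Complex (v $ 2) (v $ 3))"
      unfolding Complex_eq by (intro continuous_intros)
    then show "open {v :: real^3. W (v $ 1) (Complex (v $ 2) (v $ 3))}"
      unfolding W_def by (intro open_Collect_conj open_Collect_less continuous_intros)
    fix h z assume h: "0 \<le> h" "W h z"
    obtain m s u where m: "m < n" "0 \<le> s" "0 \<le> u" "z = cis (\<alpha> * real m) * (complex_of_real s + of_real u * cis \<alpha>)"
      using sector_exists[OF n ad, of z] by blast
    have "m \<in> fpos ` ?Fl" using flags_class_bij[OF G] m(1) unfolding bij_betw_def n_def by auto
    then obtain F where F: "F \<in> ?Fl" "fpos F = m" by blast
    obtain t i j where Fe: "F = (t, i, j)" by (cases F)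
    have ij: "i \<noteq> j" using F Fe by (auto simp: flags_def)
    let ?x = "bary i j (2 / 3 - h) s u"
    note b = bary_nth[OF ij, of "2 / 3 - h" s u]
    have cz: "cmod (complex_of_real s + of_real u * cis \<alpha>) < sin \<alpha> / 48"
      using h(2) m(4) by (simp add: W_def norm_mult)
    then have "s * sin \<alpha> < 1 / 48 * sin \<alpha>" "u * sin \<alpha> < 1 / 48 * sin \<alpha>"
      using sector_bound[OF m(2,3) less_imp_le[OF sa]] by linarith+
    then have su: "s < 1 / 48" "u < 1 / 48" using sa by (simp_all only: mult_less_cancel_right_pos)
    have "?x \<in> trunc_tet" using h su m(2,3) unfolding bary_trunc[OF ij] W_def by auto
    moreover have "edge_pred \<alpha> 0 F ?x" using h cz by (simp add: edge_pred_def Fe b W_def)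
    moreover have "z = cis (?\<theta> F) * fz \<alpha> F ?x" using m(4) F(2) by (simp add: Fe b)
    ultimately show "\<exists>F\<in>?Fl. \<exists>x\<in>trunc_tet. edge_pred \<alpha> 0 F x \<and> h = 2 / 3 - x $ fst (snd F) \<and> z = cis (?\<theta> F) * fz \<alpha> F x"
      using F(1) by (intro bexI[of _ F] bexI[of _ ?x]) (simp_all add: Fe b)
  next
    fix F x assume "x \<in> trunc_tet" "edge_pred \<alpha> 0 F x"
    then show "W (2 / 3 - x $ fst (snd F)) (cis (?\<theta> F) * fz \<alpha> F x)"
      by (simp add: W_def edge_pred_def norm_mult)
  next
    fix F x a assume x: "x \<in> trunc_tet" "edge_pred \<alpha> 0 F x" and a: "a \<noteq> fst (snd F)"
    have "x $ a + x $ fst (snd F) \<le> (\<Sum>b\<in>UNIV. x $ b)"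
      unfolding sum_third[OF a] using trunc_nonneg(1)[OF x(1)] by (simp add: add_nonneg_nonneg)
    then show "x $ a < 2 / 3" using x by (simp add: edge_pred_def trunc_tet_iff)
  qed
qed

text \<open>The number of vanishing coordinates decides the kind of chart. A flag that starts at a
  vertex with maximal coordinate keeps the point away from the other truncation triangles.\<close>

lemma fan_covers:
  assumes p: "p \<in> XS"
  obtains Fl \<theta> \<alpha> P where "good_fan Fl \<theta> \<alpha> P" "p \<in> dom Fl (P 0)"
proof -
  obtain t x where px: "p = (t, x)" by (cases p)
  have t: "t \<in> T" and x: "x \<in> trunc_tet" using p px by auto
  have nn: "0 \<le> x $ a" "x $ a \<le> 2 / 3" for a using trunc_nonneg[OF x] by auto
  obtain i where i: "\<And>a. x $ a \<le> x $ i"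
  proof -
    have "Max (range (\<lambda>a. x $ a)) \<in> range (\<lambda>a. x $ a)" by (rule Max_in) auto
    then obtain i where i: "Max (range (\<lambda>a. x $ a)) = x $ i" by (rule rangeE)
    have "x $ a \<le> x $ i" for a unfolding i[symmetric] by (rule Max_ge) auto
    then show ?thesis using that by blast
  qed
  have sum2: "x $ a + x $ b \<le> 1" if "a \<noteq> b" for a b
  proof -
    have "(\<Sum>c\<in>UNIV. x $ c) = 1" using x by (simp add: trunc_tet_iff)
    then show ?thesis unfolding sum_third[OF that] using nn[of "third a b"] nn[of "third b a"] by linarith
  qed
  have lt: "x $ a < 2 / 3" if "a \<noteq> i" for a using sum2[OF that] i[of a] by linarith
  consider (none) "\<And>a. x $ a \<noteq> 0" | (one) f where "x $ f = 0" "\<And>a. a \<noteq> f \<Longrightarrow> x $ a \<noteq> 0"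
    | (two) a b where "a \<noteq> b" "x $ a = 0" "x $ b = 0" by metis
  then show ?thesis
  proof cases
    case none
    define \<delta> where "\<delta> = Min (range (\<lambda>a. x $ a)) / 2"
    have "0 < Min (range (\<lambda>a. x $ a))" using none nn by (subst Min_gr_iff) (auto simp: less_le)
    then have d: "0 < \<delta>" "\<delta> < Min (range (\<lambda>a. x $ a))" by (auto simp: \<delta>_def)
    have dl: "\<delta> < x $ a" for a
    proof -
      have "Min (range (\<lambda>a. x $ a)) \<le> x $ a" by (rule Min_le) auto
      then show ?thesis using d by linarith
    qed
    obtain j where ij: "i \<noteq> j" using exhaust_4[of i] by (metis (full_types) one_neq_zero third_neq(1))
    then have F: "(t, i, j) \<in> flags" using t by (simp add: flags_def)
    show ?thesis
      by (rule that[OF tet_fan[OF F d(1)]]) (use t x dl lt in \<open>auto simp: px dom_def tet_pred_def\<close>)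
  next
    case (one f)
    define \<delta> where "\<delta> = Min ((\<lambda>a. x $ a) ` (- {f})) / 2"
    have "i \<noteq> f"
    proof
      assume "i = f"
      then have "x $ a = 0" for a using i[of a] nn[of a] one(1) by simp
      then show False using x by (simp add: trunc_tet_iff)
    qed
    then have ne: "- {f} \<noteq> {}" by blast
    have "0 < Min ((\<lambda>a. x $ a) ` (- {f}))" using one nn ne by (subst Min_gr_iff) (auto simp: less_le)
    then have d: "0 < \<delta>" "\<delta> < Min ((\<lambda>a. x $ a) ` (- {f}))" by (auto simp: \<delta>_def)
    have dl: "\<delta> < x $ a" if "a \<noteq> f" for a
    proof -
      have "Min ((\<lambda>a. x $ a) ` (- {f})) \<le> x $ a" using that by (intro Min_le) auto
      then show ?thesis using d by linarith
    qed
    \<comment> \<open>With this choice \<open>f\<close> is the face \<open>third j i\<close>, across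
      which \<open>face_fan\<close> unfolds.\<close>
    define j where "j = third i f"
    have ij: "i \<noteq> j" "third j i = f"
      using third_neq[OF \<open>i \<noteq> f\<close>[symmetric]] third_cycle[OF \<open>i \<noteq> f\<close>[symmetric]] third_cycle[OF \<open>i \<noteq> f\<close>] by (auto simp: j_def)
    then have F: "(t, i, j) \<in> flags" using t by (simp add: flags_def)
    show ?thesis
      by (rule that[OF face_fan[OF F d(1)]]) (use t x dl lt ij one in \<open>auto simp: px dom_def face_pred_def\<close>)
  next
    case (two a b)
    define i1 where "i1 = third a b"
    define j1 where "j1 = third b a"
    have ij: "i1 \<noteq> j1" and th: "{third i1 j1, third j1 i1} = {a, b}"
    proof -
      show "i1 \<noteq> j1" using third_neq(3)[OF two(1)] by (simp add: i1_def j1_def)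
      have "third i1 j1 = a" "third j1 i1 = b"
        using two(1) exhaust_4[of a] exhaust_4[of b] unfolding i1_def j1_def by (elim disjE; simp add: third_def)+
      then show "{third i1 j1, third j1 i1} = {a, b}" by simp
    qed
    have z: "x $ third i1 j1 = 0" "x $ third j1 i1 = 0" using th two by (auto simp: doubleton_eq_iff)
    have s: "x $ i1 + x $ j1 = 1" using x z by (simp add: trunc_tet_iff sum_third[OF ij])
    obtain i2 j2 where ij2: "i2 \<noteq> j2" "5 / 12 < x $ i2" "x $ third i2 j2 = 0" "x $ third j2 i2 = 0"
    proof (cases "x $ i1 \<ge> x $ j1")
      case True
      then show ?thesis using that[of i1 j1] ij z s by simp
    next
      case False
      then show ?thesis using that[of j1 i1] ij z s by simp
    qed
    then have F: "(t, i2, j2) \<in> flags" using t by (simp add: flags_def)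
    let ?\<alpha> = "2 * pi / real (len (fst (fcl (t, i2, j2))))"
    have "0 < sin ?\<alpha>" using sector_width[OF len_fcl[OF F] refl] by (intro sin_gt_zero) auto
    then have "edge_pred ?\<alpha> 0 (t, i2, j2) x" using ij2 by (simp add: edge_pred_def)
    then show ?thesis
      by (intro that[OF edge_fan[OF F]]) (use t x F in \<open>auto simp: px dom_def intro!: bexI[of _ "(t, i2, j2)"]\<close>)
  qed
qed

end

section \<open>The manifold and its boundary\<close>

context triangulation
begin

abbreviation NN :: "(nat \<times> (real^4)) set topology" where "NN \<equiv> quot_topology (top_of_set XS) pc"

definition XI :: "(nat \<times> (real^4)) set" where "XI = {p \<in> XS. \<forall>a. snd p $ a < 2 / 3}"

lemma top_NN: "topspace NN = pc ` XS"
  by (simp add: topspace_quot_topology)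

lemma good_fan_height:
  assumes gf: "good_fan Fl \<theta> \<alpha> P" and p: "p \<in> dom Fl (P 0)"
  shows "0 \<le> fan_map Fl \<theta> \<alpha> P p $ 1" "0 < fan_map Fl \<theta> \<alpha> P p $ 1 \<longleftrightarrow> p \<in> XI"
proof -
  have fan: "fan Fl \<theta> \<alpha> P" using gf by (simp add: good_fan_def)
  obtain F where F: "F \<in> Fl" "fst p = fst F" "P 0 F (snd p)" "snd p \<in> trunc_tet" "p \<in> XS"
    using p by (auto simp: dom_def)
  have "p = (fst F, snd p)" using F(2) by (simp add: prod_eq_iff)
  then have h: "fan_map Fl \<theta> \<alpha> P p $ 1 = 2 / 3 - snd p $ fst (snd F)"
    using fan_map_eq[OF fan F(1,4)] fan_imp[OF fan F(1,4)] F(3) by (metis cyl_nth(1))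
  have "\<forall>F\<in>Fl. \<forall>x\<in>trunc_tet. P 0 F x \<longrightarrow> (\<forall>a. a \<noteq> fst (snd F) \<longrightarrow> x $ a < 2 / 3)"
    using gf by (simp add: good_fan_def)
  then have lt: "snd p $ a < 2 / 3" if "a \<noteq> fst (snd F)" for a using F that by blast
  show "0 \<le> fan_map Fl \<theta> \<alpha> P p $ 1" unfolding h using trunc_nonneg(2)[OF F(4), of "fst (snd F)"] by simp
  have "(\<forall>a. snd p $ a < 2 / 3) \<longleftrightarrow> snd p $ fst (snd F) < 2 / 3" using lt by metis
  then show "0 < fan_map Fl \<theta> \<alpha> P p $ 1 \<longleftrightarrow> p \<in> XI" unfolding h XI_def using F(5) by auto
qed

lemma good_fanD:
  assumes "good_fan Fl \<theta> \<alpha> P"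
  shows "fan Fl \<theta> \<alpha> P" "openin (top_of_set half_space3) (fan_map Fl \<theta> \<alpha> P ` dom Fl (P 0))"
    "chart_datum XS pc (dom Fl (P 0)) (dom Fl (P 1)) (dom Fl (P 2)) (fan_map Fl \<theta> \<alpha> P)"
  using assms fan_chart by (auto simp: good_fan_def)

lemma charts_cover: "p \<in> XS \<Longrightarrow> \<exists>D K U F. chart_datum XS pc D K U F \<and> p \<in> D"
  using fan_covers good_fanD(3) by (metis (no_types, lifting))

lemma half_chart_of_datum:
  assumes cd: "chart_datum XS pc D K U F" and o: "openin (top_of_set half_space3) (F ` D)"
  shows "half_chart3 NN (pc ` D) (chart_map pc U F)"
proof -
  have "D \<subseteq> U" "openin (top_of_set XS) D" "saturated XS pc D" using cd by (auto simp: chart_datum_def)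
  then have "chart_map pc U F ` pc ` D = F ` D" "openin NN (pc ` D)"
    using chart_map_image[OF cd] openin_quot_image by auto
  then show ?thesis unfolding half_chart3_def using o chart_homeomorphic[OF cd] by simp
qed

lemma chart_of_datum:
  assumes cd: "chart_datum XS pc D K U F" and o: "open (F ` D)"
  shows "chart3 NN (pc ` D) (chart_map pc U F)"
proof -
  have "D \<subseteq> U" "openin (top_of_set XS) D" "saturated XS pc D" using cd by (auto simp: chart_datum_def)
  then have "chart_map pc U F ` pc ` D = F ` D" "openin NN (pc ` D)"
    using chart_map_image[OF cd] openin_quot_image by auto
  then show ?thesis unfolding chart3_def using o chart_homeomorphic[OF cd] by simp
qed

lemma manifold_NN: "manifold3 NN"
  unfolding manifold3_def
proof (intro conjI ballI)
  show "Hausdorff_space NN" by (rule Hausdorff_quot[OF charts_cover])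
  show "second_countable NN" by (rule second_countable_quot[OF charts_cover XS_compact])
  fix n assume "n \<in> topspace NN"
  then obtain p where p: "p \<in> XS" "n = pc p" by (auto simp: top_NN)
  obtain Fl \<theta> \<alpha> P where gf: "good_fan Fl \<theta> \<alpha> P" "p \<in> dom Fl (P 0)" using fan_covers[OF p(1)] by blast
  have "n \<in> pc ` dom Fl (P 0)" using gf(2) p by simp
  then show "\<exists>U \<phi>. n \<in> U \<and> half_chart3 NN U \<phi>"
    using half_chart_of_datum[OF good_fanD(3,2)[OF gf(1)]] by blast
qed

lemma interior_chart:
  assumes gf: "good_fan Fl \<theta> \<alpha> P"
  defines "D0 \<equiv> {p \<in> dom Fl (P 0). 0 < fan_map Fl \<theta> \<alpha> P p $ 1}"
  shows "chart_datum XS pc D0 (dom Fl (P 1)) (dom Fl (P 2)) (fan_map Fl \<theta> \<alpha> P)"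
    "open (fan_map Fl \<theta> \<alpha> P ` D0)" "chart3 NN (pc ` D0) (chart_map pc (dom Fl (P 2)) (fan_map Fl \<theta> \<alpha> P))"
proof -
  show cd: "chart_datum XS pc D0 (dom Fl (P 1)) (dom Fl (P 2)) (fan_map Fl \<theta> \<alpha> P)"
    and o: "open (fan_map Fl \<theta> \<alpha> P ` D0)"
    unfolding D0_def by (rule chart_datum_positive[OF good_fanD(3,2)[OF gf]])+
  show "chart3 NN (pc ` D0) (chart_map pc (dom Fl (P 2)) (fan_map Fl \<theta> \<alpha> P))"
    by (rule chart_of_datum[OF cd o])
qed

text \<open>In one direction a half-space chart is restricted to positive heights; the other is
  invariance of domain, through \<open>boundary_not_interior\<close>.\<close>

lemma pc_interior_iff:
  assumes p: "p \<in> XS"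
  shows "pc p \<in> mfd_interior NN \<longleftrightarrow> p \<in> XI"
proof -
  obtain Fl \<theta> \<alpha> P where gf: "good_fan Fl \<theta> \<alpha> P" "p \<in> dom Fl (P 0)" using fan_covers[OF p] by blast
  note h = good_fan_height[OF gf]
  show ?thesis
  proof
    assume "p \<in> XI"
    then have "p \<in> {p \<in> dom Fl (P 0). 0 < fan_map Fl \<theta> \<alpha> P p $ 1}" using h gf(2) by simp
    then have "pc p \<in> pc ` {p \<in> dom Fl (P 0). 0 < fan_map Fl \<theta> \<alpha> P p $ 1}" by (rule imageI)
    moreover have "pc p \<in> topspace NN" unfolding top_NN using p by (rule imageI)
    ultimately show "pc p \<in> mfd_interior NN"
      unfolding mfd_interior_def mem_Collect_eq using interior_chart(3)[OF gf(1)] by (intro conjI exI)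
  next
    assume i: "pc p \<in> mfd_interior NN"
    show "p \<in> XI"
    proof (rule ccontr)
      assume "p \<notin> XI"
      then have "fan_map Fl \<theta> \<alpha> P p $ 1 = 0" using h by simp
      moreover have "fan_map Fl \<theta> \<alpha> P ` dom Fl (P 0) \<subseteq> half_space3"
        using good_fanD(2)[OF gf(1)] openin_imp_subset by blast
      ultimately show False using boundary_not_interior[OF good_fanD(3)[OF gf(1)] _ gf(2)] i by blast
    qed
  qed
qed

lemma interior_NN: "mfd_interior NN = pc ` XI"
proof -
  have XI: "XI \<subseteq> XS" by (auto simp: XI_def)
  show ?thesis
  proof (intro equalityI subsetI)
    fix n assume n: "n \<in> mfd_interior NN"
    then have "n \<in> pc ` XS" unfolding mfd_interior_def top_NN by simp
    then obtain p where "p \<in> XS" "n = pc p" by (rule imageE) simp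
    then show "n \<in> pc ` XI" using pc_interior_iff n by simp
  next
    fix n assume "n \<in> pc ` XI"
    then obtain p where "p \<in> XI" "n = pc p" by (rule imageE) simp
    then show "n \<in> mfd_interior NN" using pc_interior_iff[of p] XI by (simp add: subset_eq)
  qed
qed

lemma boundary_NN: "mfd_boundary NN = pc ` (XS - XI)"
  unfolding mfd_boundary_def top_NN using pc_interior_iff by blast

text \<open>Sets attached to adjacent vertices meet, and the gluing connects all vertices, so each
  set lies in a connected part of the union that contains a fixed one. Applied to the truncation
  triangles this makes the boundary connected, applied to whole truncated tetrahedra the
  manifold.\<close>

lemma connected_chain:
  assumes con: "\<And>v. v \<in> T \<times> UNIV \<Longrightarrow> connectedin Y (B v)" and ne: "\<And>v. v \<in> T \<times> UNIV \<Longrightarrow> B v \<noteq> {}"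
    and meet: "\<And>v w. v \<in> T \<times> UNIV \<Longrightarrow> w \<in> T \<times> UNIV \<Longrightarrow> vertex_step T g v w \<Longrightarrow> B v \<inter> B w \<noteq> {}"
  shows "connectedin Y (\<Union>v\<in>T \<times> UNIV. B v)"
proof -
  let ?A = "\<Union>v\<in>T \<times> UNIV. B v"
  obtain t0 where t0: "t0 \<in> T" using T_nonempty by blast
  let ?v0 = "(t0, 1 :: 4)"
  define \<U> where "\<U> = {C. connectedin Y C \<and> B ?v0 \<subseteq> C \<and> C \<subseteq> ?A}"
  have reach: "\<exists>C\<in>\<U>. B v \<subseteq> C" if v: "v \<in> T \<times> UNIV" for v
  proof -
    have e: "equivclp (vertex_step T g) ?v0 v" using vertices_connected t0 v by (cases v) auto
    have ext: "\<exists>C\<in>\<U>. B w \<subseteq> C" if "\<exists>C\<in>\<U>. B u \<subseteq> C" "w \<in> T \<times> UNIV" "B u \<inter> B w \<noteq> {}" for u w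
    proof -
      obtain C where C: "C \<in> \<U>" "B u \<subseteq> C" using \<open>\<exists>C\<in>\<U>. B u \<subseteq> C\<close> by blast
      have "connectedin Y (C \<union> B w)"
        using C that con by (intro connectedin_Un) (auto simp: \<U>_def)
      then have "C \<union> B w \<in> \<U>" using C that(2) by (auto simp: \<U>_def)
      then show ?thesis by blast
    qed
    have T2: "b \<in> T \<times> UNIV \<longleftrightarrow> a \<in> T \<times> UNIV" if "vertex_step T g a b" "a \<in> T \<times> UNIV \<or> b \<in> T \<times> UNIV" for a b
      using that glueD(1) by (auto simp: vertex_step_def)
    have "v \<in> T \<times> UNIV \<and> (\<exists>C\<in>\<U>. B v \<subseteq> C)"
    proof (rule equivclp_invariant[OF e, where P = "\<lambda>v. v \<in> T \<times> UNIV \<and> (\<exists>C\<in>\<U>. B v \<subseteq> C)"])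
      have "B ?v0 \<in> \<U>" unfolding \<U>_def using con[of ?v0] t0 by blast
      then show "?v0 \<in> T \<times> UNIV \<and> (\<exists>C\<in>\<U>. B ?v0 \<subseteq> C)" using t0 by blast
      show "b \<in> T \<times> UNIV \<and> (\<exists>C\<in>\<U>. B b \<subseteq> C)" if "a \<in> T \<times> UNIV \<and> (\<exists>C\<in>\<U>. B a \<subseteq> C)" "vertex_step T g a b" for a b
        using that T2[OF that(2)] ext[of a b] meet[of a b] by blast
      show "b \<in> T \<times> UNIV \<and> (\<exists>C\<in>\<U>. B b \<subseteq> C)" if "a \<in> T \<times> UNIV \<and> (\<exists>C\<in>\<U>. B a \<subseteq> C)" "vertex_step T g b a" for a b
        using that T2[OF that(2)] ext[of a b] meet[of b a] by blast
    qed
    then show ?thesis by blast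
  qed
  have "\<Union>\<U> = ?A"
  proof
    show "\<Union>\<U> \<subseteq> ?A" by (auto simp: \<U>_def)
    show "?A \<subseteq> \<Union>\<U>" using reach by blast
  qed
  moreover have "connectedin Y (\<Union>\<U>)"
  proof (rule connectedin_Union)
    show "\<Inter>\<U> \<noteq> {}" using ne[of ?v0] t0 unfolding \<U>_def by blast
  qed (simp add: \<U>_def)
  ultimately show ?thesis by simp
qed

lemma connectedin_pc:
  assumes "convex C" "C \<subseteq> trunc_tet" "t \<in> T"
  shows "connectedin NN (pc ` ({t} \<times> C))"
proof (rule connectedin_continuous_map_image)
  show "continuous_map (top_of_set XS) NN pc"
    using quotient_imp_continuous_map[OF quotient_map_quot_topology] .
  have "connected ({t} \<times> C)" using assms(1) by (intro connected_Times convex_connected) auto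
  then show "connectedin (top_of_set XS) ({t} \<times> C)" using assms by (auto simp: connectedin_subtopology)
qed

lemma convex_trunc: "convex trunc_tet"
  unfolding trunc_tet_eq by (rule cut_weights.cut_simplex_convex[OF cut_weights_two])

lemma convex_tri: "convex (trunc_tri i)"
proof -
  have e: "trunc_tri i = trunc_tet \<inter> {x. axis i 1 \<bullet> x = 2 / 3}"
    by (auto simp: trunc_tri_def inner_axis')
  show ?thesis unfolding e by (intro convex_Int convex_trunc convex_hyperplane)
qed

lemma corner_point:
  assumes "i \<noteq> j"
  shows "bary i j (2 / 3) 0 0 \<in> trunc_tri i" "bary i j (2 / 3) 0 0 \<in> trunc_tet"
  using bary_trunc[OF assms, of "2/3" 0 0] bary_nth[OF assms, of "2/3" 0 0] by (auto simp: trunc_tri_def)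

lemma meet_tri:
  assumes "vertex_step T g (t, i) (t', i')" "t \<in> T"
  shows "pc ` ({t} \<times> trunc_tri i) \<inter> pc ` ({t'} \<times> trunc_tri i') \<noteq> {}"
proof -
  obtain f where f: "f \<noteq> i" "t' = nb t f" "i' = gl t f i" using assms by (auto simp: vertex_step_def)
  \<comment> \<open>Then \<open>f\<close> is \<open>third ?j i\<close>, so the corner of the
    triangle on the edge {i, ?j} lies in the face \<open>f\<close> that the step crosses.\<close>
  let ?j = "third i f"
  have ij: "i \<noteq> ?j" and th: "third i ?j = third f i" "third ?j i = f"
    using third_neq[OF f(1)[symmetric]] third_cycle[OF f(1)[symmetric]] by auto
  let ?x = "bary i ?j (2 / 3) 0 0"
  define y :: "real^4" where "y = (\<chi> a. ?x $ inv (gl t f) a)"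
  have y: "y $ gl t f a = ?x $ a" for a using inv_gl[OF assms(2)] by (simp add: y_def)
  have x: "?x \<in> trunc_tri i" "?x \<in> trunc_tet" "?x $ f = 0" "?x $ i = 2 / 3"
    using corner_point[OF ij] bary_nth[OF ij, of "2/3" 0 0] th by auto
  have y': "y \<in> trunc_tet" using perm_trunc[OF glueD(2)[OF assms(2)] y] x by simp
  then have "y \<in> trunc_tri i'" using y[of i] x(4) f by (simp add: trunc_tri_def)
  moreover have "point_step T g (t, ?x) (t', y)" using f x y assms(2) by (auto simp: point_step_def)
  then have "pc (t, ?x) = pc (t', y)"
    using x y' trunc_subset assms(2) f glueD(1)[OF assms(2)]
    by (subst point_class_eq_iff) (auto intro: r_into_equivclp)
  ultimately show ?thesis using x by blast
qed

lemma boundary_tri: "mfd_boundary NN = (\<Union>v\<in>T \<times> UNIV. pc ` ({fst v} \<times> trunc_tri (snd v)))"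
proof -
  have "XS - XI = (\<Union>v\<in>T \<times> UNIV. {fst v} \<times> trunc_tri (snd v))"
  proof (intro equalityI subsetI)
    fix p assume "p \<in> XS - XI"
    then obtain a where "p \<in> XS" "\<not> snd p $ a < 2 / 3" unfolding XI_def by blast
    then have "snd p \<in> trunc_tri a" "fst p \<in> T"
      using trunc_nonneg(2)[of "snd p" a] by (auto simp: trunc_tri_def)
    then have "(fst p, a) \<in> T \<times> UNIV" "p \<in> {fst (fst p, a)} \<times> trunc_tri (snd (fst p, a))"
      by (auto simp: mem_Times_iff)
    then show "p \<in> (\<Union>v\<in>T \<times> UNIV. {fst v} \<times> trunc_tri (snd v))" by (rule UN_I)
  next
    fix p assume "p \<in> (\<Union>v\<in>T \<times> UNIV. {fst v} \<times> trunc_tri (snd v))"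
    then obtain v where v: "v \<in> T \<times> UNIV" "p \<in> {fst v} \<times> trunc_tri (snd v)" by (rule UN_E)
    then have "fst p \<in> T" "snd p \<in> trunc_tet" "snd p $ snd v = 2 / 3"
      by (auto simp: trunc_tri_def mem_Times_iff)
    moreover have "p \<notin> XI"
    proof
      assume "p \<in> XI"
      then have "snd p $ snd v < 2 / 3" unfolding XI_def by blast
      then show False using \<open>snd p $ snd v = 2 / 3\<close> by simp
    qed
    ultimately show "p \<in> XS - XI" by (simp add: mem_Times_iff)
  qed
  then show ?thesis unfolding boundary_NN by (simp add: image_UN)
qed

lemma connected_boundary: "connectedin NN (mfd_boundary NN)"
  unfolding boundary_tri
proof (rule connected_chain)
  fix v :: "nat \<times> 4" assume v: "v \<in> T \<times> UNIV"
  show "connectedin NN (pc ` ({fst v} \<times> trunc_tri (snd v)))"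
    using v convex_tri by (intro connectedin_pc) (auto simp: trunc_tri_def)
  obtain j where "snd v \<noteq> j" using exhaust_4[of "snd v"] by (metis (full_types) one_neq_zero third_neq(1))
  then show "pc ` ({fst v} \<times> trunc_tri (snd v)) \<noteq> {}" using corner_point by blast
next
  fix v w :: "nat \<times> 4" assume "v \<in> T \<times> UNIV" "vertex_step T g v w"
  then show "pc ` ({fst v} \<times> trunc_tri (snd v)) \<inter> pc ` ({fst w} \<times> trunc_tri (snd w)) \<noteq> {}"
    using meet_tri[of "fst v" "snd v" "fst w" "snd w"] by (auto simp del: Int_iff)
qed

lemma connected_NN: "connected_space NN"
proof -
  have "connectedin NN (\<Union>v\<in>T \<times> (UNIV :: 4 set). pc ` ({fst v} \<times> trunc_tet))"
  proof (rule connected_chain)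
    fix v :: "nat \<times> 4" assume v: "v \<in> T \<times> UNIV"
    show "connectedin NN (pc ` ({fst v} \<times> trunc_tet))"
      using v convex_trunc by (intro connectedin_pc) auto
    show "pc ` ({fst v} \<times> trunc_tet) \<noteq> {}" using corner_point(2)[of 1 2] by auto
  next
    fix v w :: "nat \<times> 4" assume "v \<in> T \<times> UNIV" "vertex_step T g v w"
    then have "pc ` ({fst v} \<times> trunc_tri (snd v)) \<inter> pc ` ({fst w} \<times> trunc_tri (snd w)) \<noteq> {}"
      using meet_tri[of "fst v" "snd v" "fst w" "snd w"] by (auto simp del: Int_iff)
    moreover have "trunc_tri i \<subseteq> trunc_tet" for i by (auto simp: trunc_tri_def)
    ultimately show "pc ` ({fst v} \<times> trunc_tet) \<inter> pc ` ({fst w} \<times> trunc_tet) \<noteq> {}" by blast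
  qed
  moreover have "XS = (\<Union>v\<in>T \<times> (UNIV :: 4 set). {fst v} \<times> trunc_tet)" by auto
  then have "(\<Union>v\<in>T \<times> (UNIV :: 4 set). pc ` ({fst v} \<times> trunc_tet)) = topspace NN"
    unfolding top_NN by (simp only: image_UN)
  ultimately show ?thesis by (simp add: connectedin_topspace)
qed

lemma boundary_nonempty: "mfd_boundary NN \<noteq> {}"
proof -
  obtain t where "t \<in> T" using T_nonempty by blast
  then show ?thesis unfolding boundary_tri using corner_point(1)[of 1 2] by auto
qed

lemma collapse_boundary: "n \<in> mfd_boundary NN \<Longrightarrow> collapse_map NN n = mfd_boundary NN"
proof -
  assume n: "n \<in> mfd_boundary NN"
  have "mfd_boundary NN \<subseteq> topspace NN" by (auto simp: mfd_boundary_def)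
  then have "connected_space (subtopology NN (mfd_boundary NN))" "topspace (subtopology NN (mfd_boundary NN)) = mfd_boundary NN"
    using connected_boundary by (auto simp: connectedin_def)
  then show ?thesis
    using n unfolding collapse_map_def by (simp add: connected_space_connected_component_set)
qed

section \<open>Collapsing the boundary\<close>

text \<open>The ratio x_i / (2/3 - x_i) with denominators cleared, so that it stays continuous on
  the truncation triangles, where exactly one of the four values survives.\<close>

definition infl :: "real^4 \<Rightarrow> 4 \<Rightarrow> real" where
  "infl x i = x $ i * (\<Prod>k\<in>UNIV - {i}. 2 / 3 - x $ k)"

text \<open>
  The map \<open>inflate\<close> is proportional to \<open>x $ i / (2/3 - x $ i)\<close> in the \<open>i\<close>-th coordinate: it stretches
  the truncated tetrahedron over the tetrahedron and collapses the truncation triangles to the vertices.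
\<close>

definition inflate :: "real^4 \<Rightarrow> real^4" where
  "inflate x = (\<chi> i. infl x i / (\<Sum>j\<in>UNIV. infl x j))"

lemma infl_nonneg: "x \<in> trunc_tet \<Longrightarrow> 0 \<le> infl x i"
  unfolding infl_def using trunc_nonneg by (intro mult_nonneg_nonneg prod_nonneg) auto

lemma infl_ratio:
  assumes "\<And>a. x $ a < 2 / 3"
  shows "infl x i = x $ i / (2 / 3 - x $ i) * (\<Prod>k\<in>UNIV. 2 / 3 - x $ k)"
proof -
  have "(\<Prod>k\<in>UNIV. 2 / 3 - x $ k) = (2 / 3 - x $ i) * (\<Prod>k\<in>UNIV - {i}. 2 / 3 - x $ k)"
    by (rule prod.remove) auto
  moreover have "2 / 3 - x $ i \<noteq> 0" using assms[of i] by simp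
  ultimately show ?thesis by (simp add: infl_def)
qed

lemma infl_boundary:
  assumes x: "x \<in> trunc_tet" "x $ i = 2 / 3"
  shows "0 < infl x i" "j \<noteq> i \<Longrightarrow> infl x j = 0"
proof -
  have "x $ k < 2 / 3" if "k \<noteq> i" for k
  proof -
    have "(\<Sum>c\<in>UNIV. x $ c) = 1" using x by (simp add: trunc_tet_iff)
    then have "x $ k + x $ i \<le> 1"
      unfolding sum_third[OF that] using trunc_nonneg(1)[OF x(1), of "third k i"] trunc_nonneg(1)[OF x(1), of "third i k"] by linarith
    then show ?thesis using x by simp
  qed
  then have "0 < (\<Prod>k\<in>UNIV - {i}. 2 / 3 - x $ k)" by (intro prod_pos) auto
  then show "0 < infl x i" using x by (simp add: infl_def)
  assume "j \<noteq> i"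
  then have "(\<Prod>k\<in>UNIV - {j}. 2 / 3 - x $ k) = 0" using x by (intro prod_zero) auto
  then show "infl x j = 0" by (simp add: infl_def)
qed

lemma infl_sum_pos:
  assumes x: "x \<in> trunc_tet"
  shows "0 < (\<Sum>j\<in>UNIV. infl x j)"
proof -
  have "\<exists>i. 0 < infl x i"
  proof (cases "\<exists>i. x $ i = 2 / 3")
    case True
    then show ?thesis using infl_boundary(1)[OF x] by blast
  next
    case False
    then have lt: "x $ a < 2 / 3" for a using trunc_nonneg(2)[OF x, of a] by (metis less_le)
    obtain i where "x $ i \<noteq> 0"
    proof -
      have "(\<Sum>c\<in>UNIV. x $ c) = 1" using x by (simp add: trunc_tet_iff)
      then have "\<not> (\<forall>c. x $ c = 0)" by (metis sum.neutral zero_neq_one)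
      then show ?thesis using that by blast
    qed
    then have "0 < x $ i" using trunc_nonneg(1)[OF x, of i] by simp
    then have "0 < infl x i" unfolding infl_def using lt by (intro mult_pos_pos prod_pos) auto
    then show ?thesis by blast
  qed
  then obtain i where "0 < infl x i" by blast
  then show ?thesis using infl_nonneg[OF x] by (intro sum_pos2[of UNIV i]) auto
qed

lemma inflate_tetrahedron: "x \<in> trunc_tet \<Longrightarrow> inflate x \<in> tetrahedron"
  using infl_nonneg[of x] infl_sum_pos[of x]
  by (auto simp: tetrahedron_def inflate_def sum_divide_distrib[symmetric])

lemma inflate_boundary:
  assumes "x \<in> trunc_tet" "x $ i = 2 / 3"
  shows "inflate x = axis i 1"
proof -
  have "(\<Sum>j\<in>UNIV. infl x j) = infl x i"
    using infl_boundary(2)[OF assms] by (subst sum.remove[of _ i]) auto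
  then show ?thesis
    using infl_boundary[OF assms] by (auto simp: inflate_def vec_eq_iff axis_def)
qed

lemma inflate_zero: "x $ f = 0 \<Longrightarrow> inflate x $ f = 0"
  by (simp add: inflate_def infl_def)

lemma inflate_zero_iff:
  assumes "x \<in> trunc_tet" "\<And>a. x $ a < 2 / 3"
  shows "inflate x $ f = 0 \<longleftrightarrow> x $ f = 0"
proof -
  have "0 < (\<Prod>k\<in>UNIV - {f}. 2 / 3 - x $ k)" using assms by (intro prod_pos) auto
  then have "infl x f = 0 \<longleftrightarrow> x $ f = 0" unfolding infl_def mult_eq_0_iff by linarith
  moreover have "(\<Sum>j\<in>UNIV. infl x j) \<noteq> 0" using infl_sum_pos[OF assms(1)] by linarith
  ultimately show ?thesis unfolding inflate_def by simp
qed

lemma inflate_perm: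
  assumes "bij \<sigma>" "\<And>i. y $ \<sigma> i = x $ i"
  shows "inflate y $ \<sigma> i = inflate x $ i"
proof -
  have q: "infl y (\<sigma> i) = infl x i" for i
  proof -
    have "bij_betw \<sigma> (UNIV - {i}) (UNIV - {\<sigma> i})"
      using assms(1) by (auto simp: bij_betw_def bij_def inj_on_def image_set_diff)
    from prod.reindex_bij_betw[OF this, of "\<lambda>k. 2 / 3 - y $ k"]
    show ?thesis using assms(2) by (simp add: infl_def)
  qed
  have "(\<Sum>j\<in>UNIV. infl y j) = (\<Sum>j\<in>UNIV. infl x j)"
    using sum.reindex_bij_betw[OF assms(1), of "infl y"] q by simp
  then show ?thesis using q by (simp add: inflate_def)
qed

lemma continuous_inflate: "continuous_on trunc_tet inflate"
  unfolding inflate_def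
proof (intro continuous_on_vec_lambda continuous_on_divide ballI)
  have c: "continuous_on trunc_tet (\<lambda>x. infl x i)" for i
    unfolding infl_def by (intro continuous_intros)
  show "continuous_on trunc_tet (\<lambda>x. infl x i)" for i by (rule c)
  show "continuous_on trunc_tet (\<lambda>x. \<Sum>j\<in>UNIV. infl x j)" by (intro continuous_on_sum c)
  show "(\<Sum>j\<in>UNIV. infl x j) \<noteq> 0" if "x \<in> trunc_tet" for x using infl_sum_pos[OF that] by simp
qed

text \<open>Up to a common factor \<open>inflate\<close> applies the increasing function z / (2/3 -
  z) to each coordinate. Comparing the two factors shows that one point dominates the other in every
  coordinate; as both sums are 1, they agree.\<close>

lemma inflate_inj:
  assumes x: "x \<in> trunc_tet" "\<And>a. x $ a < 2 / 3" and y: "y \<in> trunc_tet" "\<And>a. y $ a < 2 / 3"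
    and e: "inflate x = inflate y"
  shows "x = y"
proof -
  define r :: "real \<Rightarrow> real" where "r = (\<lambda>z. z / (2 / 3 - z))"
  have rmono: "a \<le> b" if "r a \<le> r b" "a < 2 / 3" "b < 2 / 3" for a b
  proof -
    have "r z = (2 / 3) / (2 / 3 - z) - 1" if "z < 2 / 3" for z using that by (simp add: r_def field_simps)
    then have "(2 / 3) / (2 / 3 - a) \<le> (2 / 3) / (2 / 3 - b)" using that by simp
    then show ?thesis using that by (simp add: frac_le_eq divide_le_eq pos_le_divide_eq field_simps)
  qed
  have pp: "0 < (\<Prod>k\<in>UNIV. 2 / 3 - x $ k)" "0 < (\<Prod>k\<in>UNIV. 2 / 3 - y $ k)"
    using x y by (auto intro!: prod_pos)
  define cx where "cx = (\<Prod>k\<in>UNIV. 2 / 3 - x $ k) / (\<Sum>j\<in>UNIV. infl x j)"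
  define cy where "cy = (\<Prod>k\<in>UNIV. 2 / 3 - y $ k) / (\<Sum>j\<in>UNIV. infl y j)"
  have c: "0 < cx" "0 < cy" using pp infl_sum_pos x y by (auto simp: cx_def cy_def)
  have ix: "inflate x $ i = r (x $ i) * cx" "inflate y $ i = r (y $ i) * cy" for i
    using infl_ratio[OF x(2)] infl_ratio[OF y(2)] by (simp_all add: inflate_def r_def cx_def cy_def)
  have main: "u = v" if u: "u \<in> trunc_tet" "\<And>a. u $ a < 2 / 3" and v: "v \<in> trunc_tet" "\<And>a. v $ a < 2 / 3"
    and c: "0 < c" "c \<le> d" and e: "\<And>i. r (u $ i) * c = r (v $ i) * d" for u v :: "real^4" and c d
  proof -
    have "v $ i \<le> u $ i" for i
    proof (rule rmono)
      have "0 \<le> r (v $ i)" using v(2)[of i] trunc_nonneg(1)[OF v(1), of i] by (simp add: r_def)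
      then have "r (v $ i) * c \<le> r (v $ i) * d" using c by (intro mult_left_mono) auto
      then have "r (v $ i) * c \<le> r (u $ i) * c" using e[of i] by simp
      then show "r (v $ i) \<le> r (u $ i)" using c by simp
    qed (use u v in auto)
    moreover have "(\<Sum>i\<in>UNIV. u $ i) = (\<Sum>i\<in>UNIV. v $ i)" using u v by (simp add: trunc_tet_iff)
    then have "(\<Sum>i\<in>UNIV. u $ i - v $ i) = 0" by (simp add: sum_subtractf)
    ultimately have "u $ i - v $ i = 0" for i
      using sum_nonneg_eq_0_iff[of UNIV "\<lambda>i. u $ i - v $ i"] by auto
    then show ?thesis by (simp add: vec_eq_iff)
  qed
  have "r (x $ i) * cx = r (y $ i) * cy" for i using e ix by metis
  then show ?thesis
    using main[of x y cx cy] main[of y x cy cx] x y c by (metis linear)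
qed

text \<open>Off the truncation triangles a preimage has the form x_i = (2/3) c y_i / (1 + c y_i),
  and the intermediate value theorem finds c with sum 1. If only one y_i is positive, that sum stays
  below 2/3; then y is a vertex and comes from a truncation triangle.\<close>

lemma inflate_surj:
  assumes y: "y \<in> tetrahedron"
  obtains x where "x \<in> trunc_tet" "inflate x = y"
proof -
  have ys: "(\<Sum>i\<in>UNIV. y $ i) = 1" and yn: "0 \<le> y $ i" for i using y by (auto simp: tetrahedron_def)
  obtain a where a: "0 < y $ a"
  proof -
    have "\<not> (\<forall>c. y $ c = 0)" using ys by (metis sum.neutral zero_neq_one)
    then show ?thesis using that yn by (metis less_le)
  qed
  show ?thesis
  proof (cases "\<exists>b. b \<noteq> a \<and> 0 < y $ b")
    case False
    then have z: "y $ b = 0" if "b \<noteq> a" for b using yn[of b] that by (metis less_le)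
    obtain j where aj: "a \<noteq> j" using exhaust_4[of a] by (metis (full_types) one_neq_zero third_neq(1))
    have "y $ a = 1" using ys z third_neq[OF aj] aj by (simp add: sum_third[OF aj])
    then have "y = axis a 1" using z by (auto simp: vec_eq_iff axis_def)
    moreover have "inflate (bary a j (2 / 3) 0 0) = axis a 1"
      using corner_point[OF aj] bary_nth(1)[OF aj] by (intro inflate_boundary) auto
    ultimately show ?thesis using that corner_point(2)[OF aj] by metis
  next
    case True
    then obtain b where b: "b \<noteq> a" "0 < y $ b" by blast
    define h where "h c = (\<Sum>i\<in>UNIV. 2 / 3 * (c * y $ i) / (1 + c * y $ i))" for c
    define m where "m = min (y $ a) (y $ b)"
    have m: "0 < m" "m \<le> y $ a" "m \<le> y $ b" using a b by (auto simp: m_def)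
    have den: "0 < 1 + c * y $ i" if "0 \<le> c" for c i using that yn[of i] by (simp add: add_pos_nonneg)
    \<comment> \<open>At c = 3/m the two summands with y_i \<ge> m are already at least 2/3 * 3/4 =
      1/2 each.\<close>
    have half: "1 / 2 \<le> 2 / 3 * (3 / m * y $ i) / (1 + 3 / m * y $ i)" if "m \<le> y $ i" for i
    proof -
      define q where "q = 3 / m * y $ i"
      have "3 \<le> q" using that m(1) by (simp add: q_def field_simps)
      then show ?thesis unfolding q_def[symmetric] by (simp add: field_simps)
    qed
    have "1 \<le> h (3 / m)"
    proof -
      have "0 \<le> 2 / 3 * (3 / m * y $ i) / (1 + 3 / m * y $ i)" for i
        using den[of "3 / m" i] m yn[of i] by (intro divide_nonneg_pos mult_nonneg_nonneg) auto
      then have "2 / 3 * (3 / m * y $ b) / (1 + 3 / m * y $ b) + 2 / 3 * (3 / m * y $ a) / (1 + 3 / m * y $ a) \<le> h (3 / m)"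
        unfolding h_def sum_third[OF b(1)] by (simp add: add_nonneg_nonneg)
      then show ?thesis using half[OF m(2)] half[OF m(3)] by linarith
    qed
    moreover have "h 0 = 0" by (simp add: h_def)
    moreover have "continuous_on {0..3 / m} h"
      unfolding h_def
    proof (intro continuous_intros ballI)
      show "1 + c * y $ i \<noteq> 0" if "c \<in> {0..3 / m}" for c i using den[of c i] that by auto
    qed
    moreover have "0 \<le> 3 / m" using m by simp
    ultimately obtain c where c: "0 \<le> c" "h c = 1"
      using IVT'[of h 0 1 "3 / m"] by auto
    have cpos: "0 < c" using c \<open>h 0 = 0\<close> by (metis less_eq_real_def zero_neq_one)
    define x :: "real^4" where "x = (\<chi> i. 2 / 3 * (c * y $ i) / (1 + c * y $ i))"
    have d: "0 < 1 + c * y $ i" for i by (rule den[OF c(1)])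
    have lt: "x $ i < 2 / 3" "0 \<le> x $ i" for i
      using d[of i] yn[of i] c(1) by (simp_all add: x_def divide_less_eq)
    have xt: "x \<in> trunc_tet" unfolding trunc_tet_iff using lt less_imp_le c(2) by (auto simp: x_def h_def)
    have ratio: "x $ i / (2 / 3 - x $ i) = c * y $ i" for i
    proof -
      have "2 / 3 - x $ i = (2 / 3) / (1 + c * y $ i)" using d[of i] by (simp add: x_def field_simps)
      then show ?thesis using d[of i] by (simp add: x_def)
    qed
    have pp: "0 < (\<Prod>k\<in>UNIV. 2 / 3 - x $ k)" using lt by (intro prod_pos) auto
    have q: "infl x i = y $ i * (c * (\<Prod>k\<in>UNIV. 2 / 3 - x $ k))" for i
      unfolding infl_ratio[OF lt(1)] ratio by simp
    have "(\<Sum>j\<in>UNIV. infl x j) = c * (\<Prod>k\<in>UNIV. 2 / 3 - x $ k)"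
      unfolding q sum_distrib_right[symmetric] ys by simp
    moreover have "c * (\<Prod>k\<in>UNIV. 2 / 3 - x $ k) \<noteq> 0" using pp cpos by (metis less_irrefl mult_eq_0_iff)
    ultimately have "inflate x = y" unfolding inflate_def vec_eq_iff q
      by (simp only: vec_lambda_beta nonzero_mult_div_cancel_right) simp
    then show ?thesis using that xt by blast
  qed
qed

lemma Hausdorff_t2: "Hausdorff_space (euclidean :: 'e::t2_space topology)"
proof -
  have "\<exists>U V. open U \<and> open V \<and> x \<in> U \<and> y \<in> V \<and> disjnt U V" if "x \<noteq> y" for x y :: 'e
    using hausdorff[OF that] by (simp add: disjnt_def)
  then show ?thesis by (simp add: Hausdorff_space_def)
qed

lemma quotient_same_fibres:
  assumes f: "quotient_map X Y f" and h: "quotient_map X Z h"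
    and e: "\<And>x y. x \<in> topspace X \<Longrightarrow> y \<in> topspace X \<Longrightarrow> f x = f y \<longleftrightarrow> h x = h y"
  obtains k where "homeomorphic_map Y Z k" "\<And>x. x \<in> topspace X \<Longrightarrow> k (f x) = h x"
proof -
  obtain k where k: "continuous_map Y Z k" "\<And>x. x \<in> topspace X \<Longrightarrow> k (f x) = h x"
    using quotient_map_lift_exists[OF f quotient_imp_continuous_map[OF h]] e by metis
  obtain l where l: "continuous_map Z Y l" "\<And>x. x \<in> topspace X \<Longrightarrow> l (h x) = f x"
    using quotient_map_lift_exists[OF h quotient_imp_continuous_map[OF f]] e by metis
  have "homeomorphic_maps Y Z k l"
    unfolding homeomorphic_maps_def
  proof (intro conjI ballI k(1) l(1))
    fix y assume "y \<in> topspace Y"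
    then obtain x where "x \<in> topspace X" "y = f x" using quotient_imp_surjective_map[OF f] by blast
    then show "l (k y) = y" using k l by simp
  next
    fix z assume "z \<in> topspace Z"
    then obtain x where "x \<in> topspace X" "z = h x" using quotient_imp_surjective_map[OF h] by blast
    then show "k (l z) = z" using k l by simp
  qed
  then show ?thesis using that k(2) homeomorphic_maps_map by blast
qed

lemma realization_eq: "realization T g = quot_topology (top_of_set (T \<times> tetrahedron)) pc"
proof -
  have "discrete_topology T = top_of_set T"
    unfolding discrete_topology_unique
  proof (intro conjI ballI)
    fix t assume "t \<in> T"
    then have "{t} = T \<inter> {t}" by auto
    then show "openin (top_of_set T) {t}" using openin_open_Int[of "{t}" T] open_discrete by metis
  qed simp
  then have "prod_topology (discrete_topology T) (top_of_set tetrahedron) = top_of_set (T \<times> tetrahedron)"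
    by (simp add: subtopology_Times flip: euclidean_product_topology)
  then show ?thesis by (simp add: realization_def)
qed

lemma inflate_step:
  assumes "point_step T g (t, x) (t', y)"
  shows "point_step T g (t, inflate x) (t', inflate y)"
proof -
  obtain f where f: "t \<in> T" "x $ f = 0" "t' = nb t f" "t' \<in> T" "bij (gl t f)" "\<forall>a. y $ gl t f a = x $ a"
    using assms by (rule point_stepD)
  show ?thesis
    using f inflate_perm[OF f(5), of y x] inflate_zero[OF f(2)] unfolding point_step_def by auto
qed

lemma inflate_equiv:
  assumes "equivclp (point_step T g) (t, x) (t', y)"
  shows "equivclp (point_step T g) (t, inflate x) (t', inflate y)"
proof -
  let ?f = "\<lambda>(t, x). (t :: nat, inflate x)"
  have "True \<and> equivclp (point_step T g) (?f (t, x)) (?f (t', y))"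
    using assms
  proof (rule equivclp_map[where P = "\<lambda>_. True" and f = ?f])
    have st: "equivclp (point_step T g) (?f a) (?f b)" if "point_step T g a b" for a b
      using that inflate_step[of "fst a" "snd a" "fst b" "snd b"] by (auto simp: split_beta intro: r_into_equivclp)
    show "True \<and> equivclp (point_step T g) (?f a) (?f b)" if "point_step T g a b" for a b
      using st[OF that] by simp
    show "True \<and> equivclp (point_step T g) (?f a) (?f b)" if "point_step T g b a" for a b
      using equivclp_sym[OF st[OF that]] by simp
  qed simp
  then show ?thesis by simp
qed

text \<open>Off the truncation triangles \<open>inflate\<close> commutes with the gluing
  permutations and creates no new zero coordinates, so a chain of gluing steps lifts step by
  step.\<close>

lemma inflate_equiv_lift:
  assumes e: "equivclp (point_step T g) (t, inflate x) p" and x: "(t, x) \<in> XI"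
  obtains z where "p = (fst p, inflate z)" "(fst p, z) \<in> XI" "equivclp (point_step T g) (t, x) (fst p, z)"
proof -
  let ?P = "\<lambda>r. \<exists>z. r = (fst r, inflate z) \<and> (fst r, z) \<in> XI \<and> equivclp (point_step T g) (t, x) (fst r, z)"
  have st: "?P b" if "?P a" "point_step T g a b" for a b
  proof -
    obtain z where z: "a = (fst a, inflate z)" "(fst a, z) \<in> XI" "equivclp (point_step T g) (t, x) (fst a, z)"
      using \<open>?P a\<close> by blast
    obtain y where b: "b = (fst b, y)" by (metis prod.collapse)
    have "point_step T g (fst a, inflate z) (fst b, y)" using that(2) z(1) b by metis
    then obtain f where f: "fst a \<in> T" "inflate z $ f = 0" "fst b = nb (fst a) f" "fst b \<in> T" "bij (gl (fst a) f)"
      "\<forall>c. y $ gl (fst a) f c = inflate z $ c" by (rule point_stepD)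
    have zt: "z \<in> trunc_tet" "\<And>c. z $ c < 2 / 3" using z(2) by (auto simp: XI_def)
    define z' :: "real^4" where "z' = (\<chi> c. z $ inv (gl (fst a) f) c)"
    have z': "z' $ gl (fst a) f c = z $ c" for c using inv_gl[OF f(1)] by (simp add: z'_def)
    have "z' \<in> trunc_tet" using perm_trunc[OF f(5) z'] zt by simp
    moreover have "\<forall>c. z' $ c < 2 / 3" using zt by (simp add: z'_def)
    ultimately have zI: "(fst b, z') \<in> XI" using f(4) by (simp add: XI_def)
    have "y $ gl (fst a) f c = inflate z' $ gl (fst a) f c" for c using f(6) inflate_perm[OF f(5) z'] by simp
    then have "y $ c = inflate z' $ c" for c using gl_inv[OF f(1)] by metis
    then have "y = inflate z'" by (simp add: vec_eq_iff)
    moreover have "point_step T g (fst a, z) (fst b, z')"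
      using f inflate_zero_iff[OF zt] z' unfolding point_step_def by auto
    ultimately show ?thesis using b zI equivclp_trans[OF z(3) r_into_equivclp] by (intro exI[of _ z']) auto
  qed
  have "?P p"
  proof (rule equivclp_invariant[OF e, where P = ?P])
    show "?P (t, inflate x)" using x by (intro exI[of _ x]) simp
    show "?P b" if "?P a" "point_step T g a b" for a b using st[OF that] .
    show "?P b" if "?P a" "point_step T g b a" for a b using st[OF that(1) point_step_sym[OF that(2)]] .
  qed
  then show ?thesis using that by blast
qed

lemma vertex_class:
  assumes "t \<in> T" "t' \<in> T"
  shows "equivclp (point_step T g) (t, axis i 1) (t', axis i' 1)"
proof -
  let ?f = "\<lambda>(t, i). (t :: nat, axis i 1 :: real^4)"
  have "True \<and> equivclp (point_step T g) (?f (t, i)) (?f (t', i'))"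
    using vertices_connected[OF assms, of i i']
  proof (rule equivclp_map[where P = "\<lambda>_. True" and f = ?f])
    have st: "equivclp (point_step T g) (?f a) (?f b)" if ab: "vertex_step T g a b" for a b
    proof (rule r_into_equivclp)
      obtain t i t' i' where e: "a = (t, i)" "b = (t', i')" by (cases a; cases b)
      obtain f where f: "t \<in> T" "f \<noteq> i" "t' = nb t f" "i' = gl t f i" using ab by (auto simp: e vertex_step_def)
      then show "point_step T g (?f a) (?f b)"
        unfolding e point_step_def using gl_eq_iff[OF f(1)] by (auto simp: axis_def intro!: exI[of _ f])
    qed
    show "True \<and> equivclp (point_step T g) (?f a) (?f b)" if "vertex_step T g a b" for a b
      using st[OF that] by simp
    show "True \<and> equivclp (point_step T g) (?f a) (?f b)" if "vertex_step T g b a" for a b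
      using equivclp_sym[OF st[OF that]] by simp
  qed simp
  then show ?thesis by simp
qed

text \<open>For two inner points the gluing lifts through \<open>inflate\<close>, which is injective
  there. Two boundary points go to vertices, all of which are identified, and the boundary is a
  single component. A mixed pair is separated by both maps.\<close>

lemma fibres:
  assumes p: "p \<in> XS" "p' \<in> XS"
  shows "collapse_map NN (pc p) = collapse_map NN (pc p') \<longleftrightarrow>
    pc (fst p, inflate (snd p)) = pc (fst p', inflate (snd p'))"
proof -
  have tet: "(fst r, inflate (snd r)) \<in> T \<times> tetrahedron" if "r \<in> XS" for r
    using that inflate_tetrahedron by auto
  have iff: "pc (fst r, inflate (snd r)) = pc (fst r', inflate (snd r')) \<longleftrightarrow>
      equivclp (point_step T g) (fst r, inflate (snd r)) (fst r', inflate (snd r'))" if "r \<in> XS" "r' \<in> XS" for r r'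
    using point_class_eq_iff[OF tet[OF that(1)] tet[OF that(2)]] .
  have bd: "pc r \<in> mfd_boundary NN \<longleftrightarrow> r \<notin> XI" if "r \<in> XS" for r
    using pc_interior_iff[OF that] that unfolding mfd_boundary_def top_NN by blast
  have inflbd: "\<exists>i. inflate (snd r) = axis i 1" if r: "r \<in> XS" "r \<notin> XI" for r
  proof -
    obtain a where "\<not> snd r $ a < 2 / 3" using r unfolding XI_def by blast
    moreover have "snd r \<in> trunc_tet" using r(1) by auto
    ultimately have "snd r $ a = 2 / 3" using trunc_nonneg(2)[of "snd r" a] by simp
    then show ?thesis using inflate_boundary[OF \<open>snd r \<in> trunc_tet\<close>] by blast
  qed
  have inner: "collapse_map NN (pc r) = {pc r}" if "r \<in> XI" for r
  proof -
    have "r \<in> XS" using that by (auto simp: XI_def)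
    then show ?thesis using bd[of r] that by (simp add: collapse_map_def)
  qed
  have outer: "collapse_map NN (pc r) = mfd_boundary NN" if "r \<in> XS" "r \<notin> XI" for r
    using bd that collapse_boundary by blast
  have mixed: "collapse_map NN (pc r) \<noteq> collapse_map NN (pc r') \<and>
      pc (fst r, inflate (snd r)) \<noteq> pc (fst r', inflate (snd r'))" if r: "r \<in> XI" "r' \<in> XS" "r' \<notin> XI" for r r'
  proof
    have rX: "r \<in> XS" using r by (auto simp: XI_def)
    have "pc r \<notin> mfd_boundary NN" using bd[OF rX] r by simp
    then show "collapse_map NN (pc r) \<noteq> collapse_map NN (pc r')" using inner[OF r(1)] outer[OF r(2,3)] by auto
    obtain i where i: "inflate (snd r') = axis i 1" using inflbd r by blast
    show "pc (fst r, inflate (snd r)) \<noteq> pc (fst r', inflate (snd r'))"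
    proof
      assume "pc (fst r, inflate (snd r)) = pc (fst r', inflate (snd r'))"
      then have "equivclp (point_step T g) (fst r, inflate (snd r)) (fst r', axis i 1)"
        using iff[OF rX r(2)] i by simp
      then obtain z where z: "(fst r', axis i 1) = (fst r', inflate z)" "(fst r', z) \<in> XI"
        by (rule inflate_equiv_lift) (use r in auto)
      have zt: "z \<in> trunc_tet" "\<And>c. z $ c < 2 / 3" using z(2) by (auto simp: XI_def)
      \<comment> \<open>An inner point inflating to a vertex would have z_i = 1, beyond the
        truncation level.\<close>
      have "z $ c = 0" if "c \<noteq> i" for c
      proof -
        have "inflate z = axis i 1" using z(1) by simp
        then have "inflate z $ c = 0" using that by (simp add: axis_def)
        then show ?thesis using inflate_zero_iff[OF zt] by simp
      qed
      moreover obtain j where ij: "i \<noteq> j" using exhaust_4[of i] by (metis (full_types) one_neq_zero third_neq(1))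
      ultimately have "(\<Sum>c\<in>UNIV. z $ c) = z $ i" using third_neq[OF ij] ij by (simp add: sum_third[OF ij])
      then show False using zt(1) zt(2)[of i] by (simp add: trunc_tet_iff)
    qed
  qed
  show ?thesis
  proof (cases "p \<in> XI"; cases "p' \<in> XI")
    assume I: "p \<in> XI" "p' \<in> XI"
    have "pc p = pc p' \<longleftrightarrow> equivclp (point_step T g) (fst p, snd p) (fst p', snd p')"
      using p XS_sub by (subst point_class_eq_iff) auto
    also have "\<dots> \<longleftrightarrow> equivclp (point_step T g) (fst p, inflate (snd p)) (fst p', inflate (snd p'))"
    proof
      assume e: "equivclp (point_step T g) (fst p, inflate (snd p)) (fst p', inflate (snd p'))"
      have "(fst p, snd p) \<in> XI" using I(1) by (simp only: prod.collapse)
      from inflate_equiv_lift[OF e this] obtain z where z: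
        "(fst p', inflate (snd p')) = (fst p', inflate z)" "(fst p', z) \<in> XI"
        "equivclp (point_step T g) (fst p, snd p) (fst p', z)"
        by (auto simp only: fst_conv)
      have XID: "snd r \<in> trunc_tet" "snd r $ a < 2 / 3" if "r \<in> XI" for r :: "nat \<times> (real^4)" and a
        using that unfolding XI_def by auto
      have "snd p' = z"
        using inflate_inj[OF XID(1)[OF I(2)] XID(2)[OF I(2)] XID(1)[OF z(2)] XID(2)[OF z(2)]] z(1)
        unfolding snd_conv prod.inject by (elim conjE)
      then show "equivclp (point_step T g) (fst p, snd p) (fst p', snd p')" using z(3) by (simp only:)
    next
      assume "equivclp (point_step T g) (fst p, snd p) (fst p', snd p')"
      then show "equivclp (point_step T g) (fst p, inflate (snd p)) (fst p', inflate (snd p'))"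
        by (rule inflate_equiv)
    qed
    finally show ?thesis using inner[OF I(1)] inner[OF I(2)] iff[OF p] by simp
  next
    assume "p \<in> XI" "p' \<notin> XI"
    then show ?thesis using mixed[of p p'] p by simp
  next
    assume "p \<notin> XI" "p' \<in> XI"
    then show ?thesis using mixed[of p' p] p by metis
  next
    assume o: "p \<notin> XI" "p' \<notin> XI"
    obtain i i' where "inflate (snd p) = axis i 1" "inflate (snd p') = axis i' 1" using inflbd o p by metis
    then have "pc (fst p, inflate (snd p)) = pc (fst p', inflate (snd p'))"
      using iff[OF p] vertex_class[of "fst p" "fst p'" i i'] p by auto
    then show ?thesis using outer o p by simp
  qed
qed

text \<open>The collapse of the manifold and the realization are both quotients of the compact space
  \<open>XS\<close>, the latter through \<open>inflate\<close>, with the same fibres; such quotients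
  are homeomorphic.\<close>

theorem ideal_triangulation_NN: "ideal_triangulation T g NN"
  unfolding ideal_triangulation_def
proof (intro conjI)
  show "face_pairing T g" by (rule face_pairing)
  show "compact_space NN" by (rule quot_compact[OF XS_compact])
  show "manifold3 NN" by (rule manifold_NN)
  show "mfd_boundary NN \<noteq> {}" by (rule boundary_nonempty)
  let ?r = "\<lambda>p. (fst p, inflate (snd p))"
  have q1: "quotient_map (top_of_set XS) (collapse NN) (collapse_map NN \<circ> pc)"
    unfolding collapse_def by (rule quotient_map_compose[OF quotient_map_quot_topology quotient_map_quot_topology])
  have "continuous_on XS ?r"
    by (intro continuous_on_Pair continuous_on_fst continuous_on_id
      continuous_on_compose2[OF continuous_inflate continuous_on_snd[OF continuous_on_id]]) auto
  moreover have im: "?r ` XS = T \<times> tetrahedron"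
  proof (intro equalityI subsetI)
    fix p assume "p \<in> T \<times> tetrahedron"
    then have sp: "snd p \<in> tetrahedron" "fst p \<in> T" by auto
    obtain x where "x \<in> trunc_tet" "inflate x = snd p" by (rule inflate_surj[OF sp(1)])
    with sp have "p = ?r (fst p, x)" "(fst p, x) \<in> XS" by auto
    then show "p \<in> ?r ` XS" by blast
  next
    fix p assume "p \<in> ?r ` XS"
    then obtain q where "q \<in> XS" "p = ?r q" by (rule imageE) simp
    then show "p \<in> T \<times> tetrahedron" using inflate_tetrahedron[of "snd q"] by (simp add: mem_Times_iff)
  qed
  ultimately have "quotient_map (top_of_set XS) (top_of_set (T \<times> tetrahedron)) ?r"
    using XS_compact Hausdorff_space_subtopology[OF Hausdorff_t2, of "T \<times> tetrahedron"]
    by (intro continuous_imp_quotient_map) (simp_all add: compact_space_subtopology flip: image_subset_iff_funcset)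
  then have q2: "quotient_map (top_of_set XS) (realization T g) (pc \<circ> ?r)"
    unfolding realization_eq by (rule quotient_map_compose) (rule quotient_map_quot_topology)
  obtain h where h: "homeomorphic_map (collapse NN) (realization T g) h"
    "\<And>p. p \<in> topspace (top_of_set XS) \<Longrightarrow> h ((collapse_map NN \<circ> pc) p) = (pc \<circ> ?r) p"
  proof (rule quotient_same_fibres[OF q1 q2])
    fix p p' assume "p \<in> topspace (top_of_set XS)" "p' \<in> topspace (top_of_set XS)"
    then show "(collapse_map NN \<circ> pc) p = (collapse_map NN \<circ> pc) p' \<longleftrightarrow> (pc \<circ> ?r) p = (pc \<circ> ?r) p'"
      using fibres[of p p'] by simp
  qed blast
  have "h ` (collapse_map NN ` mfd_boundary NN) = vertex_points T g"
  proof -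
    have "h ` (collapse_map NN ` mfd_boundary NN) = (\<lambda>p. pc (?r p)) ` (XS - XI)"
      unfolding boundary_NN image_image using h(2) by (intro image_cong) auto
    also have "\<dots> = vertex_points T g"
    proof (intro equalityI subsetI)
      fix n assume "n \<in> (\<lambda>p. pc (?r p)) ` (XS - XI)"
      then obtain p a where p: "p \<in> XS" "n = pc (?r p)" "\<not> snd p $ a < 2 / 3" unfolding XI_def by blast
      then have "snd p $ a = 2 / 3" using trunc_nonneg(2)[of "snd p" a] by auto
      then have "n = pc (fst p, axis a 1)" using p inflate_boundary[of "snd p" a] by auto
      then show "n \<in> vertex_points T g" using p unfolding vertex_points_def by auto
    next
      fix n assume "n \<in> vertex_points T g"
      then obtain t i where t: "t \<in> T" "n = pc (t, axis i 1)" unfolding vertex_points_def by blast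
      obtain j where ij: "i \<noteq> j" using exhaust_4[of i] by (metis (full_types) one_neq_zero third_neq(1))
      let ?p = "(t, bary i j (2 / 3) 0 0)"
      have "?p \<in> XS - XI" using corner_point(2)[OF ij] bary_nth(1)[OF ij] t by (auto simp: XI_def intro!: exI[of _ i])
      moreover have "n = pc (?r ?p)" using inflate_boundary[OF corner_point(2)[OF ij] bary_nth(1)[OF ij]] t by simp
      ultimately show "n \<in> (\<lambda>p. pc (?r p)) ` (XS - XI)" by blast
    qed
    finally show ?thesis .
  qed
  then show "\<exists>h. homeomorphic_map (collapse NN) (realization T g) h \<and> h ` (collapse_map NN ` mfd_boundary NN) = vertex_points T g"
    using h(1) by blast
qed

end

section \<open>Orientability\<close>

lemma homotopicI:
  fixes H :: "real \<times> 'a::topological_space \<Rightarrow> 'b::topological_space"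
  assumes "continuous_on ({0..1} \<times> S) H" "\<And>u x. 0 \<le> u \<Longrightarrow> u \<le> 1 \<Longrightarrow> x \<in> S \<Longrightarrow> H (u, x) \<in> U"
    "\<And>x. x \<in> S \<Longrightarrow> H (0, x) = f x" "\<And>x. x \<in> S \<Longrightarrow> H (1, x) = g x"
  shows "homotopic_with_canon (\<lambda>_. True) S U f g"
proof -
  have "prod_topology (top_of_set {0..1}) (top_of_set S) = top_of_set ({0..1 :: real} \<times> S)"
    by (simp add: subtopology_Times flip: euclidean_product_topology)
  moreover have "H \<in> {0..1} \<times> S \<rightarrow> U" using assms(2) by auto
  ultimately have "continuous_map (prod_topology (top_of_set {0..1}) (top_of_set S)) (top_of_set U) H"
    using assms(1) by simp
  then show ?thesis using assms(3,4) by (subst homotopic_with) auto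
qed

lemma eventually_small: "0 < e \<Longrightarrow> eventually (\<lambda>r. 0 < r \<and> r < e) (at_right (0 :: real))"
  by (intro eventually_conj eventually_at_right_less) (auto simp: eventually_at_right intro!: exI[of _ e])

text \<open>Moving the base point along the segment from p to q is a homotopy between the
  displacement maps, and injectivity of f keeps it away from 0.\<close>

lemma orientation_preserving_near:
  assumes f: "continuous_on (ball p R) f" "inj_on f (ball p R)" and q: "q \<in> ball p (R / 2)"
    and o: "orientation_preserving_at f q"
  shows "orientation_preserving_at f p"
proof -
  have qp: "norm (q - p) < R / 2" using q by (simp add: dist_norm norm_minus_commute)
  then have R: "0 < R / 2" using norm_ge_zero[of "q - p"] by linarith
  have "eventually (\<lambda>r. (0 < r \<and> r < R / 2) \<and>
      homotopic_with_canon (\<lambda>_. True) (sphere 0 r) (- {0}) (\<lambda>y. f (q + y) - f q) (\<lambda>y. y)) (at_right 0)"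
    by (rule eventually_conj[OF eventually_small[OF R] o[unfolded orientation_preserving_at_def]])
  then show ?thesis
    unfolding orientation_preserving_at_def
  proof (rule eventually_mono, elim conjE)
    fix r :: real assume r: "0 < r" "r < R / 2"
      and h: "homotopic_with_canon (\<lambda>_. True) (sphere 0 r) (- {0}) (\<lambda>y. f (q + y) - f q) (\<lambda>y. y)"
    have c: "p + u *\<^sub>R (q - p) + y \<in> ball p R" if "0 \<le> u" "u \<le> 1" "norm y \<le> r" for u y
    proof -
      have "norm (u *\<^sub>R (q - p)) \<le> 1 * norm (q - p)"
        unfolding norm_scaleR using that by (intro mult_right_mono) auto
      then have "norm (u *\<^sub>R (q - p) + y) < R" using norm_triangle_ineq[of "u *\<^sub>R (q - p)" y] qp r that by linarith
      then show ?thesis by (simp add: dist_norm norm_minus_commute algebra_simps)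
    qed
    have c0: "p + u *\<^sub>R (q - p) \<in> ball p R" if "0 \<le> u" "u \<le> 1" for u using c[OF that, of 0] r by simp
    have "homotopic_with_canon (\<lambda>_. True) (sphere 0 r) (- {0}) (\<lambda>y. f (p + y) - f p) (\<lambda>y. f (q + y) - f q)"
    proof (rule homotopicI[where H = "\<lambda>x. f (p + fst x *\<^sub>R (q - p) + snd x) - f (p + fst x *\<^sub>R (q - p))"])
      show "continuous_on ({0..1} \<times> sphere 0 r) (\<lambda>x. f (p + fst x *\<^sub>R (q - p) + snd x) - f (p + fst x *\<^sub>R (q - p)))"
        using c c0 by (intro continuous_on_diff continuous_on_compose2[OF f(1)] continuous_intros) auto
      show "f (p + fst (u, y) *\<^sub>R (q - p) + snd (u, y)) - f (p + fst (u, y) *\<^sub>R (q - p)) \<in> - {0}"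
        if "0 \<le> u" "u \<le> 1" "y \<in> sphere 0 r" for u y
      proof -
        have ne: "p + u *\<^sub>R (q - p) + y \<noteq> p + u *\<^sub>R (q - p)" using that r by auto
        have "p + u *\<^sub>R (q - p) + y \<in> ball p R" using c[OF that(1,2), of y] that(3) by simp
        then have "f (p + u *\<^sub>R (q - p) + y) \<noteq> f (p + u *\<^sub>R (q - p))"
          using inj_onD[OF f(2) _ _ c0[OF that(1,2)]] ne by blast
        then show ?thesis by simp
      qed
    qed simp_all
    then show "homotopic_with_canon (\<lambda>_. True) (sphere 0 r) (- {0}) (\<lambda>y. f (p + y) - f p) (\<lambda>y. y)"
      using h by (rule homotopic_with_trans)
  qed
qed

lemma chart_transition:
  assumes c: "chart3 X U \<phi>" "chart3 X V \<psi>"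
  defines "f \<equiv> \<psi> \<circ> inv_into U \<phi>"
  shows "open (\<phi> ` (U \<inter> V))" "continuous_on (\<phi> ` (U \<inter> V)) f" "inj_on f (\<phi> ` (U \<inter> V))"
    "\<And>n. n \<in> U \<Longrightarrow> f (\<phi> n) = \<psi> n"
proof -
  have o: "openin X U" "openin X V" "open (\<phi> ` U)"
    and h: "homeomorphic_map (subtopology X U) (top_of_set (\<phi> ` U)) \<phi>" "homeomorphic_map (subtopology X V) (top_of_set (\<psi> ` V)) \<psi>"
    using c by (auto simp: chart3_def)
  have top: "topspace (subtopology X U) = U" "topspace (subtopology X V) = V" using o openin_subset by auto
  have inj: "inj_on \<phi> U" "inj_on \<psi> V" using homeomorphic_imp_injective_map[OF h(1)] homeomorphic_imp_injective_map[OF h(2)] top by auto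
  show f: "f (\<phi> n) = \<psi> n" if "n \<in> U" for n using that inj(1) by (simp add: f_def)
  have "openin (subtopology X U) (U \<inter> V)" using o by (simp add: openin_subtopology_Int2)
  then have "openin (top_of_set (\<phi> ` U)) (\<phi> ` (U \<inter> V))"
    using homeomorphic_imp_open_map[OF h(1)] by (auto simp: open_map_def)
  then show "open (\<phi> ` (U \<inter> V))" using o(3) openin_open_trans by blast
  show "inj_on f (\<phi> ` (U \<inter> V))" using f inj by (auto simp: inj_on_def)
  obtain k where k: "homeomorphic_maps (subtopology X U) (top_of_set (\<phi> ` U)) \<phi> k" using h(1) homeomorphic_map_maps by blast
  have kn: "k (\<phi> n) = n" if "n \<in> U" for n using k that top by (simp add: homeomorphic_maps_def)
  have "continuous_map (top_of_set (\<phi> ` U)) X k"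
    using k by (simp add: homeomorphic_maps_def continuous_map_in_subtopology)
  then have "continuous_map (subtopology (top_of_set (\<phi> ` U)) (\<phi> ` (U \<inter> V))) X k" by (rule continuous_map_from_subtopology)
  then have "continuous_map (top_of_set (\<phi> ` (U \<inter> V))) X k" by (simp add: subtopology_subtopology Int_absorb1 image_mono)
  moreover have "k ` (\<phi> ` (U \<inter> V)) \<subseteq> V" using kn by auto
  ultimately have "continuous_map (top_of_set (\<phi> ` (U \<inter> V))) (subtopology X V) k"
    by (auto simp: continuous_map_in_subtopology)
  moreover have "continuous_map (subtopology X V) euclidean \<psi>"
    using homeomorphic_imp_continuous_map[OF h(2)] by (simp add: continuous_map_in_subtopology)
  ultimately have "continuous_map (top_of_set (\<phi> ` (U \<inter> V))) euclidean (\<psi> \<circ> k)" by (rule continuous_map_compose)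
  then have "continuous_on (\<phi> ` (U \<inter> V)) (\<psi> \<circ> k)" by simp
  then show "continuous_on (\<phi> ` (U \<inter> V)) f" by (rule continuous_on_eq) (use f kn in auto)
qed

text \<open>
  On the hyperplane of barycentric displacements, the linear parts of all fan charts are homotopic
  through maps without zeros: the angles can be deformed, and two frames differing by an even
  permutation are joined by a segment of frames.
\<close>

definition frame :: "4 \<Rightarrow> 4 \<Rightarrow> real \<Rightarrow> real \<Rightarrow> real^4 \<Rightarrow> real^3" where
  "frame i j \<theta> \<alpha> v = cyl (- v $ i) (cis \<theta> * (complex_of_real (v $ third i j) + complex_of_real (v $ third j i) * cis \<alpha>))"

definition displacements :: "(real^4) set" where
  "displacements = {v. (\<Sum>a\<in>UNIV. v $ a) = 0} - {0}"

lemma frame_zero: "frame i j \<theta> \<alpha> 0 = 0"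
  by (simp add: frame_def vec_eq_iff forall_3 cyl_nth)

lemma frame_nonzero:
  assumes "i \<noteq> j" "0 < \<alpha>" "\<alpha> < pi" "v \<in> displacements"
  shows "frame i j \<theta> \<alpha> v \<noteq> 0"
proof
  assume z: "frame i j \<theta> \<alpha> v = 0"
  let ?s = "v $ third i j" and ?u = "v $ third j i"
  have "cyl (- v $ i) (cis \<theta> * (complex_of_real ?s + complex_of_real ?u * cis \<alpha>)) = cyl 0 0"
    using z unfolding frame_def by (simp add: vec_eq_iff forall_3 cyl_nth)
  then have "v $ i = 0" "cis \<theta> * (complex_of_real ?s + complex_of_real ?u * cis \<alpha>) = 0" unfolding cyl_eq_iff by simp_all
  then have w: "v $ i = 0" "complex_of_real ?s + complex_of_real ?u * cis \<alpha> = 0" by (simp_all add: cis_neq_zero)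
  have "Im (complex_of_real ?s + complex_of_real ?u * cis \<alpha>) = 0" "Re (complex_of_real ?s + complex_of_real ?u * cis \<alpha>) = 0"
    unfolding w(2) by simp_all
  moreover have "sin \<alpha> \<noteq> 0" using sin_gt_zero[OF assms(2,3)] by simp
  ultimately have "?u = 0" "?s = 0" by auto
  moreover from this have "v $ j = 0" using assms(4) w(1) by (simp add: displacements_def sum_third[OF assms(1)])
  ultimately have "v = 0" using w(1) by (simp add: vec_eq_iff all_third[OF assms(1)])
  then show False using assms(4) by (simp add: displacements_def)
qed

lemma continuous_frame: "continuous_on S (frame i j \<theta> \<alpha>)"
  unfolding frame_def by (intro continuous_on_cyl continuous_intros)

abbreviation frames_homotopic :: "(real^4 \<Rightarrow> real^3) \<Rightarrow> (real^4 \<Rightarrow> real^3) \<Rightarrow> bool" where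
  "frames_homotopic \<equiv> homotopic_with_canon (\<lambda>_. True) displacements (- {0})"

lemma frame_angles:
  assumes "i \<noteq> j" "0 < \<alpha>" "\<alpha> < pi"
  shows "frames_homotopic (frame i j \<theta> \<alpha>) (frame i j 0 (pi / 2))"
proof (rule homotopicI[where H = "\<lambda>x. frame i j ((1 - fst x) * \<theta>) ((1 - fst x) * \<alpha> + fst x * (pi / 2)) (snd x)"])
  show "continuous_on ({0..1} \<times> displacements) (\<lambda>x. frame i j ((1 - fst x) * \<theta>) ((1 - fst x) * \<alpha> + fst x * (pi / 2)) (snd x))"
    unfolding frame_def by (intro continuous_on_cyl continuous_intros)
  fix u :: real and v assume u: "0 \<le> u" "u \<le> 1" and v: "v \<in> displacements"
  have "(1 - u) * \<alpha> + u * (pi / 2) \<in> {0<..<pi}"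
    using convexD_alt[of "{0<..<pi}" \<alpha> "pi / 2" u] assms u by simp
  then have a: "0 < (1 - u) * \<alpha> + u * (pi / 2)" "(1 - u) * \<alpha> + u * (pi / 2) < pi" by auto
  show "frame i j ((1 - fst (u, v)) * \<theta>) ((1 - fst (u, v)) * \<alpha> + fst (u, v) * (pi / 2)) (snd (u, v)) \<in> - {0}"
    using frame_nonzero[OF assms(1) a v] by simp
qed simp_all

text \<open>The equations say that a I + b M kills (p, q) for the map M of order three sending (p,
  q) to (q, - p - q). Its determinant a^2 - a b + b^2, the norm of a plus b times a primitive cube
  root of unity, is positive.\<close>

lemma segment_cancel:
  fixes p q a b :: real
  assumes "a + b = 1" "0 \<le> a" "0 \<le> b" "a * p + b * q = 0" "a * q = b * (p + q)"
  shows "p = 0" "q = 0"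
proof -
  have "a * (a * q) = a * (b * (p + q))" unfolding assms(5) by (rule refl)
  also have "\<dots> = b * (a * p + a * q)" by (simp add: algebra_simps)
  also have "a * p = - (b * q)" using assms(4) by linarith
  finally have "(a * a - a * b + b * b) * q = 0" by (simp add: algebra_simps)
  moreover have "0 < a * a - a * b + b * b"
  proof -
    have "a * a - a * b + b * b = (a - b)\<^sup>2 + a * b" by (simp add: power2_eq_square algebra_simps)
    moreover have "0 \<le> a * b" "0 \<le> (a - b)\<^sup>2" using assms by simp_all
    moreover have "a - b \<noteq> 0 \<or> a * b \<noteq> 0" using assms(1) by auto
    ultimately show ?thesis using zero_less_power2[of "a - b"] by (metis add_nonneg_pos add_pos_nonneg less_le)
  qed
  ultimately show q: "q = 0" by simp
  have p: "a * p = 0" "b * p = 0" using assms(4,5) q by simp_all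
  have "(a + b) * p = 0" unfolding distrib_right p by simp
  then show "p = 0" using assms(1) by simp
qed

lemma frame_segment:
  assumes "\<And>a b v. a + b = 1 \<Longrightarrow> 0 \<le> a \<Longrightarrow> 0 \<le> b \<Longrightarrow> v \<in> displacements \<Longrightarrow>
    a *\<^sub>R frame i j 0 (pi / 2) v + b *\<^sub>R frame i' j' 0 (pi / 2) v \<noteq> 0"
  shows "frames_homotopic (frame i j 0 (pi / 2)) (frame i' j' 0 (pi / 2))"
proof (rule homotopic_with_linear[OF continuous_frame continuous_frame])
  fix v assume v: "v \<in> displacements"
  show "closed_segment (frame i j 0 (pi / 2) v) (frame i' j' 0 (pi / 2) v) \<subseteq> - {0}"
  proof
    fix w assume "w \<in> closed_segment (frame i j 0 (pi / 2) v) (frame i' j' 0 (pi / 2) v)"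
    then obtain u where u: "0 \<le> u" "u \<le> 1" "w = (1 - u) *\<^sub>R frame i j 0 (pi / 2) v + u *\<^sub>R frame i' j' 0 (pi / 2) v"
      by (auto simp: in_segment)
    then show "w \<in> - {0}" using assms[of "1 - u" u v] v by simp
  qed
qed

lemma frame_comb:
  "a *\<^sub>R frame i j 0 (pi / 2) v + b *\<^sub>R frame i' j' 0 (pi / 2) v = 0 \<longleftrightarrow>
    a * v $ i + b * v $ i' = 0 \<and> a * v $ third i j + b * v $ third i' j' = 0 \<and> a * v $ third j i + b * v $ third j' i' = 0"
proof -
  have "- (a * v $ i) - b * v $ i' = 0 \<longleftrightarrow> a * v $ i + b * v $ i' = 0" by linarith
  then show ?thesis by (simp add: frame_def vec_eq_iff forall_3 cyl_nth)
qed

text \<open>The two changes of flag are 3-cycles of the vertices, fixing \<open>i\<close> and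
  \<open>third j i\<close> respectively. A zero on the segment between the frames would satisfy the
  equations of \<open>segment_cancel\<close>.\<close>

lemma frame_rotate:
  assumes ij: "i \<noteq> j"
  shows "frames_homotopic (frame i j 0 (pi / 2)) (frame i (third i j) 0 (pi / 2))"
    "frames_homotopic (frame i j 0 (pi / 2)) (frame j (third i j) 0 (pi / 2))"
proof -
  note th = third_cycle[OF ij]
  have z: False if "v \<in> displacements" "v $ i = 0" "v $ third i j = 0" "v $ third j i = 0" for v :: "real^4"
  proof -
    have "v $ j = 0" using that by (simp add: displacements_def sum_third[OF ij])
    then have "v = 0" using that by (simp add: vec_eq_iff all_third[OF ij])
    then show False using that(1) by (simp add: displacements_def)
  qed
  have s: "v $ j = - v $ i - v $ third i j - v $ third j i" if "v \<in> displacements" for v :: "real^4"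
    using that by (simp add: displacements_def sum_third[OF ij])
  show "frames_homotopic (frame i j 0 (pi / 2)) (frame i (third i j) 0 (pi / 2))"
  proof (rule frame_segment, rule notI)
    fix a b v assume ab: "a + b = 1" "0 \<le> (a :: real)" "0 \<le> b" and v: "v \<in> displacements"
      and "a *\<^sub>R frame i j 0 (pi / 2) v + b *\<^sub>R frame i (third i j) 0 (pi / 2) v = 0"
    then have e: "a * v $ i + b * v $ i = 0" "a * v $ third i j + b * v $ third j i = 0" "a * v $ third j i + b * v $ j = 0"
      unfolding frame_comb th by simp_all
    have "(a + b) * v $ i = 0" using e(1) by (simp add: distrib_right)
    then have i: "v $ i = 0" using ab by simp
    have "v $ j = - (v $ third i j + v $ third j i)" using s[OF v] i by simp
    then have "b * v $ j = - (b * (v $ third i j + v $ third j i))" by (simp only: mult_minus_right)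
    then have "a * v $ third j i = b * (v $ third i j + v $ third j i)" using e(3) by linarith
    from z[OF v i segment_cancel[OF ab e(2) this]] show False .
  qed
  show "frames_homotopic (frame i j 0 (pi / 2)) (frame j (third i j) 0 (pi / 2))"
  proof (rule frame_segment, rule notI)
    fix a b v assume ab: "a + b = 1" "0 \<le> (a :: real)" "0 \<le> b" and v: "v \<in> displacements"
      and "a *\<^sub>R frame i j 0 (pi / 2) v + b *\<^sub>R frame j (third i j) 0 (pi / 2) v = 0"
    then have e: "a * v $ i + b * v $ j = 0" "a * v $ third i j + b * v $ i = 0" "a * v $ third j i + b * v $ third j i = 0"
      unfolding frame_comb th by simp_all
    have "(a + b) * v $ third j i = 0" using e(3) by (simp add: distrib_right)
    then have l: "v $ third j i = 0" using ab by simp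
    have "v $ j = - (v $ third i j + v $ i)" using s[OF v] l by simp
    then have "b * v $ j = - (b * (v $ third i j + v $ i))" by (simp only: mult_minus_right)
    then have "a * v $ i = b * (v $ third i j + v $ i)" using e(1) by linarith
    from segment_cancel[OF ab e(2) this] z[OF v _ _ l] show False by blast
  qed
qed

text \<open>The 3-cycles connect any two flags: rotate around \<open>i\<close> until the second
  vertex is \<open>i'\<close>, move \<open>i'\<close> to the first place, and rotate around
  \<open>i'\<close>.\<close>

lemma frames_all:
  assumes "i \<noteq> j" "i' \<noteq> j'" "0 < \<alpha>" "\<alpha> < pi" "0 < \<alpha>'" "\<alpha>' < pi"
  shows "frames_homotopic (frame i j \<theta> \<alpha>) (frame i' j' \<theta>' \<alpha>')"
proof -
  let ?b = "\<lambda>i j. frame i j 0 (pi / 2)"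
  have same: "frames_homotopic (?b i j) (?b i m)" if "i \<noteq> j" "i \<noteq> m" for i j m
  proof -
    have r: "frames_homotopic (?b i j) (?b i (third i j))" by (rule frame_rotate(1)[OF that(1)])
    have r2: "frames_homotopic (?b i (third i j)) (?b i (third j i))"
      using frame_rotate(1)[of i "third i j"] third_neq[OF that(1)] third_cycle[OF that(1)] by simp
    have "m = j \<or> m = third i j \<or> m = third j i" using third_cases[OF that(1), of m] that(2) by blast
    moreover have "frames_homotopic (?b i j) (?b i j)" using homotopic_with_trans[OF r homotopic_with_symD[OF r]] .
    ultimately show ?thesis using r homotopic_with_trans[OF r r2] by (elim disjE) simp_all
  qed
  have "frames_homotopic (?b i j) (?b i' j')"
  proof (cases "i = i'")
    case True
    then show ?thesis using same assms by simp
  next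
    case False
    have "i' \<noteq> third i i'" using third_neq[OF False] by blast
    from homotopic_with_trans[OF homotopic_with_trans[OF same[OF assms(1) False] frame_rotate(2)[OF False]] same[OF this assms(2)]]
    show ?thesis .
  qed
  then show ?thesis
    using homotopic_with_trans[OF homotopic_with_trans[OF frame_angles[OF assms(1,3,4)]] homotopic_with_symD[OF frame_angles[OF assms(2,5,6)]]] by blast
qed

lemma frame_inverse:
  assumes ij: "i \<noteq> j" and \<alpha>: "0 < \<alpha>" "\<alpha> < pi"
  obtains h where "continuous_on UNIV h" "\<And>w. frame i j \<theta> \<alpha> (h w) = w" "\<And>w. (\<Sum>a\<in>UNIV. h w $ a) = 0" "h 0 = 0"
proof -
  define z where "z w = cis (- \<theta>) * Complex (w $ 2) (w $ 3)" for w :: "real^3"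
  define u where "u w = Im (z w) / sin \<alpha>" for w
  define s where "s w = Re (z w) - u w * cos \<alpha>" for w
  define h :: "real^3 \<Rightarrow> real^4" where "h w = (\<chi> a. if a = i then - w $ 1 else if a = third i j then s w else if a = third j i then u w
    else w $ 1 - s w - u w)" for w
  have n: "h w $ i = - w $ 1" "h w $ third i j = s w" "h w $ third j i = u w" "h w $ j = w $ 1 - s w - u w" for w
    using third_neq[OF ij] ij by (auto simp: h_def)
  have sn: "sin \<alpha> \<noteq> 0" using sin_gt_zero[OF \<alpha>] by simp
  have zc: "continuous_on UNIV z" unfolding z_def Complex_eq by (intro continuous_intros)
  have uc: "continuous_on UNIV u" unfolding u_def using sn by (intro continuous_intros zc) auto
  have sc: "continuous_on UNIV s" unfolding s_def by (intro continuous_intros zc uc)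
  have "continuous_on UNIV h"
    unfolding h_def
  proof (rule continuous_on_vec_lambda)
    fix a
    show "continuous_on UNIV (\<lambda>w. if a = i then - w $ 1 else if a = third i j then s w else if a = third j i then u w else w $ 1 - s w - u w)"
      by (cases "a = i"; cases "a = third i j"; cases "a = third j i"; simp; intro continuous_intros sc uc)
  qed
  moreover have "frame i j \<theta> \<alpha> (h w) = w" for w
  proof -
    have "complex_of_real (s w) + complex_of_real (u w) * cis \<alpha> = z w"
      using sn by (simp add: complex_eq_iff s_def u_def)
    moreover have "cis \<theta> * z w = Complex (w $ 2) (w $ 3)" by (simp add: z_def cis_mult flip: mult.assoc)
    ultimately show ?thesis unfolding frame_def n by (simp flip: cyl_nths)
  qed
  moreover have "(\<Sum>a\<in>UNIV. h w $ a) = 0" for w by (simp add: sum_third[OF ij] n)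
  moreover have "h 0 = 0"
  proof -
    have "z 0 = 0" by (simp add: z_def complex_eq_iff)
    then have "u 0 = 0" "s 0 = 0" by (simp_all add: u_def s_def)
    then show ?thesis by (simp add: h_def vec_eq_iff)
  qed
  ultimately show ?thesis using that by blast
qed

text \<open>Near p the map is the second frame composed with the inverse h of the first. Composing
  the homotopy between the frames with h deforms its displacement map to the identity.\<close>

lemma orientation_preserving_frames:
  assumes ij: "i \<noteq> j" "i' \<noteq> j'" and \<alpha>: "0 < \<alpha>" "\<alpha> < pi" "0 < \<alpha>'" "\<alpha>' < pi" and e: "0 < e"
    and f: "\<And>v. (\<Sum>a\<in>UNIV. v $ a) = 0 \<Longrightarrow> norm v < e \<Longrightarrow> f (p + frame i j \<theta> \<alpha> v) = q + frame i' j' \<theta>' \<alpha>' v"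
  shows "orientation_preserving_at f p"
proof -
  obtain h where h: "continuous_on UNIV h" "\<And>w. frame i j \<theta> \<alpha> (h w) = w" "\<And>w. (\<Sum>a\<in>UNIV. h w $ a) = 0" "h 0 = 0"
    by (rule frame_inverse[OF ij(1) \<alpha>(1,2)]) blast
  obtain d where d: "0 < d" "\<And>w. norm w < d \<Longrightarrow> norm (h w) < e"
  proof -
    have "isCont h 0" using h(1) by (simp add: continuous_on_eq_continuous_at)
    then show ?thesis using that e h(4) unfolding continuous_at_eps_delta by (auto simp: dist_norm)
  qed
  show ?thesis
    unfolding orientation_preserving_at_def
  proof (rule eventually_mono[OF eventually_small[OF d(1)]], elim conjE)
    fix r :: real assume r: "0 < r" "r < d"
    have "h \<in> sphere 0 r \<rightarrow> displacements"
    proof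
      fix w :: "real^3" assume "w \<in> sphere 0 r"
      then have "w \<noteq> 0" using r by auto
      then have "h w \<noteq> 0" using h(2)[of w] frame_zero by metis
      then show "h w \<in> displacements" using h(3) by (simp add: displacements_def)
    qed
    moreover have "continuous_on (sphere 0 r) h" using h(1) continuous_on_subset by blast
    ultimately have "homotopic_with_canon (\<lambda>_. True) (sphere 0 r) (- {0}) (frame i' j' \<theta>' \<alpha>' \<circ> h) (frame i j \<theta> \<alpha> \<circ> h)"
      by (intro homotopic_with_compose_continuous_right[where X = displacements] frames_all ij \<alpha>) 
    then show "homotopic_with_canon (\<lambda>_. True) (sphere 0 r) (- {0}) (\<lambda>y. f (p + y) - f p) (\<lambda>y. y)"
    proof (rule homotopic_with_eq)
      fix y :: "real^3" assume "y \<in> topspace (top_of_set (sphere 0 r))"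
      then have y: "norm (h y) < e" using d r by auto
      have "f (p + y) = q + frame i' j' \<theta>' \<alpha>' (h y)" using f[OF h(3) y] h(2) by simp
      moreover have "f p = q" using f[of 0] e frame_zero by simp
      ultimately show "f (p + y) - f p = (frame i' j' \<theta>' \<alpha>' \<circ> h) y" by simp
      show "y = (frame i j \<theta> \<alpha> \<circ> h) y" using h(2) by simp
    qed simp
  qed
qed

section \<open>Orientation of the chart transitions\<close>

context triangulation
begin

abbreviation affine_fan :: "(nat \<times> 4 \<times> 4 \<Rightarrow> real) \<Rightarrow> real \<Rightarrow> nat \<times> 4 \<times> 4 \<Rightarrow> real^4 \<Rightarrow> real^3" where
  "affine_fan \<theta> \<alpha> F y \<equiv> cyl (2 / 3 - y $ fst (snd F)) (cis (\<theta> F) * fz \<alpha> F y)"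

lemma affine_fan_add:
  "affine_fan \<theta> \<alpha> F (y + v) = affine_fan \<theta> \<alpha> F y + frame (fst (snd F)) (snd (snd F)) (\<theta> F) \<alpha> v"
  by (simp add: frame_def vec_eq_iff forall_3 cyl_nth algebra_simps)

lemma continuous_affine_fan: "continuous_on S (affine_fan \<theta> \<alpha> F)"
  by (intro continuous_on_cyl continuous_intros)

definition interior_dom :: "(nat \<times> 4 \<times> 4) set \<Rightarrow> (nat \<times> 4 \<times> 4 \<Rightarrow> real) \<Rightarrow> real \<Rightarrow>
    (nat \<Rightarrow> nat \<times> 4 \<times> 4 \<Rightarrow> real^4 \<Rightarrow> bool) \<Rightarrow> (nat \<times> (real^4)) set" where
  "interior_dom Fl \<theta> \<alpha> P = {p \<in> dom Fl (P 0). 0 < fan_map Fl \<theta> \<alpha> P p $ 1}"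

lemma interior_dom_local:
  assumes gf: "good_fan Fl \<theta> \<alpha> P" and p: "(t, x) \<in> interior_dom Fl \<theta> \<alpha> P"
  obtains F W where "fst (snd F) \<noteq> snd (snd F)" "0 < \<alpha>" "\<alpha> < pi" "open W" "x \<in> W"
    "\<And>y. y \<in> trunc_tet \<Longrightarrow> y \<in> W \<Longrightarrow> (t, y) \<in> interior_dom Fl \<theta> \<alpha> P \<and> fan_map Fl \<theta> \<alpha> P (t, y) = affine_fan \<theta> \<alpha> F y"
proof -
  note fan = good_fanD(1)[OF gf] and cd = interior_chart(1)[OF gf, folded interior_dom_def]
  have sub: "interior_dom Fl \<theta> \<alpha> P \<subseteq> dom Fl (P 2)" "openin (top_of_set XS) (interior_dom Fl \<theta> \<alpha> P)"
    using cd unfolding chart_datum_def by auto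
  then have "(t, x) \<in> dom Fl (P 2)" using p by blast
  from fan_local[OF fan this] obtain F where F: "F \<in> Fl" "fst F = t" "open {y. P 2 F y}" "P 2 F x"
    "\<And>y. y \<in> trunc_tet \<Longrightarrow> P 2 F y \<Longrightarrow> (t, y) \<in> dom Fl (P 2) \<and> fan_map Fl \<theta> \<alpha> P (t, y) = affine_fan \<theta> \<alpha> F y"
    by blast
  have fl: "Fl \<subseteq> flags" "0 < \<alpha>" "\<alpha> < pi" using fan unfolding fan_def by auto
  then have "F \<in> flags" using F(1) by blast
  then have ne: "fst (snd F) \<noteq> snd (snd F)" by (auto simp: flags_def)
  obtain Q where Q: "open Q" "interior_dom Fl \<theta> \<alpha> P = XS \<inter> Q" using sub(2) openin_open by blast
  have t: "t \<in> T" "x \<in> trunc_tet" "(t, x) \<in> Q" using p Q by auto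
  have "open (Pair t -` Q)" using Q(1) by (intro open_vimage continuous_intros)
  then have "open (Pair t -` Q \<inter> {y. P 2 F y})" "x \<in> Pair t -` Q \<inter> {y. P 2 F y}" using F t by auto
  moreover have "(t, y) \<in> interior_dom Fl \<theta> \<alpha> P \<and> fan_map Fl \<theta> \<alpha> P (t, y) = affine_fan \<theta> \<alpha> F y"
    if "y \<in> trunc_tet" "y \<in> Pair t -` Q \<inter> {y. P 2 F y}" for y
    using that F(5)[OF that(1)] Q(2) t(1) by simp
  ultimately show ?thesis using that[OF ne fl(2,3)] by blast
qed

text \<open>Moving slightly towards the barycentre makes all coordinates lie strictly between 0 and
  2/3, so that a full neighbourhood in the hyperplane stays inside.\<close>

lemma interior_dense:
  assumes x: "x \<in> trunc_tet" and W: "open W" "x \<in> W"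
  obtains y e where "0 < e" "\<And>v. (\<Sum>a\<in>UNIV. v $ a) = 0 \<Longrightarrow> norm v < e \<Longrightarrow> y + v \<in> trunc_tet \<and> y + v \<in> W"
proof -
  let ?y = "\<lambda>s. (1 - s) *\<^sub>R x + s *\<^sub>R (\<chi> a. 1 / 4)"
  have "open (?y -` W)" by (intro open_vimage W continuous_intros)
  moreover have "0 \<in> ?y -` W" using W by simp
  ultimately obtain d where d: "0 < d" "ball 0 d \<subseteq> ?y -` W" using openE by blast
  define s where "s = min (d / 2) 1"
  have s: "0 < s" "s \<le> 1" "s < d" using d by (auto simp: s_def)
  then have yW: "?y s \<in> W" using d(2) by (auto simp: dist_norm subset_eq)
  have xs: "(\<Sum>a\<in>UNIV. x $ a) = 1" using x by (simp add: trunc_tet_iff)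
  have pos: "0 < ?y s $ a" "?y s $ a < 2 / 3" for a
  proof -
    have "0 \<le> (1 - s) * x $ a" using s trunc_nonneg(1)[OF x, of a] by simp
    moreover have "(1 - s) * x $ a \<le> (1 - s) * (2 / 3)"
      using s by (intro mult_left_mono trunc_nonneg(2)[OF x]) simp
    ultimately show "0 < ?y s $ a" "?y s $ a < 2 / 3" using s(1) by (simp_all add: algebra_simps)
  qed
  have sum: "(\<Sum>a\<in>UNIV. ?y s $ a) = 1"
    using xs by (simp add: sum.distrib flip: sum_distrib_left)
  have "open {y :: real^4. \<forall>a. 0 < y $ a \<and> y $ a < 2 / 3}"
    by (intro open_all4 open_Collect_conj open_Collect_less continuous_intros)
  then have "open (W \<inter> {y. \<forall>a. 0 < y $ a \<and> y $ a < 2 / 3})" using W by blast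
  moreover have "?y s \<in> W \<inter> {y. \<forall>a. 0 < y $ a \<and> y $ a < 2 / 3}" using yW pos by blast
  ultimately obtain e where e: "0 < e" "ball (?y s) e \<subseteq> W \<inter> {y. \<forall>a. 0 < y $ a \<and> y $ a < 2 / 3}" using openE by blast
  show ?thesis
  proof (rule that[OF e(1), of "?y s"])
    fix v :: "real^4" assume v: "(\<Sum>a\<in>UNIV. v $ a) = 0" "norm v < e"
    have "?y s + v \<in> ball (?y s) e" using v by (simp add: dist_norm)
    then have m: "?y s + v \<in> W" "\<forall>a. 0 < (?y s + v) $ a \<and> (?y s + v) $ a < 2 / 3" using e(2) by blast+
    moreover have "(\<Sum>a\<in>UNIV. (?y s + v) $ a) = 1" using sum v by (simp only: vector_add_component sum.distrib)
    ultimately show "?y s + v \<in> trunc_tet \<and> ?y s + v \<in> W" unfolding trunc_tet_iff using less_imp_le by blast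
  qed
qed

text \<open>At a point on a face or an edge the transition is only piecewise affine. It is therefore
  examined at a nearby point inside one tetrahedron, where both charts are affine, and the result is
  carried back by \<open>orientation_preserving_near\<close>.\<close>

lemma transition_orientation:
  assumes gf: "good_fan Fl \<theta> \<alpha> P" "good_fan Fl' \<theta>' \<alpha>' P'"
    and n: "n \<in> pc ` interior_dom Fl \<theta> \<alpha> P" "n \<in> pc ` interior_dom Fl' \<theta>' \<alpha>' P'"
  defines "\<phi> \<equiv> chart_map pc (dom Fl (P 2)) (fan_map Fl \<theta> \<alpha> P)" and "\<psi> \<equiv> chart_map pc (dom Fl' (P' 2)) (fan_map Fl' \<theta>' \<alpha>' P')"
  shows "orientation_preserving_at (\<psi> \<circ> inv_into (pc ` interior_dom Fl \<theta> \<alpha> P) \<phi>) (\<phi> n)"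
proof -
  let ?U = "pc ` interior_dom Fl \<theta> \<alpha> P" and ?V = "pc ` interior_dom Fl' \<theta>' \<alpha>' P'"
  let ?f = "\<psi> \<circ> inv_into ?U \<phi>"
  note cd = interior_chart(1)[OF gf(1), folded interior_dom_def] and cd' = interior_chart(1)[OF gf(2), folded interior_dom_def]
  note ch = interior_chart(3)[OF gf(1), folded interior_dom_def \<phi>_def] and ch' = interior_chart(3)[OF gf(2), folded interior_dom_def \<psi>_def]
  note tr = chart_transition[OF ch ch']
  have sub: "interior_dom Fl \<theta> \<alpha> P \<subseteq> dom Fl (P 2)" "interior_dom Fl' \<theta>' \<alpha>' P' \<subseteq> dom Fl' (P' 2)"
    "interior_dom Fl \<theta> \<alpha> P \<subseteq> XS" "interior_dom Fl' \<theta>' \<alpha>' P' \<subseteq> XS" "saturated XS pc (interior_dom Fl' \<theta>' \<alpha>' P')"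
    using cd cd' unfolding chart_datum_def by auto
  have val: "\<phi> (pc p) = fan_map Fl \<theta> \<alpha> P p" if "p \<in> interior_dom Fl \<theta> \<alpha> P" for p
    unfolding \<phi>_def using chart_map_eq[OF cd] sub(1) that by blast
  have val': "\<psi> (pc p) = fan_map Fl' \<theta>' \<alpha>' P' p" if "p \<in> interior_dom Fl' \<theta>' \<alpha>' P'" for p
    unfolding \<psi>_def using chart_map_eq[OF cd'] sub(2) that by blast
  obtain p p' where p: "p \<in> interior_dom Fl \<theta> \<alpha> P" "n = pc p" "p' \<in> interior_dom Fl' \<theta>' \<alpha>' P'" "n = pc p'" using n by blast
  have "p \<in> interior_dom Fl' \<theta>' \<alpha>' P'" 
  proof -
    have "p \<in> XS" "p' \<in> XS" "pc p' = pc p" using sub(3,4) p by (blast, blast, simp)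
    then show ?thesis using sub(5) p(3) unfolding saturated_def by blast
  qed
  moreover obtain t x where tx: "p = (t, x)" by (cases p)
  ultimately have px: "(t, x) \<in> interior_dom Fl \<theta> \<alpha> P" "(t, x) \<in> interior_dom Fl' \<theta>' \<alpha>' P'" using p by auto
  have xt: "x \<in> trunc_tet" using px(1) sub(3) by auto
  obtain F W where F: "fst (snd F) \<noteq> snd (snd F)" "0 < \<alpha>" "\<alpha> < pi" "open W" "x \<in> W"
    "\<And>y. y \<in> trunc_tet \<Longrightarrow> y \<in> W \<Longrightarrow> (t, y) \<in> interior_dom Fl \<theta> \<alpha> P \<and> fan_map Fl \<theta> \<alpha> P (t, y) = affine_fan \<theta> \<alpha> F y"
    using interior_dom_local[OF gf(1) px(1)] by blast
  obtain F' W' where F': "fst (snd F') \<noteq> snd (snd F')" "0 < \<alpha>'" "\<alpha>' < pi" "open W'" "x \<in> W'"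
    "\<And>y. y \<in> trunc_tet \<Longrightarrow> y \<in> W' \<Longrightarrow> (t, y) \<in> interior_dom Fl' \<theta>' \<alpha>' P' \<and> fan_map Fl' \<theta>' \<alpha>' P' (t, y) = affine_fan \<theta>' \<alpha>' F' y"
    using interior_dom_local[OF gf(2) px(2)] by blast
  have phin: "\<phi> n = affine_fan \<theta> \<alpha> F x" using val[OF px(1)] F(6)[OF xt F(5)] p(2) tx by simp
  obtain R where R: "0 < R" "ball (\<phi> n) R \<subseteq> \<phi> ` (?U \<inter> ?V)"
    using openE[OF tr(1), of "\<phi> n"] n by blast
  have f: "?f (affine_fan \<theta> \<alpha> F y) = affine_fan \<theta>' \<alpha>' F' y" if y: "y \<in> trunc_tet" "y \<in> W" "y \<in> W'" for y
  proof -
    note a = F(6)[OF y(1,2)] and b = F'(6)[OF y(1,3)]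
    have "affine_fan \<theta> \<alpha> F y = \<phi> (pc (t, y))" using a val[of "(t, y)"] by simp
    moreover have "?f (\<phi> (pc (t, y))) = \<psi> (pc (t, y))" using a by (intro tr(4) imageI) simp
    moreover have "\<psi> (pc (t, y)) = affine_fan \<theta>' \<alpha>' F' y" using b val'[of "(t, y)"] by simp
    ultimately show ?thesis by simp
  qed
  define W0 where "W0 = W \<inter> W' \<inter> affine_fan \<theta> \<alpha> F -` ball (\<phi> n) (R / 2)"
  have "open W0" unfolding W0_def using F(4) F'(4) continuous_affine_fan by (intro open_Int open_vimage) auto
  moreover have "x \<in> W0" using F(5) F'(5) R(1) phin by (simp add: W0_def)
  ultimately obtain y e where ye: "0 < e" "\<And>v. (\<Sum>a\<in>UNIV. v $ a) = 0 \<Longrightarrow> norm v < e \<Longrightarrow> y + v \<in> trunc_tet \<and> y + v \<in> W0"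
    using interior_dense[OF xt] by blast
  have "orientation_preserving_at ?f (affine_fan \<theta> \<alpha> F y)"
  proof (rule orientation_preserving_frames[OF F(1) F'(1) F(2,3) F'(2,3) ye(1)])
    fix v :: "real^4" assume v: "(\<Sum>a\<in>UNIV. v $ a) = 0" "norm v < e"
    show "?f (affine_fan \<theta> \<alpha> F y + frame (fst (snd F)) (snd (snd F)) (\<theta> F) \<alpha> v) =
        affine_fan \<theta>' \<alpha>' F' y + frame (fst (snd F')) (snd (snd F')) (\<theta>' F') \<alpha>' v"
      unfolding affine_fan_add[symmetric] by (rule f) (use ye(2)[OF v] in \<open>simp_all add: W0_def\<close>)
  qed
  moreover have "affine_fan \<theta> \<alpha> F y \<in> ball (\<phi> n) (R / 2)" using ye(2)[of 0] ye(1) by (simp add: W0_def)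
  moreover have "continuous_on (ball (\<phi> n) R) ?f" "inj_on ?f (ball (\<phi> n) R)"
    using continuous_on_subset[OF tr(2) R(2)] inj_on_subset[OF tr(3) R(2)] by auto
  ultimately show ?thesis using orientation_preserving_near by blast
qed

theorem orientable_NN: "orientable3 NN"
proof -
  define \<A> where "\<A> = {(pc ` interior_dom Fl \<theta> \<alpha> P, chart_map pc (dom Fl (P 2)) (fan_map Fl \<theta> \<alpha> P)) | Fl \<theta> \<alpha> P. good_fan Fl \<theta> \<alpha> P}"
  have A: "\<exists>Fl \<theta> \<alpha> P. good_fan Fl \<theta> \<alpha> P \<and> U = pc ` interior_dom Fl \<theta> \<alpha> P \<and> \<phi> = chart_map pc (dom Fl (P 2)) (fan_map Fl \<theta> \<alpha> P)"
    if "(U, \<phi>) \<in> \<A>" for U \<phi>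
    using that unfolding \<A>_def by blast
  show ?thesis
    unfolding orientable3_def
  proof (intro exI[of _ \<A>] conjI ballI)
    fix c assume c: "c \<in> \<A>"
    obtain U \<phi> where U: "c = (U, \<phi>)" by (cases c)
    obtain Fl \<theta> \<alpha> P where g: "good_fan Fl \<theta> \<alpha> P" "U = pc ` interior_dom Fl \<theta> \<alpha> P" "\<phi> = chart_map pc (dom Fl (P 2)) (fan_map Fl \<theta> \<alpha> P)"
      using A[OF c[unfolded U]] by (elim exE conjE)
    show "case c of (U, \<phi>) \<Rightarrow> chart3 NN U \<phi>"
      unfolding U prod.case g(2,3) interior_dom_def by (rule interior_chart(3)[OF g(1)])
    show "case c of (U, \<phi>) \<Rightarrow> \<forall>(V, \<psi>)\<in>\<A>. \<forall>x\<in>U \<inter> V. orientation_preserving_at (\<psi> \<circ> inv_into U \<phi>) (\<phi> x)"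
      unfolding U prod.case
    proof (intro ballI)
      fix c' assume c': "c' \<in> \<A>"
      obtain V \<psi> where V: "c' = (V, \<psi>)" by (cases c')
      obtain Fl' \<theta>' \<alpha>' P' where g': "good_fan Fl' \<theta>' \<alpha>' P'" "V = pc ` interior_dom Fl' \<theta>' \<alpha>' P'" "\<psi> = chart_map pc (dom Fl' (P' 2)) (fan_map Fl' \<theta>' \<alpha>' P')"
        using A[OF c'[unfolded V]] by (elim exE conjE)
      show "case c' of (V, \<psi>) \<Rightarrow> \<forall>x\<in>U \<inter> V. orientation_preserving_at (\<psi> \<circ> inv_into U \<phi>) (\<phi> x)"
        unfolding V prod.case
      proof
        fix n assume "n \<in> U \<inter> V"
        then have "n \<in> pc ` interior_dom Fl \<theta> \<alpha> P" "n \<in> pc ` interior_dom Fl' \<theta>' \<alpha>' P'" unfolding g(2) g'(2) by auto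
        from transition_orientation[OF g(1) g'(1) this] show "orientation_preserving_at (\<psi> \<circ> inv_into U \<phi>) (\<phi> n)"
          unfolding g(2,3) g'(3) .
      qed
    qed
  next
    show "(\<Union>(U, \<phi>)\<in>\<A>. U) = mfd_interior NN"
      unfolding interior_NN
    proof (intro equalityI subsetI)
      fix n assume "n \<in> (\<Union>(U, \<phi>)\<in>\<A>. U)"
      then obtain U \<phi> where U: "(U, \<phi>) \<in> \<A>" "n \<in> U" by blast
      obtain Fl \<theta> \<alpha> P where g: "good_fan Fl \<theta> \<alpha> P" "U = pc ` interior_dom Fl \<theta> \<alpha> P" using A[OF U(1)] by blast
      obtain p where p: "p \<in> interior_dom Fl \<theta> \<alpha> P" "n = pc p" using U(2) unfolding g(2) by (rule imageE) blast
      then have "p \<in> dom Fl (P 0)" "0 < fan_map Fl \<theta> \<alpha> P p $ 1" by (simp_all add: interior_dom_def)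
      then have "p \<in> XI" using good_fan_height(2)[OF g(1)] by blast
      then show "n \<in> pc ` XI" unfolding p(2) by (rule imageI)
    next
      fix n assume "n \<in> pc ` XI"
      then obtain p where p: "p \<in> XI" "n = pc p" by (rule imageE) blast
      then have "p \<in> XS" unfolding XI_def by blast
      then obtain Fl \<theta> \<alpha> P where g: "good_fan Fl \<theta> \<alpha> P" "p \<in> dom Fl (P 0)" by (rule fan_covers)
      then have "p \<in> interior_dom Fl \<theta> \<alpha> P" using good_fan_height(2)[OF g] p(1) by (simp add: interior_dom_def)
      then have "n \<in> pc ` interior_dom Fl \<theta> \<alpha> P" unfolding p(2) by (rule imageI)
      moreover have "(pc ` interior_dom Fl \<theta> \<alpha> P, chart_map pc (dom Fl (P 2)) (fan_map Fl \<theta> \<alpha> P)) \<in> \<A>"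
        unfolding \<A>_def using g(1) by blast
      ultimately show "n \<in> (\<Union>(U, \<phi>)\<in>\<A>. U)" by blast
    qed
  qed
qed

end

section \<open>The triangulations\<close>

definition sel4 :: "'a \<Rightarrow> 'a \<Rightarrow> 'a \<Rightarrow> 'a \<Rightarrow> 4 \<Rightarrow> 'a" where
  "sel4 a b c e i = (if i = 1 then a else if i = 2 then b else if i = 3 then c else e)"

lemma sel4_simps [simp]:
  "sel4 a b c e 1 = a" "sel4 a b c e 2 = b" "sel4 a b c e 3 = c" "sel4 a b c e 4 = e"
  by (simp_all add: sel4_def)

lemma third_simps:
  "third 1 2 = 3" "third 1 3 = 4" "third 1 4 = 2" "third 2 1 = 4" "third 2 3 = 1" "third 2 4 = 3"
  "third 3 1 = 2" "third 3 2 = 4" "third 3 4 = 1" "third 4 1 = 3" "third 4 2 = 1" "third 4 3 = 2"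
  by (simp_all add: third_def)

lemma cases_34:
  assumes "m < (3 :: nat)"
  obtains "m = 0" "f = 1" | "m = 0" "f = 2" | "m = 0" "f = 3" | "m = 0" "f = (4 :: 4)"
    | "m = 1" "f = 1" | "m = 1" "f = 2" | "m = 1" "f = 3" | "m = 1" "f = 4"
    | "m = 2" "f = 1" | "m = 2" "f = 2" | "m = 2" "f = 3" | "m = 2" "f = 4"
proof -
  have "m = 0 \<or> m = 1 \<or> m = 2" using assms by linarith
  then show ?thesis using that exhaust_4[of f] by blast
qed

text \<open>
  The tetrahedra of block \<open>k\<close> are \<open>3 * k\<close>, \<open>3 * k + 1\<close> and \<open>3 * k + 2\<close>. An entry \<open>(m', s, \<sigma>)\<close>
  at \<open>(m, f)\<close> glues the face \<open>f\<close> of \<open>3 * k + m\<close> to \<open>3 * k' + m'\<close> by \<open>\<sigma>\<close>, where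
  \<open>k' = k, k + 1, k - 1\<close> for \<open>s = 0, 1, 2\<close>.
\<close>

definition gtab :: "nat \<Rightarrow> 4 \<Rightarrow> nat \<times> nat \<times> (4 \<Rightarrow> 4)" where
  "gtab m =
    (if m = 0 then sel4 (0, 2, sel4 2 3 4 1) (0, 1, sel4 4 1 2 3) (1, 0, sel4 3 4 2 1) (2, 0, sel4 4 3 1 2)
     else if m = 1 then sel4 (1, 0, sel4 4 1 2 3) (0, 0, sel4 4 3 1 2) (2, 0, sel4 2 1 3 4) (1, 0, sel4 2 3 4 1)
     else sel4 (2, 0, sel4 4 1 2 3) (0, 0, sel4 3 4 2 1) (1, 0, sel4 2 1 3 4) (2, 0, sel4 2 3 4 1))"

text \<open>Adding \<open>e\<close> modulo \<open>Suc e\<close> is subtracting 1.\<close>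

definition shift :: "nat \<Rightarrow> nat \<Rightarrow> nat \<Rightarrow> nat" where
  "shift e s k = (k + (if s = 0 then 0 else if s = 1 then 1 else e)) mod Suc e"

definition cyc_gluing :: "nat \<Rightarrow> nat gluing" where
  "cyc_gluing e t f = (case gtab (t mod 3) f of (m, s, \<sigma>) \<Rightarrow> (3 * shift e s (t div 3) + m, \<sigma>))"

text \<open>
  The positively oriented flags \<open>(i, j)\<close> of a tetrahedron carry their place in the cycles around
  the edges: \<open>1, \<dots>, 7\<close> around \<open>a\<^sub>k\<close>, and \<open>8, \<dots>, 18\<close> in each of the \<open>d\<close> rounds around \<open>b\<close>.
\<close>

definition tab :: "nat \<Rightarrow> 4 \<Rightarrow> 4 \<Rightarrow> nat" where
  "tab m =
    (if m = 0 then sel4 (sel4 0 1 8 12) (sel4 0 0 0 0) (sel4 0 14 0 0) (sel4 0 18 13 0)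
     else if m = 1 then sel4 (sel4 0 4 0 17) (sel4 0 0 3 0) (sel4 11 0 0 2) (sel4 0 10 0 0)
     else sel4 (sel4 0 0 15 0) (sel4 5 0 0 16) (sel4 0 6 0 0) (sel4 9 0 7 0))"

text \<open>Around b, places 12 and 13 lead on to the next block and 18 leads one back.
  \<open>off\<close> counts the blocks gained since place 8, so that block index minus
  \<open>off\<close> is constant during a round. A round thus advances by one block in total, and
  the \<open>d\<close> rounds form a single cycle.\<close>

definition off :: "nat \<Rightarrow> nat" where
  "off c = (if c < 13 then 0 else if c = 13 then 1 else 2)"

text \<open>Label 0 stands for b and \<open>Suc k\<close> for a_k. On an edge one of the two entries
  is 0, so the sum is the entry of the positive direction.\<close>

definition cyc_class :: "nat \<Rightarrow> 4 \<Rightarrow> 4 \<Rightarrow> nat" where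
  "cyc_class t i j = (if tab (t mod 3) i j + tab (t mod 3) j i < 8 then Suc (t div 3) else 0)"

definition cyc_sign :: "nat \<Rightarrow> 4 \<Rightarrow> 4 \<Rightarrow> bool" where
  "cyc_sign t i j \<longleftrightarrow> tab (t mod 3) i j \<noteq> 0"

definition cyc_len :: "nat \<Rightarrow> nat \<Rightarrow> nat" where
  "cyc_len e c = (if c = 0 then 11 * Suc e else 7)"

definition place :: "nat \<Rightarrow> nat \<Rightarrow> nat \<Rightarrow> nat" where
  "place e k c = (if c < 8 then c - 1 else 11 * ((k + off c * e) mod Suc e) + (c - 8))"

text \<open>Seen from the other end the rotation runs backwards, hence the reversed numbering of the
  negative flags.\<close>

definition cyc_pos :: "nat \<Rightarrow> nat \<Rightarrow> 4 \<Rightarrow> 4 \<Rightarrow> nat" where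
  "cyc_pos e t i j = (if tab (t mod 3) i j \<noteq> 0 then place e (t div 3) (tab (t mod 3) i j)
     else cyc_len e (cyc_class t i j) - 1 - place e (t div 3) (tab (t mod 3) j i))"

abbreviation cyc_tets :: "nat \<Rightarrow> nat set" where "cyc_tets e \<equiv> {..<3 * Suc e}"

section \<open>Finite checks of the tables\<close>

lemma gtab_inverse:
  assumes "m < 3" "gtab m f = (m', s, \<sigma>)"
  obtains s' \<sigma>' where "m' < 3" "s < 3" "s' = (if s = 0 then 0 else 3 - s)" "gtab m' (\<sigma> f) = (m, s', \<sigma>')"
    "\<And>i. \<sigma>' (\<sigma> i) = i" "\<And>i. \<sigma> (\<sigma>' i) = i" "(m', \<sigma> f) \<noteq> (m, f)"
proof -
  obtain s' \<sigma>' where "m' < 3 \<and> s < 3 \<and> s' = (if s = 0 then 0 else 3 - s) \<and> gtab m' (\<sigma> f) = (m, s', \<sigma>') \<and>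
      (\<forall>i. \<sigma>' (\<sigma> i) = i) \<and> (\<forall>i. \<sigma> (\<sigma>' i) = i) \<and> (m', \<sigma> f) \<noteq> (m, f)"
    using assms(2) by (cases rule: cases_34[OF assms(1), of f]) (auto simp: gtab_def forall_4)
  then show ?thesis using that by blast
qed

lemma gtab_odd:
  assumes "m < 3" "gtab m f = (m', s, \<sigma>)" "i \<noteq> j"
  shows "third (\<sigma> i) (\<sigma> j) = \<sigma> (third j i)"
proof -
  have "\<forall>i j. i \<noteq> j \<longrightarrow> third (\<sigma> i) (\<sigma> j) = \<sigma> (third j i)"
    using assms(2) by (cases rule: cases_34[OF assms(1), of f]) (auto simp: gtab_def forall_4 third_simps)
  then show ?thesis using assms(3) by blast
qed

lemma tab_anti:
  assumes "m < 3" "i \<noteq> j"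
  shows "tab m i j = 0 \<longleftrightarrow> tab m j i \<noteq> 0"
proof -
  have "\<forall>j. i \<noteq> j \<longrightarrow> (tab m i j = 0 \<longleftrightarrow> tab m j i \<noteq> 0)"
    by (cases rule: cases_34[OF assms(1), of i]) (auto simp: tab_def forall_4)
  then show ?thesis using assms(2) by blast
qed

lemma tab_le: "m < 3 \<Longrightarrow> tab m i j \<le> 18"
proof -
  assume "m < 3"
  then have "\<forall>j. tab m i j \<le> 18" by (cases rule: cases_34[of m i]) (auto simp: tab_def forall_4)
  then show ?thesis by blast
qed

lemma tab_neq: "m < 3 \<Longrightarrow> tab m i j \<noteq> 0 \<Longrightarrow> i \<noteq> j"
  by (cases rule: cases_34[of m i]) (auto simp: tab_def)

text \<open>The inverse of \<open>tab\<close>; the entry at 0 is a filler, as places start with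
  1.\<close>

definition tab_at :: "nat \<Rightarrow> nat \<times> 4 \<times> 4" where
  "tab_at c = [(0, 1, 2), (0, 1, 2), (1, 3, 4), (1, 2, 3), (1, 1, 2), (2, 2, 1), (2, 3, 2), (2, 4, 3),
     (0, 1, 3), (2, 4, 1), (1, 4, 2), (1, 3, 1), (0, 1, 4), (0, 4, 3), (0, 3, 2), (2, 1, 3), (2, 2, 4), (1, 1, 4), (0, 4, 2)] ! c"

lemma tab_at_tab:
  assumes "m < 3" "tab m i j \<noteq> 0"
  shows "tab_at (tab m i j) = (m, i, j)"
proof -
  have "\<forall>j. tab m i j \<noteq> 0 \<longrightarrow> tab_at (tab m i j) = (m, i, j)"
    by (cases rule: cases_34[OF assms(1), of i]) (auto simp: tab_def tab_at_def forall_4)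
  then show ?thesis using assms(2) by blast
qed

lemma tab_step:
  assumes "m < 3" "tab m i j \<noteq> 0" "gtab m (third i j) = (m', s, \<sigma>)"
  shows "tab m' (\<sigma> i) (\<sigma> j) = (if tab m i j = 7 then 1 else if tab m i j = 18 then 8 else Suc (tab m i j))"
    "s = (if tab m i j = 12 \<or> tab m i j = 13 then 1 else if tab m i j = 18 then 2 else 0)"
proof -
  have "\<forall>j. tab m i j \<noteq> 0 \<longrightarrow> gtab m (third i j) = (m', s, \<sigma>) \<longrightarrow>
     tab m' (\<sigma> i) (\<sigma> j) = (if tab m i j = 7 then 1 else if tab m i j = 18 then 8 else Suc (tab m i j)) \<and>
     s = (if tab m i j = 12 \<or> tab m i j = 13 then 1 else if tab m i j = 18 then 2 else 0)"
    by (cases rule: cases_34[OF assms(1), of i]) (auto simp: tab_def gtab_def forall_4 third_simps)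
  then show "tab m' (\<sigma> i) (\<sigma> j) = (if tab m i j = 7 then 1 else if tab m i j = 18 then 8 else Suc (tab m i j))"
    "s = (if tab m i j = 12 \<or> tab m i j = 13 then 1 else if tab m i j = 18 then 2 else 0)"
    using assms(2,3) by blast+
qed

lemma tab_step_back:
  assumes "m < 3" "tab m j i \<noteq> 0" "gtab m (third i j) = (m', s, \<sigma>)"
  shows "tab m' (\<sigma> j) (\<sigma> i) \<noteq> 0"
proof -
  have "\<forall>j. tab m j i \<noteq> 0 \<longrightarrow> gtab m (third i j) = (m', s, \<sigma>) \<longrightarrow> tab m' (\<sigma> j) (\<sigma> i) \<noteq> 0"
    by (cases rule: cases_34[OF assms(1), of i]) (auto simp: tab_def gtab_def forall_4 third_simps)
  then show ?thesis using assms(2,3) by blast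
qed

section \<open>Arithmetic of blocks and rounds\<close>

lemma Suc_add_mod [simp]: "Suc (k + e) mod Suc e = k mod Suc e"
  by (metis add_Suc_right mod_add_self2)

lemma shift_less: "shift e s k < Suc e"
  by (simp add: shift_def)

lemma shift_shift:
  assumes "k < Suc e" "s < 3"
  shows "shift e (if s = 0 then 0 else 3 - s) (shift e s k) = k"
proof -
  consider "s = 0" | "s = 1" | "s = 2" using assms(2) by linarith
  then show ?thesis
  proof cases
    case 1 then show ?thesis using assms(1) by (simp add: shift_def)
  next
    case 2
    have "((k + 1) mod Suc e + e) mod Suc e = (k + Suc e) mod Suc e" by (simp add: mod_simps)
    then show ?thesis using assms(1) 2 by (simp add: shift_def)
  next
    case 3
    have "((k + e) mod Suc e + 1) mod Suc e = (k + Suc e) mod Suc e" unfolding mod_add_left_eq by simp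
    then show ?thesis using assms(1) 3 by (simp add: shift_def)
  qed
qed

lemma place_less:
  assumes "0 < c" "c \<le> 18"
  shows "place e k c < (if c < 8 then 7 else 11 * Suc e)"
proof (cases "c < 8")
  case False
  have "c - 8 \<le> 10" using assms(2) by simp
  then have "11 * q + (c - 8) < 11 * Suc e" if "q < Suc e" for q using that by simp
  from this[of "(k + off c * e) mod Suc e"] show ?thesis using assms False by (simp add: place_def)
qed (use assms in \<open>simp add: place_def\<close>)

lemma place_step:
  assumes c: "0 < c" "c \<le> 18" and k: "k < Suc e"
    and s: "s = (if c = 12 \<or> c = 13 then 1 else if c = 18 then 2 else 0)"
    and c': "c' = (if c = 7 then 1 else if c = 18 then 8 else Suc c)"
  shows "place e (shift e s k) c' = Suc (place e k c) mod (if c < 8 then 7 else 11 * Suc e)"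
proof -
  define q where "q = (k + off c * e) mod Suc e"
  have q: "q < Suc e" by (simp add: q_def)
  consider "c < 8" | "8 \<le> c" "c < 18" | "c = 18" using c by linarith
  then show ?thesis
  proof cases
    case 1
    then show ?thesis using c s c' by (auto simp: place_def)
  next
    case 2
    have q': "(shift e s k + off c' * e) mod Suc e = q"
    proof -
      consider "c = 12" | "c = 13" | "c \<noteq> 12" "c \<noteq> 13" by blast
      then show ?thesis
      proof cases
        case 1
        have "((k + 1) mod Suc e + e) mod Suc e = (k + Suc e) mod Suc e" by (simp add: mod_simps)
        then show ?thesis using 1 s c' by (simp add: shift_def off_def q_def)
      next
        case 2
        have "((k + 1) mod Suc e + 2 * e) mod Suc e = Suc (k + e + e) mod Suc e" by (simp add: mod_simps mult_2 add.assoc)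
        then show ?thesis using 2 s c' by (simp add: shift_def off_def q_def)
      next
        case 3
        then show ?thesis using 2 s c' k by (auto simp: shift_def off_def q_def)
      qed
    qed
    have "Suc (11 * q + (c - 8)) < 11 * Suc e" using q 2 by simp
    then have "Suc (place e k c) mod (11 * Suc e) = Suc (11 * q + (c - 8))" using 2 by (simp add: place_def q_def)
    moreover have "place e (shift e s k) c' = 11 * q + (Suc c - 8)" using 2 c' q' by (simp add: place_def)
    ultimately show ?thesis using 2 by simp
  next
    case 3
    \<comment> \<open>Place 18 is the last of its round; its successor is the first place of the
      next round, modulo the number of rounds.\<close>
    have "Suc (place e k c) = 11 * Suc q" using 3 by (simp add: place_def q_def)
    then have p: "Suc (place e k c) mod (11 * Suc e) = 11 * (Suc q mod Suc e)" by (simp only: mult_mod_right)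
    have p': "place e (shift e s k) c' = 11 * ((k + e) mod Suc e)" using 3 s c' by (simp add: place_def shift_def off_def)
    have m: "Suc q mod Suc e = (k + e) mod Suc e"
      using 3 by (simp add: q_def off_def mod_Suc_eq mult_2 add.assoc Suc_add_mod[of "k + e" e, unfolded add.assoc])
    have "\<not> c < 8" using 3 by simp
    then show ?thesis unfolding p' p[unfolded m, symmetric] by simp
  qed
qed

section \<open>The cyclic gluing as a triangulation\<close>

lemma cyc_gluing_eq:
  assumes "gtab (t mod 3) f = (m, s, \<sigma>)"
  shows "cyc_gluing e t f = (3 * shift e s (t div 3) + m, \<sigma>)"
  by (simp add: cyc_gluing_def assms)

lemma cyc_gluingE:
  assumes "t \<in> cyc_tets e"
  obtains m s \<sigma> where "gtab (t mod 3) f = (m, s, \<sigma>)" "m < 3" "s < 3"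
    "cyc_gluing e t f = (3 * shift e s (t div 3) + m, \<sigma>)"
    "(3 * shift e s (t div 3) + m) mod 3 = m" "(3 * shift e s (t div 3) + m) div 3 = shift e s (t div 3)"
    "3 * shift e s (t div 3) + m \<in> cyc_tets e"
proof -
  obtain m s \<sigma> where g: "gtab (t mod 3) f = (m, s, \<sigma>)" by (metis prod_cases3)
  have "t mod 3 < 3" by simp
  then have m: "m < 3" "s < 3" using gtab_inverse[OF _ g] by blast+
  show ?thesis
    by (rule that[OF g m cyc_gluing_eq[OF g]]) (use m shift_less[of e s "t div 3"] in auto)
qed

lemma cyc_gluing_inverse:
  assumes t: "t \<in> cyc_tets e" and g: "cyc_gluing e t f = (t', \<sigma>)"
  shows "t' \<in> cyc_tets e" "bij \<sigma>" "(t', \<sigma> f) \<noteq> (t, f)" "cyc_gluing e t' (\<sigma> f) = (t, inv \<sigma>)"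
proof -
  obtain m s \<sigma>1 where h: "gtab (t mod 3) f = (m, s, \<sigma>1)" "m < 3" "s < 3"
    "cyc_gluing e t f = (3 * shift e s (t div 3) + m, \<sigma>1)"
    "(3 * shift e s (t div 3) + m) mod 3 = m" "(3 * shift e s (t div 3) + m) div 3 = shift e s (t div 3)"
    "3 * shift e s (t div 3) + m \<in> cyc_tets e"
    by (rule cyc_gluingE[OF t])
  have e: "t' = 3 * shift e s (t div 3) + m" "\<sigma>1 = \<sigma>" using g h(4) by auto
  have h1: "gtab (t mod 3) f = (m, s, \<sigma>)" using h(1) e by simp
  have "t mod 3 < 3" by simp
  then obtain s' \<sigma>' where "m < 3" "s < 3" and i: "s' = (if s = 0 then 0 else 3 - s)"
    "gtab m (\<sigma> f) = (t mod 3, s', \<sigma>')"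
    "\<And>i. \<sigma>' (\<sigma> i) = i" "\<And>i. \<sigma> (\<sigma>' i) = i" "(m, \<sigma> f) \<noteq> (t mod 3, f)"
    by (rule gtab_inverse[OF _ h1]) (rule that; assumption)
  show "t' \<in> cyc_tets e" using h(7) e by simp
  have c: "\<sigma>' \<circ> \<sigma> = id" "\<sigma> \<circ> \<sigma>' = id" using i(3,4) by auto
  then show "bij \<sigma>" by (rule o_bij)
  have inv: "inv \<sigma> = \<sigma>'" using c by (intro inv_unique_comp) auto
  have t': "t' mod 3 = m" "t' div 3 = shift e s (t div 3)" using h(5,6) e by simp_all
  show "(t', \<sigma> f) \<noteq> (t, f)" using i(5) t' by auto
  have "t div 3 < Suc e" using t by auto
  then have "shift e s' (shift e s (t div 3)) = t div 3" using shift_shift h(3) i(1) by simp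
  then show "cyc_gluing e t' (\<sigma> f) = (t, inv \<sigma>)"
    using i(2) t' inv by (simp add: cyc_gluing_def)
qed

lemma cyc_face_pairing: "face_pairing (cyc_tets e) (cyc_gluing e)"
  unfolding face_pairing_def using cyc_gluing_inverse by (intro conjI ballI allI impI) auto

lemma cyc_class_pos:
  assumes "tab (t mod 3) i j \<noteq> 0"
  shows "cyc_class t i j = (if tab (t mod 3) i j < 8 then Suc (t div 3) else 0)"
    "cyc_len e (cyc_class t i j) = (if tab (t mod 3) i j < 8 then 7 else 11 * Suc e)"
proof -
  have "tab (t mod 3) j i = 0" using tab_anti[of "t mod 3" i j] tab_neq[OF _ assms] assms by simp
  then show "cyc_class t i j = (if tab (t mod 3) i j < 8 then Suc (t div 3) else 0)"
    "cyc_len e (cyc_class t i j) = (if tab (t mod 3) i j < 8 then 7 else 11 * Suc e)"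
    by (simp_all add: cyc_class_def cyc_len_def)
qed

lemma cyc_class_sym: "cyc_class t j i = cyc_class t i j"
  by (simp add: cyc_class_def add.commute)

lemma cyc_sign_anti: "i \<noteq> j \<Longrightarrow> cyc_sign t j i \<longleftrightarrow> \<not> cyc_sign t i j"
  using tab_anti[of "t mod 3" i j] by (simp add: cyc_sign_def)

lemma cyc_pos_pos:
  assumes "cyc_sign t i j"
  shows "cyc_pos e t i j = place e (t div 3) (tab (t mod 3) i j)" "cyc_pos e t i j < cyc_len e (cyc_class t i j)"
proof -
  show p: "cyc_pos e t i j = place e (t div 3) (tab (t mod 3) i j)" using assms by (simp add: cyc_pos_def cyc_sign_def)
  show "cyc_pos e t i j < cyc_len e (cyc_class t i j)"
    unfolding p using assms place_less[of "tab (t mod 3) i j" e] cyc_class_pos[of t i j] tab_le[of "t mod 3" i j]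
    by (simp add: cyc_sign_def)
qed

lemma cyc_pos_neg:
  assumes "i \<noteq> j" "\<not> cyc_sign t i j"
  shows "cyc_pos e t i j = cyc_len e (cyc_class t i j) - 1 - cyc_pos e t j i"
    "cyc_pos e t j i < cyc_len e (cyc_class t i j)"
proof -
  have s: "cyc_sign t j i" using assms cyc_sign_anti by blast
  show "cyc_pos e t i j = cyc_len e (cyc_class t i j) - 1 - cyc_pos e t j i"
    unfolding cyc_pos_pos(1)[OF s] using assms by (simp add: cyc_pos_def cyc_sign_def)
  show "cyc_pos e t j i < cyc_len e (cyc_class t i j)" using cyc_pos_pos(2)[OF s, of e] cyc_class_sym[of t j i] by simp
qed

lemma cyc_step_pos:
  assumes t: "t \<in> cyc_tets e" and s: "cyc_sign t i j" and g: "cyc_gluing e t (third i j) = (t', \<sigma>)"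
  shows "cyc_class t' (\<sigma> i) (\<sigma> j) = cyc_class t i j" "cyc_sign t' (\<sigma> i) (\<sigma> j)"
    "cyc_pos e t' (\<sigma> i) (\<sigma> j) = Suc (cyc_pos e t i j) mod cyc_len e (cyc_class t i j)"
proof -
  obtain m s1 \<sigma>1 where h: "gtab (t mod 3) (third i j) = (m, s1, \<sigma>1)" "m < 3" "s1 < 3"
    "cyc_gluing e t (third i j) = (3 * shift e s1 (t div 3) + m, \<sigma>1)"
    "(3 * shift e s1 (t div 3) + m) mod 3 = m" "(3 * shift e s1 (t div 3) + m) div 3 = shift e s1 (t div 3)"
    "3 * shift e s1 (t div 3) + m \<in> cyc_tets e"
    by (rule cyc_gluingE[OF t])
  have e: "t' = 3 * shift e s1 (t div 3) + m" "\<sigma>1 = \<sigma>" using g h(4) by auto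
  have t': "t' mod 3 = m" "t' div 3 = shift e s1 (t div 3)" using h(5,6) e by simp_all
  define c where "c = tab (t mod 3) i j"
  have c: "0 < c" "c \<le> 18" "tab (t mod 3) i j \<noteq> 0" "t mod 3 < 3" using s tab_le[of "t mod 3" i j] by (auto simp: c_def cyc_sign_def)
  note st = tab_step[OF c(4,3) h(1)[unfolded e(2)], folded c_def]
  have k: "t div 3 < Suc e" using t by auto
  have tab': "tab (t' mod 3) (\<sigma> i) (\<sigma> j) = (if c = 7 then 1 else if c = 18 then 8 else Suc c)" using st(1) t' by simp
  have s1: "s1 = 0" if "c < 8" using st(2) that by simp
  show s': "cyc_sign t' (\<sigma> i) (\<sigma> j)" using tab' by (simp add: cyc_sign_def)
  have lt: "tab (t' mod 3) (\<sigma> i) (\<sigma> j) < 8 \<longleftrightarrow> c < 8" unfolding tab' using c by auto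
  show "cyc_class t' (\<sigma> i) (\<sigma> j) = cyc_class t i j"
    using cyc_class_pos(1)[of t' "\<sigma> i" "\<sigma> j"] s' cyc_class_pos(1)[OF c(3)] lt s1 t' k
    by (auto simp: cyc_sign_def c_def[symmetric] shift_def)
  show "cyc_pos e t' (\<sigma> i) (\<sigma> j) = Suc (cyc_pos e t i j) mod cyc_len e (cyc_class t i j)"
    unfolding cyc_pos_pos(1)[OF s'] cyc_pos_pos(1)[OF s] cyc_class_pos(2)[OF c(3)] t'(2) tab' c_def[symmetric]
    by (rule place_step[OF c(1,2) k st(2)]) simp
qed

lemma reverse_step:
  assumes "p' < n" "(p :: nat) = Suc p' mod n"
  shows "n - 1 - p' = Suc (n - 1 - p) mod n"
proof (cases "Suc p' = n")
  case False
  then have "p = Suc p'" using assms by simp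
  then show ?thesis using assms(1) False by simp
next
  case True
  then have "p = 0" using assms(2) by simp
  then show ?thesis using True by auto
qed

text \<open>For a negative flag, the reversed flag on the far side of the face is positive and its
  own step leads back through the same face; \<open>reverse_step\<close> turns this into a forward
  step of the reversed numbering.\<close>

lemma cyc_step:
  assumes t: "t \<in> cyc_tets e" and ij: "i \<noteq> j" and g: "cyc_gluing e t (third i j) = (t', \<sigma>)"
  shows "cyc_class t' (\<sigma> i) (\<sigma> j) = cyc_class t i j \<and> cyc_sign t' (\<sigma> i) (\<sigma> j) = cyc_sign t i j \<and>
    cyc_pos e t' (\<sigma> i) (\<sigma> j) = Suc (cyc_pos e t i j) mod cyc_len e (cyc_class t i j)"
proof (cases "cyc_sign t i j")
  case True
  then show ?thesis using cyc_step_pos[OF t True g] by simp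
next
  case False
  note inv = cyc_gluing_inverse[OF t g]
  obtain m s1 \<sigma>1 where h: "gtab (t mod 3) (third i j) = (m, s1, \<sigma>1)" "m < 3" "s1 < 3"
    "cyc_gluing e t (third i j) = (3 * shift e s1 (t div 3) + m, \<sigma>1)"
    "(3 * shift e s1 (t div 3) + m) mod 3 = m" "(3 * shift e s1 (t div 3) + m) div 3 = shift e s1 (t div 3)"
    "3 * shift e s1 (t div 3) + m \<in> cyc_tets e"
    by (rule cyc_gluingE[OF t])
  have e: "t' = 3 * shift e s1 (t div 3) + m" "\<sigma>1 = \<sigma>" using g h(4) by auto
  have t': "t' mod 3 = m" using h(5) e by simp
  have h1: "gtab (t mod 3) (third i j) = (m, s1, \<sigma>)" using h(1) e by simp
  have m3: "t mod 3 < 3" by simp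
  have ne: "\<sigma> i \<noteq> \<sigma> j" using inv(2) ij by (metis bij_pointE)
  have "tab (t mod 3) j i \<noteq> 0" using False tab_anti[OF m3 ij] by (simp add: cyc_sign_def)
  then have s': "cyc_sign t' (\<sigma> j) (\<sigma> i)" using tab_step_back[OF m3 _ h1] t' by (simp add: cyc_sign_def)
  have th: "third (\<sigma> j) (\<sigma> i) = \<sigma> (third i j)" using gtab_odd[OF m3 h1 ij[symmetric]] .
  have inv_\<sigma>: "inv \<sigma> (\<sigma> a) = a" for a using inv(2) by (simp add: bij_is_inj)
  note st = cyc_step_pos[OF inv(1) s', unfolded th, OF inv(4), unfolded inv_\<sigma>]
  have cl: "cyc_class t' (\<sigma> i) (\<sigma> j) = cyc_class t i j"
    using st(1) by (simp only: cyc_class_sym[of _ i j] cyc_class_sym[of _ "\<sigma> i" "\<sigma> j"])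
  have neg: "\<not> cyc_sign t' (\<sigma> i) (\<sigma> j)" using s' cyc_sign_anti[OF ne] by blast
  have "cyc_len e (cyc_class t i j) - 1 - cyc_pos e t' (\<sigma> j) (\<sigma> i) =
      Suc (cyc_len e (cyc_class t i j) - 1 - cyc_pos e t j i) mod cyc_len e (cyc_class t i j)"
  proof (rule reverse_step)
    show "cyc_pos e t' (\<sigma> j) (\<sigma> i) < cyc_len e (cyc_class t i j)" using cyc_pos_neg(2)[OF ne neg, of e] cl by simp
    show "cyc_pos e t j i = Suc (cyc_pos e t' (\<sigma> j) (\<sigma> i)) mod cyc_len e (cyc_class t i j)"
      using st(3) cl by (simp only: cyc_class_sym[of t' "\<sigma> i" "\<sigma> j"])
  qed
  then show ?thesis
    using cl neg False cyc_pos_neg(1)[OF ne neg, of e] cyc_pos_neg(1)[OF ij False, of e] by simp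
qed

lemma add_mod_inj:
  assumes "(k + c) mod d = (k' + c) mod d" "k < d" "k' < (d :: nat)"
  shows "k = k'"
proof -
  have le: "x = y" if "(x + c) mod d = (y + c) mod d" "x \<le> y" "y < d" for x y :: nat
  proof -
    have "d dvd y + c - (x + c)" using that mod_eq_dvd_iff_nat[of "x + c" "y + c" d] by simp
    then show ?thesis using that by (auto dest: dvd_imp_le)
  qed
  show ?thesis using le[of k k'] le[of k' k] assms by (cases "k \<le> k'") auto
qed

text \<open>Around b, division by 11 recovers the round and the place. The place determines the type
  of the tetrahedron and the flag in it, and then the round determines the block.\<close>

lemma cyc_inj_pos:
  assumes t: "t \<in> cyc_tets e" "t' \<in> cyc_tets e" and s: "cyc_sign t i j" "cyc_sign t' i' j'"
    and c: "cyc_class t i j = cyc_class t' i' j'" and p: "cyc_pos e t i j = cyc_pos e t' i' j'"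
  shows "(t, i, j) = (t', i', j')"
proof -
  define c1 where "c1 = tab (t mod 3) i j"
  define c2 where "c2 = tab (t' mod 3) i' j'"
  have c0: "c1 \<noteq> 0" "c2 \<noteq> 0" "c1 \<le> 18" "c2 \<le> 18"
    using s tab_le[of "t mod 3" i j] tab_le[of "t' mod 3" i' j'] by (auto simp: c1_def c2_def cyc_sign_def)
  have k: "t div 3 < Suc e" "t' div 3 < Suc e" using t by auto
  have pl: "place e (t div 3) c1 = place e (t' div 3) c2"
    using p cyc_pos_pos(1)[OF s(1)] cyc_pos_pos(1)[OF s(2)] by (simp add: c1_def c2_def)
  have cl: "(if c1 < 8 then Suc (t div 3) else 0) = (if c2 < 8 then Suc (t' div 3) else 0)"
    using c cyc_class_pos(1)[of t i j] cyc_class_pos(1)[of t' i' j'] c0 by (simp add: c1_def c2_def)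
  have "c1 = c2 \<and> t div 3 = t' div 3"
  proof (cases "c1 < 8")
    case True
    then have "c2 < 8" "t div 3 = t' div 3" using cl by (auto split: if_splits)
    then show ?thesis using pl True c0 by (simp add: place_def)
  next
    case False
    then have c2: "\<not> c2 < 8" using cl by (auto split: if_splits)
    define q where "q = (t div 3 + off c1 * e) mod Suc e"
    define q' where "q' = (t' div 3 + off c2 * e) mod Suc e"
    have e: "11 * q + (c1 - 8) = 11 * q' + (c2 - 8)" using pl False c2 by (simp add: place_def q_def q'_def)
    have "c1 - 8 < 11" "c2 - 8 < 11" using c0 by simp_all
    then have "q = q'" "c1 - 8 = c2 - 8"
      using arg_cong[OF e, of "\<lambda>x. x div 11"] arg_cong[OF e, of "\<lambda>x. x mod 11"] by simp_all
    then have "c1 = c2" using False c2 by simp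
    then show ?thesis using \<open>q = q'\<close> add_mod_inj[OF _ k] unfolding q_def q'_def by blast
  qed
  moreover have "tab_at c1 = (t mod 3, i, j)" "tab_at c2 = (t' mod 3, i', j')"
    using tab_at_tab[of "t mod 3" i j] tab_at_tab[of "t' mod 3" i' j'] c0 by (simp_all add: c1_def c2_def)
  ultimately have "t div 3 = t' div 3" "t mod 3 = t' mod 3" "i = i'" "j = j'" by auto
  moreover have "t = 3 * (t div 3) + t mod 3" "t' = 3 * (t' div 3) + t' mod 3" by simp_all
  ultimately show ?thesis by metis
qed

lemma cyc_inj:
  assumes t: "t \<in> cyc_tets e" "i \<noteq> j" "t' \<in> cyc_tets e" "i' \<noteq> j'"
    and c: "cyc_class t i j = cyc_class t' i' j'" and s: "cyc_sign t i j = cyc_sign t' i' j'"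
    and p: "cyc_pos e t i j = cyc_pos e t' i' j'"
  shows "(t, i, j) = (t', i', j')"
proof (cases "cyc_sign t i j")
  case True
  then show ?thesis using cyc_inj_pos[OF t(1,3) True _ c p] s by simp
next
  case False
  have n: "\<not> cyc_sign t' i' j'" using False s by simp
  have "cyc_pos e t j i = cyc_pos e t' j' i'"
    using p cyc_pos_neg[OF t(2) False, of e] cyc_pos_neg[OF t(4) n, of e] c by simp
  moreover have "cyc_sign t j i" "cyc_sign t' j' i'" using False n cyc_sign_anti t by blast+
  moreover have "cyc_class t j i = cyc_class t' j' i'" using c cyc_class_sym by metis
  ultimately have "(t, j, i) = (t', j', i')" using cyc_inj_pos[OF t(1,3)] by blast
  then show ?thesis by simp
qed

lemma cyc_vertex_step:
  assumes "3 * k + m \<in> cyc_tets e" "m < 3" "f \<noteq> i" "gtab m f = (m', s, \<sigma>)"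
  shows "equivclp (vertex_step (cyc_tets e) (cyc_gluing e)) (3 * k + m, i) (3 * shift e s k + m', \<sigma> i)"
proof (rule r_into_equivclp)
  have "(3 * k + m) mod 3 = m" "(3 * k + m) div 3 = k" using assms(2) by auto
  then have "cyc_gluing e (3 * k + m) f = (3 * shift e s k + m', \<sigma>)" using assms(4) by (simp add: cyc_gluing_def)
  then show "vertex_step (cyc_tets e) (cyc_gluing e) (3 * k + m, i) (3 * shift e s k + m', \<sigma> i)"
    using assms(1,3) unfolding vertex_step_def by (auto intro!: exI[of _ f])
qed

text \<open>Inside a block the listed gluings reach every vertex from vertex 1 of its first
  tetrahedron; the face glued with shift 2 connects a block with the preceding one.\<close>

lemma cyc_connected:
  assumes "t \<in> cyc_tets e"
  shows "equivclp (vertex_step (cyc_tets e) (cyc_gluing e)) (0, 1) (t, i)"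
proof -
  let ?E = "equivclp (vertex_step (cyc_tets e) (cyc_gluing e))"
  note tr = equivclp_trans and sy = equivclp_sym
  have block: "?E (3 * k, 1) (3 * k + m, i)" if k: "k < Suc e" and m: "m < 3" for k m i
  proof -
    have "3 * k + 0 \<in> cyc_tets e" "3 * k + 1 \<in> cyc_tets e" "3 * k + 2 \<in> cyc_tets e" using k by auto
    note st = this[THEN cyc_vertex_step]
    have s0: "shift e 0 k = k" using k by (simp add: shift_def)
    have A: "?E (3 * k, 1) (3 * k + 1, 3)" "?E (3 * k, 2) (3 * k + 1, 4)" "?E (3 * k, 4) (3 * k + 1, 1)"
      "?E (3 * k, 1) (3 * k + 2, 4)" "?E (3 * k, 2) (3 * k + 2, 3)" "?E (3 * k, 3) (3 * k + 2, 1)"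
      using st(1)[of 3 1 1 0 "sel4 3 4 2 1"] st(1)[of 3 2 1 0 "sel4 3 4 2 1"] st(1)[of 3 4 1 0 "sel4 3 4 2 1"]
        st(1)[of 4 1 2 0 "sel4 4 3 1 2"] st(1)[of 4 2 2 0 "sel4 4 3 1 2"] st(1)[of 4 3 2 0 "sel4 4 3 1 2"]
      by (simp_all add: gtab_def s0)
    have B: "?E (3 * k + 1, 2) (3 * k + 1, 1)" "?E (3 * k + 1, 3) (3 * k + 1, 2)" "?E (3 * k + 1, 4) (3 * k + 1, 3)"
      using st(2)[of 1 2 1 0 "sel4 4 1 2 3"] st(2)[of 1 3 1 0 "sel4 4 1 2 3"] st(2)[of 1 4 1 0 "sel4 4 1 2 3"]
      by (simp_all add: gtab_def s0)
    have C: "?E (3 * k + 2, 2) (3 * k + 2, 1)" "?E (3 * k + 2, 3) (3 * k + 2, 2)" "?E (3 * k + 2, 4) (3 * k + 2, 3)"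
      using st(3)[of 1 2 2 0 "sel4 4 1 2 3"] st(3)[of 1 3 2 0 "sel4 4 1 2 3"] st(3)[of 1 4 2 0 "sel4 4 1 2 3"]
      by (simp_all add: gtab_def s0)
    have b: "?E (3 * k, 1) (3 * k + 1, 3)" "?E (3 * k, 1) (3 * k + 1, 2)" "?E (3 * k, 1) (3 * k + 1, 1)" "?E (3 * k, 1) (3 * k + 1, 4)"
      using A(1) tr[OF A(1) B(2)] tr[OF tr[OF A(1) B(2)] B(1)] tr[OF A(1) sy[OF B(3)]] by auto
    have c: "?E (3 * k, 1) (3 * k + 2, 4)" "?E (3 * k, 1) (3 * k + 2, 3)" "?E (3 * k, 1) (3 * k + 2, 2)" "?E (3 * k, 1) (3 * k + 2, 1)"
      using A(4) tr[OF A(4) C(3)] tr[OF tr[OF A(4) C(3)] C(2)] tr[OF tr[OF tr[OF A(4) C(3)] C(2)] C(1)] by auto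
    have a: "?E (3 * k, 1) (3 * k, 1)" "?E (3 * k, 1) (3 * k, 2)" "?E (3 * k, 1) (3 * k, 3)" "?E (3 * k, 1) (3 * k, 4)"
      using tr[OF b(4) sy[OF A(2)]] tr[OF c(4) sy[OF A(6)]] tr[OF b(3) sy[OF A(3)]] by auto
    show ?thesis using a b c by (cases rule: cases_34[OF m, of i]) simp_all
  qed
  have chain: "k < Suc e \<Longrightarrow> ?E (0, 1) (3 * k, 1)" for k
  proof (induction k)
    case (Suc k)
    have k: "3 * Suc k + 0 \<in> cyc_tets e" using Suc.prems by auto
    have s: "shift e 2 (Suc k) = k"
    proof -
      have "(Suc k + e) mod Suc e = (k + Suc e) mod Suc e" by simp
      then show ?thesis using Suc.prems by (simp add: shift_def)
    qed
    have x: "?E (3 * Suc k, 2) (3 * k, 3)" using cyc_vertex_step[OF k, of 1 2 0 2 "sel4 2 3 4 1"] s by (simp add: gtab_def)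
    have y: "?E (3 * Suc k, 1) (3 * Suc k, 2)" using block[OF Suc.prems, of 0 2] by simp
    have z: "?E (3 * k, 1) (3 * k, 3)" using block[of k 0 3] Suc.prems by simp
    have "?E (3 * k, 1) (3 * Suc k, 1)" by (rule tr[OF z sy[OF tr[OF y x]]])
    then show ?case using tr[OF Suc.IH] Suc.prems by simp
  qed simp
  have "t div 3 < Suc e" "t mod 3 < 3" using assms by auto
  then have "?E (0, 1) (3 * (t div 3) + t mod 3, i)" using tr[OF chain block] by blast
  then show ?thesis by simp
qed

lemma cyc_triangulation:
  "triangulation (cyc_tets e) (cyc_gluing e) cyc_class cyc_sign (cyc_pos e) (cyc_len e)"
proof
  show "face_pairing (cyc_tets e) (cyc_gluing e)" by (rule cyc_face_pairing)
  show "cyc_tets e \<noteq> {}" by (simp add: lessThan_empty_iff)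
  fix t t' :: nat and i j i' j' :: 4 and \<sigma>
  assume t: "t \<in> cyc_tets e"
  show "third (snd (cyc_gluing e t f) i) (snd (cyc_gluing e t f) j) = snd (cyc_gluing e t f) (third j i)" if "i \<noteq> j" for f
  proof -
    obtain m s \<sigma> where "gtab (t mod 3) f = (m, s, \<sigma>)" by (metis prod_cases3)
    then show ?thesis using gtab_odd[of "t mod 3" f m s \<sigma> i j] that by (simp add: cyc_gluing_def)
  qed
  show "cyc_class t j i = cyc_class t i j" by (rule cyc_class_sym)
  show "cyc_len e (cyc_class t i j) \<ge> 3" by (simp add: cyc_len_def)
  show "equivclp (vertex_step (cyc_tets e) (cyc_gluing e)) (t, i) (t', i')" if "t' \<in> cyc_tets e"
    using equivclp_trans[OF equivclp_sym[OF cyc_connected[OF t]] cyc_connected[OF that]] .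
  assume ij: "i \<noteq> j"
  show "cyc_sign t j i \<longleftrightarrow> \<not> cyc_sign t i j" by (rule cyc_sign_anti[OF ij])
  show "cyc_pos e t i j < cyc_len e (cyc_class t i j)"
    using cyc_pos_pos(2)[of t i j e] cyc_pos_neg[OF ij, of t e] by (cases "cyc_sign t i j") auto
  show "cyc_class t' (\<sigma> i) (\<sigma> j) = cyc_class t i j \<and> cyc_sign t' (\<sigma> i) (\<sigma> j) = cyc_sign t i j \<and>
      cyc_pos e t' (\<sigma> i) (\<sigma> j) = Suc (cyc_pos e t i j) mod cyc_len e (cyc_class t i j)"
    if "cyc_gluing e t (third i j) = (t', \<sigma>)" using cyc_step[OF t ij that] .
  show "(t, i, j) = (t', i', j')" if "t' \<in> cyc_tets e" "i' \<noteq> j'" "cyc_class t i j = cyc_class t' i' j'"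
    "cyc_sign t i j = cyc_sign t' i' j'" "cyc_pos e t i j = cyc_pos e t' i' j'"
    using cyc_inj[OF t ij that] .
qed

lemma cyc_labels: "triangulation.labels (cyc_tets e) cyc_class = {..Suc e}"
proof -
  have "{cyc_class t i j | t i j. t \<in> cyc_tets e \<and> i \<noteq> j} = {..Suc e}"
  proof (intro equalityI subsetI)
    fix c assume "c \<in> {cyc_class t i j | t i j. t \<in> cyc_tets e \<and> i \<noteq> j}"
    then obtain t i j where "c = cyc_class t i j" "t \<in> cyc_tets e" by blast
    moreover from this have "t div 3 < Suc e" by auto
    ultimately show "c \<in> {..Suc e}" by (auto simp: cyc_class_def)
  next
    fix c assume "c \<in> {..Suc e}"
    show "c \<in> {cyc_class t i j | t i j. t \<in> cyc_tets e \<and> i \<noteq> j}"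
    proof (cases c)
      case 0
      then have "c = cyc_class 0 1 3" by (simp add: cyc_class_def tab_def)
      moreover have "0 \<in> cyc_tets e" "(1 :: 4) \<noteq> 3" by simp_all
      ultimately show ?thesis by blast
    next
      case (Suc k)
      then have "c = cyc_class (3 * k) 1 2" by (simp add: cyc_class_def tab_def)
      moreover have "3 * k \<in> cyc_tets e" "(1 :: 4) \<noteq> 2" using Suc \<open>c \<in> {..Suc e}\<close> by simp_all
      ultimately show ?thesis by blast
    qed
  qed
  then show ?thesis using triangulation.labels_def[OF cyc_triangulation] by simp
qed

section \<open>The hyperbolic structure\<close>

definition cone_mat :: "real \<Rightarrow> real \<Rightarrow> 4 \<Rightarrow> 4 \<Rightarrow> real" where
  "cone_mat x y i j = (if {i, j} = {1, 2} then x else y)"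

definition path_mat :: "real \<Rightarrow> real \<Rightarrow> 4 \<Rightarrow> 4 \<Rightarrow> real" where
  "path_mat x y i j = (if {i, j} \<in> {{1, 2}, {2, 3}, {3, 4}} then x else y)"

lemma mat_sym: "cone_mat x y i j = cone_mat x y j i" "path_mat x y i j = path_mat x y j i"
  by (simp_all add: cone_mat_def path_mat_def insert_commute)

lemma edge_cos_sym:
  assumes "\<And>i j. x i j = x j i"
  shows "edge_cos x i j = edge_cos x j i"
proof -
  have "num4 x i j k l = num4 x j i l k" "tri3 x i j k = tri3 x j i k" for k l
    using assms[of i j] assms[of k l] by (simp_all add: num4_def tri3_def algebra_simps)
  then show ?thesis unfolding edge_cos_def by (simp add: mult.commute)
qed

lemma quot_sqrt_same:
  assumes "0 < a" "0 < (p :: real)"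
  shows "a * n / (sqrt (a * p) * sqrt (a * p)) = n / p"
  using assms by simp

lemma quot_sqrt:
  assumes "0 < a" "0 < p" "0 < (q :: real)"
  shows "a * n / (sqrt (a * p) * sqrt q) = n * sqrt a / sqrt (p * q)" "a * n / (sqrt q * sqrt (a * p)) = n * sqrt a / sqrt (p * q)"
proof -
  define r where "r = sqrt a"
  have r: "0 < r" "sqrt a = r" "a = r\<^sup>2" using assms(1) by (simp_all add: r_def)
  have s: "0 < sqrt p" "0 < sqrt q" using assms by simp_all
  show e: "a * n / (sqrt (a * p) * sqrt q) = n * sqrt a / sqrt (p * q)"
    unfolding real_sqrt_mult r(2) using r s by (simp add: r(3) power2_eq_square)
  show "a * n / (sqrt q * sqrt (a * p)) = n * sqrt a / sqrt (p * q)"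
    unfolding e[symmetric] by (simp only: mult.commute)
qed

context
  fixes x y :: real
  assumes x: "1 < x" "x < 3" and y: "1 < y" "y < 9 / 4"
begin

lemma pos_terms: "0 < 2 * y\<^sup>2 + x - 1" "0 < 2 * x\<^sup>2 + y - 1" "0 < 2 * y - 1" "0 < 1 + x" "0 < 1 + y" "0 < (1 + y) * (2 * y - 1)"
  "0 < (1 + x) * (2 * y\<^sup>2 + x - 1)" "0 < (1 + y) * (2 * x\<^sup>2 + y - 1)"
proof -
  have "0 < y\<^sup>2" "0 < x\<^sup>2" using x y by simp_all
  then show p: "0 < 2 * y\<^sup>2 + x - 1" "0 < 2 * x\<^sup>2 + y - 1" using x y by linarith+
  show q: "0 < 2 * y - 1" using y(1) by linarith
  show r: "0 < 1 + x" "0 < 1 + y" using x y by linarith+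
  show "0 < (1 + y) * (2 * y - 1)" "0 < (1 + x) * (2 * y\<^sup>2 + x - 1)" "0 < (1 + y) * (2 * x\<^sup>2 + y - 1)"
    using mult_pos_pos[OF r(2) q] mult_pos_pos[OF r(1) p(1)] mult_pos_pos[OF r(2) p(2)] .
qed

text \<open>The symmetric pattern makes the Gram expressions factor: cofactors and minors share
  factors 1 + x and 1 + y, which cancel from the quotients.\<close>

lemma cone_cos:
  "edge_cos (cone_mat x y) 1 2 = cosA x y" "edge_cos (cone_mat x y) 3 4 = cosB x y"
  "edge_cos (cone_mat x y) 1 3 = cosC x y" "edge_cos (cone_mat x y) 1 4 = cosC x y"
  "edge_cos (cone_mat x y) 2 3 = cosC x y" "edge_cos (cone_mat x y) 2 4 = cosC x y"
proof -
  let ?X = "cone_mat x y"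
  have m: "?X 1 2 = x" "?X 2 1 = x" "?X 1 3 = y" "?X 3 1 = y" "?X 1 4 = y" "?X 4 1 = y" "?X 2 3 = y" "?X 3 2 = y"
    "?X 2 4 = y" "?X 4 2 = y" "?X 3 4 = y" "?X 4 3 = y"
    by (simp_all add: cone_mat_def doubleton_eq_iff)
  note al = num4_def tri3_def m algebra_simps power2_eq_square power3_eq_cube
  note p = pos_terms
  have t1: "tri3 ?X 1 2 3 = (1 + x) * (2 * y\<^sup>2 + x - 1)" "tri3 ?X 1 2 4 = (1 + x) * (2 * y\<^sup>2 + x - 1)"
    "tri3 ?X 1 3 2 = (1 + x) * (2 * y\<^sup>2 + x - 1)" "tri3 ?X 1 4 2 = (1 + x) * (2 * y\<^sup>2 + x - 1)"
    "tri3 ?X 2 3 1 = (1 + x) * (2 * y\<^sup>2 + x - 1)" "tri3 ?X 2 4 1 = (1 + x) * (2 * y\<^sup>2 + x - 1)"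
    by (simp_all add: al)
  have t2: "tri3 ?X 3 4 1 = (1 + y) * ((1 + y) * (2 * y - 1))" "tri3 ?X 3 4 2 = (1 + y) * ((1 + y) * (2 * y - 1))"
    "tri3 ?X 1 3 4 = (1 + y) * ((1 + y) * (2 * y - 1))" "tri3 ?X 1 4 3 = (1 + y) * ((1 + y) * (2 * y - 1))"
    "tri3 ?X 2 3 4 = (1 + y) * ((1 + y) * (2 * y - 1))" "tri3 ?X 2 4 3 = (1 + y) * ((1 + y) * (2 * y - 1))"
    by (simp_all add: al)
  have n1: "num4 ?X 1 2 3 4 = (1 + x) * (2 * y\<^sup>2 + y * (1 - x))" by (simp add: al)
  have n2: "num4 ?X 3 4 1 2 = (1 + y) * (2 * y\<^sup>2 + x * (1 - y))" by (simp add: al)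
  have n3: "num4 ?X 1 3 4 2 = (1 + x) * (y * (1 + y))" "num4 ?X 1 4 2 3 = (1 + x) * (y * (1 + y))"
    "num4 ?X 2 3 1 4 = (1 + x) * (y * (1 + y))" "num4 ?X 2 4 3 1 = (1 + x) * (y * (1 + y))"
    by (simp_all add: al)
  show "edge_cos ?X 1 2 = cosA x y"
    unfolding edge_cos_def third_simps t1 n1 cosA_def by (rule quot_sqrt_same[OF p(4,1)])
  show "edge_cos ?X 3 4 = cosB x y"
    unfolding edge_cos_def third_simps t2 n2 cosB_def quot_sqrt_same[OF p(5,6)] by (simp add: add.commute)
  have q: "0 < (1 + y) * ((1 + y) * (2 * y - 1))" by (rule mult_pos_pos[OF p(5,6)])
  have c: "y * (1 + y) * sqrt (1 + x) / sqrt ((2 * y\<^sup>2 + x - 1) * ((1 + y) * ((1 + y) * (2 * y - 1)))) = cosC x y"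
  proof -
    have "sqrt ((1 + y) * ((1 + y) * (2 * y - 1))) = (1 + y) * sqrt (2 * y - 1)"
      using p(5) by (simp add: real_sqrt_mult mult.assoc[symmetric])
    then show ?thesis unfolding cosC_def real_sqrt_mult[of "2 * y\<^sup>2 + x - 1"] using p(5) by simp
  qed
  show "edge_cos ?X 1 3 = cosC x y" "edge_cos ?X 1 4 = cosC x y" "edge_cos ?X 2 3 = cosC x y" "edge_cos ?X 2 4 = cosC x y"
    unfolding edge_cos_def third_simps t1 t2 n3 quot_sqrt[OF p(4,1) q] c by (rule refl)+
qed

text \<open>After division by (1 + x)^2 the claim is |n| < p; the bound x < 3 gives p + n >
  0.\<close>

lemma cone_angle: "(num4 (cone_mat x y) 1 2 3 4)\<^sup>2 < tri3 (cone_mat x y) 1 2 3 * tri3 (cone_mat x y) 1 2 4"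
proof -
  have m: "cone_mat x y 1 2 = x" "cone_mat x y 1 3 = y" "cone_mat x y 1 4 = y" "cone_mat x y 2 3 = y" "cone_mat x y 2 4 = y" "cone_mat x y 3 4 = y"
    by (simp_all add: cone_mat_def doubleton_eq_iff)
  let ?n = "2 * y\<^sup>2 + y * (1 - x)" and ?p = "2 * y\<^sup>2 + x - 1"
  have e: "num4 (cone_mat x y) 1 2 3 4 = (1 + x) * ?n" "tri3 (cone_mat x y) 1 2 3 = (1 + x) * ?p" "tri3 (cone_mat x y) 1 2 4 = (1 + x) * ?p"
    by (simp_all add: num4_def tri3_def m algebra_simps power2_eq_square)
  have pm: "?p - ?n = (x - 1) * (y + 1)" "?p + ?n = 4 * y\<^sup>2 - 2 * y + 2 + (3 - x) * (y - 1)"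
    by (simp_all add: algebra_simps power2_eq_square)
  have "0 < (x - 1) * (y + 1)" "0 < (3 - x) * (y - 1)" "y < y\<^sup>2" using x y by (simp_all add: power2_eq_square)
  then have "0 < ?p - ?n" "0 < ?p + ?n" unfolding pm using x y by linarith+
  then have "\<bar>?n\<bar> < ?p" by linarith
  then have "\<bar>(1 + x) * ?n\<bar> < (1 + x) * ?p" using x by (simp add: abs_mult)
  then show ?thesis unfolding e power2_eq_square[symmetric] by (metis abs_ge_zero power2_abs power_strict_mono zero_less_numeral)
qed

lemma path_cos:
  "edge_cos (path_mat x y) 2 3 = cosM x y" "edge_cos (path_mat x y) 1 4 = cosM y x"
  "edge_cos (path_mat x y) 1 2 = cosE x y" "edge_cos (path_mat x y) 3 4 = cosE x y"
  "edge_cos (path_mat x y) 1 3 = cosE y x" "edge_cos (path_mat x y) 2 4 = cosE y x"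
  "(num4 (path_mat x y) 1 2 3 4)\<^sup>2 < tri3 (path_mat x y) 1 2 3 * tri3 (path_mat x y) 1 2 4"
proof -
  let ?X = "path_mat x y"
  have m: "?X 1 2 = x" "?X 2 1 = x" "?X 1 3 = y" "?X 3 1 = y" "?X 1 4 = y" "?X 4 1 = y" "?X 2 3 = x" "?X 3 2 = x"
    "?X 2 4 = y" "?X 4 2 = y" "?X 3 4 = x" "?X 4 3 = x"
    by (simp_all add: path_mat_def doubleton_eq_iff)
  note al = num4_def tri3_def m algebra_simps power2_eq_square power3_eq_cube
  note p = pos_terms
  have t1: "tri3 ?X 1 2 4 = (1 + x) * (2 * y\<^sup>2 + x - 1)" "tri3 ?X 3 4 1 = (1 + x) * (2 * y\<^sup>2 + x - 1)"
    "tri3 ?X 1 4 2 = (1 + x) * (2 * y\<^sup>2 + x - 1)" "tri3 ?X 1 4 3 = (1 + x) * (2 * y\<^sup>2 + x - 1)"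
    "tri3 ?X 1 3 4 = (1 + x) * (2 * y\<^sup>2 + x - 1)" "tri3 ?X 2 4 1 = (1 + x) * (2 * y\<^sup>2 + x - 1)"
    by (simp_all add: al)
  have t2: "tri3 ?X 1 2 3 = (1 + y) * (2 * x\<^sup>2 + y - 1)" "tri3 ?X 3 4 2 = (1 + y) * (2 * x\<^sup>2 + y - 1)"
    "tri3 ?X 2 3 1 = (1 + y) * (2 * x\<^sup>2 + y - 1)" "tri3 ?X 2 3 4 = (1 + y) * (2 * x\<^sup>2 + y - 1)"
    "tri3 ?X 1 3 2 = (1 + y) * (2 * x\<^sup>2 + y - 1)" "tri3 ?X 2 4 3 = (1 + y) * (2 * x\<^sup>2 + y - 1)"
    by (simp_all add: al)
  have n1: "num4 ?X 1 2 3 4 = (1 + x) * (y\<^sup>2 + x * y + x - x\<^sup>2)" "num4 ?X 3 4 1 2 = (1 + x) * (y\<^sup>2 + x * y + x - x\<^sup>2)"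
    "num4 ?X 1 3 4 2 = (1 + y) * (x\<^sup>2 + y * x + y - y\<^sup>2)" "num4 ?X 2 4 3 1 = (1 + y) * (x\<^sup>2 + y * x + y - y\<^sup>2)"
    "num4 ?X 2 3 1 4 = x ^ 3 + x * y\<^sup>2 + 2 * x * y + y - x\<^sup>2 * y" "num4 ?X 1 4 2 3 = y ^ 3 + y * x\<^sup>2 + 2 * y * x + x - y\<^sup>2 * x"
    by (simp_all add: al)
  have ss: "n / (sqrt q * sqrt q) = n / q" if "0 < q" for n q :: real using that by simp
  show "edge_cos ?X 2 3 = cosM x y"
    unfolding edge_cos_def third_simps t2 n1 cosM_def ss[OF p(8)] by (simp only: add.commute)
  show "edge_cos ?X 1 4 = cosM y x"
    unfolding edge_cos_def third_simps t1 n1 cosM_def ss[OF p(7)] by (simp only: add.commute)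
  show "edge_cos ?X 1 2 = cosE x y" "edge_cos ?X 3 4 = cosE x y"
    unfolding edge_cos_def third_simps t1 t2 n1 quot_sqrt[OF p(4,1,8)] cosE_def
    by (simp_all only: mult.assoc add.commute[of 1 y])
  show "edge_cos ?X 1 3 = cosE y x" "edge_cos ?X 2 4 = cosE y x"
    unfolding edge_cos_def third_simps t1 t2 n1 quot_sqrt[OF p(5,2,7)] cosE_def
    by (simp_all only: mult.assoc add.commute[of 1 x])
  \<comment> \<open>By Jacobi's identity the defect at the edge {1, 2} equals that at {2, 3}, as
    both edges have parameter x. At {2, 3} the two minors coincide, so the defect is a difference of
    squares.\<close>
  let ?N = "x ^ 3 + x * y\<^sup>2 + 2 * x * y + y - x\<^sup>2 * y" and ?D = "(1 + y) * (2 * x\<^sup>2 + y - 1)"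
  have "?D * ((1 + x) * (2 * y\<^sup>2 + x - 1)) - ((1 + x) * (y\<^sup>2 + x * y + x - x\<^sup>2))\<^sup>2 = (?D - ?N) * (?D + ?N)"
    by (simp add: algebra_simps power2_eq_square power3_eq_cube)
  moreover have "0 < (?D - ?N) * (?D + ?N)"
  proof (rule mult_pos_pos)
    \<comment> \<open>The factorization is arranged so that x < 3 and y < 9/4 make every summand of
      the second factor positive.\<close>
    have "?D - ?N = (x - 1) * ((x - 1) * (3 - x) + 3 * (x * (y - 1)) + (4 + y - y * y))"
      by (simp add: algebra_simps power2_eq_square power3_eq_cube)
    moreover have "y * y < 9 / 4 * y" using y by (intro mult_strict_right_mono) auto
    then have "0 < 4 + y - y * y" using y by linarith
    moreover have "0 < (x - 1) * (3 - x)" "0 < x * (y - 1)" using x y by simp_all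
    then have "0 < (x - 1) * ((x - 1) * (3 - x) + 3 * (x * (y - 1)) + (4 + y - y * y))"
      using x \<open>0 < 4 + y - y * y\<close> by (intro mult_pos_pos[of "x - 1"] add_pos_pos) simp_all
    ultimately show "0 < ?D - ?N" by (simp only:)
    have "?D + ?N = x ^ 3 + x * y\<^sup>2 + 2 * x * y + (y - 1) + x\<^sup>2 * y + 2 * x\<^sup>2 + y\<^sup>2"
      by (simp add: algebra_simps power2_eq_square power3_eq_cube)
    moreover have "0 < x ^ 3" "0 < x * y\<^sup>2" "0 < 2 * x * y" "0 < x\<^sup>2 * y" "0 < x\<^sup>2" "0 < y\<^sup>2" using x y by simp_all
    ultimately show "0 < ?D + ?N" using y by linarith
  qed
  ultimately show "(num4 ?X 1 2 3 4)\<^sup>2 < tri3 ?X 1 2 3 * tri3 ?X 1 2 4"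
    unfolding n1 t1 t2 by linarith
qed

end

text \<open>The second and third tetrahedron of a block have the same pattern of edge classes, a
  path of three edges labelled a_k, and are therefore given congruent shapes.\<close>

definition block_mat :: "real \<Rightarrow> real \<Rightarrow> nat \<Rightarrow> 4 \<Rightarrow> 4 \<Rightarrow> real" where
  "block_mat x y t = (if t mod 3 = 0 then cone_mat x y else path_mat x y)"

definition edge_angle :: "real \<Rightarrow> real \<Rightarrow> nat \<Rightarrow> 4 set \<Rightarrow> real" where
  "edge_angle x y t s = angle_of
    (if t mod 3 = 0 then if s = {1, 2} then cosA x y else if s = {3, 4} then cosB x y else cosC x y
     else if s = {2, 3} then cosM x y else if s = {1, 4} then cosM y x
     else if s = {1, 2} \<or> s = {3, 4} then cosE x y else cosE y x)"

lemma third_complement: "k \<noteq> m \<Longrightarrow> {third k m, third m k} = - {k, m}"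
  using UNIV_third[of k m] third_neq[of k m] by blast

lemma edge_cos_angle:
  assumes x: "1 < x" "x < 3" and y: "1 < y" "y < 9 / 4" and ij: "i \<noteq> j"
  shows "angle_of (edge_cos (block_mat x y t) i j) = edge_angle x y t {i, j}"
proof -
  note c = cone_cos[OF x y] path_cos[OF x y]
  note s = edge_cos_sym[of "cone_mat x y", OF mat_sym(1)] edge_cos_sym[of "path_mat x y", OF mat_sym(2)]
  have c': "edge_cos (cone_mat x y) 2 1 = cosA x y" "edge_cos (cone_mat x y) 4 3 = cosB x y"
    "edge_cos (cone_mat x y) 3 1 = cosC x y" "edge_cos (cone_mat x y) 4 1 = cosC x y"
    "edge_cos (cone_mat x y) 3 2 = cosC x y" "edge_cos (cone_mat x y) 4 2 = cosC x y"
    "edge_cos (path_mat x y) 3 2 = cosM x y" "edge_cos (path_mat x y) 4 1 = cosM y x"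
    "edge_cos (path_mat x y) 2 1 = cosE x y" "edge_cos (path_mat x y) 4 3 = cosE x y"
    "edge_cos (path_mat x y) 3 1 = cosE y x" "edge_cos (path_mat x y) 4 2 = cosE y x"
    using c s by metis+
  show ?thesis
    using ij exhaust_4[of i] exhaust_4[of j]
    by (cases "t mod 3 = 0") (elim disjE; simp add: edge_angle_def block_mat_def c c' doubleton_eq_iff)+
qed

lemma cyc_class_block:
  assumes "m < 3"
  shows "cyc_class (3 * k + m) i j = (if tab m i j + tab m j i < 8 then Suc k else 0)"
  using assms by (simp add: cyc_class_def)

text \<open>Lengths depend only on the quotient class of an edge, so the shapes chosen for the
  tetrahedra fit together.\<close>

lemma block_mat_class:
  assumes "i \<noteq> j"
  shows "block_mat x y t i j = (if cyc_class t i j = 0 then y else x)"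
proof -
  have "t mod 3 < 3" by simp
  then have "\<forall>j. i \<noteq> j \<longrightarrow> block_mat x y t i j = (if tab (t mod 3) i j + tab (t mod 3) j i < 8 then x else y)"
    by (cases rule: cases_34[of "t mod 3" i])
      (auto simp: forall_4 tab_def block_mat_def cone_mat_def path_mat_def doubleton_eq_iff)
  then show ?thesis using assms by (simp add: cyc_class_def)
qed

definition pairs4 :: "4 set set" where
  "pairs4 = {{1, 2}, {1, 3}, {1, 4}, {2, 3}, {2, 4}, {3, 4}}"

lemma pairs4_eq: "pairs4 = {s. card s = 2}"
proof (intro equalityI subsetI)
  fix s assume "s \<in> pairs4"
  then show "s \<in> {s. card s = 2}" unfolding pairs4_def by auto
next
  fix s :: "4 set" assume "s \<in> {s. card s = 2}"
  then obtain i j where "s = {i, j}" "i \<noteq> j" by (auto simp: card_2_iff)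
  then show "s \<in> pairs4"
    using exhaust_4[of i] exhaust_4[of j] unfolding pairs4_def by (elim disjE) (simp_all add: insert_commute)
qed

lemma sum_pairs4: "sum f pairs4 = f {1, 2} + f {1, 3} + f {1, 4} + f {2, 3} + f {2, 4} + f {3, 4}"
  for f :: "4 set \<Rightarrow> 'e::comm_monoid_add"
  unfolding pairs4_def by (simp add: doubleton_eq_iff add.assoc)

lemma sum_triples: "sum f {..<3 * n} = (\<Sum>k<n. f (3 * k) + f (3 * k + 1) + f (3 * k + 2))"
  for f :: "nat \<Rightarrow> 'e::comm_monoid_add" and n :: nat
proof (induction n)
  case (Suc n)
  have "3 * Suc n = Suc (Suc (Suc (3 * n)))" by simp
  then show ?case by (simp only: sum.lessThan_Suc Suc) (simp add: add.assoc)
qed simp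

context
  fixes e :: nat
begin

interpretation cyc: triangulation "cyc_tets e" "cyc_gluing e" cyc_class cyc_sign "cyc_pos e" "cyc_len e"
  by (rule cyc_triangulation)

text \<open>Every block contributes the same amount to b, while a_k receives contributions from
  block k alone.\<close>

lemma cyc_angle_sum:
  assumes c: "c \<in> {..Suc e}"
  shows "(\<Sum>\<epsilon> | \<epsilon> \<in> local_edges (cyc_tets e) \<and> edge_class (cyc_tets e) (cyc_gluing e) \<epsilon> = cyc.eset c.
      edge_angle x y (fst \<epsilon>) (snd \<epsilon>)) = (if c = 0 then real (Suc e) * sumB x y else sumA x y)"
proof -
  let ?f = "\<lambda>t s. if (t, s) \<in> cyc.eset c then edge_angle x y t s else 0"
  have mem: "edge_class (cyc_tets e) (cyc_gluing e) (t, s) = cyc.eset c \<longleftrightarrow> (t, s) \<in> cyc.eset c"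
    if ts: "t \<in> cyc_tets e" "s \<in> pairs4" for t s
  proof -
    obtain i j where s: "s = {i, j}" "i \<noteq> j" using ts(2) unfolding pairs4_eq by (auto simp: card_2_iff)
    have "cyc_class t i j \<in> cyc.labels" using ts s(2) unfolding cyc.labels_def by blast
    moreover have "c \<in> cyc.labels" using c unfolding cyc_labels .
    ultimately show ?thesis
      unfolding s(1) cyc.edge_class_eq[OF ts(1) s(2)] cyc.eset_mem_iff[OF ts(1) s(2)]
      using cyc.inj_eset by (auto simp: inj_on_def)
  qed
  have loc: "local_edges (cyc_tets e) = cyc_tets e \<times> pairs4" unfolding local_edges_def pairs4_eq by auto
  have "(\<Sum>\<epsilon> | \<epsilon> \<in> local_edges (cyc_tets e) \<and> edge_class (cyc_tets e) (cyc_gluing e) \<epsilon> = cyc.eset c.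
      edge_angle x y (fst \<epsilon>) (snd \<epsilon>)) =
      (\<Sum>\<epsilon> \<in> cyc_tets e \<times> pairs4. if edge_class (cyc_tets e) (cyc_gluing e) \<epsilon> = cyc.eset c then edge_angle x y (fst \<epsilon>) (snd \<epsilon>) else 0)"
    unfolding loc by (rule sum.mono_neutral_cong_left) (auto simp: pairs4_def)
  also have "\<dots> = (\<Sum>\<epsilon> \<in> cyc_tets e \<times> pairs4. ?f (fst \<epsilon>) (snd \<epsilon>))"
  proof (rule sum.cong)
    fix \<epsilon> assume "\<epsilon> \<in> cyc_tets e \<times> pairs4"
    then have "fst \<epsilon> \<in> cyc_tets e" "snd \<epsilon> \<in> pairs4" by (simp_all only: mem_Times_iff)
    from mem[OF this] show "(if edge_class (cyc_tets e) (cyc_gluing e) \<epsilon> = cyc.eset c then edge_angle x y (fst \<epsilon>) (snd \<epsilon>) else 0) =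
        ?f (fst \<epsilon>) (snd \<epsilon>)" by (simp only: prod.collapse)
  qed (rule refl)
  also have "\<dots> = (\<Sum>t<3 * Suc e. \<Sum>s\<in>pairs4. ?f t s)"
    by (simp only: sum.cartesian_product split_def)
  also have "\<dots> = (\<Sum>k<Suc e. (\<Sum>s\<in>pairs4. ?f (3 * k) s) + (\<Sum>s\<in>pairs4. ?f (3 * k + 1) s) + (\<Sum>s\<in>pairs4. ?f (3 * k + 2) s))"
    by (rule sum_triples)
  also have "\<dots> = (\<Sum>k<Suc e. if c = 0 then sumB x y else if c = Suc k then sumA x y else 0)"
  proof (rule sum.cong)
    fix k assume k: "k \<in> {..<Suc e}"
    have mt: "(3 * k + m, {i, j}) \<in> cyc.eset c \<longleftrightarrow> (if tab m i j + tab m j i < 8 then c = Suc k else c = 0)"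
      if "m < 3" "i \<noteq> j" for m i j
    proof -
      have "3 * k + m \<in> cyc_tets e" using k that by auto
      then show ?thesis using cyc.eset_mem_iff[of "3 * k + m" i j c] that by (auto simp: cyc_class_block)
    qed
    have mA: "(3 * k, {1, 2}) \<in> cyc.eset c \<longleftrightarrow> c = Suc k"
      "(3 * k, {1, 3}) \<in> cyc.eset c \<longleftrightarrow> c = 0"
      "(3 * k, {1, 4}) \<in> cyc.eset c \<longleftrightarrow> c = 0"
      "(3 * k, {2, 3}) \<in> cyc.eset c \<longleftrightarrow> c = 0"
      "(3 * k, {2, 4}) \<in> cyc.eset c \<longleftrightarrow> c = 0"
      "(3 * k, {3, 4}) \<in> cyc.eset c \<longleftrightarrow> c = 0"
      using mt[of 0 1 2] mt[of 0 1 3] mt[of 0 1 4] mt[of 0 2 3] mt[of 0 2 4] mt[of 0 3 4] by (simp_all add: tab_def)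
    have mB: "(3 * k + 1, {1, 2}) \<in> cyc.eset c \<longleftrightarrow> c = Suc k"
      "(3 * k + 1, {1, 3}) \<in> cyc.eset c \<longleftrightarrow> c = 0"
      "(3 * k + 1, {1, 4}) \<in> cyc.eset c \<longleftrightarrow> c = 0"
      "(3 * k + 1, {2, 3}) \<in> cyc.eset c \<longleftrightarrow> c = Suc k"
      "(3 * k + 1, {2, 4}) \<in> cyc.eset c \<longleftrightarrow> c = 0"
      "(3 * k + 1, {3, 4}) \<in> cyc.eset c \<longleftrightarrow> c = Suc k"
      using mt[of 1 1 2] mt[of 1 1 3] mt[of 1 1 4] mt[of 1 2 3] mt[of 1 2 4] mt[of 1 3 4] by (simp_all add: tab_def del: One_nat_def)
    have mC: "(3 * k + 2, {1, 2}) \<in> cyc.eset c \<longleftrightarrow> c = Suc k"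
      "(3 * k + 2, {1, 3}) \<in> cyc.eset c \<longleftrightarrow> c = 0"
      "(3 * k + 2, {1, 4}) \<in> cyc.eset c \<longleftrightarrow> c = 0"
      "(3 * k + 2, {2, 3}) \<in> cyc.eset c \<longleftrightarrow> c = Suc k"
      "(3 * k + 2, {2, 4}) \<in> cyc.eset c \<longleftrightarrow> c = 0"
      "(3 * k + 2, {3, 4}) \<in> cyc.eset c \<longleftrightarrow> c = Suc k"
      using mt[of 2 1 2] mt[of 2 1 3] mt[of 2 1 4] mt[of 2 2 3] mt[of 2 2 4] mt[of 2 3 4] by (simp_all add: tab_def)
    have ea: "edge_angle x y (3 * k) s = edge_angle x y 0 s" "edge_angle x y (3 * k + 1) s = edge_angle x y 1 s"
      "edge_angle x y (3 * k + 2) s = edge_angle x y 1 s" for s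
    proof -
      have "(3 * k) mod 3 = 0" "(3 * k + 1) mod 3 = 1" "(3 * k + 2) mod 3 = 2" by presburger+
      then show "edge_angle x y (3 * k) s = edge_angle x y 0 s" "edge_angle x y (3 * k + 1) s = edge_angle x y 1 s"
        "edge_angle x y (3 * k + 2) s = edge_angle x y 1 s" by (simp_all only: edge_angle_def) simp_all
    qed
    have A: "(\<Sum>s\<in>pairs4. ?f (3 * k) s) =
        (if c = Suc k then edge_angle x y 0 {1, 2} else 0) +
        (if c = 0 then edge_angle x y 0 {3, 4} + edge_angle x y 0 {1, 3} + edge_angle x y 0 {1, 4} + edge_angle x y 0 {2, 3} + edge_angle x y 0 {2, 4} else 0)"
      unfolding sum_pairs4 mA ea by (cases "c = 0"; cases "c = Suc k"; simp)
    have B: "(\<Sum>s\<in>pairs4. ?f (3 * k + 1) s) =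
        (if c = Suc k then edge_angle x y 1 {1, 2} + edge_angle x y 1 {2, 3} + edge_angle x y 1 {3, 4} else 0) +
        (if c = 0 then edge_angle x y 1 {1, 3} + edge_angle x y 1 {1, 4} + edge_angle x y 1 {2, 4} else 0)"
      unfolding sum_pairs4 mB ea by (cases "c = 0"; cases "c = Suc k"; simp)
    have C: "(\<Sum>s\<in>pairs4. ?f (3 * k + 2) s) =
        (if c = Suc k then edge_angle x y 1 {1, 2} + edge_angle x y 1 {2, 3} + edge_angle x y 1 {3, 4} else 0) +
        (if c = 0 then edge_angle x y 1 {1, 3} + edge_angle x y 1 {1, 4} + edge_angle x y 1 {2, 4} else 0)"
      unfolding sum_pairs4 mC ea by (cases "c = 0"; cases "c = Suc k"; simp)
    show "(\<Sum>s\<in>pairs4. ?f (3 * k) s) + (\<Sum>s\<in>pairs4. ?f (3 * k + 1) s) + (\<Sum>s\<in>pairs4. ?f (3 * k + 2) s) =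
        (if c = 0 then sumB x y else if c = Suc k then sumA x y else 0)"
      unfolding A B C by (simp add: edge_angle_def doubleton_eq_iff sumA_def sumB_def)
  qed simp
  also have "\<dots> = (if c = 0 then real (Suc e) * sumB x y else sumA x y)"
  proof (cases c)
    case (Suc k)
    then have "k < Suc e" using c by simp
    then show ?thesis using Suc by (simp add: sum.delta' del: sum.lessThan_Suc)
  qed simp
  finally show ?thesis .
qed

theorem cyc_geometric: "geometric (cyc_tets e) (cyc_gluing e)"
proof -
  \<comment> \<open>The edge b runs through all \<open>Suc e\<close> blocks, so each of them has to
    contribute 2 pi / \<open>Suc e\<close>.\<close>
  obtain x y where x: "1 < x" "x < 3" and y: "1 < y" "y < 9 / 4" and s: "sumA x y = 2 * pi" "sumB x y = 2 * pi / Suc e"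
    by (rule angle_equations[of "2 * pi / Suc e"]) (auto simp: divide_le_eq)
  have "\<exists>P \<Phi>. hyper_ideal_tet P \<Phi> \<and> (\<forall>i j. i \<noteq> j \<longrightarrow> internal_length \<Phi> i j = arcosh (block_mat x y t i j)) \<and>
     (\<forall>k m. k \<noteq> m \<longrightarrow> hyp_dihedral P (\<Phi> (trunc_hex k)) (\<Phi> (trunc_hex m)) (edge_angle x y t (- {k, m})))" for t
  proof -
    have sym: "block_mat x y t i j = block_mat x y t j i" for i j using mat_sym by (simp add: block_mat_def)
    have "(num4 (block_mat x y t) 1 2 3 4)\<^sup>2 < tri3 (block_mat x y t) 1 2 3 * tri3 (block_mat x y t) 1 2 4"
      using cone_angle[OF x y] path_cos(7)[OF x y] by (simp add: block_mat_def)
    moreover have "1 < block_mat x y t i j" for i j using x y by (simp add: block_mat_def cone_mat_def path_mat_def)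
    ultimately have ex: "(\<exists>P \<Phi>. hyper_ideal_tet P \<Phi> \<and> (\<forall>i j. i \<noteq> j \<longrightarrow> internal_length \<Phi> i j = arcosh (block_mat x y t i j)) \<and>
        (\<forall>k m. k \<noteq> m \<longrightarrow> hyp_dihedral P (\<Phi> (trunc_hex k)) (\<Phi> (trunc_hex m)) (arccos (edge_cos (block_mat x y t) (third k m) (third m k))))) \<and>
        (\<forall>i j. i \<noteq> j \<longrightarrow> \<bar>edge_cos (block_mat x y t) i j\<bar> \<le> 1)"
      by (intro hyper_ideal_tet_exists sym)
    from ex[THEN conjunct1] obtain P \<Phi> where h: "hyper_ideal_tet P \<Phi>" "\<forall>i j. i \<noteq> j \<longrightarrow> internal_length \<Phi> i j = arcosh (block_mat x y t i j)"
      "\<forall>k m. k \<noteq> m \<longrightarrow> hyp_dihedral P (\<Phi> (trunc_hex k)) (\<Phi> (trunc_hex m)) (arccos (edge_cos (block_mat x y t) (third k m) (third m k)))"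
      by (elim exE conjE)
    note bound = ex[THEN conjunct2, rule_format]
    have "arccos (edge_cos (block_mat x y t) (third k m) (third m k)) = edge_angle x y t (- {k, m})" if km: "k \<noteq> m" for k m
    proof -
      have ne: "third k m \<noteq> third m k" using third_neq(3)[OF km] .
      then have "\<bar>edge_cos (block_mat x y t) (third k m) (third m k)\<bar> \<le> 1" by (rule bound)
      then have "arccos (edge_cos (block_mat x y t) (third k m) (third m k)) = angle_of (edge_cos (block_mat x y t) (third k m) (third m k))"
        by (intro angle_of_eq[symmetric]) (simp_all add: abs_le_iff)
      then show ?thesis unfolding edge_cos_angle[OF x y ne] third_complement[OF km] .
    qed
    then show ?thesis using h(1-3) by (intro exI[of _ P] exI[of _ \<Phi>]) simp
  qed
  then obtain P \<Phi> where h: "hyper_ideal_tet (P t) (\<Phi> t)" "\<forall>i j. i \<noteq> j \<longrightarrow> internal_length (\<Phi> t) i j = arcosh (block_mat x y t i j)"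
     "\<forall>k m. k \<noteq> m \<longrightarrow> hyp_dihedral (P t) (\<Phi> t (trunc_hex k)) (\<Phi> t (trunc_hex m)) (edge_angle x y t (- {k, m}))" for t
    by metis
  define l where "l c = (if c = cyc.eset 0 then arcosh y else arcosh x)" for c
  have pos: "0 < arcosh x" "0 < arcosh y" using arcosh_real_strict_mono[of 1 x] arcosh_real_strict_mono[of 1 y] x y by simp_all
  have len: "internal_length (\<Phi> t) i j = l (edge_class (cyc_tets e) (cyc_gluing e) (t, {i, j}))"
    if t: "t \<in> cyc_tets e" and ij: "i \<noteq> j" for t i j
  proof -
    have "cyc_class t i j \<in> cyc.labels" using t ij unfolding cyc.labels_def by blast
    moreover have "0 \<in> cyc.labels" unfolding cyc_labels by simp
    ultimately have "cyc.eset (cyc_class t i j) = cyc.eset 0 \<longleftrightarrow> cyc_class t i j = 0" using cyc.inj_eset by (auto simp: inj_on_def)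
    then show ?thesis unfolding cyc.edge_class_eq[OF t ij] l_def using h(2) ij by (simp add: block_mat_class)
  qed
  show ?thesis
    unfolding geometric_def
  proof (intro exI[of _ l] exI[of _ P] exI[of _ \<Phi>] exI[of _ "\<lambda>\<epsilon>. edge_angle x y (fst \<epsilon>) (snd \<epsilon>)"] conjI ballI allI impI)
    show "0 < l c" for c using pos by (simp add: l_def)
    show "hyper_ideal_tet (P t) (\<Phi> t)" for t by (rule h(1))
    show "internal_length (\<Phi> t) i j = l (edge_class (cyc_tets e) (cyc_gluing e) (t, {i, j}))"
      if "t \<in> cyc_tets e" "i \<noteq> j" for t i j using len[OF that] .
    show "hyp_dihedral (P t) (\<Phi> t (trunc_hex k)) (\<Phi> t (trunc_hex m)) (edge_angle x y (fst (t, - {k, m})) (snd (t, - {k, m})))"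
      if "k \<noteq> m" for t k m using h(3) that by simp
    fix q assume "q \<in> quot_edges (cyc_tets e) (cyc_gluing e)"
    then obtain c where c: "c \<in> {..Suc e}" "q = cyc.eset c" unfolding cyc.quot_edges_eq cyc_labels by blast
    show "(\<Sum>\<epsilon> | \<epsilon> \<in> local_edges (cyc_tets e) \<and> edge_class (cyc_tets e) (cyc_gluing e) \<epsilon> = q. edge_angle x y (fst \<epsilon>) (snd \<epsilon>)) = 2 * pi"
      unfolding c(2) cyc_angle_sum[OF c(1)] s by simp
  qed
qed

end

theorem proposition3p6:
  fixes d :: nat
  assumes "d \<ge> 1"
  shows "\<exists>(T :: nat set) (g :: nat gluing) (N :: (nat \<times> (real^4)) set topology)
            (A :: nat \<Rightarrow> nat) (B :: nat \<Rightarrow> nat) (C :: nat \<Rightarrow> nat)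
            (a :: nat \<Rightarrow> (nat \<times> 4 set) set) (b :: (nat \<times> 4 set) set) (v :: (nat \<times> 4) set).
     ideal_triangulation T g N \<and> connected_space N \<and> orientable3 N \<and>
     quot_vertices T g = {v} \<and>
     card T = 3 * d \<and> T = A ` {..<d} \<union> B ` {..<d} \<union> C ` {..<d} \<and>
     card (quot_edges T g) = d + 1 \<and> quot_edges T g = a ` {..<d} \<union> {b} \<and>
     (\<forall>k<d. valence T g (a k) = 7) \<and> valence T g b = 11 * d \<and>
     link_genus T g v = 2 * real d \<and>
     (\<forall>k<d. \<forall>t \<in> {A k, B k, C k}. \<forall>s. card s = 2 \<longrightarrow> edge_class T g (t, s) \<in> {a k, b}) \<and>
     geometric T g"
proof -
  obtain e where d: "d = Suc e" using assms by (cases d) auto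
  interpret cyc: triangulation "cyc_tets e" "cyc_gluing e" cyc_class cyc_sign "cyc_pos e" "cyc_len e"
    by (rule cyc_triangulation)
  have len: "cyc_len e 0 = 11 * d" "cyc_len e (Suc k) = 7" for k by (simp_all add: cyc_len_def d)
  have labels: "cyc.labels = {..d}" unfolding cyc_labels d ..
  have card: "card (quot_edges (cyc_tets e) (cyc_gluing e)) = d + 1"
    unfolding cyc.quot_edges_eq using card_image[OF cyc.inj_eset] by (simp only: labels) simp
  have "{..d} = Suc ` {..<d} \<union> {0}"
    using lessThan_Suc_eq_insert_0[of d] by (simp add: lessThan_Suc_atMost)
  then have edges: "quot_edges (cyc_tets e) (cyc_gluing e) = (\<lambda>k. cyc.eset (Suc k)) ` {..<d} \<union> {cyc.eset 0}"
    unfolding cyc.quot_edges_eq labels by (simp add: image_Un image_image)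
  have tets: "cyc_tets e = (\<lambda>k. 3 * k) ` {..<d} \<union> (\<lambda>k. 3 * k + 1) ` {..<d} \<union> (\<lambda>k. 3 * k + 2) ` {..<d}"
  proof (intro equalityI subsetI)
    fix t assume "t \<in> cyc_tets e"
    then have "t div 3 \<in> {..<d}" using d by auto
    moreover have "t = 3 * (t div 3) \<or> t = 3 * (t div 3) + 1 \<or> t = 3 * (t div 3) + 2" by presburger
    ultimately show "t \<in> (\<lambda>k. 3 * k) ` {..<d} \<union> (\<lambda>k. 3 * k + 1) ` {..<d} \<union> (\<lambda>k. 3 * k + 2) ` {..<d}" by blast
  qed (use d in auto)
  have local: "edge_class (cyc_tets e) (cyc_gluing e) (t, s) \<in> {cyc.eset (Suc k), cyc.eset 0}"
    if "k < d" "t \<in> {3 * k, 3 * k + 1, 3 * k + 2}" "card s = 2" for k t s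
  proof -
    obtain i j where s: "s = {i, j}" "i \<noteq> j" using \<open>card s = 2\<close> by (auto simp: card_2_iff)
    have "t div 3 = k" "t \<in> cyc_tets e" using that(1,2) d by auto
    then show ?thesis unfolding s(1) cyc.edge_class_eq[OF \<open>t \<in> cyc_tets e\<close> s(2)] by (simp add: cyc_class_def)
  qed
  have genus: "link_genus (cyc_tets e) (cyc_gluing e) (cyc_tets e \<times> UNIV) = 2 * real d"
    unfolding cyc.link_genus_eq labels by (simp add: d)
  have val: "valence (cyc_tets e) (cyc_gluing e) (cyc.eset (Suc k)) = 7" if "k < d" for k
    using cyc.valence_eset[of "Suc k"] that unfolding labels len by simp
  have val0: "valence (cyc_tets e) (cyc_gluing e) (cyc.eset 0) = 11 * d"
    using cyc.valence_eset[of 0] unfolding labels len by simp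
  show ?thesis
    by (rule exI[of _ "cyc_tets e"], rule exI[of _ "cyc_gluing e"], rule exI[of _ cyc.NN],
        rule exI[of _ "\<lambda>k. 3 * k"], rule exI[of _ "\<lambda>k. 3 * k + 1"], rule exI[of _ "\<lambda>k. 3 * k + 2"],
        rule exI[of _ "\<lambda>k. cyc.eset (Suc k)"], rule exI[of _ "cyc.eset 0"], rule exI[of _ "cyc_tets e \<times> UNIV"],
        intro conjI allI impI ballI cyc.ideal_triangulation_NN cyc.connected_NN cyc.orientable_NN
          cyc.quot_vertices_eq card edges tets genus cyc_geometric local val val0)
      (simp_all add: d)
qed

end
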